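(* For each $d\ge1$ let $\{A_{d,i}\}_{i\in I}$ be a family of $d\times d$ random matrices such that the ensemble has a real second order limit distribution as $d\to\infty$, and let $O_d$ be a Haar distributed $d\times d$ random orthogonal matrix whose entries are independent from the entries of $\{A_{d,i}\}_{i\in I}$. Then the ensembles $\{A_{d,i}\}_{i\in I}$ and $\{O_d\}$ are asymptotically real free of second order.
   Context: Conventions. All random matrices have entries with moments of all orders. $\mathrm{Tr}$ is the un-normalized trace, $\mathrm{tr}=d^{-1}\mathrm{Tr}$ on $d\times d$ matrices, $A^t$ is the transpose. $k_r$ denotes the $r$-th classical (multilinear) joint cumulant of random variables; $\mathrm{cov}(X,Y)=k_2(X,Y)=\mathrm{E}(XY)-\mathrm{E}(X)\mathrm{E}(Y)$. Real second order non-commutative probability space. This is a tuple $(\mathcal A,\varphi,\varphi_2,t)$ where $\mathcal A$ is a unital algebra over $\mathbb C$ with an anti-automorphism $a\mapsto a^t$ of order 2, $\varphi:\mathcal A\to\mathbb C$ is a tracial state (linear, $\varphi(1)=1$, $\varphi(ab)=\varphi(ba)$), and $\varphi_2:\mathcal A\times\mathcal A\to\mathbb C$ is bilinear and tracial in each entry, with $\varphi_2(1,a)=\varphi_2(a,1)=0$, $\varphi(a^t)=\varphi(a)$, $\varphi_2(a^t,b)=\varphi_2(a,b^t)=\varphi_2(a,b)$ for all $a,b$. Real freeness of second order. Let $\mathcal A_1,\dots,\mathcal A_r\subset\mathcal A$ be unital subalgebras invariant under $t$. A tuple $(a_1,\dots,a_n)$ is cyclically alternating if there are indices $j_i$ with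 $a_i\in\mathcal A_{j_i}$ and, if $n\ge2$, $j_k\ne j_{k+1}$ for all $k=1,\dots,n$ (indices modulo $n$). It is centred if $\varphi(a_i)=0$ for all $i$. The subalgebras are real free of second order if (i) they are free with respect to $\varphi$ (i.e. $\varphi(a_1\cdots a_n)=0$ whenever $a_i\in\mathcal A_{j_i}$, $\varphi(a_i)=0$, and $j_1\neq j_2\neq\cdots\neq j_n$), and (ii) whenever $(a_1,\dots,a_m)$ and $(b_1,\dots,b_n)$ are both centred and cyclically alternating: (a) $\varphi_2(a_1\cdots a_m,b_1\cdots b_n)=0$ if $m\ne n$, or if $m=n=1$ and $a_1,b_1$ are from different subalgebras; (b) if $m=n>1$, with indices modulo $n$, $$\varphi_2(a_1\cdots a_n,b_1\cdots b_n)=\sum_{k=1}^n\Big(\prod_{i=1}^n\varphi(a_ib_{k-i})+\prod_{i=1}^n\varphi(a_ib_{i-k}^t)\Big).$$ Real second order limit distribution. An ensemble $\{A_{d,i}\}_{i\in I}$ of $d\times d$ random matrices ($d\ge1$) has a real second order limit distribution, given by $\{a_i\}_{i\in I}$ in a real second order non-commutative probability space $(\mathcal A,\varphi,\varphi_2,t)$, if for all polynomials $p_1,p_2,\dots$ in the non-commuting variables $\{x_i,x_i^t\}_{i\in I}$ (evaluated by $x_i\mapsto A_{d,i}$, $x_i^t\mapsto A_{d,i}^t$, respectively $x_i\mapsto a_i$, $x_i^t\mapsto a_i^t$): $\lim_d \mathrm{E}(\mathrm{tr}(p_1(A_d)))=\varphi(p_1(a))$; $\lim_d\mathrm{cov}(\mathrm{Tr}(p_1(A_d)),\mathrm{Tr}(p_2(A_d)))=\varphi_2(p_1(a),p_2(a))$;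 and $\lim_d k_r(\mathrm{Tr}(p_1(A_d)),\dots,\mathrm{Tr}(p_r(A_d)))=0$ for all $r\ge3$. Asymptotic real second order freeness. Ensembles $\{A_{d,i}\}_{i\in I}$ and $\{B_{d,j}\}_{j\in J}$ are asymptotically real free of second order if the joint ensemble $\{A_{d,i}\}_i\cup\{B_{d,j}\}_j$ has a real second order limit distribution, given by $\{a_i\}_i\cup\{b_j\}_j$ in some $(\mathcal A,\varphi,\varphi_2,t)$, and the unital subalgebras generated by $\{a_i,a_i^t\}_i$ and by $\{b_j,b_j^t\}_j$ are real free of second order. *)

theory Defs
  imports
    "HOL-Probability.Probability"
    "HOL-Library.Poly_Mapping"
    "HOL-Library.Disjoint_Sets"
    "Jordan_Normal_Form.Matrix"
begin

section \<open>Polynomials in non-commuting variables \<open>x\<^sub>i, x\<^sub>i\<^sup>t\<close>\<close>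

datatype 'i letter = Var 'i | VarT 'i

datatype 'i word = Word (letters: "'i letter list")

instantiation word :: (type) monoid_add
begin

definition zero_word :: "'a word" where
  "zero_word = Word []"

definition plus_word :: "'a word \<Rightarrow> 'a word \<Rightarrow> 'a word" where
  "plus_word u v = Word (letters u @ letters v)"

instance
  by standard (simp_all add: zero_word_def plus_word_def)

end

text \<open>
  The monoid of words is written additively, so that the convolution product of
  \<open>Poly_Mapping\<close> is the product of the free unital algebra over \<open>\<complex>\<close>.
\<close>

type_synonym 'i ncpoly = "'i word \<Rightarrow>\<^sub>0 complex"

fun letter_value :: "('a \<Rightarrow> 'a) \<Rightarrow> ('i \<Rightarrow> 'a) \<Rightarrow> 'i letter \<Rightarrow> 'a" where
  "letter_value t a (Var i) = a i"
| "letter_value t a (VarT i) = t (a i)"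

definition nc_eval ::
    "(complex \<Rightarrow> 'a::ring_1 \<Rightarrow> 'a) \<Rightarrow> ('a \<Rightarrow> 'a) \<Rightarrow> ('i \<Rightarrow> 'a) \<Rightarrow> 'i ncpoly \<Rightarrow> 'a" where
  "nc_eval smul t a p =
    (\<Sum>w\<in>Poly_Mapping.keys p.
      smul (Poly_Mapping.lookup p w) (prod_list (map (letter_value t a) (letters w))))"

definition mat_word :: "nat \<Rightarrow> ('i \<Rightarrow> complex mat) \<Rightarrow> 'i word \<Rightarrow> complex mat" where
  "mat_word d X w = foldr (*) (map (letter_value transpose_mat X) (letters w)) (1\<^sub>m d)"

definition mat_eval :: "nat \<Rightarrow> ('i \<Rightarrow> complex mat) \<Rightarrow> 'i ncpoly \<Rightarrow> complex mat" where
  "mat_eval d X p =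
    mat d d (\<lambda>rc. \<Sum>w\<in>Poly_Mapping.keys p. Poly_Mapping.lookup p w * mat_word d X w $$ rc)"


section \<open>Real second order non-commutative probability spaces\<close>

text \<open>
  The underlying unital ring is a type of class \<open>ring_1\<close>; \<open>smul\<close> makes it
  an algebra over \<open>\<complex>\<close>.
\<close>

locale real_second_order_space =
  vector_space smul
  for smul :: "complex \<Rightarrow> 'a::ring_1 \<Rightarrow> 'a" +
  fixes \<phi> :: "'a \<Rightarrow> complex"
    and \<phi>2 :: "'a \<Rightarrow> 'a \<Rightarrow> complex"
    and t :: "'a \<Rightarrow> 'a"
  assumes smul_mult_left: "smul c x * y = smul c (x * y)"
    and smul_mult_right: "x * smul c y = smul c (x * y)"
    and t_add: "t (x + y) = t x + t y"
    and t_smul: "t (smul c x) = smul c (t x)"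
    and t_mult: "t (x * y) = t y * t x"
    and t_t: "t (t x) = x"
    and \<phi>_add: "\<phi> (x + y) = \<phi> x + \<phi> y"
    and \<phi>_smul: "\<phi> (smul c x) = c * \<phi> x"
    and \<phi>_one: "\<phi> 1 = 1"
    and \<phi>_trace: "\<phi> (x * y) = \<phi> (y * x)"
    and \<phi>_t: "\<phi> (t x) = \<phi> x"
    and \<phi>2_add_left: "\<phi>2 (x + y) z = \<phi>2 x z + \<phi>2 y z"
    and \<phi>2_add_right: "\<phi>2 x (y + z) = \<phi>2 x y + \<phi>2 x z"
    and \<phi>2_smul_left: "\<phi>2 (smul c x) y = c * \<phi>2 x y"
    and \<phi>2_smul_right: "\<phi>2 x (smul c y) = c * \<phi>2 x y"
    and \<phi>2_trace_left: "\<phi>2 (x * y) z = \<phi>2 (y * x) z"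
    and \<phi>2_trace_right: "\<phi>2 x (y * z) = \<phi>2 x (z * y)"
    and \<phi>2_one_left: "\<phi>2 1 x = 0"
    and \<phi>2_one_right: "\<phi>2 x 1 = 0"
    and \<phi>2_t_left: "\<phi>2 (t x) y = \<phi>2 x y"
    and \<phi>2_t_right: "\<phi>2 x (t y) = \<phi>2 x y"

definition unital_subalgebra :: "(complex \<Rightarrow> 'a::ring_1 \<Rightarrow> 'a) \<Rightarrow> 'a set \<Rightarrow> bool" where
  "unital_subalgebra smul B \<longleftrightarrow>
    module.subspace smul B \<and> 1 \<in> B \<and> (\<forall>x\<in>B. \<forall>y\<in>B. x * y \<in> B)"

definition generated_subalgebra ::
    "(complex \<Rightarrow> 'a::ring_1 \<Rightarrow> 'a) \<Rightarrow> ('a \<Rightarrow> 'a) \<Rightarrow> ('i \<Rightarrow> 'a) \<Rightarrow> 'a set" where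
  "generated_subalgebra smul t a =
    unital_subalgebra smul hull (range a \<union> range (\<lambda>i. t (a i)))"


section \<open>Real freeness of second order\<close>

text \<open>
  A finite family of subalgebras is a list \<open>Bs\<close>, and a tuple is a nonempty list with
  positions \<open>0, \<dots>, n - 1\<close>.
\<close>

definition centred :: "('a \<Rightarrow> complex) \<Rightarrow> 'a list \<Rightarrow> bool" where
  "centred \<phi> as \<longleftrightarrow> (\<forall>x\<in>set as. \<phi> x = 0)"

definition in_subalgebras :: "'a set list \<Rightarrow> nat list \<Rightarrow> 'a list \<Rightarrow> bool" where
  "in_subalgebras Bs js as \<longleftrightarrow>
    length js = length as \<and>
    (\<forall>i<length as. js ! i < length Bs \<and> as ! i \<in> Bs ! (js ! i))"

definition alternating :: "'a set list \<Rightarrow> 'a list \<Rightarrow> bool" where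
  "alternating Bs as \<longleftrightarrow>
    as \<noteq> [] \<and>
    (\<exists>js. in_subalgebras Bs js as \<and> (\<forall>i. Suc i < length as \<longrightarrow> js ! i \<noteq> js ! Suc i))"

definition cyclically_alternating :: "'a set list \<Rightarrow> 'a list \<Rightarrow> bool" where
  "cyclically_alternating Bs as \<longleftrightarrow>
    as \<noteq> [] \<and>
    (\<exists>js. in_subalgebras Bs js as \<and>
      (2 \<le> length as \<longrightarrow> (\<forall>k<length as. js ! k \<noteq> js ! (Suc k mod length as))))"

definition cyc_nth :: "'a list \<Rightarrow> int \<Rightarrow> 'a" where
  "cyc_nth xs z = xs ! nat (z mod int (length xs))"

definition free_family :: "('a::ring_1 \<Rightarrow> complex) \<Rightarrow> 'a set list \<Rightarrow> bool" where
  "free_family \<phi> Bs \<longleftrightarrow>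
    (\<forall>as. alternating Bs as \<and> centred \<phi> as \<longrightarrow> \<phi> (prod_list as) = 0)"

text \<open>
  Counting positions from \<open>0\<close>, the factor \<open>b\<close> with index \<open>k - i\<close> sits at position
  \<open>(k - 2) - (i - 1)\<close> and the one with index \<open>i - k\<close> at position \<open>(i - 1) - k\<close>. Since \<open>k\<close> runs
  through all residues modulo \<open>n\<close>, each of the two sums over \<open>k\<close> keeps its form.
\<close>

definition real_free_second_order ::
    "(complex \<Rightarrow> 'a::ring_1 \<Rightarrow> 'a) \<Rightarrow> ('a \<Rightarrow> complex) \<Rightarrow> ('a \<Rightarrow> 'a \<Rightarrow> complex) \<Rightarrow>
      ('a \<Rightarrow> 'a) \<Rightarrow> 'a set list \<Rightarrow> bool" where
  "real_free_second_order smul \<phi> \<phi>2 t Bs \<longleftrightarrow>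
    (\<forall>B\<in>set Bs. unital_subalgebra smul B \<and> t ` B \<subseteq> B) \<and>
    free_family \<phi> Bs \<and>
    (\<forall>as bs.
      cyclically_alternating Bs as \<and> centred \<phi> as \<and>
      cyclically_alternating Bs bs \<and> centred \<phi> bs \<longrightarrow>
        (length as \<noteq> length bs \<longrightarrow> \<phi>2 (prod_list as) (prod_list bs) = 0) \<and>
        (length as = length bs \<and> length as > 1 \<longrightarrow>
          \<phi>2 (prod_list as) (prod_list bs) =
            (\<Sum>k<length as.
              (\<Prod>i<length as. \<phi> (as ! i * cyc_nth bs (int k - int i))) +
              (\<Prod>i<length as. \<phi> (as ! i * t (cyc_nth bs (int i - int k))))))) \<and>
    (\<forall>i<length Bs. \<forall>j<length Bs. i \<noteq> j \<longrightarrow>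
      (\<forall>x\<in>Bs ! i. \<forall>y\<in>Bs ! j. \<phi> x = 0 \<and> \<phi> y = 0 \<longrightarrow> \<phi>2 x y = 0))"


section \<open>Ensembles of random matrices\<close>

definition random_matrix :: "'w measure \<Rightarrow> nat \<Rightarrow> ('w \<Rightarrow> complex mat) \<Rightarrow> bool" where
  "random_matrix M d X \<longleftrightarrow>
    (\<forall>\<omega>\<in>space M. X \<omega> \<in> carrier_mat d d) \<and>
    (\<forall>r<d. \<forall>c<d. (\<lambda>\<omega>. X \<omega> $$ (r, c)) \<in> borel_measurable M \<and>
      (\<forall>n::nat. integrable M (\<lambda>\<omega>. norm (X \<omega> $$ (r, c)) ^ n)))"

definition mat_trace :: "complex mat \<Rightarrow> complex" where
  "mat_trace X = (\<Sum>i<dim_row X. X $$ (i, i))"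

definition covariance :: "'w measure \<Rightarrow> ('w \<Rightarrow> complex) \<Rightarrow> ('w \<Rightarrow> complex) \<Rightarrow> complex" where
  "covariance M X Y = (\<integral>\<omega>. X \<omega> * Y \<omega> \<partial>M) - (\<integral>\<omega>. X \<omega> \<partial>M) * (\<integral>\<omega>. Y \<omega> \<partial>M)"

text \<open>
  The moment-cumulant formula: the coefficient of a partition with \<open>m\<close> blocks is its
  Moebius value \<open>(-1)^(m - 1) (m - 1)!\<close> in the partition lattice.
\<close>

definition joint_cumulant :: "'w measure \<Rightarrow> nat \<Rightarrow> (nat \<Rightarrow> 'w \<Rightarrow> complex) \<Rightarrow> complex" where
  "joint_cumulant M r X =
    (\<Sum>P | partition_on {..<r} P.
      (-1) ^ (card P - 1) * fact (card P - 1) * (\<Prod>B\<in>P. \<integral>\<omega>. (\<Prod>i\<in>B. X i \<omega>) \<partial>M))"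

text \<open>
  \<open>A d i\<close> is the \<open>i\<close>-th \<open>d \<times> d\<close> random matrix of the ensemble, on the probability space \<open>M d\<close>;
  nothing is required for \<open>d = 0\<close>.
\<close>

definition real_second_order_limit ::
    "(nat \<Rightarrow> 'w measure) \<Rightarrow> (nat \<Rightarrow> 'i \<Rightarrow> 'w \<Rightarrow> complex mat) \<Rightarrow>
      (complex \<Rightarrow> 'a::ring_1 \<Rightarrow> 'a) \<Rightarrow> ('a \<Rightarrow> complex) \<Rightarrow> ('a \<Rightarrow> 'a \<Rightarrow> complex) \<Rightarrow>
      ('a \<Rightarrow> 'a) \<Rightarrow> ('i \<Rightarrow> 'a) \<Rightarrow> bool" where
  "real_second_order_limit M A smul \<phi> \<phi>2 t a \<longleftrightarrow>
    (\<forall>d\<ge>1. prob_space (M d) \<and> (\<forall>i. random_matrix (M d) d (A d i))) \<and>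
    real_second_order_space smul \<phi> \<phi>2 t \<and>
    (let Tr = (\<lambda>p d \<omega>. mat_trace (mat_eval d (\<lambda>i. A d i \<omega>) p));
         ev = nc_eval smul t a
     in
      (\<forall>p. (\<lambda>d. \<integral>\<omega>. Tr p d \<omega> / of_nat d \<partial>M d) \<longlonglongrightarrow> \<phi> (ev p)) \<and>
      (\<forall>p q. (\<lambda>d. covariance (M d) (Tr p d) (Tr q d)) \<longlonglongrightarrow> \<phi>2 (ev p) (ev q)) \<and>
      (\<forall>r\<ge>3. \<forall>p. (\<lambda>d. joint_cumulant (M d) r (\<lambda>k. Tr (p k) d)) \<longlonglongrightarrow> 0))"

text \<open>
  The limit space is sought on the free algebra. By the lemma
  \<open>asymptotically_real_freeI\<close> below, a limit in any other real second order
  space, over any type, can be pulled back to it.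
\<close>

definition asymptotically_real_free ::
    "(nat \<Rightarrow> 'w measure) \<Rightarrow> (nat \<Rightarrow> 'i \<Rightarrow> 'w \<Rightarrow> complex mat) \<Rightarrow>
      (nat \<Rightarrow> 'j \<Rightarrow> 'w \<Rightarrow> complex mat) \<Rightarrow> bool" where
  "asymptotically_real_free M A B \<longleftrightarrow>
    (\<exists>(smul :: complex \<Rightarrow> ('i + 'j) ncpoly \<Rightarrow> ('i + 'j) ncpoly) \<phi> \<phi>2 t
        (a :: 'i \<Rightarrow> ('i + 'j) ncpoly) (b :: 'j \<Rightarrow> ('i + 'j) ncpoly).
      real_second_order_limit M (\<lambda>d. case_sum (A d) (B d)) smul \<phi> \<phi>2 t (case_sum a b) \<and>
      real_free_second_order smul \<phi> \<phi>2 t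
        [generated_subalgebra smul t a, generated_subalgebra smul t b])"


section \<open>Haar distributed orthogonal matrices and independence\<close>

definition orthogonal_group :: "nat \<Rightarrow> real mat set" where
  "orthogonal_group d = {U \<in> carrier_mat d d. transpose_mat U * U = 1\<^sub>m d}"

definition mat_entries :: "nat \<Rightarrow> 'b mat \<Rightarrow> nat \<times> nat \<Rightarrow> 'b" where
  "mat_entries d X = (\<lambda>rc\<in>{..<d} \<times> {..<d}. X $$ rc)"

definition entries_space :: "nat \<Rightarrow> (nat \<times> nat \<Rightarrow> 'b::topological_space) measure" where
  "entries_space d = (\<Pi>\<^sub>M rc\<in>{..<d} \<times> {..<d}. borel)"

text \<open>
  On a compact group, the left-invariant probability measure is unique and is the Haar
  measure, so invariance under right translations need not be assumed.
\<close>

definition haar_orthogonal :: "'w measure \<Rightarrow> nat \<Rightarrow> ('w \<Rightarrow> real mat) \<Rightarrow> bool" where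
  "haar_orthogonal M d Q \<longleftrightarrow>
    (\<forall>\<omega>\<in>space M. Q \<omega> \<in> orthogonal_group d) \<and>
    (\<lambda>\<omega>. mat_entries d (Q \<omega>)) \<in> measurable M (entries_space d) \<and>
    (\<forall>U\<in>orthogonal_group d.
      distr M (entries_space d) (\<lambda>\<omega>. mat_entries d (U * Q \<omega>)) =
      distr M (entries_space d) (\<lambda>\<omega>. mat_entries d (Q \<omega>)))"

definition sigma_entries ::
    "'w measure \<Rightarrow> nat \<Rightarrow> ('i \<Rightarrow> 'w \<Rightarrow> 'b::topological_space mat) \<Rightarrow> 'w set set" where
  "sigma_entries M d X =
    sets (vimage_algebra (space M)
      (\<lambda>\<omega> i. mat_entries d (X i \<omega>)) (\<Pi>\<^sub>M i\<in>UNIV. entries_space d))"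



section \<open>Pulling a limit back to the free algebra\<close>

lemma ncpoly_induct [case_names single add]:
  fixes p :: "'i ncpoly"
  assumes single: "\<And>w c. P (Poly_Mapping.single w c)"
    and add: "\<And>p q. P p \<Longrightarrow> P q \<Longrightarrow> P (p + q)"
  shows "P p"
proof -
  have *: "P (\<Sum>w\<in>S. Poly_Mapping.single w (f w))" if "finite S" for S and f :: "'i word \<Rightarrow> complex"
    using that
  proof induction
    case empty
    show ?case using single[of 0 0] by simp
  next
    case (insert x S)
    then show ?case using add single by simp
  qed
  have "p = (\<Sum>w\<in>Poly_Mapping.keys p. Poly_Mapping.single w (Poly_Mapping.lookup p w))"
    by (intro poly_mapping_eqI)
      (auto simp: lookup_sum lookup_single when_def in_keys_iff)
  then show ?thesis using *[of "Poly_Mapping.keys p" "Poly_Mapping.lookup p"] by simp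
qed

definition nc_smul :: "complex \<Rightarrow> 'i ncpoly \<Rightarrow> 'i ncpoly" where
  "nc_smul c p = Poly_Mapping.single 0 c * p"

fun letter_transpose :: "'i letter \<Rightarrow> 'i letter" where
  "letter_transpose (Var i) = VarT i"
| "letter_transpose (VarT i) = Var i"

definition word_transpose :: "'i word \<Rightarrow> 'i word" where
  "word_transpose w = Word (rev (map letter_transpose (letters w)))"

definition nc_transpose :: "'i ncpoly \<Rightarrow> 'i ncpoly" where
  "nc_transpose p = Poly_Mapping.map_key word_transpose p"

definition nc_var :: "'i \<Rightarrow> 'i ncpoly" where
  "nc_var i = Poly_Mapping.single (Word [Var i]) 1"

lemma letter_transpose_twice [simp]: "letter_transpose (letter_transpose x) = x"
  by (cases x) simp_all

lemma word_transpose_twice [simp]: "word_transpose (word_transpose w) = w"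
  by (cases w) (simp add: word_transpose_def rev_map comp_def)

lemma letters_zero [simp]: "letters 0 = []"
  by (simp add: zero_word_def)

lemma inj_word_transpose: "inj word_transpose"
  by (rule inj_on_inverseI[where g = word_transpose]) simp

lemma word_transpose_add: "word_transpose (u + v) = word_transpose v + word_transpose u"
  by (simp add: word_transpose_def plus_word_def)

lemma nc_transpose_add: "nc_transpose (p + q) = nc_transpose p + nc_transpose q"
  unfolding nc_transpose_def by (rule map_key_plus[OF inj_word_transpose])

lemma nc_transpose_single:
  "nc_transpose (Poly_Mapping.single w c) = Poly_Mapping.single (word_transpose w) c"
  using map_key_single[OF inj_word_transpose, of "word_transpose w" c]
  by (simp add: nc_transpose_def)

lemma nc_transpose_twice: "nc_transpose (nc_transpose p) = p"
  by (induction p rule: ncpoly_induct) (simp_all add: nc_transpose_add nc_transpose_single)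

lemma nc_transpose_mult: "nc_transpose (p * q) = nc_transpose q * nc_transpose p"
proof (induction p rule: ncpoly_induct)
  case (single u c)
  show ?case
    by (induction q rule: ncpoly_induct)
      (simp_all add: nc_transpose_add nc_transpose_single mult_single word_transpose_add
        distrib_left distrib_right mult.commute)
qed (simp add: nc_transpose_add distrib_left distrib_right)

lemma nc_smul_single: "nc_smul c (Poly_Mapping.single w e) = Poly_Mapping.single w (c * e)"
  by (simp add: nc_smul_def mult_single)

lemma nc_smul_add: "nc_smul c (p + q) = nc_smul c p + nc_smul c q"
  by (simp add: nc_smul_def distrib_left)

lemma nc_smul_mult_left: "nc_smul c p * q = nc_smul c (p * q)"
  by (simp add: nc_smul_def mult.assoc)

lemma nc_smul_mult_right: "p * nc_smul c q = nc_smul c (p * q)"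
proof -
  have "p * Poly_Mapping.single 0 c = Poly_Mapping.single 0 c * p"
    by (induction p rule: ncpoly_induct) (simp_all add: mult_single distrib_left distrib_right mult.commute)
  then show ?thesis by (simp add: nc_smul_def flip: mult.assoc)
qed

lemma nc_transpose_smul: "nc_transpose (nc_smul c p) = nc_smul c (nc_transpose p)"
  by (induction p rule: ncpoly_induct)
    (simp_all add: nc_smul_add nc_smul_single nc_transpose_add nc_transpose_single)

lemma vector_space_nc_smul: "vector_space (nc_smul :: complex \<Rightarrow> 'i ncpoly \<Rightarrow> 'i ncpoly)"
proof
  show "nc_smul a (nc_smul b x) = nc_smul (a * b) x" for a b and x :: "'i ncpoly"
    by (simp add: nc_smul_def mult_single flip: mult.assoc)
qed (simp_all add: nc_smul_def distrib_left distrib_right single_add)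

context real_second_order_space
begin

lemma t_one: "t 1 = 1"
  by (metis mult_1 mult_1_right t_mult t_t)

abbreviation ev :: "('i \<Rightarrow> 'a) \<Rightarrow> 'i ncpoly \<Rightarrow> 'a" where
  "ev \<equiv> nc_eval smul t"

abbreviation word_value :: "('i \<Rightarrow> 'a) \<Rightarrow> 'i word \<Rightarrow> 'a" where
  "word_value a w \<equiv> prod_list (map (letter_value t a) (letters w))"

lemma ev_single: "ev a (Poly_Mapping.single w c) = smul c (word_value a w)"
  by (simp add: nc_eval_def)

lemma ev_add: "ev a (p + q) = ev a p + ev a q"
proof -
  have *: "ev a r = (\<Sum>w\<in>Poly_Mapping.keys p \<union> Poly_Mapping.keys q.
      smul (Poly_Mapping.lookup r w) (word_value a w))"
    if "Poly_Mapping.keys r \<subseteq> Poly_Mapping.keys p \<union> Poly_Mapping.keys q" for r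
    unfolding nc_eval_def using that
    by (intro sum.mono_neutral_left) (auto simp: in_keys_iff)
  show ?thesis
    by (simp add: * Poly_Mapping.keys_add lookup_add scale_left_distrib sum.distrib)
qed

lemma ev_smul: "ev a (nc_smul c p) = smul c (ev a p)"
  by (induction p rule: ncpoly_induct)
    (simp_all add: nc_smul_add nc_smul_single ev_add ev_single scale_right_distrib)

lemma ev_mult: "ev a (p * q) = ev a p * ev a q"
proof (induction p rule: ncpoly_induct)
  case (single u c)
  show ?case
    by (induction q rule: ncpoly_induct)
      (simp_all add: ev_add ev_single mult_single plus_word_def distrib_left
        smul_mult_left smul_mult_right mult.commute)
qed (simp add: ev_add distrib_right)

lemma ev_one: "ev a 1 = 1"
  using ev_single[of a 0 1] by (simp add: letters_zero)

lemma ev_zero: "ev a 0 = 0"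
  by (simp add: nc_eval_def)

lemma t_word_value: "word_value a (word_transpose w) = t (word_value a w)"
proof -
  have l: "letter_value t a (letter_transpose x) = t (letter_value t a x)" for x
    by (cases x) (simp_all add: t_t)
  have "prod_list (map (letter_value t a) (rev (map letter_transpose xs)))
      = t (prod_list (map (letter_value t a) xs))" for xs
    by (induction xs) (simp_all add: t_one t_mult l)
  then show ?thesis by (simp add: word_transpose_def)
qed

lemma ev_transpose: "ev a (nc_transpose p) = t (ev a p)"
  by (induction p rule: ncpoly_induct)
    (simp_all add: nc_transpose_add nc_transpose_single ev_add ev_single t_add t_smul t_word_value)

lemma ev_var: "ev a (nc_var i) = a i"
  by (simp add: nc_var_def ev_single)

lemma ev_prod_list: "ev a (prod_list ps) = prod_list (map (ev a) ps)"
  by (induction ps) (simp_all add: ev_one ev_mult)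

lemma pullback_space:
  "real_second_order_space nc_smul (\<lambda>p. \<phi> (ev a p)) (\<lambda>p q. \<phi>2 (ev a p) (ev a q)) nc_transpose"
proof (intro real_second_order_space.intro vector_space_nc_smul real_second_order_space_axioms.intro)
  show "\<phi> (ev a (x * y)) = \<phi> (ev a (y * x))" for x y
    unfolding ev_mult by (rule \<phi>_trace)
  show "\<phi>2 (ev a (x * y)) (ev a z) = \<phi>2 (ev a (y * x)) (ev a z)" for x y z
    unfolding ev_mult by (rule \<phi>2_trace_left)
  show "\<phi>2 (ev a x) (ev a (y * z)) = \<phi>2 (ev a x) (ev a (z * y))" for x y z
    unfolding ev_mult by (rule \<phi>2_trace_right)
qed (simp_all add: ev_add ev_smul ev_one ev_transpose nc_smul_mult_left nc_smul_mult_right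
    nc_transpose_add nc_transpose_smul nc_transpose_mult nc_transpose_twice
    \<phi>_add \<phi>_smul \<phi>_one \<phi>_t \<phi>2_add_left \<phi>2_add_right \<phi>2_smul_left \<phi>2_smul_right
    \<phi>2_one_left \<phi>2_one_right \<phi>2_t_left \<phi>2_t_right)

lemma unital_subalgebra_hull: "unital_subalgebra smul (unital_subalgebra smul hull S)"
  by (rule hull_in) (auto simp: unital_subalgebra_def subspace_def)

end

lemma (in real_second_order_space) limit_pullback:
  assumes "real_second_order_limit M A smul \<phi> \<phi>2 t a"
  shows "real_second_order_limit M A nc_smul (\<lambda>p. \<phi> (ev a p)) (\<lambda>p q. \<phi>2 (ev a p) (ev a q))
    nc_transpose nc_var"
proof -
  interpret F: real_second_order_space nc_smul "\<lambda>p. \<phi> (ev a p)" "\<lambda>p q. \<phi>2 (ev a p) (ev a q)" nc_transpose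
    by (rule pullback_space)
  have w: "ev a (F.word_value nc_var w) = word_value a w" for w
  proof -
    have "ev a (letter_value nc_transpose nc_var x) = letter_value t a x" for x
      by (cases x) (simp_all add: ev_transpose ev_var)
    then show ?thesis by (simp add: ev_prod_list comp_def)
  qed
  have "ev a (F.ev nc_var p) = ev a p" for p
    by (induction p rule: ncpoly_induct)
      (simp_all add: F.ev_add F.ev_single ev_add ev_single ev_smul w)
  with assms pullback_space show ?thesis
    by (simp add: real_second_order_limit_def Let_def)
qed

context real_second_order_space
begin

lemma generated_subalgebra_pullback:
  assumes "p \<in> generated_subalgebra nc_smul nc_transpose x"
  shows "ev a p \<in> generated_subalgebra smul t (\<lambda>i. ev a (x i))"
proof -
  let ?G = "generated_subalgebra smul t (\<lambda>i. ev a (x i))"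
  interpret V: vector_space nc_smul by (rule vector_space_nc_smul)
  have G: "unital_subalgebra smul ?G"
    unfolding generated_subalgebra_def by (rule unital_subalgebra_hull)
  have "unital_subalgebra nc_smul {p. ev a p \<in> ?G}"
    using G unfolding unital_subalgebra_def subspace_def V.subspace_def
    by (simp add: ev_zero ev_add ev_smul ev_one ev_mult)
  moreover have "range x \<union> range (\<lambda>i. nc_transpose (x i)) \<subseteq> {p. ev a p \<in> ?G}"
    by (auto simp: ev_transpose generated_subalgebra_def intro!: hull_inc)
  ultimately have "unital_subalgebra nc_smul hull (range x \<union> range (\<lambda>i. nc_transpose (x i)))
      \<subseteq> {p. ev a p \<in> ?G}"
    by (intro hull_minimal)
  with assms show ?thesis by (auto simp: generated_subalgebra_def)
qed

lemma generated_subalgebra_transpose: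
  "t ` generated_subalgebra smul t x \<subseteq> generated_subalgebra smul t x"
proof -
  let ?G = "generated_subalgebra smul t x"
  have G: "unital_subalgebra smul ?G"
    unfolding generated_subalgebra_def by (rule unital_subalgebra_hull)
  have t0: "t 0 = 0" using t_smul[of 0 0] by simp
  have "unital_subalgebra smul {y. t y \<in> ?G}"
    using G unfolding unital_subalgebra_def subspace_def
    by (simp add: t0 t_add t_smul t_one t_mult)
  moreover have "range x \<union> range (\<lambda>i. t (x i)) \<subseteq> {y. t y \<in> ?G}"
    by (auto simp: t_t generated_subalgebra_def intro!: hull_inc)
  ultimately have "unital_subalgebra smul hull (range x \<union> range (\<lambda>i. t (x i))) \<subseteq> {y. t y \<in> ?G}"
    by (intro hull_minimal)
  then show ?thesis by (auto simp: generated_subalgebra_def)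
qed

lemma real_free_pullback:
  assumes free: "real_free_second_order smul \<phi> \<phi>2 t Bs"
    and len: "length Cs = length Bs"
    and sub: "\<And>i p. i < length Cs \<Longrightarrow> p \<in> Cs ! i \<Longrightarrow> ev a p \<in> Bs ! i"
    and alg: "\<And>C. C \<in> set Cs \<Longrightarrow> unital_subalgebra nc_smul C \<and> nc_transpose ` C \<subseteq> C"
  shows "real_free_second_order nc_smul (\<lambda>p. \<phi> (ev a p)) (\<lambda>p q. \<phi>2 (ev a p) (ev a q)) nc_transpose Cs"
proof -
  let ?h = "map (ev a)"
  have ins: "in_subalgebras Bs js (?h ps)" if "in_subalgebras Cs js ps" for js ps
    using that sub len by (auto simp: in_subalgebras_def)
  have alt: "alternating Bs (?h ps)" if "alternating Cs ps" for ps
    using that ins unfolding alternating_def by fastforce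
  have cyc: "cyclically_alternating Bs (?h ps)" if "cyclically_alternating Cs ps" for ps
    using that ins unfolding cyclically_alternating_def by (metis length_map map_is_Nil_conv)
  have cen: "centred (\<lambda>p. \<phi> (ev a p)) ps \<longleftrightarrow> centred \<phi> (?h ps)" for ps
    by (simp add: centred_def)
  have nth: "ev a (cyc_nth ps z) = cyc_nth (?h ps) z" if "ps \<noteq> []" for ps z
    using that by (simp add: cyc_nth_def nat_less_iff)
  have 1: "free_family (\<lambda>p. \<phi> (ev a p)) Cs"
    using free alt by (auto simp: real_free_second_order_def free_family_def cen ev_prod_list)
  have 2: "(length ps \<noteq> length qs \<longrightarrow> \<phi>2 (ev a (prod_list ps)) (ev a (prod_list qs)) = 0) \<and>
      (length ps = length qs \<and> length ps > 1 \<longrightarrow>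
        \<phi>2 (ev a (prod_list ps)) (ev a (prod_list qs)) =
          (\<Sum>k<length ps.
            (\<Prod>i<length ps. \<phi> (ev a (ps ! i * cyc_nth qs (int k - int i)))) +
            (\<Prod>i<length ps. \<phi> (ev a (ps ! i * nc_transpose (cyc_nth qs (int i - int k)))))))"
    if "cyclically_alternating Cs ps" "centred (\<lambda>p. \<phi> (ev a p)) ps"
      "cyclically_alternating Cs qs" "centred (\<lambda>p. \<phi> (ev a p)) qs" for ps qs
  proof -
    have "ps \<noteq> []" "qs \<noteq> []" using that by (auto simp: cyclically_alternating_def)
    moreover note free[unfolded real_free_second_order_def, THEN conjunct2, THEN conjunct2,
      THEN conjunct1, rule_format, of "?h ps" "?h qs"]
    ultimately show ?thesis
      using that cyc by (simp add: cen ev_prod_list ev_mult ev_transpose nth)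
  qed
  have 3: "\<phi>2 (ev a p) (ev a q) = 0"
    if "i < length Cs" "j < length Cs" "i \<noteq> j" "p \<in> Cs ! i" "q \<in> Cs ! j"
      "\<phi> (ev a p) = 0" "\<phi> (ev a q) = 0" for i j p q
    using that free sub len unfolding real_free_second_order_def by metis
  show ?thesis
    unfolding real_free_second_order_def using 1 2 3 alg by auto
qed

end

lemma asymptotically_real_freeI:
  fixes M :: "nat \<Rightarrow> 'w measure"
    and A :: "nat \<Rightarrow> 'i \<Rightarrow> 'w \<Rightarrow> complex mat"
    and B :: "nat \<Rightarrow> 'j \<Rightarrow> 'w \<Rightarrow> complex mat"
    and smul :: "complex \<Rightarrow> 'a::ring_1 \<Rightarrow> 'a"
  assumes lim: "real_second_order_limit M (\<lambda>d. case_sum (A d) (B d)) smul \<phi> \<phi>2 t (case_sum a b)"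
    and free: "real_free_second_order smul \<phi> \<phi>2 t
      [generated_subalgebra smul t a, generated_subalgebra smul t b]"
  shows "asymptotically_real_free M A B"
proof -
  interpret real_second_order_space smul \<phi> \<phi>2 t
    using lim by (simp add: real_second_order_limit_def)
  let ?c = "case_sum a b"
  interpret F: real_second_order_space nc_smul "\<lambda>p. \<phi> (ev ?c p)"
      "\<lambda>p q. \<phi>2 (ev ?c p) (ev ?c q)" nc_transpose
    by (rule pullback_space)
  let ?x = "\<lambda>i::'i. nc_var (Inl i :: 'i + 'j)" and ?y = "\<lambda>j::'j. nc_var (Inr j :: 'i + 'j)"
  let ?X = "generated_subalgebra nc_smul nc_transpose ?x"
  let ?Y = "generated_subalgebra nc_smul nc_transpose ?y"
  have var: "case_sum ?x ?y = nc_var"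
    by (auto split: sum.split)
  have 1: "real_second_order_limit M (\<lambda>d. case_sum (A d) (B d)) nc_smul (\<lambda>p. \<phi> (ev ?c p))
      (\<lambda>p q. \<phi>2 (ev ?c p) (ev ?c q)) nc_transpose (case_sum ?x ?y)"
    unfolding var by (rule limit_pullback[OF lim])
  have sub: "unital_subalgebra nc_smul ?X" "unital_subalgebra nc_smul ?Y"
    by (simp_all add: generated_subalgebra_def F.unital_subalgebra_hull)
  have 2: "real_free_second_order nc_smul (\<lambda>p. \<phi> (ev ?c p)) (\<lambda>p q. \<phi>2 (ev ?c p) (ev ?c q))
      nc_transpose [?X, ?Y]"
  proof (rule real_free_pullback[OF free])
    show "ev ?c p \<in> [generated_subalgebra smul t a, generated_subalgebra smul t b] ! i"
      if "i < length [?X, ?Y]" "p \<in> [?X, ?Y] ! i" for i p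
      using that generated_subalgebra_pullback[of p ?x ?c] generated_subalgebra_pullback[of p ?y ?c]
      by (auto simp: less_Suc_eq ev_var)
    show "unital_subalgebra nc_smul C \<and> nc_transpose ` C \<subseteq> C" if "C \<in> set [?X, ?Y]" for C
      using that sub F.generated_subalgebra_transpose[of ?x] F.generated_subalgebra_transpose[of ?y]
      by auto
  qed simp
  show ?thesis
    unfolding asymptotically_real_free_def using 1 2 by blast
qed

end

theory Submission
  imports Defs "Jordan_Normal_Form.Determinant"
begin

text \<open>
  The Haar measure is left invariant, so the expectation of a product of centred traces
  of words in \<open>O\<close>, \<open>O\<^sup>t\<close> and the \<open>A\<^sub>i\<close> does not change when \<open>O\<close> is multiplied by a
  rotation by the angle \<open>\<theta>\<close> in a coordinate plane. Differentiating at \<open>\<theta> = 0\<close> and summing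
  over all planes gives loop equations, which replace the Weingarten calculus: they express
  the moments of a word \<open>O V\<close> by those obtained by cutting \<open>V\<close> at its letters \<open>O\<close>, \<open>O\<^sup>t\<close> or by
  gluing it to another word.

  By induction on the number of letters \<open>O\<close>, \<open>O\<^sup>t\<close> all mean traces and centred moments converge.
  The terms in a loop equation that have as many such letters as its left-hand side carry a
  factor \<open>1/d\<close>, and they range over a finite set of words, so they form a linear system that is
  a small perturbation of the identity. In the limit the equations give Wick's formula, hence
  vanishing higher cumulants. A word that is reduced (centred coefficients, no cancellation)
  has limit mean \<open>0\<close>, which is first order freeness. For two cyclically reduced words
  only the gluing terms survive in the covariance, and they add up to the two kinds of
  spoke diagrams.
\<close>

section \<open>Cumulants\<close>

text \<open>Means of unnormalized traces grow like \<open>d\<close>, while centred moments should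
  stay bounded; treating them as separate unknowns makes the order of every term of a loop equation
  visible. The infinitesimal rotation \<open>E_ab - E_ba\<close> is skew, and its two halves
  contract differently: \<open>E_ab\<close> joins words through a transpose, \<open>E_ba\<close>
  splits a trace in two or joins words directly. This is where the two orientations of the spoke
  diagrams come from. A second obstacle is algebraic. Freeness concerns arbitrary centred elements
  of subalgebras of the free algebra, where the orthogonality relations hold only under the limit
  functionals. The formulas are therefore proved for products of blocks, each a centred coefficient
  or a power of \<open>O\<close> or of its transpose, and then extended entry by entry with
  functionals that respect these relations.\<close>

definition cumul :: "(nat set \<Rightarrow> complex) \<Rightarrow> nat set \<Rightarrow> complex" where
  "cumul m S = (\<Sum>P | partition_on S P. (-1) ^ (card P - 1) * fact (card P - 1) * (\<Prod>B\<in>P. m B))"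

text \<open>\<open>cumul\<close> takes the moments of all index subsets instead of random variables:
  limit functionals, which come from no random variables, then have cumulants as well.\<close>

lemma joint_cumulant_cumul: "joint_cumulant M r X = cumul (\<lambda>B. \<integral>\<omega>. (\<Prod>i\<in>B. X i \<omega>) \<partial>M) {..<r}"
  by (simp add: joint_cumulant_def cumul_def)

lemma finite_partitions: "finite S \<Longrightarrow> finite {P. partition_on S P}"
  by (rule finitely_many_partition_on)

lemma partition_on_block: "partition_on S P \<Longrightarrow> B \<in> P \<Longrightarrow> B \<subseteq> S \<and> B \<noteq> {}"
  by (auto simp: partition_on_def)

lemma partition_finite: "finite S \<Longrightarrow> partition_on S P \<Longrightarrow> finite P"
  by (rule finite_elements)

lemma cumul_cong: "(\<And>B. B \<subseteq> S \<Longrightarrow> B \<noteq> {} \<Longrightarrow> m B = m' B) \<Longrightarrow> cumul m S = cumul m' S"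
  unfolding cumul_def by (intro sum.cong refl arg_cong2[where f = "(*)"] prod.cong) (auto dest: partition_on_block)

lemma cumul_tendsto:
  assumes "finite S" "\<And>B. B \<subseteq> S \<Longrightarrow> (\<lambda>d. m d B) \<longlonglongrightarrow> m' B"
  shows "(\<lambda>d. cumul (m d) S) \<longlonglongrightarrow> cumul m' S"
  unfolding cumul_def using assms by (intro tendsto_intros) (auto dest: partition_on_block)

text \<open>The moment-cumulant recursion at the block of \<open>z\<close>, straight from the
  Moebius coefficients. A partition of \<open>S\<close> into \<open>n\<close> blocks collects
  \<open>c n\<close> once, and \<open>c (n - 1)\<close> once for each of its \<open>n - 1\<close>
  blocks without \<open>z\<close>; these contributions cancel unless \<open>n = 1\<close>.\<close>

lemma cumul_rec:
  assumes S: "finite S" "z \<in> S" and m: "m {} = 1"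
  shows "m S = (\<Sum>B | z \<in> B \<and> B \<subseteq> S. cumul m B * m (S - B))"
proof -
  define c where "c k = (-1) ^ (k - 1) * (fact (k - 1) :: complex)" for k :: nat
  let ?part = "\<lambda>B. {P. partition_on B P}"
  let ?w = "\<lambda>P. \<Prod>B\<in>P. m B"
  have fin: "finite (?part B)" if "B \<subseteq> S" for B using finite_partitions finite_subset[OF that S(1)] .
  have finP: "finite P" if "partition_on S P" for P using partition_finite[OF S(1) that] .
  have "(\<Sum>B | z \<in> B \<and> B \<subseteq> S. cumul m B * m (S - B)) =
    cumul m S + (\<Sum>B | z \<in> B \<and> B \<subset> S. cumul m B * m (S - B))"
  proof -
    have "{B. z \<in> B \<and> B \<subseteq> S} = insert S {B. z \<in> B \<and> B \<subset> S}" using S by auto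
    moreover have "finite {B. z \<in> B \<and> B \<subset> S}" using S by (auto intro: finite_subset[of _ "Pow S"])
    ultimately show ?thesis by (simp add: m)
  qed
  also have "(\<Sum>B | z \<in> B \<and> B \<subset> S. cumul m B * m (S - B)) =
    (\<Sum>B | z \<in> B \<and> B \<subset> S. \<Sum>P\<in>?part B. c (card P) * ?w P * m (S - B))"
    by (simp add: cumul_def c_def sum_distrib_right)
  also have "\<dots> = (\<Sum>(B, P)\<in>Sigma {B. z \<in> B \<and> B \<subset> S} ?part. c (card P) * ?w P * m (S - B))"
    using S by (intro sum.Sigma) (auto intro: finite_subset[of _ "Pow S"] fin)
  \<comment> \<open>A proper subset \<open>B\<close> with a partition of it corresponds to a
    partition of \<open>S\<close> with a marked block \<open>D = S - B\<close> that misses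
    \<open>z\<close>.\<close>
  also have "\<dots> = (\<Sum>(P, D)\<in>Sigma (?part S) (\<lambda>P. {D \<in> P. z \<notin> D}). c (card P - 1) * ?w P)"
  proof (rule sum.reindex_bij_witness[of _ "\<lambda>(P, D). (S - D, P - {D})" "\<lambda>(B, P). (insert (S - B) P, S - B)"])
    fix x assume "x \<in> Sigma {B. z \<in> B \<and> B \<subset> S} ?part"
    then obtain B P where x: "x = (B, P)" and *: "z \<in> B" "B \<subset> S" "partition_on B P" by auto
    have nin: "S - B \<notin> P" using *(2,3) by (auto dest: partition_on_block)
    show "(case case x of (B, P) \<Rightarrow> (insert (S - B) P, S - B) of (P, D) \<Rightarrow> (S - D, P - {D})) = x"
      using nin * x by auto
    have "partition_on S (insert (S - B) P)"
      using * by (auto simp: partition_on_def disjoint_def)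
    then show "(case x of (B, P) \<Rightarrow> (insert (S - B) P, S - B)) \<in> Sigma (?part S) (\<lambda>P. {D \<in> P. z \<notin> D})"
      using * x by auto
    have "finite P" using partition_finite[OF finite_subset[OF _ S(1)] *(3)] * by auto
    then show "(case case x of (B, P) \<Rightarrow> (insert (S - B) P, S - B) of (P, D) \<Rightarrow> c (card P - 1) * ?w P) = (case x of (B, P) \<Rightarrow> c (card P) * ?w P * m (S - B))"
      using nin x by (simp add: mult_ac)
  next
    fix x assume "x \<in> Sigma (?part S) (\<lambda>P. {D \<in> P. z \<notin> D})"
    then obtain P D where x: "x = (P, D)" and *: "partition_on S P" "D \<in> P" "z \<notin> D" by auto
    have D: "D \<subseteq> S" "D \<noteq> {}" using partition_on_block[OF *(1,2)] by auto
    then have "S - (S - D) = D" by auto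
    then show "(case case x of (P, D) \<Rightarrow> (S - D, P - {D}) of (B, P) \<Rightarrow> (insert (S - B) P, S - B)) = x"
      using * x by auto
    have "partition_on (S - D) (P - {D})"
      using * by (auto simp: partition_on_def disjoint_def)
    then show "(case x of (P, D) \<Rightarrow> (S - D, P - {D})) \<in> Sigma {B. z \<in> B \<and> B \<subset> S} ?part"
      using * x D S by auto
  qed
  also have "\<dots> = (\<Sum>P\<in>?part S. \<Sum>D | D \<in> P \<and> z \<notin> D. c (card P - 1) * ?w P)"
    using S finP by (intro sum.Sigma[symmetric]) (auto simp: fin)
  also have "\<dots> = (\<Sum>P\<in>?part S. of_nat (card P - 1) * c (card P - 1) * ?w P)"
  proof (intro sum.cong refl)
    fix P assume "P \<in> ?part S"
    then have P: "partition_on S P" by simp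
    then obtain B0 where B0: "B0 \<in> P" "z \<in> B0" using S(2) by (auto simp: partition_on_def)
    have "{D. D \<in> P \<and> z \<notin> D} = P - {B0}"
      using P B0 by (auto simp: partition_on_def disjoint_def)
    then show "(\<Sum>D | D \<in> P \<and> z \<notin> D. c (card P - 1) * ?w P) = of_nat (card P - 1) * c (card P - 1) * ?w P"
      using B0 finP[OF P] by simp
  qed
  also have "cumul m S + \<dots> = (\<Sum>P\<in>?part S. (c (card P) + of_nat (card P - 1) * c (card P - 1)) * ?w P)"
    by (simp add: cumul_def c_def sum.distrib distrib_right)
  also have "\<dots> = (\<Sum>P\<in>?part S. if P = {S} then m S else 0)"
  proof (intro sum.cong refl)
    fix P assume "P \<in> ?part S"
    then have P: "partition_on S P" by simp
    have "P \<noteq> {}" using P S(2) by (auto simp: partition_on_def)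
    then have "card P \<noteq> 0" using finP[OF P] by simp
    show "(c (card P) + of_nat (card P - 1) * c (card P - 1)) * ?w P = (if P = {S} then m S else 0)"
    proof (cases "card P = 1")
      case True
      then obtain B where "P = {B}" by (auto simp: card_1_singleton_iff)
      moreover from this have "B = S" using P by (simp add: partition_on_def)
      ultimately show ?thesis by (simp add: c_def)
    next
      case False
      with \<open>card P \<noteq> 0\<close> obtain k where k: "card P = Suc (Suc k)" by (metis One_nat_def not0_implies_Suc)
      then have "P \<noteq> {S}" by auto
      \<comment> \<open>For \<open>k + 2\<close> blocks the coefficient is (-1)^(k+1) (k+1)! + (k+1)
        (-1)^k k! = 0.\<close>
      with k show ?thesis by (simp add: c_def)
    qed
  qed
  also have "\<dots> = m S"
  proof -
    have "{S} \<in> ?part S" using S by (auto intro: partition_on_space)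
    then show ?thesis using fin[of S] by (simp add: sum.delta')
  qed
  finally show ?thesis by simp
qed

text \<open>In the recursion the term \<open>B = S'\<close> has coefficient \<open>m {} = 1\<close>
  and all others involve smaller sets, so there is one solution. Cumulants can thus be found by
  guessing, without sums over partitions.\<close>

lemma cumul_unique:
  assumes S: "finite S" and m: "m {} = 1"
    and rec: "\<And>S'. z \<in> S' \<Longrightarrow> S' \<subseteq> S \<Longrightarrow> m S' = (\<Sum>B | z \<in> B \<and> B \<subseteq> S'. k B * m (S' - B))"
  shows "z \<in> B \<Longrightarrow> B \<subseteq> S \<Longrightarrow> cumul m B = k B"
proof (induction "card B" arbitrary: B rule: less_induct)
  case less
  have fB: "finite B" using finite_subset[OF less.prems(2) S] .
  have fin: "finite {B'. z \<in> B' \<and> B' \<subset> B}" using fB by (auto intro: finite_subset[of _ "Pow B"])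
  have split: "{B'. z \<in> B' \<and> B' \<subseteq> B} = insert B {B'. z \<in> B' \<and> B' \<subset> B}" using less.prems by auto
  have "(\<Sum>B' | z \<in> B' \<and> B' \<subset> B. cumul m B' * m (B - B')) = (\<Sum>B' | z \<in> B' \<and> B' \<subset> B. k B' * m (B - B'))"
  proof (intro sum.cong refl)
    fix B' assume "B' \<in> {B'. z \<in> B' \<and> B' \<subset> B}"
    then have B': "z \<in> B'" "B' \<subset> B" by auto
    have "cumul m B' = k B'"
      by (rule less.hyps) (use B' less.prems psubset_card_mono[OF fB] in auto)
    then show "cumul m B' * m (B - B') = k B' * m (B - B')" by simp
  qed
  then show ?case
    using cumul_rec[of B z m, OF fB less.prems(1) m] rec[OF less.prems] unfolding split
    by (simp add: fin m)
qed

text \<open>Such moments belong to a family whose entry at \<open>z\<close> is the constant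
  \<open>c\<close>; the recursion is solved by a cumulant supported on \<open>{z}\<close>.\<close>

lemma cumul_const:
  assumes "finite S" "z \<in> S" "card S \<ge> 2" "m {} = 1"
    and "\<And>B. z \<in> B \<Longrightarrow> B \<subseteq> S \<Longrightarrow> m B = c * m (B - {z})"
  shows "cumul m S = 0"
proof -
  have "cumul m S = (if S = {z} then c else 0)"
  proof (rule cumul_unique[where S = S and z = z and m = m and B = S and k = "\<lambda>B. if B = {z} then c else 0", OF assms(1,4) _ assms(2)])
    fix S' assume S': "z \<in> S'" "S' \<subseteq> S"
    then have "finite {B. z \<in> B \<and> B \<subseteq> S'}"
      using assms(1) by (auto intro: finite_subset[of _ "Pow S"])
    then have "(\<Sum>B | z \<in> B \<and> B \<subseteq> S'. (if B = {z} then c else 0) * m (S' - B)) = c * m (S' - {z})"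
      using S' by (simp add: if_distrib[of "\<lambda>x. x * _"] sum.If_cases sum.delta' cong: if_cong)
    then show "m S' = (\<Sum>B | z \<in> B \<and> B \<subseteq> S'. (if B = {z} then c else 0) * m (S' - B))"
      using assms(5)[OF S'] by simp
  qed simp
  then show ?thesis using assms(3) by auto
qed

lemma sum_pairs:
  assumes "finite S" "z \<in> S"
  shows "(\<Sum>B | z \<in> B \<and> B \<subseteq> S. (if \<exists>j. j \<noteq> z \<and> B = {z, j} then f B else 0)) = (\<Sum>j\<in>S - {z}. (f {z, j} :: complex))"
proof -
  have "(\<Sum>B | z \<in> B \<and> B \<subseteq> S. (if \<exists>j. j \<noteq> z \<and> B = {z, j} then f B else 0)) = (\<Sum>B\<in>(\<lambda>j. {z, j}) ` (S - {z}). f B)"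
    using assms by (intro sum.mono_neutral_cong_right) (auto intro: finite_subset[of _ "Pow S"])
  also have "\<dots> = (\<Sum>j\<in>S - {z}. f {z, j})"
    by (subst sum.reindex) (auto simp: inj_on_def doubleton_eq_iff)
  finally show ?thesis .
qed

text \<open>Wick's formula is the recursion in which only two-element blocks at \<open>z\<close>
  occur; by uniqueness the longer cumulants vanish.\<close>

lemma cumul_gaussian:
  assumes S: "finite S" "z \<in> S" "card S \<ge> 3" and m: "m {} = 1"
    and wick: "\<And>S'. z \<in> S' \<Longrightarrow> S' \<subseteq> S \<Longrightarrow> m S' = (\<Sum>j\<in>S' - {z}. c j * m (S' - {z, j}))"
  shows "cumul m S = 0"
proof -
  \<comment> \<open>A solution has to be a function of the block, so \<open>THE\<close> recovers the
    partner of \<open>z\<close> from the set \<open>{z, j}\<close>.\<close>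
  let ?k = "\<lambda>B. if \<exists>j. j \<noteq> z \<and> B = {z, j} then c (THE j. B = {z, j} \<and> j \<noteq> z) else 0"
  have the: "(THE j'. {z, j} = {z, j'} \<and> j' \<noteq> z) = j" if "j \<noteq> z" for j
    using that by (intro the_equality) (auto simp: doubleton_eq_iff)
  have "cumul m S = ?k S"
  proof (rule cumul_unique[where S = S and z = z and m = m and B = S and k = ?k, OF S(1) m _ S(2)])
    fix S' assume S': "z \<in> S'" "S' \<subseteq> S"
    have "(\<Sum>B | z \<in> B \<and> B \<subseteq> S'. ?k B * m (S' - B)) =
      (\<Sum>B | z \<in> B \<and> B \<subseteq> S'. if \<exists>j. j \<noteq> z \<and> B = {z, j} then c (THE j. B = {z, j} \<and> j \<noteq> z) * m (S' - B) else 0)"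
      by (intro sum.cong) auto
    also have "\<dots> = (\<Sum>j\<in>S' - {z}. c (THE j'. {z, j} = {z, j'} \<and> j' \<noteq> z) * m (S' - {z, j}))"
      using sum_pairs[of S' z "\<lambda>B. c (THE j. B = {z, j} \<and> j \<noteq> z) * m (S' - B)"] S' finite_subset[OF S'(2) S(1)] by blast
    also have "\<dots> = m S'"
      unfolding wick[OF S'] by (intro sum.cong refl) (simp add: the)
    finally show "m S' = (\<Sum>B | z \<in> B \<and> B \<subseteq> S'. ?k B * m (S' - B))" ..
  qed simp
  moreover have "\<not> (\<exists>j. j \<noteq> z \<and> S = {z, j})" using S(3) by auto
  ultimately show ?thesis by simp
qed

lemma cumul_pair:
  assumes "a \<noteq> b" "m {} = 1"
  shows "cumul m {a, b} = m {a, b} - m {a} * m {b}"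
proof -
  have s: "{B. a \<in> B \<and> B \<subseteq> {a}} = {{a}}" by auto
  have 1: "m {a} = cumul m {a}" using cumul_rec[of "{a}" a m] assms unfolding s by simp
  have "{B. a \<in> B \<and> B \<subseteq> {a, b}} = {{a}, {a, b}}" by auto
  moreover have "{a, b} - {a} = {b}" "{a} \<noteq> {a, b}" using assms by auto
  ultimately show ?thesis using cumul_rec[of "{a, b}" a m] assms 1 by simp
qed

text \<open>The converse direction: limits of cumulants give limits of moments, by induction on the
  size through the recursion. In the limit only pairs remain, since singletons vanish by centring
  and larger blocks by \<open>k3\<close>.\<close>

lemma wick_limit:
  assumes S: "finite S" and m: "\<And>d. m d {} = 1" "\<And>d i. i \<in> S \<Longrightarrow> m d {i} = 0"
    and k: "\<And>B. B \<subseteq> S \<Longrightarrow> card B \<ge> 2 \<Longrightarrow> (\<lambda>d. cumul (m d) B) \<longlonglongrightarrow> k B"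
    and k3: "\<And>B. B \<subseteq> S \<Longrightarrow> card B \<ge> 3 \<Longrightarrow> k B = 0"
  obtains g where "\<And>B. B \<subseteq> S \<Longrightarrow> (\<lambda>d. m d B) \<longlonglongrightarrow> g B"
    "\<And>z B. z \<in> B \<Longrightarrow> B \<subseteq> S \<Longrightarrow> g B = (\<Sum>j\<in>B - {z}. k {z, j} * g (B - {z, j}))"
proof -
  have k1: "(\<lambda>d. cumul (m d) {i}) \<longlonglongrightarrow> 0" if "i \<in> S" for i
  proof -
    have "{B. i \<in> B \<and> B \<subseteq> {i}} = {{i}}" by auto
    then have "m d {i} = cumul (m d) {i}" for d using cumul_rec[of "{i}" i "m d"] m(1) by simp
    then have "cumul (m d) {i} = 0" for d using m(2)[OF that, of d] by metis
    then show ?thesis by simp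
  qed
  \<comment> \<open>\<open>k\<close> is unconstrained below two elements. On singletons 0 is the
    true limit, as the variables are centred.\<close>
  define k' where "k' B = (if card B \<ge> 2 then k B else 0)" for B
  have kk: "(\<lambda>d. cumul (m d) B) \<longlonglongrightarrow> k' B" if "B \<subseteq> S" "i \<in> B" for B i
  proof (cases "card B \<ge> 2")
    case True
    then show ?thesis using k that by (simp add: k'_def)
  next
    case False
    moreover have "card B \<noteq> 0" using that finite_subset[OF that(1) S] by auto
    ultimately have "card B = 1" by linarith
    then obtain x where "B = {x}" by (auto simp: card_1_singleton_iff)
    then show ?thesis using k1 that by (simp add: k'_def)
  qed
  have conv: "B \<subseteq> S \<Longrightarrow> convergent (\<lambda>d. m d B)" for B
  proof (induction "card B" arbitrary: B rule: less_induct)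
    case less
    have fB: "finite B" using finite_subset[OF less.prems S] .
    show ?case
    proof (cases "B = {}")
      case False
      then obtain i where i: "i \<in> B" by auto
      have "convergent (\<lambda>d. \<Sum>B' | i \<in> B' \<and> B' \<subseteq> B. cumul (m d) B' * m d (B - B'))"
      proof (intro convergent_sum convergent_mult)
        fix B' assume "B' \<in> {B'. i \<in> B' \<and> B' \<subseteq> B}"
        then have B': "i \<in> B'" "B' \<subseteq> B" by auto
        show "convergent (\<lambda>d. cumul (m d) B')" using kk[of B' i] B' less.prems by (auto simp: convergent_def)
        have "card (B - B') < card B" using B' i fB by (intro psubset_card_mono) auto
        then show "convergent (\<lambda>d. m d (B - B'))" using less by auto
      qed
      moreover have "m d B = (\<Sum>B' | i \<in> B' \<and> B' \<subseteq> B. cumul (m d) B' * m d (B - B'))" for d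
        by (rule cumul_rec[of B i "m d", OF fB i m(1)])
      ultimately show ?thesis by simp
    qed (simp add: m convergent_const)
  qed
  define g where "g B = lim (\<lambda>d. m d B)" for B
  have g: "(\<lambda>d. m d B) \<longlonglongrightarrow> g B" if "B \<subseteq> S" for B
    using conv[OF that] by (simp add: g_def convergent_LIMSEQ_iff)
  show thesis
  proof (rule that[OF g])
    fix z B assume B: "z \<in> B" "B \<subseteq> S"
    have fB: "finite B" using finite_subset[OF B(2) S] .
    have "(\<lambda>d. \<Sum>B' | z \<in> B' \<and> B' \<subseteq> B. cumul (m d) B' * m d (B - B')) \<longlonglongrightarrow>
      (\<Sum>B' | z \<in> B' \<and> B' \<subseteq> B. k' B' * g (B - B'))"
      using B by (intro tendsto_intros kk g) auto
    moreover have "(\<lambda>d. \<Sum>B' | z \<in> B' \<and> B' \<subseteq> B. cumul (m d) B' * m d (B - B')) = (\<lambda>d. m d B)"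
      using cumul_rec[of B z "m d" for d, OF fB B(1) m(1)] by simp
    ultimately have "g B = (\<Sum>B' | z \<in> B' \<and> B' \<subseteq> B. k' B' * g (B - B'))"
      using g[OF B(2)] LIMSEQ_unique by metis
    also have "\<dots> = (\<Sum>B' | z \<in> B' \<and> B' \<subseteq> B. if \<exists>j. j \<noteq> z \<and> B' = {z, j} then k B' * g (B - B') else 0)"
    proof (intro sum.cong refl)
      fix B' assume "B' \<in> {B'. z \<in> B' \<and> B' \<subseteq> B}"
      then have B': "z \<in> B'" "B' \<subseteq> B" by auto
      then have fB': "finite B'" using fB finite_subset by auto
      show "k' B' * g (B - B') = (if \<exists>j. j \<noteq> z \<and> B' = {z, j} then k B' * g (B - B') else 0)"
      proof (cases "\<exists>j. j \<noteq> z \<and> B' = {z, j}")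
        case True
        then have "card B' = 2" by auto
        then show ?thesis using True by (simp add: k'_def)
      next
        case False
        have "card B' \<noteq> 2"
        proof
          assume "card B' = 2"
          then obtain x y where "B' = {x, y}" "x \<noteq> y" by (auto simp: card_2_iff)
          with B' False show False by auto
        qed
        then have "k' B' = 0" using k3[of B'] B' B by (auto simp: k'_def)
        then show ?thesis unfolding if_not_P[OF False] by simp
      qed
    qed
    also have "\<dots> = (\<Sum>j\<in>B - {z}. k {z, j} * g (B - {z, j}))"
      by (rule sum_pairs[OF fB B(1)])
    finally show "g B = (\<Sum>j\<in>B - {z}. k {z, j} * g (B - {z, j}))" .
  qed
qed

lemma partition_on_image: "partition_on S P \<Longrightarrow> inj_on h S \<Longrightarrow> partition_on (h ` S) ((`) h ` P)"
proof -
  assume *: "partition_on S P" "inj_on h S"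
  then have "(`) h ` P - {{}} = (`) h ` P" by (auto simp: partition_on_def)
  then show ?thesis using partition_on_inj_image[OF *] by simp
qed

text \<open>\<open>joint_cumulant\<close> is tied to initial segments, whereas cumulants over
  arbitrary finite index sets occur below.\<close>

lemma cumul_reindex:
  assumes h: "inj_on h S"
  shows "cumul m (h ` S) = cumul (\<lambda>B. m (h ` B)) S"
proof -
  have "cumul (\<lambda>B. m (h ` B)) S = (\<Sum>P | partition_on S P. (-1) ^ (card ((`) h ` P) - 1) * fact (card ((`) h ` P) - 1) * (\<Prod>B\<in>(`) h ` P. m B))"
    unfolding cumul_def
  proof (intro sum.cong refl)
    fix P assume "P \<in> {P. partition_on S P}"
    then have P: "partition_on S P" by simp
    have "inj_on ((`) h) P"
      using h P by (intro inj_onI) (metis inj_on_image_eq_iff partition_on_block)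
    then show "(-1) ^ (card P - 1) * fact (card P - 1) * (\<Prod>B\<in>P. m (h ` B)) =
      (-1) ^ (card ((`) h ` P) - 1) * fact (card ((`) h ` P) - 1) * (\<Prod>B\<in>(`) h ` P. m B)"
      by (simp add: card_image prod.reindex)
  qed
  also have "\<dots> = cumul m (h ` S)"
    unfolding cumul_def
  proof (rule sum.reindex_bij_witness[of _ "\<lambda>P. (`) (the_inv_into S h) ` P" "\<lambda>P. (`) h ` P"])
    fix P assume "P \<in> {P. partition_on S P}"
    then have P: "partition_on S P" by simp
    have "the_inv_into S h ` h ` B = B" if "B \<in> P" for B
      using partition_on_block[OF P that] h by (force simp: image_image the_inv_into_f_f subset_iff)
    then show "(`) (the_inv_into S h) ` (`) h ` P = P" by (force simp: image_image)
    show "(`) h ` P \<in> {P. partition_on (h ` S) P}"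
      using partition_on_image[OF P h] by simp
  next
    fix P assume "P \<in> {P. partition_on (h ` S) P}"
    then have P: "partition_on (h ` S) P" by simp
    have "h ` the_inv_into S h ` B = B" if "B \<in> P" for B
      using partition_on_block[OF P that] h by (force simp: image_image f_the_inv_into_f subset_iff)
    then show "(`) h ` (`) (the_inv_into S h) ` P = P" by (force simp: image_image)
    have "inj_on (the_inv_into S h) (h ` S)" by (rule inj_on_the_inv_into[OF h])
    from partition_on_image[OF P this] show "(`) (the_inv_into S h) ` P \<in> {P. partition_on S P}"
      using h by (simp add: image_image the_inv_into_f_f cong: image_cong)
  qed simp
  finally show ?thesis by simp
qed

text \<open>Multilinearity in the entry \<open>z\<close>: exactly one block of each partition
  contains \<open>z\<close>, and on the other blocks the three moment functions agree.\<close>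

lemma cumul_slot:
  assumes S: "finite S" "z \<in> S"
    and m: "\<And>B. B \<subseteq> S \<Longrightarrow> z \<in> B \<Longrightarrow> m B = a * m1 B + b * m2 B"
      "\<And>B. B \<subseteq> S \<Longrightarrow> z \<notin> B \<Longrightarrow> m1 B = m B" "\<And>B. B \<subseteq> S \<Longrightarrow> z \<notin> B \<Longrightarrow> m2 B = m B"
  shows "cumul m S = a * cumul m1 S + b * cumul m2 S"
proof -
  have "(\<Prod>B\<in>P. m B) = a * (\<Prod>B\<in>P. m1 B) + b * (\<Prod>B\<in>P. m2 B)" if P: "partition_on S P" for P
  proof -
    obtain B0 where B0: "B0 \<in> P" "z \<in> B0" using S(2) P by (auto simp: partition_on_def)
    have o: "z \<notin> B" if "B \<in> P - {B0}" for B
      using P B0 that by (auto simp: partition_on_def disjoint_def)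
    have fin: "finite P" using partition_finite[OF S(1) P] .
    have e: "(\<Prod>B\<in>P. f B) = f B0 * (\<Prod>B\<in>P - {B0}. f B)" for f :: "nat set \<Rightarrow> complex"
      by (rule prod.remove[OF fin B0(1)])
    have sub: "B \<subseteq> S" if "B \<in> P" for B using partition_on_block[OF P that] by simp
    have "(\<Prod>B\<in>P - {B0}. m1 B) = (\<Prod>B\<in>P - {B0}. m B)" "(\<Prod>B\<in>P - {B0}. m2 B) = (\<Prod>B\<in>P - {B0}. m B)"
      using m(2,3) sub o by (auto intro!: prod.cong)
    then show ?thesis unfolding e[of m] e[of m1] e[of m2] using m(1)[OF sub[OF B0(1)] B0(2)] by (simp add: algebra_simps)
  qed
  then show ?thesis
    unfolding cumul_def by (simp add: sum_distrib_left sum.distrib[symmetric] algebra_simps)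
qed

section \<open>Words in an orthogonal matrix and coefficients\<close>

text \<open>
  A maximal factor of a word without the orthogonal matrix is kept as one letter \<open>Coef p\<close>, where
  \<open>p\<close> is a polynomial in the given ensemble.
\<close>

datatype 'i oletter = Orth | OrthT | Coef "'i ncpoly"

type_synonym 'i oword = "'i oletter list"

fun olt :: "'i oletter \<Rightarrow> 'i oletter" where
  "olt Orth = OrthT"
| "olt OrthT = Orth"
| "olt (Coef p) = Coef (nc_transpose p)"

definition owt :: "'i oword \<Rightarrow> 'i oword" where
  "owt w = rev (map olt w)"

fun is_coef :: "'i oletter \<Rightarrow> bool" where
  "is_coef (Coef p) = True"
| "is_coef _ = False"

definition odeg :: "'i oword \<Rightarrow> nat" where
  "odeg w = length (filter (\<lambda>l. \<not> is_coef l) w)"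

definition odegs :: "'i oword multiset \<Rightarrow> nat" where
  "odegs M = (\<Sum>w\<in>#M. odeg w)"

text \<open>
  A rotation of the orthogonal matrix acts to the left of \<open>Orth\<close> and to the right of \<open>OrthT\<close>,
  which is where a word is cut; the first component is the sign of that contribution to the
  derivative.
\<close>

fun cuts :: "'i oword \<Rightarrow> (complex \<times> 'i oword \<times> 'i oword) list" where
  "cuts [] = []"
| "cuts (l # w) =
    (case l of Orth \<Rightarrow> [(1, [], Orth # w)] | OrthT \<Rightarrow> [(-1, [OrthT], w)] | Coef p \<Rightarrow> []) @
    map (\<lambda>(s, L, R). (s, l # L, R)) (cuts w)"

text \<open>
  Generators of the relation "equal trace for every orthogonal matrix and every ensemble".
\<close>

inductive teq :: "'i oword \<Rightarrow> 'i oword \<Rightarrow> bool" where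
  teq_refl: "teq w w"
| teq_sym: "teq u v \<Longrightarrow> teq v u"
| teq_trans: "teq u v \<Longrightarrow> teq v w \<Longrightarrow> teq u w"
| teq_rot: "teq (u @ v) (v @ u)"
| teq_transp: "teq w (owt w)"
| teq_cancel1: "teq (Orth # OrthT # w) w"
| teq_cancel2: "teq (OrthT # Orth # w) w"
| teq_merge: "teq (Coef p # Coef q # w) (Coef (p * q) # w)"

lemma olt_olt [simp]: "olt (olt l) = l"
  by (cases l) (simp_all add: nc_transpose_twice)

lemma owt_owt [simp]: "owt (owt w) = w"
  by (simp add: owt_def rev_map comp_def)

lemma owt_append [simp]: "owt (u @ v) = owt v @ owt u"
  by (simp add: owt_def)

lemma owt_Nil [simp]: "owt [] = []"
  by (simp add: owt_def)

lemma owt_Cons: "owt (l # w) = owt w @ [olt l]"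
  by (simp add: owt_def)

lemma length_owt [simp]: "length (owt w) = length w"
  by (simp add: owt_def)

lemma set_owt: "set (owt w) = olt ` set w"
  by (simp add: owt_def)

lemma is_coef_olt [simp]: "is_coef (olt l) = is_coef l"
  by (cases l) simp_all

lemma odeg_simps [simp]:
  "odeg [] = 0" "odeg (u @ v) = odeg u + odeg v"
  "odeg (l # w) = (if is_coef l then odeg w else Suc (odeg w))"
  by (simp_all add: odeg_def)

lemma odeg_owt [simp]: "odeg (owt w) = odeg w"
  by (induction w) (simp_all add: owt_Cons)

lemma odegs_simps [simp]:
  "odegs {#} = 0" "odegs (add_mset w M) = odeg w + odegs M" "odegs (M + N) = odegs M + odegs N"
  by (simp_all add: odegs_def)

text \<open>The two signs behave differently in loop equations. A positive cut keeps an
  \<open>Orth\<close> at the head of \<open>R\<close>, so that \<open>Orth # L\<close> has lower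
  degree than \<open>Orth # w\<close>. After a negative one the last letter \<open>OrthT\<close> of
  \<open>L\<close> cancels cyclically against an \<open>Orth\<close> put in front.\<close>

lemma cuts_cases:
  assumes "(s, L, R) \<in> set (cuts w)"
  obtains R' where "s = 1" "R = Orth # R'" "w = L @ R"
  | L' where "s = -1" "L = L' @ [OrthT]" "w = L @ R"
  using assms
proof (induction w arbitrary: L thesis)
  case (Cons l w)
  from Cons.prems(3) consider
    "l = Orth" "s = 1" "L = []" "R = Orth # w"
  | "l = OrthT" "s = -1" "L = [OrthT]" "R = w"
  | L0 where "(s, L0, R) \<in> set (cuts w)" "L = l # L0"
    by (cases l) auto
  then show ?case
  proof cases
    case 3
    show ?thesis
      by (rule Cons.IH[OF _ _ 3(1)]) (use 3(2) Cons.prems(1,2) in auto)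
  qed (use Cons.prems(1,2) in auto)
qed simp

lemma cuts_odeg: "(s, L, R) \<in> set (cuts w) \<Longrightarrow> odeg L + odeg R = odeg w"
  by (erule cuts_cases) simp_all

lemma cuts_append_eq: "(s, L, R) \<in> set (cuts w) \<Longrightarrow> L @ R = w"
  by (erule cuts_cases) simp_all

lemma cuts_odeg_0: "odeg w = 0 \<Longrightarrow> cuts w = []"
proof (induction w)
  case (Cons l w)
  then show ?case by (cases l) auto
qed simp

lemma teq_Orth_cancel: "teq (Orth # w @ [OrthT]) w"
  using teq_trans[OF teq_rot[of "Orth # w" "[OrthT]", simplified] teq_cancel2] by simp

text \<open>Loop equations are stated for words that begin with \<open>Orth\<close>. A rotation
  brings such a letter to the front, after a transposition if all orthogonal letters are
  \<open>OrthT\<close>. Length, degree and letters are recorded so that the new word stays within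
  the same finite set of configurations.\<close>

lemma teq_normal:
  assumes "odeg w > 0"
  obtains V where "teq w (Orth # V)" "length (Orth # V) = length w" "odeg (Orth # V) = odeg w"
    "set (Orth # V) \<subseteq> set w \<union> olt ` set w"
proof -
  have *: "\<exists>V. teq x (Orth # V) \<and> length (Orth # V) = length x \<and> odeg (Orth # V) = odeg x \<and>
    set (Orth # V) = set x" if "Orth \<in> set x" for x :: "'a oword"
  proof -
    from that obtain u v where x: "x = u @ Orth # v" by (meson split_list)
    show ?thesis
      by (rule exI[of _ "v @ u"]) (use teq_rot[of u "Orth # v"] x in auto)
  qed
  show thesis
  proof (cases "Orth \<in> set w")
    case True
    from *[OF this] show thesis using that by blast
  next
    case False
    from assms obtain l where l: "l \<in> set w" "\<not> is_coef l" by (auto simp: odeg_def filter_empty_conv)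
    with False have "l = OrthT" by (cases l) auto
    with l have "Orth \<in> set (owt w)" by (force simp: set_owt)
    from *[OF this] obtain V where "teq (owt w) (Orth # V)" "length (Orth # V) = length w"
      "odeg (Orth # V) = odeg w" "set (Orth # V) = olt ` set w" by (auto simp: set_owt)
    with teq_transp teq_trans show thesis by (intro that) blast+
  qed
qed

text \<open>
  Convergent up to an error of order \<open>r d\<close>. The rate \<open>r\<close> is a parameter because the first pass
  uses a rate that contains the unknown quantities themselves.
\<close>

definition conv_upto :: "(nat \<Rightarrow> real) \<Rightarrow> (nat \<Rightarrow> complex) \<Rightarrow> bool" where
  "conv_upto r f \<longleftrightarrow> (\<exists>b. convergent b \<and> (\<exists>K. \<forall>d\<ge>1. norm (f d - b d) \<le> K * r d))"

lemma conv_upto_conv: "convergent f \<Longrightarrow> conv_upto r f"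
  unfolding conv_upto_def by (rule exI[of _ f]) (auto intro: exI[of _ 0])

lemma conv_upto_small: "(\<And>d. d \<ge> 1 \<Longrightarrow> norm (f d) \<le> K * r d) \<Longrightarrow> conv_upto r f"
  unfolding conv_upto_def by (rule exI[of _ "\<lambda>_. 0"]) (auto simp: convergent_const)

lemma conv_upto_cong: "(\<And>d. d \<ge> 1 \<Longrightarrow> f d = g d) \<Longrightarrow> conv_upto r f \<longleftrightarrow> conv_upto r g"
  unfolding conv_upto_def by auto

lemma conv_upto_add:
  assumes "conv_upto r f" "conv_upto r g"
  shows "conv_upto r (\<lambda>d. f d + g d)"
proof -
  from assms obtain a b K L where *: "convergent a" "convergent b"
    "\<And>d. d \<ge> 1 \<Longrightarrow> norm (f d - a d) \<le> K * r d" "\<And>d. d \<ge> 1 \<Longrightarrow> norm (g d - b d) \<le> L * r d"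
    unfolding conv_upto_def by blast
  have "norm (f d + g d - (a d + b d)) \<le> (K + L) * r d" if "d \<ge> 1" for d
    using norm_triangle_ineq[of "f d - a d" "g d - b d"] *(3,4)[OF that]
    by (simp add: algebra_simps)
  then show ?thesis unfolding conv_upto_def using convergent_add[OF *(1,2)]
    by (intro exI[of _ "\<lambda>d. a d + b d"]) auto
qed

lemma conv_upto_mult:
  assumes "convergent g" "conv_upto r f" "\<And>d. d \<ge> 1 \<Longrightarrow> 0 \<le> r d"
  shows "conv_upto r (\<lambda>d. g d * f d)"
proof -
  from assms obtain b K where *: "convergent b" "\<And>d. d \<ge> 1 \<Longrightarrow> norm (f d - b d) \<le> K * r d"
    unfolding conv_upto_def by blast
  from convergent_imp_Bseq[OF assms(1)] obtain B where B: "\<And>d. norm (g d) \<le> B" "B > 0"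
    unfolding Bseq_def by blast
  have "norm (g d * f d - g d * b d) \<le> (B * K) * r d" if "d \<ge> 1" for d
  proof -
    have "norm (g d * f d - g d * b d) = norm (g d) * norm (f d - b d)"
      by (simp add: norm_mult right_diff_distrib[symmetric])
    also have "\<dots> \<le> B * (K * r d)"
      using B *(2)[OF that] by (intro mult_mono) (auto intro: order_trans[OF norm_ge_zero])
    finally show ?thesis by (simp add: mult.assoc)
  qed
  then show ?thesis unfolding conv_upto_def using convergent_mult[OF assms(1) *(1)]
    by (intro exI[of _ "\<lambda>d. g d * b d"]) auto
qed

lemma conv_upto_diff:
  assumes "conv_upto r f" "conv_upto r g" "\<And>d. d \<ge> 1 \<Longrightarrow> 0 \<le> r d"
  shows "conv_upto r (\<lambda>d. f d - g d)"
  using conv_upto_add[OF assms(1) conv_upto_mult[OF convergent_const[of "-1"] assms(2,3)]] by simp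

lemma conv_upto_sum_list:
  "(\<And>x. x \<in> set xs \<Longrightarrow> conv_upto r (f x)) \<Longrightarrow> conv_upto r (\<lambda>d. \<Sum>x\<leftarrow>xs. f x d)"
  by (induction xs) (auto intro: conv_upto_add conv_upto_conv convergent_const)

lemma conv_upto_sum_mset:
  "(\<And>x. x \<in># M \<Longrightarrow> conv_upto r (f x)) \<Longrightarrow> conv_upto r (\<lambda>d. \<Sum>x\<in>#M. f x d)"
  by (induction M) (auto intro: conv_upto_add conv_upto_conv convergent_const)

lemma conv_upto_bounded:
  assumes "conv_upto r f" "\<And>d. d \<ge> 1 \<Longrightarrow> 0 \<le> r d"
  shows "\<exists>B K. B \<ge> 0 \<and> K \<ge> 0 \<and> (\<forall>d\<ge>1. norm (f d) \<le> B + K * r d)"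
proof -
  from assms obtain b K where *: "convergent b" "\<And>d. d \<ge> 1 \<Longrightarrow> norm (f d - b d) \<le> K * r d"
    unfolding conv_upto_def by blast
  from convergent_imp_Bseq[OF *(1)] obtain B where B: "\<And>d. norm (b d) \<le> B" "B > 0"
    unfolding Bseq_def by blast
  have "norm (f d) \<le> B + \<bar>K\<bar> * r d" if "d \<ge> 1" for d
  proof -
    have "norm (f d) \<le> norm (b d) + norm (f d - b d)" using norm_triangle_sub by blast
    also have "K * r d \<le> \<bar>K\<bar> * r d" using assms(2)[OF that] by (intro mult_right_mono) auto
    ultimately show ?thesis using B(1)[of d] *(2)[OF that] by linarith
  qed
  with B show ?thesis by (intro exI[of _ B] exI[of _ "\<bar>K\<bar>"]) auto
qed

lemma conv_upto_convergent:
  assumes "conv_upto (\<lambda>d. 1 / real d) f"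
  shows "convergent f"
proof -
  from assms obtain b K where *: "convergent b" "\<And>d. d \<ge> 1 \<Longrightarrow> norm (f d - b d) \<le> K * (1 / real d)"
    unfolding conv_upto_def by blast
  have "(\<lambda>d. f d - b d) \<longlonglongrightarrow> 0"
  proof (rule Lim_null_comparison)
    show "(\<lambda>d. K * (1 / real d)) \<longlonglongrightarrow> 0"
      by (rule tendsto_mult_right_zero) (rule lim_1_over_n)
    show "\<forall>\<^sub>F d in sequentially. norm (f d - b d) \<le> K * (1 / real d)"
      using *(2) by (auto simp: eventually_sequentially intro: exI[of _ 1])
  qed
  then have "convergent (\<lambda>d. f d - b d)" by (rule convergentI)
  from convergent_add[OF this *(1)] show ?thesis by simp
qed

section \<open>Finite sets of configurations; sums over multisets and cuts\<close>

definition tlen :: "'i oword multiset \<Rightarrow> nat" where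
  "tlen M = (\<Sum>w\<in>#M. length w)"

definition zeros :: "'i oword multiset \<Rightarrow> nat" where
  "zeros M = size (filter_mset (\<lambda>w. odeg w = 0) M)"

definition letters_in :: "'i oletter set \<Rightarrow> 'i oword multiset \<Rightarrow> bool" where
  "letters_in F M \<longleftrightarrow> (\<forall>w\<in>#M. set w \<subseteq> F)"

text \<open>The index set of the linear system in degree \<open>n\<close>. Total length and the
  number of words of degree 0 are bounded separately, because the degree sees neither the
  coefficients in a word nor the words without orthogonal letters. Cutting and gluing respect the
  bounds as long as the degree remains \<open>n\<close>.\<close>

definition confs :: "nat \<Rightarrow> 'i oletter set \<Rightarrow> nat \<Rightarrow> nat \<Rightarrow> 'i oword multiset set" where
  "confs n F N z = {M. odegs M = n \<and> letters_in F M \<and> tlen M \<le> N \<and> zeros M \<le> z}"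

definition wconfs :: "nat \<Rightarrow> 'i oletter set \<Rightarrow> nat \<Rightarrow> 'i oword set" where
  "wconfs n F N = {w. odeg w = n \<and> set w \<subseteq> F \<and> length w \<le> N}"

lemma tlen_simps [simp]: "tlen {#} = 0" "tlen (add_mset w M) = length w + tlen M"
  by (simp_all add: tlen_def)

lemma zeros_simps [simp]: "zeros {#} = 0" "zeros (add_mset w M) = (if odeg w = 0 then Suc (zeros M) else zeros M)"
  by (simp_all add: zeros_def)

lemma letters_in_simps [simp]: "letters_in F {#}" "letters_in F (add_mset w M) \<longleftrightarrow> set w \<subseteq> F \<and> letters_in F M"
  by (auto simp: letters_in_def)

lemma finite_wconfs: "finite F \<Longrightarrow> finite (wconfs n F N)"
  by (rule finite_subset[OF _ finite_lists_length_le[of F N]]) (auto simp: wconfs_def)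

lemma size_le_degs: "size M \<le> odegs M + zeros M"
  by (induction M) auto

lemma finite_confs:
  assumes "finite F"
  shows "finite (confs n F N z)"
proof -
  let ?W = "{w. set w \<subseteq> F \<and> length w \<le> N}"
  have "finite (mset ` {ws. set ws \<subseteq> ?W \<and> length ws \<le> n + z})"
    by (intro finite_imageI finite_lists_length_le assms)
  moreover have "confs n F N z \<subseteq> mset ` {ws. set ws \<subseteq> ?W \<and> length ws \<le> n + z}"
  proof
    fix M assume M: "M \<in> confs n F N z"
    obtain ws where ws: "mset ws = M" using ex_mset by blast
    have "length w \<le> tlen M" if "w \<in># M" for w
      using multi_member_split[OF that] by auto
    with M have "set ws \<subseteq> ?W" using ws by (fastforce simp: confs_def letters_in_def)
    moreover have "length ws \<le> n + z"
      using M size_le_degs[of M] unfolding ws[symmetric] confs_def by auto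
    ultimately show "M \<in> mset ` {ws. set ws \<subseteq> ?W \<and> length ws \<le> n + z}"
      using ws by blast
  qed
  ultimately show ?thesis using finite_subset by blast
qed

text \<open>Dimension 0 is unconstrained, so sequences are compared from dimension 1 on.\<close>

lemma LIMSEQ_unique_ge1:
  fixes f g :: "nat \<Rightarrow> complex"
  assumes "f \<longlonglongrightarrow> a" "g \<longlonglongrightarrow> b" "\<And>d. d \<ge> 1 \<Longrightarrow> f d = g d"
  shows "a = b"
proof -
  have "\<forall>\<^sub>F d in sequentially. f d = g d"
    using assms(3) by (auto simp: eventually_sequentially)
  with assms(1) have "g \<longlonglongrightarrow> a" by (simp cong: filterlim_cong)
  with assms(2) show ?thesis using LIMSEQ_unique by blast
qed

lemma tendsto_sum_mset':
  fixes f :: "'b \<Rightarrow> nat \<Rightarrow> complex"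
  shows "(\<And>x. x \<in># M \<Longrightarrow> f x \<longlonglongrightarrow> l x) \<Longrightarrow> (\<lambda>d. \<Sum>x\<in>#M. f x d) \<longlonglongrightarrow> (\<Sum>x\<in>#M. l x)"
  by (induction M) (auto intro!: tendsto_add)

lemma tendsto_sum_triples:
  fixes f :: "complex \<Rightarrow> 'b \<Rightarrow> 'c \<Rightarrow> nat \<Rightarrow> complex"
  assumes "\<And>s L R. f s L R \<longlonglongrightarrow> l s L R"
  shows "(\<lambda>d. \<Sum>(s, L, R)\<leftarrow>xs. f s L R d) \<longlonglongrightarrow> (\<Sum>(s, L, R)\<leftarrow>xs. l s L R)"
  by (induction xs) (auto intro!: tendsto_add assms)

lemma sum_triples_cong:
  assumes "\<And>s L R. c * f s L R = (g s L R :: complex)"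
  shows "c * (\<Sum>(s, L, R)\<leftarrow>xs. f s L R) = (\<Sum>(s, L, R)\<leftarrow>xs. g s L R)"
  by (induction xs) (auto simp: distrib_left assms)

lemma sum_mset_cong_left:
  assumes "\<And>u. c * f u = (g u :: complex)"
  shows "c * (\<Sum>u\<in>#M. f u) = (\<Sum>u\<in>#M. g u)"
  by (induction M) (auto simp: distrib_left assms)

lemma sum_mset_lincomb:
  "(\<Sum>u\<in>#M. c * (a * f u + b * g u) * h u) =
    c * (a * (\<Sum>u\<in>#M. f u * h u) + b * (\<Sum>u\<in>#M. g u * (h u :: complex)))"
  by (induction M) (simp_all add: algebra_simps)

lemma sum_mset_list_swap:
  "(\<Sum>x\<leftarrow>xs. \<Sum>u\<in>#M. f x u) = (\<Sum>u\<in>#M. \<Sum>x\<leftarrow>xs. (f x u :: complex))"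
  by (induction xs) (simp_all add: sum_mset.distrib)

lemma sum_triples_cong':
  assumes "\<And>s L R. (s, L, R) \<in> set xs \<Longrightarrow> f s L R = (g s L R :: complex)"
  shows "(\<Sum>(s, L, R)\<leftarrow>xs. f s L R) = (\<Sum>(s, L, R)\<leftarrow>xs. g s L R)"
  by (intro arg_cong[where f = sum_list] map_cong refl) (use assms in auto)

text \<open>Both sides run over ordered pairs of distinct occurrences. Each is the full double sum
  minus its diagonal, and the full double sum may be exchanged.\<close>

lemma sum_mset_remove_swap:
  fixes f :: "'b \<Rightarrow> 'b \<Rightarrow> complex"
  shows "(\<Sum>u\<in>#M. \<Sum>v\<in>#M - {#u#}. f u v) = (\<Sum>v\<in>#M. \<Sum>u\<in>#M - {#v#}. f u v)"
proof -
  have *: "(\<Sum>v\<in>#M - {#u#}. g v) = (\<Sum>v\<in>#M. g v) - g u" if "u \<in># M" for u and g :: "'b \<Rightarrow> complex"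
    using multi_member_split[OF that] by auto
  have sw: "(\<Sum>u\<in>#M. \<Sum>v\<in>#N. f u v) = (\<Sum>v\<in>#N. \<Sum>u\<in>#M. f u v)" for N
    by (induction N) (simp_all add: sum_mset.distrib)
  have d: "(\<Sum>u\<in>#M. g u - h u) = (\<Sum>u\<in>#M. g u) - (\<Sum>u\<in>#M. h u)" for g h :: "'b \<Rightarrow> complex"
    by (induction M) simp_all
  have "(\<Sum>u\<in>#M. \<Sum>v\<in>#M - {#u#}. f u v) = (\<Sum>u\<in>#M. (\<Sum>v\<in>#M. f u v) - f u u)"
    by (intro arg_cong[where f = sum_mset] image_mset_cong *)
  also have "\<dots> = (\<Sum>v\<in>#M. (\<Sum>u\<in>#M. f u v) - f v v)"
    unfolding d sw[of M] ..
  also have "\<dots> = (\<Sum>v\<in>#M. \<Sum>u\<in>#M - {#v#}. f u v)"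
    by (intro arg_cong[where f = sum_mset] image_mset_cong *[symmetric])
  finally show ?thesis .
qed

lemma conv_upto_sum_bounded:
  assumes "finite S" "\<And>s. s \<in> S \<Longrightarrow> conv_upto r (f s)" "\<And>d. d \<ge> 1 \<Longrightarrow> 0 \<le> r d"
  shows "\<exists>B K. B \<ge> 0 \<and> K \<ge> 0 \<and> (\<forall>d\<ge>1. (\<Sum>s\<in>S. norm (f s d)) \<le> B + K * r d)"
  using assms(1,2)
proof (induction S)
  case empty
  show ?case by (intro exI[of _ 0]) auto
next
  case (insert x S)
  then obtain B K where B: "B \<ge> 0" "K \<ge> 0" "\<And>d. d \<ge> 1 \<Longrightarrow> (\<Sum>s\<in>S. norm (f s d)) \<le> B + K * r d" by auto
  from conv_upto_bounded[of r "f x"] insert assms(3) obtain B' K' where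
    B': "B' \<ge> 0" "K' \<ge> 0" "\<And>d. d \<ge> 1 \<Longrightarrow> norm (f x d) \<le> B' + K' * r d" by auto
  show ?case
    by (rule exI[of _ "B + B'"], rule exI[of _ "K + K'"])
      (use insert B(1,2) B'(1,2) add_mono[OF B'(3) B(3)] in \<open>auto simp: algebra_simps\<close>)
qed

section \<open>Loop equations and their limit\<close>

text \<open>
  \<open>\<tau> d w\<close> stands for the expected normalized trace of \<open>w\<close>, and \<open>C d M\<close> for the expectation of the
  product of the centred unnormalized traces of the words in \<open>M\<close>.
\<close>

locale loop_asymp =
  fixes \<tau> :: "nat \<Rightarrow> 'i oword \<Rightarrow> complex" and C :: "nat \<Rightarrow> 'i oword multiset \<Rightarrow> complex"
  assumes \<tau>_teq: "d \<ge> 1 \<Longrightarrow> teq u v \<Longrightarrow> \<tau> d u = \<tau> d v"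
    and C_teq: "d \<ge> 1 \<Longrightarrow> teq u v \<Longrightarrow> C d (add_mset u M) = C d (add_mset v M)"
    and C_empty: "d \<ge> 1 \<Longrightarrow> C d {#} = 1"
    and C_single: "d \<ge> 1 \<Longrightarrow> C d {#w#} = 0"
    and \<tau>_loop: "d \<ge> 1 \<Longrightarrow> (of_nat d - 1) * (of_nat d * \<tau> d (Orth # V)) =
      (\<Sum>(s, L, R)\<leftarrow>cuts V. s * (of_nat d * \<tau> d (Orth # L @ owt R) - C d {#Orth # L, R#}
        - of_nat d ^ 2 * \<tau> d (Orth # L) * \<tau> d R))"
    and C_loop: "d \<ge> 1 \<Longrightarrow> (of_nat d - 1) * C d (add_mset (Orth # V) us) =
      (\<Sum>(s, L, R)\<leftarrow>cuts V. s * (C d (add_mset (Orth # L @ owt R) us) - C d (add_mset (Orth # L) (add_mset R us))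
        + C d {#Orth # L, R#} * C d us
        - of_nat d * \<tau> d (Orth # L) * C d (add_mset R us) - of_nat d * \<tau> d R * C d (add_mset (Orth # L) us)))
      + (\<Sum>u\<in>#us. \<Sum>(s, L, R)\<leftarrow>cuts u. s *
          (C d (add_mset (Orth # V @ owt (R @ L)) (us - {#u#})) + of_nat d * \<tau> d (Orth # V @ owt (R @ L)) * C d (us - {#u#})
          - C d (add_mset (Orth # V @ R @ L) (us - {#u#})) - of_nat d * \<tau> d (Orth # V @ R @ L) * C d (us - {#u#})))"
    and \<tau>_base: "odeg w = 0 \<Longrightarrow> convergent (\<lambda>d. \<tau> d w)"
    and C_base: "odegs M = 0 \<Longrightarrow> convergent (\<lambda>d. C d M)"
    and wick_base: "odegs (add_mset w M) = 0 \<Longrightarrow>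
      lim (\<lambda>d. C d (add_mset w M)) = (\<Sum>u\<in>#M. lim (\<lambda>d. C d {#w, u#}) * lim (\<lambda>d. C d (M - {#u#})))"
begin

lemma conv_upto_C_cong:
  "teq u v \<Longrightarrow> conv_upto r (\<lambda>d. g d * C d (add_mset u M)) \<longleftrightarrow> conv_upto r (\<lambda>d. g d * C d (add_mset v M))"
  by (rule conv_upto_cong) (simp add: C_teq[of _ u v])

text \<open>One pass through the loop equation, divided by \<open>d\<close>: terms of lower degree
  converge by induction, those of full degree are controlled by \<open>h1\<close> and
  \<open>h2\<close>. The weight \<open>\<sigma>\<close> is \<open>1/d\<close> while the moments are
  only being bounded and 1 when they are shown to converge.\<close>

lemma step_C:
  assumes n: "add_mset (Orth # V) us \<in> confs n F N z"
    and F: "\<And>l. l \<in> F \<Longrightarrow> olt l \<in> F"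
    and r: "\<And>d. d \<ge> 1 \<Longrightarrow> 0 \<le> r d"
    and IHt: "\<And>w. odeg w < n \<Longrightarrow> convergent (\<lambda>d. \<tau> d w)"
    and IHC: "\<And>M. odegs M < n \<Longrightarrow> convergent (\<lambda>d. C d M)"
    and \<sigma>: "convergent \<sigma>"
    and h1: "\<And>M. M \<in> confs n F N z \<Longrightarrow> conv_upto r (\<lambda>d. \<sigma> d / of_nat d * C d M)"
    and h2: "\<And>w. w \<in> wconfs n F N \<Longrightarrow> conv_upto r (\<lambda>d. \<sigma> d * \<tau> d w)"
  shows "conv_upto r (\<lambda>d. \<sigma> d * C d (add_mset (Orth # V) us))"
proof -
  note in_confs = confs_def wconfs_def
  have inv: "convergent (\<lambda>d. 1 / of_nat d :: complex)"
    by (rule convergentI[OF lim_1_over_n])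
  have c2: "conv_upto r (\<lambda>d. f d * g d)" if "convergent f" "convergent g" for f g
    using conv_upto_conv[OF convergent_mult[OF that]] .
  have \<sigma>d: "convergent (\<lambda>d. \<sigma> d / of_nat d)"
    using convergent_mult[OF \<sigma> inv] by simp
  let ?G = "Orth # V"
  have us: "odegs us < n" using n by (auto simp: in_confs)
  have eq: "conv_upto r (\<lambda>d. \<sigma> d * C d (add_mset ?G us)) \<longleftrightarrow>
    conv_upto r (\<lambda>d. \<sigma> d / of_nat d * C d (add_mset ?G us) +
      (\<Sum>(s, L, R)\<leftarrow>cuts V. \<sigma> d / of_nat d * (s * (C d (add_mset (Orth # L @ owt R) us) - C d (add_mset (Orth # L) (add_mset R us))
        + C d {#Orth # L, R#} * C d us
        - of_nat d * \<tau> d (Orth # L) * C d (add_mset R us) - of_nat d * \<tau> d R * C d (add_mset (Orth # L) us)))) +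
      (\<Sum>u\<in>#us. \<Sum>(s, L, R)\<leftarrow>cuts u. \<sigma> d / of_nat d * (s *
          (C d (add_mset (Orth # V @ owt (R @ L)) (us - {#u#})) + of_nat d * \<tau> d (Orth # V @ owt (R @ L)) * C d (us - {#u#})
          - C d (add_mset (Orth # V @ R @ L) (us - {#u#})) - of_nat d * \<tau> d (Orth # V @ R @ L) * C d (us - {#u#})))))"
    (is "_ \<longleftrightarrow> conv_upto r (\<lambda>d. ?a d + ?b d + ?c d)")
  proof (rule conv_upto_cong)
    fix d :: nat assume d: "d \<ge> 1"
    \<comment> \<open>Write 1 = 1/d + (d - 1)/d. The second part is replaced by the loop equation;
      the first has full degree, but carries \<open>1/d\<close>.\<close>
    have "\<sigma> d * C d (add_mset ?G us) =
      \<sigma> d / of_nat d * C d (add_mset ?G us) + \<sigma> d / of_nat d * ((of_nat d - 1) * C d (add_mset ?G us))"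
      using d by (simp add: field_simps)
    then show "\<sigma> d * C d (add_mset ?G us) = ?a d + ?b d + ?c d"
      unfolding C_loop[OF d] distrib_left sum_mset_distrib_left sum_list_const_mult[symmetric]
      by (simp add: case_prod_unfold add.assoc)
  qed
  have split: "conv_upto r (\<lambda>d. \<sigma> d / of_nat d * (s * (C d (add_mset (Orth # L @ owt R) us) - C d (add_mset (Orth # L) (add_mset R us))
        + C d {#Orth # L, R#} * C d us
        - of_nat d * \<tau> d (Orth # L) * C d (add_mset R us) - of_nat d * \<tau> d R * C d (add_mset (Orth # L) us))))"
    if c: "(s, L, R) \<in> set (cuts V)" for s L R
  proof -
    have LR: "odeg L + odeg R = odeg V" "L @ R = V"
      using cuts_odeg[OF c] cuts_append_eq[OF c] by auto
    have t1: "conv_upto r (\<lambda>d. \<sigma> d / of_nat d * C d (add_mset (Orth # L @ owt R) us))"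
      by (rule h1) (use n LR F in \<open>auto simp: in_confs set_owt\<close>)
    have "conv_upto r (\<lambda>d. \<sigma> d / of_nat d * C d (add_mset (Orth # L) (add_mset R us))) \<and>
      conv_upto r (\<lambda>d. \<sigma> d / of_nat d * C d {#Orth # L, R#}) \<and>
      conv_upto r (\<lambda>d. (\<sigma> d * \<tau> d (Orth # L)) * C d (add_mset R us)) \<and>
      conv_upto r (\<lambda>d. (\<sigma> d * \<tau> d R) * C d (add_mset (Orth # L) us))"
      using c
    proof (cases rule: cuts_cases)
      case (1 R')
      have "conv_upto r (\<lambda>d. \<sigma> d / of_nat d * C d (add_mset (Orth # L) (add_mset R us)))"
        by (rule h1) (use n LR 1 in \<open>auto simp: in_confs\<close>)
      \<comment> \<open>This factor has lost \<open>us\<close>, so it has full degree only if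
        \<open>us\<close> has degree 0; otherwise the induction hypothesis applies.\<close>
      moreover have "conv_upto r (\<lambda>d. \<sigma> d / of_nat d * C d {#Orth # L, R#})"
      proof (cases "odegs us = 0")
        case True
        show ?thesis by (rule h1) (use n LR 1 True in \<open>auto simp: in_confs\<close>)
      next
        case False
        show ?thesis by (rule c2[OF \<sigma>d IHC]) (use n LR False in \<open>auto simp: in_confs\<close>)
      qed
      moreover have "convergent (\<lambda>d. \<tau> d R)" "convergent (\<lambda>d. \<tau> d (Orth # L))"
        by (rule IHt; use n LR 1 in \<open>auto simp: in_confs\<close>)+
      moreover have "convergent (\<lambda>d. C d (add_mset R us))" "convergent (\<lambda>d. C d (add_mset (Orth # L) us))"
        by (rule IHC; use n LR 1 in \<open>auto simp: in_confs\<close>)+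
      ultimately show ?thesis by (auto intro!: c2 intro: convergent_mult \<sigma>)
    next
      case (2 L')
      \<comment> \<open>After the cyclic cancellation the degree has dropped by 2, so all four terms
        fall under the induction hypothesis.\<close>
      have teq: "teq (Orth # L) L'" using teq_Orth_cancel 2 by auto
      have "convergent (\<lambda>d. C d (add_mset L' (add_mset R us)))" "convergent (\<lambda>d. C d {#L', R#})"
         "convergent (\<lambda>d. C d (add_mset L' us))" "convergent (\<lambda>d. C d (add_mset R us))"
        by (rule IHC; use n LR 2 in \<open>auto simp: in_confs\<close>)+
      moreover have "convergent (\<lambda>d. \<tau> d R)" "convergent (\<lambda>d. \<tau> d L')"
        by (rule IHt; use n LR 2 in \<open>auto simp: in_confs\<close>)+
      moreover have "conv_upto r (\<lambda>d. (\<sigma> d * \<tau> d (Orth # L)) * C d (add_mset R us)) \<longleftrightarrow>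
         conv_upto r (\<lambda>d. (\<sigma> d * \<tau> d L') * C d (add_mset R us))"
        by (rule conv_upto_cong) (simp add: \<tau>_teq[OF _ teq])
      ultimately show ?thesis
        unfolding conv_upto_C_cong[OF teq] by (simp only:) (intro conjI c2 convergent_mult \<sigma> \<sigma>d)
    qed
    then have a1: "conv_upto r (\<lambda>d. \<sigma> d / of_nat d * C d (add_mset (Orth # L) (add_mset R us)))"
      and a2: "conv_upto r (\<lambda>d. \<sigma> d / of_nat d * C d {#Orth # L, R#})"
      and a3: "conv_upto r (\<lambda>d. (\<sigma> d * \<tau> d (Orth # L)) * C d (add_mset R us))"
      and a4: "conv_upto r (\<lambda>d. (\<sigma> d * \<tau> d R) * C d (add_mset (Orth # L) us))" by blast+
    have "conv_upto r (\<lambda>d. s * (\<sigma> d / of_nat d * C d (add_mset (Orth # L @ owt R) us)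
        - \<sigma> d / of_nat d * C d (add_mset (Orth # L) (add_mset R us))
        + C d us * (\<sigma> d / of_nat d * C d {#Orth # L, R#})
        - (\<sigma> d * \<tau> d (Orth # L)) * C d (add_mset R us) - (\<sigma> d * \<tau> d R) * C d (add_mset (Orth # L) us)))"
      by (rule conv_upto_mult[OF convergent_const conv_upto_diff[OF conv_upto_diff[OF conv_upto_add[OF conv_upto_diff[OF t1 a1 r]
        conv_upto_mult[OF IHC[OF us] a2 r]] a3 r] a4 r] r])
    then show ?thesis
      by (rule conv_upto_cong[THEN iffD1, rotated]) (simp add: field_simps)
  qed
  have merge: "conv_upto r (\<lambda>d. \<sigma> d / of_nat d * (s *
          (C d (add_mset (Orth # V @ owt (R @ L)) (us - {#u#})) + of_nat d * \<tau> d (Orth # V @ owt (R @ L)) * C d (us - {#u#})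
          - C d (add_mset (Orth # V @ R @ L) (us - {#u#})) - of_nat d * \<tau> d (Orth # V @ R @ L) * C d (us - {#u#}))))"
    if c: "(s, L, R) \<in> set (cuts u)" and u: "u \<in># us" for s L R u
  proof -
    obtain us' where us': "us = add_mset u us'" using multi_member_split[OF u] by blast
    have LR: "odeg L + odeg R = odeg u" "L @ R = u"
      using cuts_odeg[OF c] cuts_append_eq[OF c] by auto
    have "odeg u > 0" using c cuts_odeg_0[of u] by (cases "odeg u") auto
    have a: "conv_upto r (\<lambda>d. \<sigma> d / of_nat d * C d (add_mset (Orth # V @ owt (R @ L)) us'))"
      "conv_upto r (\<lambda>d. \<sigma> d / of_nat d * C d (add_mset (Orth # V @ R @ L) us'))"
      by (rule h1; use n LR F us' in \<open>auto simp: in_confs set_owt split: if_splits\<close>)+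
    \<comment> \<open>The factor \<open>d\<close> in front of \<open>\<tau>\<close> cancels
      \<open>1/d\<close>. The glued word reaches degree \<open>n\<close> only if the words besides
      \<open>Orth # V\<close> and \<open>u\<close> have degree 0.\<close>
    have b: "conv_upto r (\<lambda>d. \<sigma> d * \<tau> d w)" if "odeg w = odeg (Orth # V) + odeg u" "set w \<subseteq> F"
      "length w = length (Orth # V) + length u" for w
    proof (cases "odeg w = n")
      case True
      then show ?thesis by (intro h2) (use n us' that in \<open>auto simp: in_confs split: if_splits\<close>)
    next
      case False
      then show ?thesis by (intro conv_upto_conv convergent_mult \<sigma> IHt) (use n us' that in \<open>auto simp: in_confs\<close>)
    qed
    have b1: "conv_upto r (\<lambda>d. \<sigma> d * \<tau> d (Orth # V @ owt (R @ L)))"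
      "conv_upto r (\<lambda>d. \<sigma> d * \<tau> d (Orth # V @ R @ L))"
      by (rule b; use n LR F us' in \<open>auto simp: in_confs set_owt\<close>)+
    have e: "convergent (\<lambda>d. C d us')"
      by (rule IHC) (use n us' in \<open>auto simp: in_confs\<close>)
    have "conv_upto r (\<lambda>d. s * (\<sigma> d / of_nat d * C d (add_mset (Orth # V @ owt (R @ L)) us')
        + C d us' * (\<sigma> d * \<tau> d (Orth # V @ owt (R @ L)))
        - \<sigma> d / of_nat d * C d (add_mset (Orth # V @ R @ L) us')
        - C d us' * (\<sigma> d * \<tau> d (Orth # V @ R @ L))))"
      by (rule conv_upto_mult[OF convergent_const conv_upto_diff[OF conv_upto_diff[OF conv_upto_add[OF a(1) conv_upto_mult[OF e b1(1) r]]
        a(2) r] conv_upto_mult[OF e b1(2) r] r] r])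
    then show ?thesis
      by (rule conv_upto_cong[THEN iffD1, rotated]) (simp add: us' field_simps)
  qed
  show ?thesis
    unfolding eq
  proof (intro conv_upto_add)
    show "conv_upto r (\<lambda>d. \<sigma> d / of_nat d * C d (add_mset ?G us))" by (rule h1[OF n])
  qed (use split merge in \<open>auto intro!: conv_upto_sum_list conv_upto_sum_mset simp: case_prod_unfold\<close>)
qed

text \<open>Division by d^2 leaves products of two means of lower degree at order one. Everything of
  full degree keeps a factor \<open>1/d\<close> or 1/d^2.\<close>

lemma step_\<tau>:
  assumes n: "Orth # V \<in> wconfs n F N"
    and F: "\<And>l. l \<in> F \<Longrightarrow> olt l \<in> F"
    and r: "\<And>d. d \<ge> 1 \<Longrightarrow> 0 \<le> r d"
    and IHt: "\<And>w. odeg w < n \<Longrightarrow> convergent (\<lambda>d. \<tau> d w)"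
    and IHC: "\<And>M. odegs M < n \<Longrightarrow> convergent (\<lambda>d. C d M)"
    and h1: "\<And>M. M \<in> confs n F N z \<Longrightarrow> conv_upto r (\<lambda>d. C d M / of_nat d ^ 2)"
    and h2: "\<And>w. w \<in> wconfs n F N \<Longrightarrow> conv_upto r (\<lambda>d. \<tau> d w / of_nat d)"
  shows "conv_upto r (\<lambda>d. \<tau> d (Orth # V))"
proof -
  note in_confs = confs_def wconfs_def
  have inv: "convergent (\<lambda>d. 1 / of_nat d :: complex)"
    by (rule convergentI[OF lim_1_over_n])
  have inv2: "convergent (\<lambda>d. 1 / of_nat d ^ 2 :: complex)"
    using convergent_mult[OF inv inv] by (simp add: power2_eq_square)
  have eq: "conv_upto r (\<lambda>d. \<tau> d (Orth # V)) \<longleftrightarrow>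
    conv_upto r (\<lambda>d. \<tau> d (Orth # V) / of_nat d +
      (\<Sum>(s, L, R)\<leftarrow>cuts V. 1 / of_nat d ^ 2 * (s * (of_nat d * \<tau> d (Orth # L @ owt R) - C d {#Orth # L, R#}
        - of_nat d ^ 2 * \<tau> d (Orth # L) * \<tau> d R))))"
    (is "_ \<longleftrightarrow> conv_upto r (\<lambda>d. ?a d + ?b d)")
  proof (rule conv_upto_cong)
    fix d :: nat assume d: "d \<ge> 1"
    have "\<tau> d (Orth # V) = \<tau> d (Orth # V) / of_nat d + 1 / of_nat d ^ 2 * ((of_nat d - 1) * (of_nat d * \<tau> d (Orth # V)))"
      using d by (simp add: field_simps power2_eq_square)
    then show "\<tau> d (Orth # V) = ?a d + ?b d"
      unfolding \<tau>_loop[OF d] sum_list_const_mult[symmetric]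
      by (simp add: case_prod_unfold)
  qed
  have split: "conv_upto r (\<lambda>d. 1 / of_nat d ^ 2 * (s * (of_nat d * \<tau> d (Orth # L @ owt R) - C d {#Orth # L, R#}
        - of_nat d ^ 2 * \<tau> d (Orth # L) * \<tau> d R)))"
    if c: "(s, L, R) \<in> set (cuts V)" for s L R
  proof -
    have LR: "odeg L + odeg R = odeg V" "L @ R = V"
      using cuts_odeg[OF c] cuts_append_eq[OF c] by auto
    have t1: "conv_upto r (\<lambda>d. \<tau> d (Orth # L @ owt R) / of_nat d)"
      by (rule h2) (use n LR F in \<open>auto simp: in_confs set_owt\<close>)
    have "conv_upto r (\<lambda>d. C d {#Orth # L, R#} / of_nat d ^ 2) \<and> conv_upto r (\<lambda>d. \<tau> d R * \<tau> d (Orth # L))"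
      using c
    proof (cases rule: cuts_cases)
      case (1 R')
      have "conv_upto r (\<lambda>d. C d {#Orth # L, R#} / of_nat d ^ 2)"
        by (rule h1) (use n LR 1 in \<open>auto simp: in_confs\<close>)
      moreover have "convergent (\<lambda>d. \<tau> d R)" "convergent (\<lambda>d. \<tau> d (Orth # L))"
        by (rule IHt; use n LR 1 in \<open>auto simp: in_confs\<close>)+
      ultimately show ?thesis by (auto intro!: convergent_mult conv_upto_conv)
    next
      case (2 L')
      have teq: "teq (Orth # L) L'" using teq_Orth_cancel 2 by auto
      have C: "convergent (\<lambda>d. C d {#L', R#})"
        by (rule IHC; use n LR 2 in \<open>auto simp: in_confs\<close>)+
      have t: "convergent (\<lambda>d. \<tau> d R)" "convergent (\<lambda>d. \<tau> d L')"
        by (rule IHt; use n LR 2 in \<open>auto simp: in_confs\<close>)+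
      have "conv_upto r (\<lambda>d. \<tau> d R * \<tau> d L')" "conv_upto r (\<lambda>d. C d {#L', R#} / of_nat d ^ 2)"
        using convergent_mult[OF t] convergent_mult[OF inv2 C] by (auto intro: conv_upto_conv)
      then show ?thesis
        using conv_upto_cong[of "\<lambda>d. \<tau> d R * \<tau> d (Orth # L)" "\<lambda>d. \<tau> d R * \<tau> d L'" r]
          conv_upto_cong[of "\<lambda>d. C d {#Orth # L, R#} / of_nat d ^ 2" "\<lambda>d. C d {#L', R#} / of_nat d ^ 2" r]
        by (simp add: \<tau>_teq[OF _ teq] C_teq[OF _ teq])
    qed
    note * = this
    have "conv_upto r (\<lambda>d. s * (\<tau> d (Orth # L @ owt R) / of_nat d
        - C d {#Orth # L, R#} / of_nat d ^ 2 - \<tau> d R * \<tau> d (Orth # L)))"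
      using * t1 by (intro conv_upto_mult[OF convergent_const] conv_upto_diff r) auto
    then show ?thesis
      by (rule conv_upto_cong[THEN iffD1, rotated]) (simp add: field_simps power2_eq_square)
  qed
  show ?thesis
    unfolding eq
  proof (intro conv_upto_add)
    show "conv_upto r (\<lambda>d. \<tau> d (Orth # V) / of_nat d)" by (rule h2[OF n])
  qed (use split in \<open>auto intro!: conv_upto_sum_list simp: case_prod_unfold\<close>)
qed

lemma step_C':
  assumes M: "M \<in> confs n F N z" and "n > 0"
    and F: "\<And>l. l \<in> F \<Longrightarrow> olt l \<in> F"
    and r: "\<And>d. d \<ge> 1 \<Longrightarrow> 0 \<le> r d"
    and IHt: "\<And>w. odeg w < n \<Longrightarrow> convergent (\<lambda>d. \<tau> d w)"
    and IHC: "\<And>M. odegs M < n \<Longrightarrow> convergent (\<lambda>d. C d M)"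
    and \<sigma>: "convergent \<sigma>"
    and h1: "\<And>M. M \<in> confs n F N z \<Longrightarrow> conv_upto r (\<lambda>d. \<sigma> d / of_nat d * C d M)"
    and h2: "\<And>w. w \<in> wconfs n F N \<Longrightarrow> conv_upto r (\<lambda>d. \<sigma> d * \<tau> d w)"
  shows "conv_upto r (\<lambda>d. \<sigma> d * C d M)"
proof -
  have "\<exists>w\<in>#M. odeg w > 0"
  proof (rule ccontr)
    assume "\<not> ?thesis"
    then have "odegs M = 0" by (auto simp: odegs_def)
    with M \<open>n > 0\<close> show False by (simp add: confs_def)
  qed
  then obtain w us where w: "M = add_mset w us" "odeg w > 0" by (metis multi_member_split)
  from teq_normal[OF this(2)] obtain V where V: "teq w (Orth # V)" "length (Orth # V) = length w"
    "odeg (Orth # V) = odeg w" "set (Orth # V) \<subseteq> set w \<union> olt ` set w" .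
  have sub: "set (Orth # V) \<subseteq> F" using V(4) M F w by (fastforce simp: confs_def)
  have "add_mset (Orth # V) us \<in> confs n F N z"
    using M w V(2,3) sub by (auto simp: confs_def)
  from step_C[OF this F r IHt IHC \<sigma> h1 h2] show ?thesis
    unfolding w(1) conv_upto_C_cong[OF V(1)] by blast
qed

lemma step_\<tau>':
  assumes w: "w \<in> wconfs n F N" and "n > 0"
    and F: "\<And>l. l \<in> F \<Longrightarrow> olt l \<in> F"
    and r: "\<And>d. d \<ge> 1 \<Longrightarrow> 0 \<le> r d"
    and IHt: "\<And>w. odeg w < n \<Longrightarrow> convergent (\<lambda>d. \<tau> d w)"
    and IHC: "\<And>M. odegs M < n \<Longrightarrow> convergent (\<lambda>d. C d M)"
    and h1: "\<And>M. M \<in> confs n F N z \<Longrightarrow> conv_upto r (\<lambda>d. C d M / of_nat d ^ 2)"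
    and h2: "\<And>w. w \<in> wconfs n F N \<Longrightarrow> conv_upto r (\<lambda>d. \<tau> d w / of_nat d)"
  shows "conv_upto r (\<lambda>d. \<tau> d w)"
proof -
  have "odeg w > 0" using w \<open>n > 0\<close> by (simp add: wconfs_def)
  from teq_normal[OF this] obtain V where V: "teq w (Orth # V)" "length (Orth # V) = length w"
    "odeg (Orth # V) = odeg w" "set (Orth # V) \<subseteq> set w \<union> olt ` set w" .
  have sub: "set (Orth # V) \<subseteq> F" using V(4) w F by (fastforce simp: wconfs_def)
  have "Orth # V \<in> wconfs n F N"
    using w V(2,3) sub by (auto simp: wconfs_def)
  from step_\<tau>[OF this F r IHt IHC h1 h2] show ?thesis
    using conv_upto_cong[of "\<lambda>d. \<tau> d w" "\<lambda>d. \<tau> d (Orth # V)" r] \<tau>_teq[OF _ V(1)] by simp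
qed

text \<open>
  The sum \<open>X d\<close> of all quantities of a given degree satisfies \<open>X d \<le> B + (K / d) X d\<close> by the loop
  equations, hence is bounded. No a priori bound on the moments is available, because the
  ensemble need not be closed under adjoints.
\<close>

lemma \<tau>_convergent_C_bounded:
  assumes F: "finite F" "\<And>l. l \<in> F \<Longrightarrow> olt l \<in> F" and "n > 0"
    and IHt: "\<And>w. odeg w < n \<Longrightarrow> convergent (\<lambda>d. \<tau> d w)"
    and IHC: "\<And>M. odegs M < n \<Longrightarrow> convergent (\<lambda>d. C d M)"
  shows "(\<forall>w\<in>wconfs n F N. convergent (\<lambda>d. \<tau> d w)) \<and>
    (\<forall>M\<in>confs n F N z. \<exists>B. \<forall>d\<ge>1. norm (C d M / of_nat d) \<le> B)"
proof -
  \<comment> \<open>The moments enter with weight \<open>1/d\<close> because their own loop equation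
    couples them to means of full degree without a small factor.\<close>
  define X where "X d = 1 + (\<Sum>w\<in>wconfs n F N. norm (\<tau> d w)) + (\<Sum>M\<in>confs n F N z. norm (C d M / of_nat d))" for d
  let ?r = "\<lambda>d. X d / real d"
  note fin = finite_wconfs[OF F(1), of n N] finite_confs[OF F(1), of n N z]
  have X1: "X d \<ge> 1" for d unfolding X_def by (simp add: sum_nonneg)
  have r: "0 \<le> ?r d" for d using X1[of d] by simp
  have Xt: "norm (\<tau> d w) \<le> X d" if "w \<in> wconfs n F N" for d w
  proof -
    have "norm (\<tau> d w) \<le> (\<Sum>w\<in>wconfs n F N. norm (\<tau> d w))"
      using fin that by (intro member_le_sum) auto
    moreover have "0 \<le> (\<Sum>M\<in>confs n F N z. norm (C d M / of_nat d))" by (simp add: sum_nonneg)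
    ultimately show ?thesis unfolding X_def by linarith
  qed
  have XC: "norm (C d M / of_nat d) \<le> X d" if "M \<in> confs n F N z" for d M
  proof -
    have "norm (C d M / of_nat d) \<le> (\<Sum>M\<in>confs n F N z. norm (C d M / of_nat d))"
      using fin that by (intro member_le_sum) auto
    moreover have "0 \<le> (\<Sum>w\<in>wconfs n F N. norm (\<tau> d w))" by (simp add: sum_nonneg)
    ultimately show ?thesis unfolding X_def by linarith
  qed
  have h1: "conv_upto ?r (\<lambda>d. C d M / of_nat d ^ 2)" if "M \<in> confs n F N z" for M
  proof (rule conv_upto_small[where K = 1])
    fix d :: nat assume "d \<ge> 1"
    then show "norm (C d M / of_nat d ^ 2) \<le> 1 * ?r d"
      using XC[OF that, of d] by (simp add: norm_divide norm_power norm_mult power2_eq_square field_simps)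
  qed
  have h2: "conv_upto ?r (\<lambda>d. \<tau> d w / of_nat d)" if "w \<in> wconfs n F N" for w
  proof (rule conv_upto_small[where K = 1])
    fix d :: nat assume "d \<ge> 1"
    then show "norm (\<tau> d w / of_nat d) \<le> 1 * ?r d"
      using Xt[OF that, of d] by (simp add: norm_divide field_simps)
  qed
  have t: "conv_upto ?r (\<lambda>d. \<tau> d w)" if "w \<in> wconfs n F N" for w
    by (rule step_\<tau>'[OF that \<open>n > 0\<close> F(2) r IHt IHC h1 h2])
  have c: "conv_upto ?r (\<lambda>d. 1 / of_nat d * C d M)" if "M \<in> confs n F N z" for M
  proof (rule step_C'[OF that \<open>n > 0\<close> F(2) r IHt IHC])
    show "convergent (\<lambda>d. 1 / of_nat d :: complex)" by (rule convergentI[OF lim_1_over_n])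
    show "conv_upto ?r (\<lambda>d. 1 / of_nat d / of_nat d * C d M)" if "M \<in> confs n F N z" for M
      using h1[OF that] by (simp add: power2_eq_square)
    show "conv_upto ?r (\<lambda>d. 1 / of_nat d * \<tau> d w)" if "w \<in> wconfs n F N" for w
      using h2[OF that] by simp
  qed auto
  from conv_upto_sum_bounded[OF fin(1), of ?r "\<lambda>w d. \<tau> d w", OF t r] obtain B1 K1 where
    B1: "B1 \<ge> 0" "K1 \<ge> 0" "\<And>d. d \<ge> 1 \<Longrightarrow> (\<Sum>w\<in>wconfs n F N. norm (\<tau> d w)) \<le> B1 + K1 * ?r d" by auto
  from conv_upto_sum_bounded[OF fin(2), of ?r "\<lambda>M d. 1 / of_nat d * C d M", OF c r] obtain B2 K2 where
    B2: "B2 \<ge> 0" "K2 \<ge> 0" "\<And>d. d \<ge> 1 \<Longrightarrow> (\<Sum>M\<in>confs n F N z. norm (1 / of_nat d * C d M)) \<le> B2 + K2 * ?r d" by auto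
  \<comment> \<open>From dimension \<open>D\<close> on, \<open>(K1 + K2) / d\<close> is at most 1/2
    and the term in \<open>X d\<close> can be absorbed into the left-hand side. The finitely many
    earlier values go into the bound \<open>B\<close>.\<close>
  define D where "D = nat \<lceil>2 * (K1 + K2)\<rceil>"
  define B where "B = 2 * (1 + B1 + B2) + (\<Sum>d<D. X d)"
  have B: "X d \<le> B" if "d \<ge> 1" for d
  proof (cases "d < D")
    case True
    have "X d \<le> (\<Sum>d<D. X d)"
      using True X1 by (intro member_le_sum) (auto intro: order_trans[OF zero_le_one])
    moreover have "0 \<le> 2 * (1 + B1 + B2)" using B1(1) B2(1) by simp
    ultimately show ?thesis unfolding B_def by (rule add_increasing[rotated])
  next
    case False
    then have D: "2 * (K1 + K2) \<le> real d" unfolding D_def by linarith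
    have "X d \<le> 1 + B1 + B2 + (K1 + K2) * ?r d"
    proof -
      have "X d = 1 + (\<Sum>w\<in>wconfs n F N. norm (\<tau> d w)) + (\<Sum>M\<in>confs n F N z. norm (1 / of_nat d * C d M))"
        unfolding X_def by simp
      also have "\<dots> \<le> 1 + (B1 + K1 * ?r d) + (B2 + K2 * ?r d)"
        using B1(3)[OF that] B2(3)[OF that] by linarith
      finally show ?thesis by (simp add: distrib_right add_divide_distrib)
    qed
    also have "(K1 + K2) * ?r d \<le> (real d / 2) * ?r d"
      using D r by (intro mult_right_mono) auto
    also have "\<dots> = X d / 2" using that by simp
    finally have "X d \<le> 2 * (1 + B1 + B2)" by simp
    moreover have "0 \<le> (\<Sum>d<D. X d)" by (intro sum_nonneg order_trans[OF zero_le_one X1])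
    ultimately show ?thesis unfolding B_def by linarith
  qed
  \<comment> \<open>Once \<open>X\<close> is bounded, an error of order \<open>X d / d\<close> has
    order \<open>1/d\<close>.\<close>
  have mono: "conv_upto (\<lambda>d. 1 / real d) f" if f: "conv_upto ?r f" for f
  proof -
    from f obtain b K where b: "convergent b" "\<And>d. d \<ge> 1 \<Longrightarrow> norm (f d - b d) \<le> K * ?r d"
      unfolding conv_upto_def by blast
    have "norm (f d - b d) \<le> (\<bar>K\<bar> * B) * (1 / real d)" if "d \<ge> 1" for d
    proof -
      have "norm (f d - b d) \<le> K * ?r d" by (rule b(2)[OF that])
      also have "\<dots> \<le> \<bar>K\<bar> * (B / real d)"
        using B[OF that] r[of d] by (intro mult_mono divide_right_mono) auto
      finally show ?thesis by simp
    qed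
    with b(1) show ?thesis unfolding conv_upto_def by blast
  qed
  have "\<exists>B. \<forall>d\<ge>1. norm (C d M / of_nat d) \<le> B" if M: "M \<in> confs n F N z" for M
    using XC[OF M] B order_trans by blast
  then show ?thesis using mono[OF t] conv_upto_convergent by blast
qed

text \<open>The means of degree \<open>n\<close> converge at once; the moments take three passes.
  The first bounds \<open>C / d\<close>. Inserted into the loop equation, this bounds
  \<open>C\<close> itself, and that in turn makes the remaining full-degree terms of order
  \<open>1/d\<close>, whence convergence.\<close>

lemma convergent_all:
  "(\<forall>w. odeg w = n \<longrightarrow> convergent (\<lambda>d. \<tau> d w)) \<and> (\<forall>M. odegs M = n \<longrightarrow> convergent (\<lambda>d. C d M))"
proof (induction n rule: less_induct)
  case (less n)
  then have IHt: "\<And>w. odeg w < n \<Longrightarrow> convergent (\<lambda>d. \<tau> d w)"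
    and IHC: "\<And>M. odegs M < n \<Longrightarrow> convergent (\<lambda>d. C d M)" by blast+
  show ?case
  proof (cases "n = 0")
    case True
    then show ?thesis using \<tau>_base C_base by auto
  next
    case False
    then have n: "n > 0" by simp
    have clo: "\<exists>F. finite F \<and> (\<forall>l\<in>F. olt l \<in> F) \<and> letters_in F M" for M :: "'i oword multiset"
    proof (rule exI[of _ "(\<Union>w\<in>set_mset M. set w) \<union> olt ` (\<Union>w\<in>set_mset M. set w)"])
    qed (auto simp: letters_in_def)
    have t: "convergent (\<lambda>d. \<tau> d w)" if "odeg w = n" for w
    proof -
      from clo[of "{#w#}"] obtain F where F: "finite F" "\<And>l. l \<in> F \<Longrightarrow> olt l \<in> F" "set w \<subseteq> F" by auto
      have "w \<in> wconfs n F (length w)" using F that by (auto simp: wconfs_def)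
      then show ?thesis using \<tau>_convergent_C_bounded[OF F(1,2) n IHt IHC] by blast
    qed
    have *: "conv_upto r (\<lambda>d. C d M)" if M: "odegs M = n" and r: "\<And>d. d \<ge> 1 \<Longrightarrow> 0 \<le> r d"
      and h: "\<And>M. odegs M = n \<Longrightarrow> \<exists>K. \<forall>d\<ge>1. norm (C d M / of_nat d) \<le> K * r d" for r M
    proof -
      from clo[of M] obtain F where F: "finite F" "\<And>l. l \<in> F \<Longrightarrow> olt l \<in> F" "letters_in F M" by auto
      have "M \<in> confs n F (tlen M) (zeros M)" using M F by (auto simp: confs_def)
      then have "conv_upto r (\<lambda>d. 1 * C d M)"
      proof (rule step_C'[OF _ n F(2) r IHt IHC convergent_const])
        fix M' assume "M' \<in> confs n F (tlen M) (zeros M)"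
        then have "odegs M' = n" by (simp add: confs_def)
        from h[OF this] obtain K where "\<forall>d\<ge>1. norm (C d M' / of_nat d) \<le> K * r d" ..
        then show "conv_upto r (\<lambda>d. 1 / of_nat d * C d M')" by (intro conv_upto_small[where K = K]) auto
      next
        fix w assume "w \<in> wconfs n F (tlen M)"
        then show "conv_upto r (\<lambda>d. 1 * \<tau> d w)" using conv_upto_conv[OF t, of w r] by (simp add: wconfs_def)
      qed
      then show ?thesis by simp
    qed
    have 1: "\<exists>B. \<forall>d\<ge>1. norm (C d M / of_nat d) \<le> B" if M: "odegs M = n" for M
    proof -
      from clo[of M] obtain F where F: "finite F" "\<And>l. l \<in> F \<Longrightarrow> olt l \<in> F" "letters_in F M" by auto
      have "M \<in> confs n F (tlen M) (zeros M)" using M F by (auto simp: confs_def)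
      then show ?thesis using \<tau>_convergent_C_bounded[OF F(1,2) n IHt IHC] by blast
    qed
    have 2: "\<exists>B. \<forall>d\<ge>1. norm (C d M) \<le> B" if M: "odegs M = n" for M
    proof -
      have "conv_upto (\<lambda>_. 1) (\<lambda>d. C d M)" by (rule *[OF M]) (use 1 in auto)
      from conv_upto_bounded[OF this] obtain B K where "\<forall>d\<ge>1. norm (C d M) \<le> B + K * 1" by auto
      then show ?thesis by blast
    qed
    have 3: "\<exists>K. \<forall>d\<ge>1. norm (C d M / of_nat d) \<le> K * (1 / real d)" if M: "odegs M = n" for M
    proof -
      from 2[OF M] obtain B where "\<And>d. d \<ge> 1 \<Longrightarrow> norm (C d M) \<le> B" by blast
      then have "norm (C d M / of_nat d) \<le> B * (1 / real d)" if "d \<ge> 1" for d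
        using that by (simp add: norm_divide divide_right_mono)
      then show ?thesis by blast
    qed
    have "convergent (\<lambda>d. C d M)" if M: "odegs M = n" for M
      by (rule conv_upto_convergent[OF *[OF M _ 3]]) auto
    with t show ?thesis by blast
  qed
qed

definition phi :: "'i oword \<Rightarrow> complex" where
  "phi w = lim (\<lambda>d. \<tau> d w)"

definition cc :: "'i oword multiset \<Rightarrow> complex" where
  "cc M = lim (\<lambda>d. C d M)"

lemma tendsto_phi: "(\<lambda>d. \<tau> d w) \<longlonglongrightarrow> phi w"
  using convergent_all[of "odeg w"] by (simp add: phi_def convergent_LIMSEQ_iff)

lemma tendsto_cc: "(\<lambda>d. C d M) \<longlonglongrightarrow> cc M"
  using convergent_all[of "odegs M"] by (simp add: cc_def convergent_LIMSEQ_iff)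

lemma phi_teq: "teq u v \<Longrightarrow> phi u = phi v"
  by (rule LIMSEQ_unique_ge1[OF tendsto_phi tendsto_phi]) (rule \<tau>_teq)

lemma cc_teq: "teq u v \<Longrightarrow> cc (add_mset u M) = cc (add_mset v M)"
  by (rule LIMSEQ_unique_ge1[OF tendsto_cc tendsto_cc]) (rule C_teq)

lemma cc_empty [simp]: "cc {#} = 1"
  by (rule LIMSEQ_unique_ge1[OF tendsto_cc tendsto_const]) (rule C_empty)

text \<open>Only products of means have order d^2. The limit is a Schwinger-Dyson equation for the
  first order moments.\<close>

lemma phi_loop: "phi (Orth # V) = (\<Sum>(s, L, R)\<leftarrow>cuts V. - s * phi (Orth # L) * phi R)"
proof (rule LIMSEQ_unique_ge1)
  let ?f = "\<lambda>d. \<tau> d (Orth # V) - 1 / of_nat d * \<tau> d (Orth # V)"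
  let ?g = "\<lambda>d. \<Sum>(s, L, R)\<leftarrow>cuts V. s * (1 / of_nat d * \<tau> d (Orth # L @ owt R)
    - 1 / of_nat d * (1 / of_nat d) * C d {#Orth # L, R#} - \<tau> d (Orth # L) * \<tau> d R)"
  have "?f \<longlonglongrightarrow> phi (Orth # V) - 0 * phi (Orth # V)"
    by (intro tendsto_intros tendsto_phi lim_1_over_n)
  then show "?f \<longlonglongrightarrow> phi (Orth # V)" by simp
  have "?g \<longlonglongrightarrow> (\<Sum>(s, L, R)\<leftarrow>cuts V. s * (0 * phi (Orth # L @ owt R) - 0 * 0 * cc {#Orth # L, R#} - phi (Orth # L) * phi R))"
    by (intro tendsto_sum_triples tendsto_intros tendsto_phi tendsto_cc lim_1_over_n)
  then show "?g \<longlonglongrightarrow> (\<Sum>(s, L, R)\<leftarrow>cuts V. - s * phi (Orth # L) * phi R)"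
    by (simp add: mult.assoc)
  fix d :: nat assume d: "d \<ge> 1"
  then have d0: "of_nat d \<noteq> (0 :: complex)" by simp
  have "?f d = 1 / of_nat d ^ 2 * ((of_nat d - 1) * (of_nat d * \<tau> d (Orth # V)))"
    using d0 by (simp add: field_simps power2_eq_square)
  also have "\<dots> = ?g d"
    unfolding \<tau>_loop[OF d]
    by (rule sum_triples_cong) (use d0 in \<open>simp add: field_simps power2_eq_square\<close>)
  finally show "?f d = ?g d" .
qed

text \<open>What survives division by \<open>d\<close>: cuts of the first word with one piece
  replaced by its mean, and gluings in which the glued trace is replaced by its mean.\<close>

lemma cc_loop: "cc (add_mset (Orth # V) us) =
    (\<Sum>(s, L, R)\<leftarrow>cuts V. - s * (phi (Orth # L) * cc (add_mset R us) + phi R * cc (add_mset (Orth # L) us)))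
    + (\<Sum>u\<in>#us. (\<Sum>(s, L, R)\<leftarrow>cuts u. s * (phi (Orth # V @ owt (R @ L)) - phi (Orth # V @ R @ L))) * cc (us - {#u#}))"
proof (rule LIMSEQ_unique_ge1)
  let ?f = "\<lambda>d. C d (add_mset (Orth # V) us) - 1 / of_nat d * C d (add_mset (Orth # V) us)"
  let ?g1 = "\<lambda>d. \<Sum>(s, L, R)\<leftarrow>cuts V. s * (1 / of_nat d * (C d (add_mset (Orth # L @ owt R) us) - C d (add_mset (Orth # L) (add_mset R us))
        + C d {#Orth # L, R#} * C d us)
        - \<tau> d (Orth # L) * C d (add_mset R us) - \<tau> d R * C d (add_mset (Orth # L) us))"
  let ?g2 = "\<lambda>d. \<Sum>u\<in>#us. \<Sum>(s, L, R)\<leftarrow>cuts u. s *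
          (1 / of_nat d * C d (add_mset (Orth # V @ owt (R @ L)) (us - {#u#})) + \<tau> d (Orth # V @ owt (R @ L)) * C d (us - {#u#})
          - 1 / of_nat d * C d (add_mset (Orth # V @ R @ L) (us - {#u#})) - \<tau> d (Orth # V @ R @ L) * C d (us - {#u#}))"
  have "?f \<longlonglongrightarrow> cc (add_mset (Orth # V) us) - 0 * cc (add_mset (Orth # V) us)"
    by (intro tendsto_intros tendsto_cc lim_1_over_n)
  then show "?f \<longlonglongrightarrow> cc (add_mset (Orth # V) us)" by simp
  have "?g1 \<longlonglongrightarrow> (\<Sum>(s, L, R)\<leftarrow>cuts V. s * (0 * (cc (add_mset (Orth # L @ owt R) us) - cc (add_mset (Orth # L) (add_mset R us))
        + cc {#Orth # L, R#} * cc us)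
        - phi (Orth # L) * cc (add_mset R us) - phi R * cc (add_mset (Orth # L) us)))"
    by (intro tendsto_sum_triples tendsto_intros tendsto_phi tendsto_cc lim_1_over_n)
  also have "(\<lambda>s L R. s * (0 * (cc (add_mset (Orth # L @ owt R) us) - cc (add_mset (Orth # L) (add_mset R us))
        + cc {#Orth # L, R#} * cc us)
        - phi (Orth # L) * cc (add_mset R us) - phi R * cc (add_mset (Orth # L) us)))
     = (\<lambda>s L R. - s * (phi (Orth # L) * cc (add_mset R us) + phi R * cc (add_mset (Orth # L) us)))"
    by (simp add: fun_eq_iff algebra_simps)
  finally have g1: "?g1 \<longlonglongrightarrow> (\<Sum>(s, L, R)\<leftarrow>cuts V. - s * (phi (Orth # L) * cc (add_mset R us) + phi R * cc (add_mset (Orth # L) us)))" .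
  have "?g2 \<longlonglongrightarrow> (\<Sum>u\<in>#us. \<Sum>(s, L, R)\<leftarrow>cuts u. s * (0 * cc (add_mset (Orth # V @ owt (R @ L)) (us - {#u#})) + phi (Orth # V @ owt (R @ L)) * cc (us - {#u#})
          - 0 * cc (add_mset (Orth # V @ R @ L) (us - {#u#})) - phi (Orth # V @ R @ L) * cc (us - {#u#})))"
    by (intro tendsto_sum_mset' tendsto_sum_triples tendsto_intros tendsto_phi tendsto_cc lim_1_over_n)
  also have "(\<lambda>u. \<Sum>(s, L, R)\<leftarrow>cuts u. s * (0 * cc (add_mset (Orth # V @ owt (R @ L)) (us - {#u#})) + phi (Orth # V @ owt (R @ L)) * cc (us - {#u#})
          - 0 * cc (add_mset (Orth # V @ R @ L) (us - {#u#})) - phi (Orth # V @ R @ L) * cc (us - {#u#})))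
      = (\<lambda>u. (\<Sum>(s, L, R)\<leftarrow>cuts u. s * (phi (Orth # V @ owt (R @ L)) - phi (Orth # V @ R @ L))) * cc (us - {#u#}))"
    unfolding mult.commute[of _ "cc _"]
    by (intro ext sum_triples_cong[symmetric]) (simp add: algebra_simps)
  finally have g2: "?g2 \<longlonglongrightarrow> (\<Sum>u\<in>#us. (\<Sum>(s, L, R)\<leftarrow>cuts u. s * (phi (Orth # V @ owt (R @ L)) - phi (Orth # V @ R @ L))) * cc (us - {#u#}))" .
  show "(\<lambda>d. ?g1 d + ?g2 d) \<longlonglongrightarrow> (\<Sum>(s, L, R)\<leftarrow>cuts V. - s * (phi (Orth # L) * cc (add_mset R us) + phi R * cc (add_mset (Orth # L) us)))
    + (\<Sum>u\<in>#us. (\<Sum>(s, L, R)\<leftarrow>cuts u. s * (phi (Orth # V @ owt (R @ L)) - phi (Orth # V @ R @ L))) * cc (us - {#u#}))"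
    by (rule tendsto_add[OF g1 g2])
  fix d :: nat assume d: "d \<ge> 1"
  then have d0: "of_nat d \<noteq> (0 :: complex)" by simp
  have "?f d = 1 / of_nat d * ((of_nat d - 1) * C d (add_mset (Orth # V) us))"
    using d0 by (simp add: field_simps)
  also have "\<dots> = ?g1 d + ?g2 d"
    unfolding C_loop[OF d] distrib_left
    by (intro arg_cong2[where f = "(+)"] sum_triples_cong sum_mset_cong_left)
      (use d0 in \<open>simp_all add: field_simps\<close>)
  finally show "?f d = ?g1 d + ?g2 d" .
qed

text \<open>In the limiting loop equation the cutting terms have lower degree and expand by
  \<open>IH\<close>, while each gluing term already removes one \<open>u\<close> and multiplies by a
  number. The total coefficient of \<open>cc (M - {#u#})\<close> is \<open>cc {#w, u#}\<close>, by
  the same equation for the single partner \<open>u\<close>.\<close>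

lemma wick_Orth:
  assumes IH: "\<And>w M. odegs (add_mset w M) < n \<Longrightarrow> cc (add_mset w M) = (\<Sum>u\<in>#M. cc {#w, u#} * cc (M - {#u#}))"
    and n: "odegs (add_mset w M) = n" "odeg w > 0"
  shows "cc (add_mset w M) = (\<Sum>u\<in>#M. cc {#w, u#} * cc (M - {#u#}))"
proof -
  from teq_normal[OF n(2)] obtain V where V: "teq w (Orth # V)" "odeg (Orth # V) = odeg w" .
  let ?A = "\<lambda>us. (\<Sum>(s, L, R)\<leftarrow>cuts V. - s * (phi (Orth # L) * cc (add_mset R us) + phi R * cc (add_mset (Orth # L) us)))"
  let ?B = "\<lambda>u. (\<Sum>(s, L, R)\<leftarrow>cuts u. s * (phi (Orth # V @ owt (R @ L)) - phi (Orth # V @ R @ L)))"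
  have A: "?A M = (\<Sum>u\<in>#M. ?A {#u#} * cc (M - {#u#}))"
  proof -
    have "?A M = (\<Sum>(s, L, R)\<leftarrow>cuts V. \<Sum>u\<in>#M.
      - s * (phi (Orth # L) * cc {#R, u#} + phi R * cc {#Orth # L, u#}) * cc (M - {#u#}))"
    proof (rule sum_triples_cong')
      fix s L R assume c: "(s, L, R) \<in> set (cuts V)"
      have LR: "odeg L + odeg R = odeg V" by (rule cuts_odeg[OF c])
      have R: "cc (add_mset R M) = (\<Sum>u\<in>#M. cc {#R, u#} * cc (M - {#u#}))"
        by (rule IH) (use LR V n in auto)
      have L: "cc (add_mset (Orth # L) M) = (\<Sum>u\<in>#M. cc {#Orth # L, u#} * cc (M - {#u#}))"
        using c
      proof (cases rule: cuts_cases)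
        case (1 R')
        show ?thesis by (rule IH) (use LR V n 1 in auto)
      next
        case (2 L')
        have teq: "teq (Orth # L) L'" using teq_Orth_cancel 2 by auto
        show ?thesis unfolding cc_teq[OF teq] by (rule IH) (use LR V n 2 in auto)
      qed
      show "- s * (phi (Orth # L) * cc (add_mset R M) + phi R * cc (add_mset (Orth # L) M)) =
        (\<Sum>u\<in>#M. - s * (phi (Orth # L) * cc {#R, u#} + phi R * cc {#Orth # L, u#}) * cc (M - {#u#}))"
        unfolding R L by (simp only: sum_mset_lincomb)
    qed
    then show ?thesis by (simp add: sum_mset_list_swap sum_list_mult_const[symmetric] case_prod_unfold)
  qed
  have "cc (add_mset (Orth # V) M) = (\<Sum>u\<in>#M. (?A {#u#} + ?B u) * cc (M - {#u#}))"
    unfolding cc_loop[of V M] A by (simp add: sum_mset.distrib distrib_right)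
  also have "(\<lambda>u. ?A {#u#} + ?B u) = (\<lambda>u. cc {#Orth # V, u#})"
    using cc_loop[of V "{#u#}" for u] by (intro ext) simp
  finally show ?thesis unfolding cc_teq[OF V(1)] by (simp add: fun_eq_iff)
qed

theorem wick: "cc (add_mset w M) = (\<Sum>u\<in>#M. cc {#w, u#} * cc (M - {#u#}))"
proof (induction "odegs (add_mset w M)" arbitrary: w M rule: less_induct)
  case less
  note Orth = wick_Orth[OF less(1)]
  let ?n = "odegs (add_mset w M)"
  consider "odeg w > 0" | "?n = 0" | "odeg w = 0" "?n > 0" by auto
  then show ?case
  proof cases
    case 1
    then show ?thesis by (intro Orth) auto
  next
    case 2
    then show ?thesis using wick_base[of w M] by (simp add: cc_def)
  next
    \<comment> \<open>Here \<open>w\<close> has no orthogonal letter, but some \<open>v\<close> has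
      one. Expand along \<open>v\<close>, then along \<open>w\<close> in what is left, and exchange
      the two sums; the result is the expansion along \<open>w\<close> followed by the one along
      \<open>v\<close>.\<close>
    case 3
    have "\<exists>v\<in>#M. odeg v > 0"
    proof (rule ccontr)
      assume "\<not> ?thesis"
      then have "odegs M = 0" by (auto simp: odegs_def)
      with 3 show False by simp
    qed
    then obtain v N where v: "M = add_mset v N" "odeg v > 0" by (metis multi_member_split)
    have O: "cc (add_mset v N') = (\<Sum>u\<in>#N'. cc {#v, u#} * cc (N' - {#u#}))"
      if "odegs (add_mset v N') \<le> ?n" for N'
    proof (cases "odegs (add_mset v N') = ?n")
      case True
      show ?thesis by (rule Orth[OF _ True v(2)])
    next
      case False
      with that show ?thesis by (intro less(1)) auto
    qed
    have sub: "add_mset w N - {#u#} = add_mset w (N - {#u#})" if "u \<in># N" for u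
      using that by (simp add: multiset_eq_iff)
    have "cc (add_mset w M) = cc (add_mset v (add_mset w N))"
      by (simp add: v add_mset_commute)
    also have "\<dots> = cc {#v, w#} * cc N + (\<Sum>u\<in>#N. cc {#v, u#} * cc (add_mset w (N - {#u#})))"
    proof -
      have "(\<Sum>u\<in>#N. cc {#v, u#} * cc (add_mset w N - {#u#})) = (\<Sum>u\<in>#N. cc {#v, u#} * cc (add_mset w (N - {#u#})))"
        by (intro arg_cong[where f = sum_mset] image_mset_cong) (simp add: sub)
      then show ?thesis using O[of "add_mset w N"] v by (simp add: add.left_commute)
    qed
    also have "(\<Sum>u\<in>#N. cc {#v, u#} * cc (add_mset w (N - {#u#}))) =
      (\<Sum>u\<in>#N. \<Sum>x\<in>#N - {#u#}. cc {#v, u#} * (cc {#w, x#} * cc (N - {#u#} - {#x#})))"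
    proof (intro arg_cong[where f = sum_mset] image_mset_cong)
      fix u assume "u \<in># N"
      then obtain N' where N': "N = add_mset u N'" by (metis multi_member_split)
      have "cc (add_mset w (N - {#u#})) = (\<Sum>x\<in>#N - {#u#}. cc {#w, x#} * cc (N - {#u#} - {#x#}))"
        by (rule less(1)) (use v N' in auto)
      show "cc {#v, u#} * cc (add_mset w (N - {#u#})) =
        (\<Sum>x\<in>#N - {#u#}. cc {#v, u#} * (cc {#w, x#} * cc (N - {#u#} - {#x#})))"
        unfolding \<open>cc (add_mset w (N - {#u#})) = _\<close> by (rule sum_mset_cong_left) simp
    qed
    also have "\<dots> = (\<Sum>x\<in>#N. \<Sum>u\<in>#N - {#x#}. cc {#v, u#} * (cc {#w, x#} * cc (N - {#u#} - {#x#})))"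
      by (rule sum_mset_remove_swap)
    also have "\<dots> = (\<Sum>x\<in>#N. cc {#w, x#} * cc (add_mset v (N - {#x#})))"
    proof (intro arg_cong[where f = sum_mset] image_mset_cong)
      fix x assume "x \<in># N"
      then obtain N' where N': "N = add_mset x N'" by (metis multi_member_split)
      have "cc (add_mset v (N - {#x#})) = (\<Sum>u\<in>#N - {#x#}. cc {#v, u#} * cc (N - {#x#} - {#u#}))"
        by (rule O) (use v N' in auto)
      show "(\<Sum>u\<in>#N - {#x#}. cc {#v, u#} * (cc {#w, x#} * cc (N - {#u#} - {#x#}))) =
        cc {#w, x#} * cc (add_mset v (N - {#x#}))"
        unfolding \<open>cc (add_mset v (N - {#x#})) = _\<close>
        by (rule sum_mset_cong_left[symmetric]) (simp add: add_mset_commute mult.left_commute)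
    qed
    also have "cc {#v, w#} * cc N + \<dots> = (\<Sum>u\<in>#M. cc {#w, u#} * cc (M - {#u#}))"
    proof -
      have sub: "M - {#x#} = add_mset v (N - {#x#})" if "x \<in># N" for x
        using that by (simp add: v multiset_eq_iff)
      have "(\<Sum>u\<in>#N. cc {#w, u#} * cc (M - {#u#})) = (\<Sum>x\<in>#N. cc {#w, x#} * cc (add_mset v (N - {#x#})))"
        by (intro arg_cong[where f = sum_mset] image_mset_cong) (simp add: sub)
      then show ?thesis by (simp add: v add_mset_commute)
    qed
    finally show ?thesis .
  qed
qed

end

section \<open>Cancelling neighbours and cyclic rotations of words\<close>

fun clash :: "'i oletter \<Rightarrow> 'i oletter \<Rightarrow> bool" where
  "clash (Coef p) (Coef q) = True"
| "clash Orth OrthT = True"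
| "clash OrthT Orth = True"
| "clash _ _ = False"

lemma clash_sym: "clash a b = clash b a"
  by (cases a; cases b) simp_all

lemma clash_olt [simp]: "clash (olt a) (olt b) = clash a b"
  by (cases a; cases b) simp_all

lemma clash_cases:
  assumes "clash a b"
  obtains p q where "a = Coef p" "b = Coef q" | "a = Orth" "b = OrthT" | "a = OrthT" "b = Orth"
  using assms by (cases a; cases b) auto

lemma teq_cong_rot: "teq (u @ v) w \<Longrightarrow> teq (v @ u) w"
  using teq_trans[OF teq_rot] .

lemma teq_cancel_mid:
  assumes "(a = Orth \<and> b = OrthT) \<or> (a = OrthT \<and> b = Orth)"
  shows "teq (u @ a # b # v) (u @ v)"
proof -
  have "teq ((a # b # v) @ u) (v @ u)"
    using assms teq_cancel1[of "v @ u"] teq_cancel2[of "v @ u"] by auto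
  then show ?thesis using teq_trans[OF teq_cong_rot teq_rot] by blast
qed

text \<open>Indexing cuts by positions makes \<open>R @ L\<close> a rotation of the word: by
  \<open>k\<close> at a letter \<open>Orth\<close>, by \<open>k + 1\<close> at a letter
  \<open>OrthT\<close>, since the cut lies behind the latter.\<close>

lemma cuts_sum:
  "(\<Sum>(s, L, R)\<leftarrow>cuts p. F s L R) = (\<Sum>k<length p. case p ! k of
      Orth \<Rightarrow> F 1 (take k p) (drop k p) | OrthT \<Rightarrow> F (-1) (take (Suc k) p) (drop (Suc k) p) | Coef _ \<Rightarrow> (0::complex))"
proof (induction p arbitrary: F)
  case (Cons l p)
  have "(\<Sum>(s, L, R)\<leftarrow>map (\<lambda>(s, L, R). (s, l # L, R)) (cuts p). F s L R) = (\<Sum>(s, L, R)\<leftarrow>cuts p. F s (l # L) R)"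
    by (simp add: comp_def case_prod_unfold)
  also note Cons.IH[of "\<lambda>s L. F s (l # L)"]
  finally have "(\<Sum>(s, L, R)\<leftarrow>map (\<lambda>(s, L, R). (s, l # L, R)) (cuts p). F s L R) = (\<Sum>k<length p. case p ! k of
      Orth \<Rightarrow> F 1 (l # take k p) (drop k p) | OrthT \<Rightarrow> F (-1) (l # take (Suc k) p) (drop (Suc k) p) | Coef _ \<Rightarrow> 0)" .
  then show ?case
    by (cases l) (simp_all add: sum.lessThan_Suc_shift del: sum.lessThan_Suc cong: oletter.case_cong)
qed simp

lemma sum_rotate_Suc:
  fixes F :: "'b list \<Rightarrow> complex"
  shows "(\<Sum>k<length p. F (rotate (Suc k) p)) = (\<Sum>k<length p. F (rotate k p))"
proof (cases p)
  case (Cons a q)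
  have "(\<Sum>k<Suc (length q). F (rotate (Suc k) p)) + F (rotate 0 p) = (\<Sum>k<Suc (length q). F (rotate k p)) + F (rotate (length p) p)"
    using sum.lessThan_Suc_shift[of "\<lambda>k. F (rotate k p)" "Suc (length q)"] Cons
    by (simp add: add.commute del: rotate_Suc)
  then show ?thesis using Cons by (simp del: rotate_Suc sum.lessThan_Suc)
qed simp

lemma last_rotate_Suc: "k < length p \<Longrightarrow> last (rotate (Suc k) p) = p ! k"
proof -
  assume k: "k < length p"
  then have ne: "rotate k p \<noteq> []" by auto
  have "rotate (Suc k) p = tl (rotate k p) @ [hd (rotate k p)]"
    using ne by (simp add: rotate1_hd_tl)
  then show ?thesis using hd_rotate_conv_nth[of p k] k by (cases "p = []") (auto simp del: rotate_Suc)
qed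

lemma hd_rotate: "k < length p \<Longrightarrow> hd (rotate k p) = p ! k"
  using hd_rotate_conv_nth[of p k] by (cases "p = []") auto

text \<open>Transposition reverses the word, so the rotation by \<open>k\<close> turns into the one
  by \<open>length p - k\<close>.\<close>

lemma sum_rotate_owt:
  fixes F :: "'i oword \<Rightarrow> complex"
  shows "(\<Sum>k<length p. F (owt (rotate k p))) = (\<Sum>k<length p. F (rotate k (owt p)))"
proof -
  have "owt (rotate k p) = rotate (length p - k) (owt p)" if "k < length p" for k
  proof -
    have "rotate (length p - k) (owt p) = rev (rotate (length p - ((length p - k) mod length p)) (map olt p))"
      unfolding owt_def by (subst rotate_rev) simp
    also have "rotate (length p - ((length p - k) mod length p)) (map olt p) = rotate k (map olt p)"
    proof (cases "k = 0")
      case False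
      then have "(length p - k) mod length p = length p - k" using that by simp
      then show ?thesis using that by simp
    qed (use that in \<open>simp add: rotate_conv_mod[of "length p" "map olt p"]\<close>)
    finally show ?thesis by (simp add: owt_def rotate_map)
  qed
  then have "(\<Sum>k<length p. F (owt (rotate k p))) = (\<Sum>k<length p. F (rotate (length p - k) (owt p)))"
    by simp
  also have "\<dots> = (\<Sum>k<length p. F (rotate (Suc k) (owt p)))"
    by (rule sum.reindex_bij_witness[of _ "\<lambda>k. length p - Suc k" "\<lambda>k. length p - Suc k"])
      (auto simp: Suc_diff_Suc simp del: rotate_Suc)
  also have "\<dots> = (\<Sum>k<length p. F (rotate k (owt p)))"
    using sum_rotate_Suc[of F "owt p"] by simp
  finally show ?thesis .
qed

section \<open>Reduced words\<close>

text \<open>The affine rule is the form of linearity that centring uses: a multiple of the unit is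
  subtracted from a coefficient letter.\<close>

locale loop_free = loop_asymp +
  assumes \<tau>_Nil: "d \<ge> 1 \<Longrightarrow> \<tau> d [] = 1"
    and \<tau>_affine: "d \<ge> 1 \<Longrightarrow> \<tau> d (Coef (p + Poly_Mapping.single 0 c) # v) = \<tau> d (Coef p # v) + c * \<tau> d v"
begin

lemma phi_Nil [simp]: "phi [] = 1"
  by (rule LIMSEQ_unique_ge1[OF tendsto_phi tendsto_const]) (rule \<tau>_Nil)

lemma phi_affine: "phi (Coef (p + Poly_Mapping.single 0 c) # v) = phi (Coef p # v) + c * phi v"
  by (rule LIMSEQ_unique_ge1[OF tendsto_phi tendsto_add[OF tendsto_phi tendsto_mult[OF tendsto_const tendsto_phi]]])
    (rule \<tau>_affine)

definition reduced :: "'a oword \<Rightarrow> bool" where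
  "reduced w \<longleftrightarrow> (\<forall>l\<in>set w. is_coef l \<longrightarrow> phi [l] = 0) \<and> successively (\<lambda>a b. \<not> clash a b) w"

definition cyc_reduced :: "'a oword \<Rightarrow> bool" where
  "cyc_reduced w \<longleftrightarrow> w \<noteq> [] \<and> reduced w \<and> \<not> clash (last w) (hd w)"

lemma reduced_append:
  "reduced (u @ v) \<longleftrightarrow> reduced u \<and> reduced v \<and> (u = [] \<or> v = [] \<or> \<not> clash (last u) (hd v))"
  by (auto simp: reduced_def successively_append_iff)

lemma reduced_Nil [simp]: "reduced []"
  by (simp add: reduced_def)

lemma reduced_Cons:
  "reduced (l # v) \<longleftrightarrow> (is_coef l \<longrightarrow> phi [l] = 0) \<and> reduced v \<and> (v = [] \<or> \<not> clash l (hd v))"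
  by (auto simp: reduced_def successively_Cons)

lemma phi_olt: "phi [olt l] = phi [l]"
  using phi_teq[OF teq_transp[of "[l]"]] by (simp add: owt_def)

lemma reduced_owt [simp]: "reduced (owt w) = reduced w"
proof -
  have *: "reduced (owt w)" if "reduced w" for w
    using that
  proof (induction w)
    case (Cons l w)
    then show ?case
      by (auto simp: owt_Cons reduced_append reduced_Cons phi_olt clash_sym last_rev hd_map owt_def last_map)
  qed simp
  show ?thesis using *[of w] *[of "owt w"] by auto
qed

lemma cyc_reduced_owt: "cyc_reduced w \<Longrightarrow> cyc_reduced (owt w)"
  unfolding cyc_reduced_def
  by (auto simp: owt_def[of w] hd_rev last_rev hd_map last_map clash_sym) (simp add: owt_def[symmetric])

lemma cyc_reduced_swap:
  assumes "cyc_reduced (u @ v)"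
  shows "cyc_reduced (v @ u)"
  using assms by (cases "u = []"; cases "v = []") (auto simp: cyc_reduced_def reduced_append)

lemma cyc_reduced_rotate: "cyc_reduced w \<Longrightarrow> cyc_reduced (rotate k w)"
  unfolding rotate_drop_take using cyc_reduced_swap[of "take (k mod length w) w" "drop (k mod length w) w"] by simp

lemma reduced_rotate: "cyc_reduced w \<Longrightarrow> reduced (rotate k w)"
  using cyc_reduced_rotate cyc_reduced_def by blast

lemma phi_centre:
  obtains r where "phi [Coef r] = 0" "\<And>v. phi (Coef p # v) = phi (Coef r # v) + phi [Coef p] * phi v"
proof -
  define c where "c = phi [Coef p]"
  define r where "r = p - Poly_Mapping.single 0 c"
  have p: "p = r + Poly_Mapping.single 0 c" by (simp add: r_def)
  have *: "phi (Coef p # v) = phi (Coef r # v) + c * phi v" for v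
    unfolding p by (rule phi_affine)
  from *[of "[]"] have "phi [Coef r] = 0" by (simp add: c_def)
  then show thesis by (rule that) (rule *[unfolded c_def])
qed

text \<open>Induction on the length. Clashing ends meet cyclically: two orthogonal letters cancel,
  two coefficients merge and split into a centred part and a scalar, and shorter reduced words
  remain. If the ends do not clash, an \<open>Orth\<close> is rotated to the front, and each term of
  the loop equation contains the mean of the shorter reduced word \<open>Orth # L\<close>.\<close>

theorem phi_reduced: "reduced w \<Longrightarrow> w \<noteq> [] \<Longrightarrow> phi w = 0"
proof (induction "length w" arbitrary: w rule: less_induct)
  case less
  show ?case
  proof (cases "\<exists>l. w = [l] \<and> is_coef l")
    case True
    then show ?thesis using less.prems by (auto simp: reduced_def)
  next
    case ns: False
    show ?thesis
    proof (cases "clash (last w) (hd w)")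
      case True
      obtain a v0 where w0: "w = a # v0" using less.prems by (cases w) auto
      have "v0 \<noteq> []"
        using ns True w0 by (cases a) auto
      then obtain v b where w: "w = a # v @ [b]" using w0 by (metis append_butlast_last_id)
      \<comment> \<open>Otherwise the two clashing ends would be neighbours in the reduced word
        \<open>w\<close>.\<close>
      have v: "v \<noteq> []"
        using less.prems(1) True w by (auto simp: reduced_Cons clash_sym)
      have rv: "reduced v" "\<not> clash a (hd v)" using less.prems(1) w v by (auto simp: reduced_Cons reduced_append)
      then have v0: "phi v = 0" using less.hyps[of v] v w by simp
      from True w have "clash b a" by simp
      then show ?thesis
      proof (cases rule: clash_cases)
        case (1 q p)
        obtain r where r: "phi [Coef r] = 0"
          "\<And>u. phi (Coef (q * p) # u) = phi (Coef r # u) + phi [Coef (q * p)] * phi u"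
          using phi_centre[of "q * p"] by blast
        have "phi w = phi (Coef (q * p) # v)"
          using phi_teq[OF teq_rot[of "a # v" "[b]"]] phi_teq[OF teq_merge[of q p v]] w 1 by simp
        also have "\<dots> = phi (Coef r # v)" using r(2)[of v] v0 by simp
        also have "\<dots> = 0"
        proof (rule less.hyps)
          have "\<not> is_coef (hd v)" using rv(2) 1 by (cases "hd v") auto
          then have "\<not> clash (Coef r) (hd v)" by (cases "hd v") auto
          then show "reduced (Coef r # v)" using r(1) rv by (simp add: reduced_Cons)
        qed (use w in auto)
        finally show ?thesis .
      next
        case 2
        have "phi w = phi ([b, a] @ v)"
          using phi_teq[OF teq_rot[of "a # v" "[b]"]] w by simp
        then show ?thesis using phi_teq[OF teq_cancel_mid[of b a "[]" v]] 2 v0 by simp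
      next
        case 3
        have "phi w = phi ([b, a] @ v)"
          using phi_teq[OF teq_rot[of "a # v" "[b]"]] w by simp
        then show ?thesis using phi_teq[OF teq_cancel_mid[of b a "[]" v]] 3 v0 by simp
      qed
    next
      case False
      have cyc: "cyc_reduced w" using less.prems False by (simp add: cyc_reduced_def)
      \<comment> \<open>Quantified over all \<open>x\<close> of this length, because it is applied
        to the transpose of \<open>w\<close> as well.\<close>
      have *: "phi x = 0" if x: "cyc_reduced x" "Orth \<in> set x" "length x = length w" for x
      proof -
        from x(2) obtain u v where uv: "x = u @ Orth # v" by (meson split_list)
        define V where "V = v @ u"
        have cV: "cyc_reduced (Orth # V)" using cyc_reduced_swap[of u "Orth # v"] x(1) uv by (simp add: V_def)
        have "phi x = phi (Orth # V)"
          using phi_teq[OF teq_rot[of u "Orth # v"]] uv by (simp add: V_def)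
        also have "\<dots> = (\<Sum>(s, L, R)\<leftarrow>cuts V. - s * phi (Orth # L) * phi R)" by (rule phi_loop)
        also have "\<dots> = (\<Sum>(s, L, R)\<leftarrow>cuts V. 0)"
        proof (rule sum_triples_cong')
          fix s L R assume c: "(s, L, R) \<in> set (cuts V)"
          have LR: "L @ R = V" by (rule cuts_append_eq[OF c])
          \<comment> \<open>An empty \<open>R\<close> would make \<open>V\<close> end in
            \<open>OrthT\<close>, which clashes with the leading \<open>Orth\<close> of a cyclically
            reduced word. With \<open>R\<close> non-empty, \<open>Orth # L\<close> is short enough
            for the induction.\<close>
          have "R \<noteq> []"
            using c
          proof (cases rule: cuts_cases)
            case (2 L')
            show ?thesis
            proof
              assume "R = []"
              with 2 cV show False by (simp add: cyc_reduced_def)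
            qed
          qed simp
          have "reduced ((Orth # L) @ R)" using cV LR by (simp add: cyc_reduced_def)
          then have "reduced (Orth # L)" unfolding reduced_append by blast
          moreover have "length (Orth # L) < length w" using LR \<open>R \<noteq> []\<close> x(3) uv V_def
            by (metis One_nat_def Suc_less_eq add.commute add_Suc_right length_Cons length_append length_greater_0_conv less_add_same_cancel1)
          ultimately have "phi (Orth # L) = 0" by (intro less.hyps) auto
          then show "- s * phi (Orth # L) * phi R = 0" by simp
        qed
        finally show ?thesis by (simp add: case_prod_unfold)
      qed
      show ?thesis
      proof (cases "Orth \<in> set w")
        case True
        then show ?thesis using *[OF cyc] by simp
      next
        case no: False
        \<comment> \<open>Without orthogonal letters two neighbouring coefficients would clash, so
          \<open>w\<close> would be a single coefficient.\<close>
        have "OrthT \<in> set w"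
        proof (rule ccontr)
          assume "OrthT \<notin> set w"
          with no have "\<forall>l\<in>set w. is_coef l" by (metis is_coef.elims(3))
          moreover obtain a v where w: "w = a # v" using less.prems by (cases w) auto
          ultimately have "is_coef a" "v \<noteq> [] \<Longrightarrow> is_coef (hd v)" by auto
          then have "v \<noteq> [] \<Longrightarrow> clash a (hd v)" by (cases a; cases "hd v") auto
          then have "v = []" using less.prems(1) w by (auto simp: reduced_Cons)
          with ns w \<open>is_coef a\<close> show False by auto
        qed
        then have "Orth \<in> set (owt w)" by (force simp: set_owt)
        from *[OF cyc_reduced_owt[OF cyc] this] show ?thesis
          using phi_teq[OF teq_transp[of w]] by simp
      qed
    qed
  qed
qed

text \<open>Both pieces of a cut of the first word are non-empty and reduced. Their means vanish,
  and only gluing is left.\<close>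

lemma cc_loop_reduced:
  assumes x: "cyc_reduced (Orth # V)"
  shows "cc {#Orth # V, p#} = (\<Sum>(s, L, R)\<leftarrow>cuts p. s * (phi (Orth # V @ owt (R @ L)) - phi (Orth # V @ R @ L)))"
proof -
  let ?x = "Orth # V"
  have rx: "reduced ?x" and lx: "\<not> clash (last ?x) Orth"
    using x by (auto simp: cyc_reduced_def)
  have "(\<Sum>(s, L, R)\<leftarrow>cuts V. - s * (phi (Orth # L) * cc (add_mset R {#p#}) + phi R * cc (add_mset (Orth # L) {#p#})))
    = (\<Sum>(s, L, R)\<leftarrow>cuts V. 0)"
  proof (rule sum_triples_cong')
    fix s L R assume c: "(s, L, R) \<in> set (cuts V)"
    have LR: "L @ R = V" by (rule cuts_append_eq[OF c])
    have "R \<noteq> []"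
      using c
    proof (cases rule: cuts_cases)
      case (2 L')
      show ?thesis
      proof
        assume "R = []"
        with 2 lx show False by simp
      qed
    qed simp
    have "reduced ((Orth # L) @ R)" using rx LR by simp
    then have "reduced (Orth # L)" "reduced R" unfolding reduced_append by blast+
    then show "- s * (phi (Orth # L) * cc (add_mset R {#p#}) + phi R * cc (add_mset (Orth # L) {#p#})) = 0"
      using phi_reduced \<open>R \<noteq> []\<close> by simp
  qed
  then show ?thesis
    using cc_loop[of V "{#p#}"] by (simp add: case_prod_unfold)
qed

text \<open>Gluing yields a signed pair of terms for each orthogonal letter of \<open>p\<close>. A
  glued word can have a nonzero mean only if its letters clash at both junctions. At an
  \<open>Orth\<close> this kills the direct term and at an \<open>OrthT\<close> the transposed one,
  which are the terms with a minus sign. The rotations absent from the sum vanish for the same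
  reason, so both sums may run over all positions.\<close>

theorem cc_cyc_reduced:
  assumes x: "cyc_reduced (Orth # V)" and p: "cyc_reduced p"
  shows "cc {#Orth # V, p#} =
    (\<Sum>k<length p. phi (Orth # V @ rotate k p)) + (\<Sum>k<length p. phi (Orth # V @ rotate k (owt p)))"
proof -
  let ?x = "Orth # V"
  have rx: "reduced ?x" and lx: "\<not> clash (last ?x) Orth"
    using x by (auto simp: cyc_reduced_def)
  have A: "phi (?x @ y) = 0" if "reduced y" "y \<noteq> []" "hd y = Orth" for y
    using phi_reduced[of "?x @ y"] reduced_append[of ?x y] that rx lx by auto
  \<comment> \<open>\<open>A\<close> uses the junction of \<open>?x\<close> with \<open>y\<close>,
    and \<open>B\<close> the cyclic one of \<open>y\<close> with the leading \<open>Orth\<close> of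
    \<open>?x\<close>.\<close>
  have B: "phi (?x @ y) = 0" if "reduced y" "y \<noteq> []" "last y \<noteq> OrthT" for y
  proof -
    have "phi (?x @ y) = phi (y @ ?x)" by (rule phi_teq[OF teq_rot])
    also have "\<dots> = 0"
    proof (rule phi_reduced)
      have "\<not> clash (last y) Orth" using that(3) by (cases "last y") auto
      then show "reduced (y @ ?x)" using that rx by (auto simp: reduced_append[of y])
    qed simp
    finally show ?thesis .
  qed
  have pne: "p \<noteq> []" using p by (simp add: cyc_reduced_def)
  have "cc {#?x, p#} = (\<Sum>(s, L, R)\<leftarrow>cuts p. s * (phi (?x @ owt (R @ L)) - phi (?x @ R @ L)))"
    using cc_loop_reduced[OF x, of p] by simp
  also have "\<dots> = (\<Sum>k<length p. phi (?x @ owt (rotate k p)) + phi (?x @ rotate (Suc k) p))"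
    unfolding cuts_sum
  proof (rule sum.cong)
    fix k assume "k \<in> {..<length p}"
    then have k: "k < length p" by simp
    have r: "rotate k p = drop k p @ take k p" "rotate (Suc k) p = drop (Suc k) p @ take (Suc k) p"
      using k by (auto simp: rotate_drop_take mod_Suc simp del: rotate_Suc)
    note red = reduced_rotate[OF p]
    have red': "reduced (owt (rotate j p))" for j by (simp add: red)
    have ne: "rotate j p \<noteq> []" "owt (rotate j p) \<noteq> []" for j using pne by (auto simp: owt_def)
    have hl: "hd (rotate k p) = p ! k" "last (rotate (Suc k) p) = p ! k"
      using k by (simp_all add: hd_rotate last_rotate_Suc del: rotate_Suc)
    have hl': "last (owt (rotate k p)) = olt (p ! k)" "hd (owt (rotate (Suc k) p)) = olt (p ! k)"
      unfolding owt_def using hl ne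
      by (simp_all add: last_rev hd_rev hd_map last_map del: rotate_Suc)
    show "(case p ! k of
         Orth \<Rightarrow> 1 * (phi (?x @ owt (drop k p @ take k p)) - phi (?x @ drop k p @ take k p))
         | OrthT \<Rightarrow> - 1 * (phi (?x @ owt (drop (Suc k) p @ take (Suc k) p)) - phi (?x @ drop (Suc k) p @ take (Suc k) p))
         | Coef x \<Rightarrow> 0) = phi (?x @ owt (rotate k p)) + phi (?x @ rotate (Suc k) p)"
    proof (cases "p ! k")
      case Orth
      then show ?thesis
        using A[OF red ne(1), of k] B[OF red ne(1), of "Suc k"] hl unfolding r by simp
    next
      case OrthT
      then show ?thesis
        using A[OF red' ne(2), of "Suc k"] B[OF red' ne(2), of k] hl' unfolding r by simp
    next
      case (Coef q)
      then show ?thesis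
        using B[OF _ ne(2), of k] B[OF red ne(1), of "Suc k"] hl hl' red by simp
    qed
  qed simp
  also have "\<dots> = (\<Sum>k<length p. phi (?x @ rotate k p)) + (\<Sum>k<length p. phi (?x @ rotate k (owt p)))"
    using sum_rotate_Suc[of "\<lambda>y. phi (?x @ y)" p] sum_rotate_owt[of "\<lambda>y. phi (?x @ y)" p]
    by (simp add: sum.distrib del: rotate_Suc)
  finally show ?thesis by simp
qed

lemma cc_Coef_right: "cyc_reduced (Orth # V) \<Longrightarrow> cc {#Orth # V, [Coef q]#} = 0"
  using cc_loop_reduced[of V "[Coef q]"] by simp

end

section \<open>Words as elements of the free algebra\<close>

definition emb :: "'i ncpoly \<Rightarrow> ('i + unit) ncpoly" where
  "emb = nc_eval nc_smul nc_transpose (\<lambda>i. nc_var (Inl i))"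

fun letter_poly :: "'i oletter \<Rightarrow> ('i + unit) ncpoly" where
  "letter_poly Orth = nc_var (Inr ())"
| "letter_poly OrthT = nc_transpose (nc_var (Inr ()))"
| "letter_poly (Coef p) = emb p"

definition word_poly :: "'i oword \<Rightarrow> ('i + unit) ncpoly" where
  "word_poly w = prod_list (map letter_poly w)"

fun to_oletter :: "('i + unit) letter \<Rightarrow> 'i oletter" where
  "to_oletter (Var (Inl i)) = Coef (nc_var i)"
| "to_oletter (VarT (Inl i)) = Coef (nc_transpose (nc_var i))"
| "to_oletter (Var (Inr u)) = Orth"
| "to_oletter (VarT (Inr u)) = OrthT"

definition to_oword :: "('i + unit) word \<Rightarrow> 'i oword" where
  "to_oword w = map to_oletter (letters w)"

lemma word_poly_simps [simp]:
  "word_poly [] = 1" "word_poly (l # w) = letter_poly l * word_poly w" "word_poly (u @ v) = word_poly u * word_poly v"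
  by (simp_all add: word_poly_def)

lemma word_poly_concat: "word_poly (concat ws) = prod_list (map word_poly ws)"
  by (induction ws) simp_all

section \<open>Cyclic index shifts and reflections\<close>

lemma bij_shift:
  assumes "n > 0"
  shows "bij_betw (\<lambda>i. nat ((int i + c) mod int n)) {..<n} {..<n}"
proof (rule bij_betw_byWitness[where f' = "\<lambda>i. nat ((int i - c) mod int n)"])
  show "\<forall>a\<in>{..<n}. nat ((int (nat ((int a + c) mod int n)) - c) mod int n) = a"
    using assms by (auto simp: mod_diff_left_eq)
  show "\<forall>a\<in>{..<n}. nat ((int (nat ((int a - c) mod int n)) + c) mod int n) = a"
    using assms by (auto simp: mod_add_left_eq)
qed (use assms in \<open>auto simp: nat_less_iff\<close>)

lemma bij_reflect:
  assumes "n > 0"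
  shows "bij_betw (\<lambda>i. nat ((c - int i) mod int n)) {..<n} {..<n}"
proof (rule bij_betw_byWitness[where f' = "\<lambda>i. nat ((c - int i) mod int n)"])
  show "\<forall>a\<in>{..<n}. nat ((c - int (nat ((c - int a) mod int n))) mod int n) = a"
    using assms by (auto simp: mod_diff_right_eq)
  then show "\<forall>a\<in>{..<n}. nat ((c - int (nat ((c - int a) mod int n))) mod int n) = a" .
qed (use assms in \<open>auto simp: nat_less_iff\<close>)

text \<open>The spoke formula uses integer offsets. Only residues matter, and shifts and reflections
  permute them.\<close>

lemma periodic:
  fixes f :: "int \<Rightarrow> complex"
  assumes f: "\<And>x. f (x mod int n) = f x"
  shows sum_shift: "(\<Sum>i<n. f (int i + c)) = (\<Sum>i<n. f (int i))"
    and prod_shift: "(\<Prod>i<n. f (int i + c)) = (\<Prod>i<n. f (int i))"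
    and sum_reflect: "(\<Sum>i<n. f (c - int i)) = (\<Sum>i<n. f (int i))"
    and prod_reflect: "(\<Prod>i<n. f (c - int i)) = (\<Prod>i<n. f (int i))"
proof -
  have *: "f (int (nat (x mod int n))) = f x" if "n > 0" for x using f that by simp
  show "(\<Sum>i<n. f (int i + c)) = (\<Sum>i<n. f (int i))"
    using sum.reindex_bij_betw[OF bij_shift, of n "\<lambda>i. f (int i)" c] * by (cases "n = 0") auto
  show "(\<Prod>i<n. f (int i + c)) = (\<Prod>i<n. f (int i))"
    using prod.reindex_bij_betw[OF bij_shift, of n "\<lambda>i. f (int i)" c] * by (cases "n = 0") auto
  show "(\<Sum>i<n. f (c - int i)) = (\<Sum>i<n. f (int i))"
    using sum.reindex_bij_betw[OF bij_reflect, of n "\<lambda>i. f (int i)" c] * by (cases "n = 0") auto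
  show "(\<Prod>i<n. f (c - int i)) = (\<Prod>i<n. f (int i))"
    using prod.reindex_bij_betw[OF bij_reflect, of n "\<lambda>i. f (int i)" c] * by (cases "n = 0") auto
qed

lemma cyc_nth_mod [simp]: "cyc_nth xs (z mod int (length xs)) = cyc_nth xs z"
  by (simp add: cyc_nth_def)

lemma cyc_nth_cong: "z mod int (length xs) = z' mod int (length xs) \<Longrightarrow> cyc_nth xs z = cyc_nth xs z'"
  by (simp add: cyc_nth_def)

lemma cyc_nth_of_nat: "i < length xs \<Longrightarrow> cyc_nth xs (int i) = xs ! i"
  by (simp add: cyc_nth_def)

lemma cyc_nth_map: "xs \<noteq> [] \<Longrightarrow> cyc_nth (map f xs) z = f (cyc_nth xs z)"
  by (simp add: cyc_nth_def nat_less_iff)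

lemma cyc_nth_rotate: "xs \<noteq> [] \<Longrightarrow> cyc_nth (rotate k xs) z = cyc_nth xs (z + int k)"
proof -
  assume ne: "xs \<noteq> []"
  define n where "n = length xs"
  have n: "n > 0" using ne by (simp add: n_def)
  have "cyc_nth (rotate k xs) z = xs ! ((k + nat (z mod int n)) mod n)"
    using n by (simp add: cyc_nth_def nth_rotate nat_less_iff n_def)
  also have "(k + nat (z mod int n)) mod n = nat ((z + int k) mod int n)"
    using n by (simp add: nat_eq_iff2 zmod_int mod_add_right_eq add.commute)
  finally show ?thesis by (simp add: cyc_nth_def n_def)
qed

text \<open>Counting from 0, position \<open>i\<close> of the reversal is \<open>n - 1 - i\<close>,
  that is \<open>- 1 - i\<close> modulo \<open>n\<close>. This is the source of the offsets
  \<open>- 1\<close> below.\<close>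

lemma cyc_nth_rev: "xs \<noteq> [] \<Longrightarrow> cyc_nth (rev xs) z = cyc_nth xs (- 1 - z)"
proof -
  assume ne: "xs \<noteq> []"
  define n where "n = int (length xs)"
  have n: "n > 0" using ne by (simp add: n_def)
  have m: "(- 1 - z) mod n = n - 1 - z mod n"
  proof -
    have "(- 1 - z) mod n = (n - 1 - z mod n) mod n"
      by (simp add: mod_diff_right_eq mod_simps) (metis (no_types, opaque_lifting) diff_add_cancel diff_diff_eq2 mod_add_self1 add.commute uminus_add_conv_diff)
    also have "\<dots> = n - 1 - z mod n"
      using n pos_mod_bound[of n z] pos_mod_sign[of n z] by (intro mod_pos_pos_trivial) linarith+
    finally show ?thesis .
  qed
  have "nat (z mod n) < length xs" using n pos_mod_bound[of n z] by (simp add: nat_less_iff n_def)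
  then have "cyc_nth (rev xs) z = xs ! (length xs - Suc (nat (z mod n)))"
    by (simp add: cyc_nth_def rev_nth n_def)
  also have "length xs - Suc (nat (z mod n)) = nat ((- 1 - z) mod n)"
    unfolding m using n pos_mod_sign[of n z] by (simp add: n_def nat_diff_distrib)
  finally show ?thesis by (simp add: cyc_nth_def n_def)
qed

section \<open>Spoke sums in a real second order space\<close>

text \<open>The right-hand side of the second order freeness formula: annular spoke diagrams in both
  orientations.\<close>

definition spokes :: "('a::ring_1 \<Rightarrow> complex) \<Rightarrow> ('a \<Rightarrow> 'a) \<Rightarrow> 'a list \<Rightarrow> 'a list \<Rightarrow> complex" where
  "spokes f t as bs = (\<Sum>k<length as. (\<Prod>i<length as. f (as ! i * cyc_nth bs (int k - int i))) +
     (\<Prod>i<length as. f (as ! i * t (cyc_nth bs (int i - int k)))))"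

lemma successively_neq_rev: "successively (\<noteq>) (rev xs) \<longleftrightarrow> successively (\<noteq>) xs"
  by (induction xs) (auto simp: successively_append_iff successively_Cons last_rev)

context real_second_order_space
begin

text \<open>The value of a product \<open>rev xs\<close> times \<open>ys\<close> under freeness. The
  heads of the two lists are neighbours there, and pairs are contracted from the inside out.\<close>

fun nested :: "'a list \<Rightarrow> 'a list \<Rightarrow> complex" where
  "nested [] [] = 1"
| "nested (x # xs) (y # ys) = \<phi> (x * y) * nested xs ys"
| "nested _ _ = 0"

lemma nested_length: "length xs \<noteq> length ys \<Longrightarrow> nested xs ys = 0"
  by (induction xs ys rule: nested.induct) auto

lemma nested_prod: "length xs = length ys \<Longrightarrow> nested xs ys = (\<Prod>i<length xs. \<phi> (xs ! i * ys ! i))"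
  by (induction xs ys rule: nested.induct) (auto simp: prod.lessThan_Suc_shift simp del: prod.lessThan_Suc)

lemma \<phi>_diff: "\<phi> (x - y) = \<phi> x - \<phi> y"
  using \<phi>_add[of "x - y" y] by simp

text \<open>Look at the two entries that meet in the middle. From different subalgebras, they make
  the whole product alternating and centred. From the same one, their product is a centred element,
  which again gives an alternating product of mean 0, plus the scalar \<open>\<phi> (x * y)\<close>,
  which lets the next pair meet.\<close>

lemma nested_freeness:
  fixes B :: "nat \<Rightarrow> 'a set"
  defines "gen \<equiv> \<lambda>j x. x \<in> B j \<and> \<phi> x = 0"
  assumes B: "\<And>j. j \<in> J \<Longrightarrow> unital_subalgebra smul (B j)"
    and free: "\<And>js as. list_all2 gen js as \<Longrightarrow> set js \<subseteq> J \<Longrightarrow> successively (\<noteq>) js \<Longrightarrow> js \<noteq> [] \<Longrightarrow> \<phi> (prod_list as) = 0"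
    and xs: "list_all2 gen js xs" "successively (\<noteq>) js" "set js \<subseteq> J"
    and ys: "list_all2 gen ks ys" "successively (\<noteq>) ks" "set ks \<subseteq> J"
  shows "\<phi> (prod_list (rev xs) * prod_list ys) = nested xs ys"
  using xs ys
proof (induction xs ys arbitrary: js ks rule: nested.induct)
  case 1
  then show ?case by (simp add: \<phi>_one)
next
  case (2 x xs y ys)
  from 2(2) obtain j js' where js: "js = j # js'" "gen j x" "list_all2 gen js' xs" by (cases js) auto
  from 2(5) obtain k ks' where ks: "ks = k # ks'" "gen k y" "list_all2 gen ks' ys" by (cases ks) auto
  have suc: "successively (\<noteq>) js'" "successively (\<noteq>) ks'"
    and nxt: "js' = [] \<or> hd js' \<noteq> j" "ks' = [] \<or> hd ks' \<noteq> k"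
    using 2 js ks by (auto simp: successively_Cons)
  have rl: "list_all2 gen (rev js') (rev xs)" using js by simp
  have rs: "successively (\<noteq>) (rev js')" using suc by (simp only: successively_neq_rev)
  have lr: "js' \<noteq> [] \<Longrightarrow> last (rev js') = hd js'" by (simp add: last_rev)
  have prod_eq: "prod_list (rev (x # xs)) * prod_list (y # ys) = prod_list (rev xs @ [x, y] @ ys)"
    by (simp add: mult.assoc)
  show ?case
  proof (cases "j = k")
    case False
    have "\<phi> (prod_list (rev xs @ [x, y] @ ys)) = 0"
    proof (rule free)
      show "list_all2 gen (rev js' @ [j, k] @ ks') (rev xs @ [x, y] @ ys)"
        using rl js ks by (intro list_all2_appendI) auto
      show "successively (\<noteq>) (rev js' @ [j, k] @ ks')"
        using rs suc nxt False lr by (auto simp: successively_append_iff successively_Cons)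
    qed (use 2 js ks in auto)
    \<comment> \<open>The first factor of \<open>nested\<close> vanishes as well, so both sides are
      0.\<close>
    moreover have "\<phi> (prod_list [x, y]) = 0"
      by (rule free[of "[j, k]"]) (use False 2 js ks in auto)
    ultimately show ?thesis unfolding prod_eq by simp
  next
    case True
    define c where "c = \<phi> (x * y)"
    \<comment> \<open>The centred part of the product of the two neighbours; it stays in their
      common subalgebra.\<close>
    define z where "z = x * y - smul c 1"
    have xy: "x * y = z + smul c 1" by (simp add: z_def)
    have "j \<in> J" using 2 js by auto
    note Bj = B[OF this, unfolded unital_subalgebra_def]
    have "z \<in> B j"
      using Bj js ks True unfolding z_def gen_def by (auto intro!: subspace_diff subspace_scale)
    moreover have "\<phi> z = 0" by (simp add: z_def \<phi>_diff \<phi>_smul \<phi>_one c_def)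
    ultimately have z: "gen j z" by (simp add: gen_def)
    have "\<phi> (prod_list (rev xs @ [z] @ ys)) = 0"
    proof (rule free)
      show "list_all2 gen (rev js' @ [j] @ ks') (rev xs @ [z] @ ys)"
        using rl js ks z by (intro list_all2_appendI) auto
      show "successively (\<noteq>) (rev js' @ [j] @ ks')"
        using rs suc nxt True lr by (auto simp: successively_append_iff successively_Cons)
    qed (use 2 js ks in auto)
    moreover have "prod_list (rev xs @ [x, y] @ ys) = prod_list (rev xs @ [z] @ ys) + smul c (prod_list (rev xs) * prod_list ys)"
      by (simp add: mult.assoc[symmetric] xy distrib_left distrib_right smul_mult_left smul_mult_right)
    moreover have "\<phi> (prod_list (rev xs) * prod_list ys) = nested xs ys"
      by (rule 2(1)[of js' ks']) (use js ks suc 2 in auto)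
    ultimately show ?thesis unfolding prod_eq by (simp add: \<phi>_add \<phi>_smul c_def)
  qed
next
  case ("3_1" v va)
  have "\<phi> (prod_list (rev (v # va))) = 0"
    by (rule free[of "rev js"]) (use "3_1" in \<open>auto simp del: rev.simps simp del: successively_rev simp: successively_neq_rev\<close>)
  then show ?case using "3_1" by simp
next
  case ("3_2" v va)
  have "\<phi> (prod_list (v # va)) = 0"
    by (rule free[of ks]) (use "3_2" in auto)
  then show ?case using "3_2" by simp
qed

lemma \<phi>_t_mult: "\<phi> (t x * y) = \<phi> (x * t y)"
  using \<phi>_t[of "t x * y"] by (simp add: t_mult t_t \<phi>_trace)

section \<open>Symmetries of spoke sums\<close>

lemma spokes_cyc:
  assumes "length as = length bs"
  shows "spokes \<phi> t as bs = (\<Sum>k<length as. (\<Prod>i<length as. \<phi> (cyc_nth as (int i) * cyc_nth bs (int k - int i)))) +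
     (\<Sum>k<length as. (\<Prod>i<length as. \<phi> (cyc_nth as (int i) * t (cyc_nth bs (int i - int k)))))"
  unfolding spokes_def by (simp add: cyc_nth_of_nat sum.distrib)

lemma cyc_nth_shift_mod:
  assumes "length xs = n"
  shows "cyc_nth xs (x mod int n + c) = cyc_nth xs (x + c)" "cyc_nth xs (c + x mod int n) = cyc_nth xs (c + x)"
    "cyc_nth xs (c - x mod int n) = cyc_nth xs (c - x)" "cyc_nth xs (x mod int n - c) = cyc_nth xs (x - c)"
  by (rule cyc_nth_cong; simp add: assms mod_simps)+

text \<open>A rotation of \<open>as\<close> shifts the summation index \<open>k\<close> in both
  orientations. With the next two lemmas, the spoke sum has the symmetries of the covariance, which
  allows words to be normalized on both sides of the formula at once.\<close>

lemma spokes_rotate: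
  assumes "length as = length bs"
  shows "spokes \<phi> t (rotate r as) bs = spokes \<phi> t as bs"
proof (cases "as = []")
  case False
  let ?n = "length as"
  let ?A = "cyc_nth as" and ?B = "cyc_nth bs"
  note [simp] = cyc_nth_shift_mod[where n = ?n and xs = as] cyc_nth_shift_mod[where n = ?n and xs = bs, OF assms[symmetric]]
  have m: "?A (x mod int ?n) = ?A x" "?B (x mod int ?n) = ?B x" for x
    using cyc_nth_mod[of as x] cyc_nth_mod[of bs x] assms by simp_all
  note [simp] = m
  have 1: "(\<Prod>i<?n. \<phi> (?A (int i + int r) * ?B (int k - int i))) = (\<Prod>i<?n. \<phi> (?A (int i) * ?B (int k + int r - int i)))" for k
    proof -
    have P: "(\<lambda>x. \<phi> (?A x * ?B (int k + int r - x))) (x mod int ?n) = (\<lambda>x. \<phi> (?A x * ?B (int k + int r - x))) x" for x by simp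
    show ?thesis using prod_shift[where n = ?n and f = "\<lambda>x. \<phi> (?A x * ?B (int k + int r - x))" and c = "int r", OF P] by (simp add: algebra_simps)
  qed
  have 2: "(\<Prod>i<?n. \<phi> (?A (int i + int r) * t (?B (int i - int k)))) = (\<Prod>i<?n. \<phi> (?A (int i) * t (?B (int i - (int k + int r)))))" for k
    proof -
    have P: "(\<lambda>x. \<phi> (?A x * t (?B (x - (int k + int r))))) (x mod int ?n) = (\<lambda>x. \<phi> (?A x * t (?B (x - (int k + int r))))) x" for x by simp
    show ?thesis using prod_shift[where n = ?n and f = "\<lambda>x. \<phi> (?A x * t (?B (x - (int k + int r))))" and c = "int r", OF P] by (simp add: algebra_simps)
  qed
  have 3: "(\<Sum>k<?n. (\<Prod>i<?n. \<phi> (?A (int i) * ?B (int k + int r - int i)))) = (\<Sum>k<?n. (\<Prod>i<?n. \<phi> (?A (int i) * ?B (int k - int i))))"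
    by (rule sum_shift[where f = "\<lambda>x. \<Prod>i<?n. \<phi> (?A (int i) * ?B (x - int i))"]) simp
  have 4: "(\<Sum>k<?n. (\<Prod>i<?n. \<phi> (?A (int i) * t (?B (int i - (int k + int r)))))) = (\<Sum>k<?n. (\<Prod>i<?n. \<phi> (?A (int i) * t (?B (int i - int k)))))"
    by (rule sum_shift[where f = "\<lambda>x. \<Prod>i<?n. \<phi> (?A (int i) * t (?B (int i - x)))"]) simp
  have L: "length (rotate r as) = length bs" using assms by simp
  show ?thesis
    by (simp only: spokes_cyc[OF assms] spokes_cyc[OF L] length_rotate cyc_nth_rotate[OF False] 1 2 3 4)
qed simp

text \<open>Reversing and transposing one tuple exchanges the two orientations.\<close>

lemma spokes_transpose:
  assumes "length as = length bs"
  shows "spokes \<phi> t (rev (map t as)) bs = spokes \<phi> t as bs"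
proof (cases "as = []")
  case False
  let ?n = "length as"
  let ?A = "cyc_nth as" and ?B = "cyc_nth bs"
  note [simp] = cyc_nth_shift_mod[where n = ?n and xs = as] cyc_nth_shift_mod[where n = ?n and xs = bs, OF assms[symmetric]]
  have m: "?A (x mod int ?n) = ?A x" "?B (x mod int ?n) = ?B x" for x
    using cyc_nth_mod[of as x] cyc_nth_mod[of bs x] assms by simp_all
  note [simp] = m
  have 1: "(\<Prod>i<?n. \<phi> (t (?A (- 1 - int i)) * ?B (int k - int i))) = (\<Prod>i<?n. \<phi> (?A (int i) * t (?B (int i - (- 1 - int k)))))" for k
    proof -
    have P: "(\<lambda>x. \<phi> (?A x * t (?B (x - (- 1 - int k))))) (x mod int ?n) = (\<lambda>x. \<phi> (?A x * t (?B (x - (- 1 - int k))))) x" for x by simp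
    show ?thesis using prod_reflect[where n = ?n and f = "\<lambda>x. \<phi> (?A x * t (?B (x - (- 1 - int k))))" and c = "- 1", OF P] by (simp add: algebra_simps \<phi>_t_mult)
  qed
  have 2: "(\<Prod>i<?n. \<phi> (t (?A (- 1 - int i)) * t (?B (int i - int k)))) = (\<Prod>i<?n. \<phi> (?A (int i) * ?B (- 1 - int k - int i)))" for k
    proof -
    have P: "(\<lambda>x. \<phi> (?A x * ?B (- 1 - int k - x))) (x mod int ?n) = (\<lambda>x. \<phi> (?A x * ?B (- 1 - int k - x))) x" for x by simp
    show ?thesis using prod_reflect[where n = ?n and f = "\<lambda>x. \<phi> (?A x * ?B (- 1 - int k - x))" and c = "- 1", OF P] by (simp add: algebra_simps \<phi>_t_mult t_t)
  qed
  have 3: "(\<Sum>k<?n. (\<Prod>i<?n. \<phi> (?A (int i) * ?B (- 1 - int k - int i)))) = (\<Sum>k<?n. (\<Prod>i<?n. \<phi> (?A (int i) * ?B (int k - int i))))"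
    by (rule sum_reflect[where f = "\<lambda>x. \<Prod>i<?n. \<phi> (?A (int i) * ?B (x - int i))"]) simp
  have 4: "(\<Sum>k<?n. (\<Prod>i<?n. \<phi> (?A (int i) * t (?B (int i - (- 1 - int k)))))) = (\<Sum>k<?n. (\<Prod>i<?n. \<phi> (?A (int i) * t (?B (int i - int k)))))"
    by (rule sum_reflect[where f = "\<lambda>x. \<Prod>i<?n. \<phi> (?A (int i) * t (?B (int i - x)))"]) simp
  have L: "length (rev (map t as)) = length bs" using assms by simp
  show ?thesis
    using False by (simp only: spokes_cyc[OF assms] spokes_cyc[OF L]
      length_rev length_map cyc_nth_rev cyc_nth_map map_is_Nil_conv 1 2 3 4 not_False_eq_True add.commute)
qed simp

text \<open>The direct products are reflected by \<open>i\<close> to \<open>k - i\<close>; in the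
  transposed ones \<open>i\<close> is shifted and \<open>k\<close> changes its sign.\<close>

lemma spokes_sym:
  assumes "length as = length bs"
  shows "spokes \<phi> t as bs = spokes \<phi> t bs as"
proof -
  let ?n = "length as"
  let ?A = "cyc_nth as" and ?B = "cyc_nth bs"
  note [simp] = cyc_nth_shift_mod[where n = ?n and xs = as] cyc_nth_shift_mod[where n = ?n and xs = bs, OF assms[symmetric]]
  have m: "?A (x mod int ?n) = ?A x" "?B (x mod int ?n) = ?B x" for x
    using cyc_nth_mod[of as x] cyc_nth_mod[of bs x] assms by simp_all
  note [simp] = m
  have 1: "(\<Prod>i<?n. \<phi> (?A (int i) * ?B (int k - int i))) = (\<Prod>i<?n. \<phi> (?B (int i) * ?A (int k - int i)))" for k
    proof -
    have P: "(\<lambda>x. \<phi> (?B x * ?A (int k - x))) (x mod int ?n) = (\<lambda>x. \<phi> (?B x * ?A (int k - x))) x" for x by simp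
    show ?thesis using prod_reflect[where n = ?n and f = "\<lambda>x. \<phi> (?B x * ?A (int k - x))" and c = "int k", OF P] by (simp add: \<phi>_trace)
  qed
  have H: "\<phi> (?A x * t (?B y)) = \<phi> (?B y * t (?A x))" for x y
    using \<phi>_t_mult[of "?A x" "?B y"] \<phi>_trace by metis
  then have 2: "(\<Prod>i<?n. \<phi> (?A (int i) * t (?B (int i - int k)))) = (\<Prod>i<?n. \<phi> (?B (int i) * t (?A (int i + int k))))" for k
    proof -
    have P: "(\<lambda>x. \<phi> (?B x * t (?A (x + int k)))) (x mod int ?n) = (\<lambda>x. \<phi> (?B x * t (?A (x + int k)))) x" for x by simp
    show ?thesis using prod_shift[where n = ?n and f = "\<lambda>x. \<phi> (?B x * t (?A (x + int k)))" and c = "- int k", OF P] by (simp add: H)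
  qed
  have 3: "(\<Sum>k<?n. (\<Prod>i<?n. \<phi> (?B (int i) * t (?A (int i + int k))))) = (\<Sum>k<?n. (\<Prod>i<?n. \<phi> (?B (int i) * t (?A (int i - int k)))))"
  proof -
    have P: "(\<lambda>x. \<Prod>i<?n. \<phi> (?B (int i) * t (?A (int i - x)))) (x mod int ?n) = (\<lambda>x. \<Prod>i<?n. \<phi> (?B (int i) * t (?A (int i - x)))) x" for x by simp
    show ?thesis using sum_reflect[where f = "\<lambda>x. \<Prod>i<?n. \<phi> (?B (int i) * t (?A (int i - x)))" and c = 0 and n = ?n, OF P] by simp
  qed
  show ?thesis
    by (simp add: spokes_cyc assms[symmetric] spokes_cyc[OF assms] 1 2 3)
qed

text \<open>The bridge from glued words to spokes: rotations of \<open>bs\<close> against the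
  reversed \<open>as\<close> give the direct spokes, rotations of the reversed and transposed
  \<open>bs\<close> the other orientation. The offset \<open>- 1\<close> in the direct part
  disappears in the sum over \<open>k\<close>.\<close>

lemma nested_rotations:
  assumes "length as = length bs"
  shows "(\<Sum>j<length bs. nested (rev as) (rotate j bs)) + (\<Sum>j<length bs. nested (rev as) (rotate j (rev (map t bs)))) = spokes \<phi> t as bs"
proof (cases "as = []")
  case False
  let ?n = "length as"
  let ?A = "cyc_nth as" and ?B = "cyc_nth bs"
  note [simp] = cyc_nth_shift_mod[where n = ?n and xs = as] cyc_nth_shift_mod[where n = ?n and xs = bs, OF assms[symmetric]]
  have m: "?A (x mod int ?n) = ?A x" "?B (x mod int ?n) = ?B x" for x
    using cyc_nth_mod[of as x] cyc_nth_mod[of bs x] assms by simp_all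
  note [simp] = m
  have ne: "as \<noteq> []" "bs \<noteq> []" using False assms by auto
  have nst: "nested (rev as) ys = (\<Prod>i<?n. \<phi> (?A (- 1 - int i) * cyc_nth ys (int i)))" if "length ys = ?n" for ys
  proof -
    have "rev as ! i = ?A (- 1 - int i)" if "i < ?n" for i
      using cyc_nth_of_nat[of i "rev as"] cyc_nth_rev[OF ne(1), of "int i"] that by simp
    then show ?thesis using that by (simp add: nested_prod cyc_nth_of_nat)
  qed
  have 1: "(\<Prod>i<?n. \<phi> (?A (- 1 - int i) * ?B (int i + int j))) = (\<Prod>i<?n. \<phi> (?A (int i) * ?B (int j - 1 - int i)))" for j
    proof -
    have P: "(\<lambda>x. \<phi> (?A x * ?B (int j - 1 - x))) (x mod int ?n) = (\<lambda>x. \<phi> (?A x * ?B (int j - 1 - x))) x" for x by simp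
    show ?thesis using prod_reflect[where n = ?n and f = "\<lambda>x. \<phi> (?A x * ?B (int j - 1 - x))" and c = "- 1", OF P] by (simp add: algebra_simps)
  qed
  have 2: "(\<Prod>i<?n. \<phi> (?A (- 1 - int i) * t (?B (- 1 - (int i + int j))))) = (\<Prod>i<?n. \<phi> (?A (int i) * t (?B (int i - int j))))" for j
    proof -
    have P: "(\<lambda>x. \<phi> (?A x * t (?B (x - int j)))) (x mod int ?n) = (\<lambda>x. \<phi> (?A x * t (?B (x - int j)))) x" for x by simp
    show ?thesis using prod_reflect[where n = ?n and f = "\<lambda>x. \<phi> (?A x * t (?B (x - int j)))" and c = "- 1", OF P] by (simp add: algebra_simps)
  qed
  have 3: "(\<Sum>j<?n. (\<Prod>i<?n. \<phi> (?A (int i) * ?B (int j - 1 - int i)))) = (\<Sum>k<?n. (\<Prod>i<?n. \<phi> (?A (int i) * ?B (int k - int i))))"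
    using sum_shift[where n = ?n and f = "\<lambda>x. \<Prod>i<?n. \<phi> (?A (int i) * ?B (x - int i))" and c = "- 1"] by simp
  have "nested (rev as) (rotate j bs) = (\<Prod>i<?n. \<phi> (?A (int i) * ?B (int j - 1 - int i)))" for j
    using assms[symmetric] ne by (simp add: nst cyc_nth_rotate 1[symmetric])
  moreover have "nested (rev as) (rotate j (rev (map t bs))) = (\<Prod>i<?n. \<phi> (?A (int i) * t (?B (int i - int j))))" for j
    using assms[symmetric] ne by (simp add: nst cyc_nth_rotate cyc_nth_rev cyc_nth_map 2[symmetric])
  ultimately show ?thesis
    using 3 by (simp add: spokes_cyc[OF assms] assms[symmetric])
qed (use assms in \<open>simp add: spokes_def\<close>)

text \<open>
  A slot is a linear functional of one entry of a product. It only sees an element modulo those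
  relations that hold under \<open>\<phi>\<close> and \<open>\<phi>2\<close>; in the free algebra \<open>x x\<^sup>t = 1\<close> is not an identity.
\<close>

definition eqv :: "'a \<Rightarrow> 'a \<Rightarrow> bool" where
  "eqv z z' \<longleftrightarrow> (\<forall>x y. \<phi> (x * z * y) = \<phi> (x * z' * y) \<and> (\<forall>b. \<phi>2 (x * z * y) b = \<phi>2 (x * z' * y) b))"

definition slot :: "('a \<Rightarrow> complex) \<Rightarrow> bool" where
  "slot F \<longleftrightarrow> (\<forall>x y. F (x + y) = F x + F y) \<and> (\<forall>c x. F (smul c x) = c * F x) \<and>
    (\<forall>z z'. eqv z z' \<longrightarrow> F z = F z')"

lemma slot_0: "slot (\<lambda>z. 0)"
  by (simp add: slot_def)

lemma slot_diff: "slot F \<Longrightarrow> slot G \<Longrightarrow> slot (\<lambda>z. F z - G z)"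
  by (auto simp: slot_def algebra_simps)

lemma slot_add: "slot F \<Longrightarrow> slot G \<Longrightarrow> slot (\<lambda>z. F z + G z)"
  by (auto simp: slot_def algebra_simps)

lemma slot_sum: "(\<And>k. k \<in> K \<Longrightarrow> slot (F k)) \<Longrightarrow> slot (\<lambda>z. \<Sum>k\<in>K. F k z)"
  by (induction K rule: infinite_finite_induct) (auto simp: slot_0 intro!: slot_add)

lemma slot_mult: "slot F \<Longrightarrow> slot (\<lambda>z. F z * c)"
  by (auto simp: slot_def algebra_simps)

lemma slot_\<phi>: "slot (\<lambda>z. \<phi> (x * z * y))"
  by (auto simp: slot_def eqv_def distrib_left distrib_right smul_mult_left smul_mult_right \<phi>_add \<phi>_smul)

lemma slot_\<phi>2: "slot (\<lambda>z. \<phi>2 (x * z * y) b)"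
  by (auto simp: slot_def eqv_def distrib_left distrib_right smul_mult_left smul_mult_right \<phi>2_add_left \<phi>2_smul_left)

lemma slot_prod: "slot (\<lambda>z. \<Prod>i<length (xs @ z # ys). \<phi> ((xs @ z # ys) ! i * g i))"
proof -
  let ?n = "length (xs @ 0 # ys)"
  let ?c = "\<Prod>i\<in>{..<?n} - {length xs}. \<phi> ((xs @ 0 # ys) ! i * g i)"
  have "(\<lambda>z. \<Prod>i<length (xs @ z # ys). \<phi> ((xs @ z # ys) ! i * g i)) = (\<lambda>z. \<phi> (1 * z * g (length xs)) * ?c)"
  proof
    fix z
    have "(\<Prod>i<length (xs @ z # ys). \<phi> ((xs @ z # ys) ! i * g i)) = \<phi> ((xs @ z # ys) ! length xs * g (length xs)) *
      (\<Prod>i\<in>{..<length (xs @ z # ys)} - {length xs}. \<phi> ((xs @ z # ys) ! i * g i))"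
      by (intro prod.remove) auto
    also have "(\<Prod>i\<in>{..<length (xs @ z # ys)} - {length xs}. \<phi> ((xs @ z # ys) ! i * g i)) = ?c"
      by (intro prod.cong) (auto simp: nth_append nth_Cons split: nat.splits)
    finally show "(\<Prod>i<length (xs @ z # ys). \<phi> ((xs @ z # ys) ! i * g i)) = \<phi> (1 * z * g (length xs)) * ?c"
      by simp
  qed
  then show ?thesis by (simp only: slot_mult[OF slot_\<phi>])
qed

lemma slot_spokes: "slot (\<lambda>z. spokes \<phi> t (xs @ z # ys) bs)"
proof -
  have "(\<lambda>z. spokes \<phi> t (xs @ z # ys) bs) =
    (\<lambda>z. \<Sum>k<length (xs @ 0 # ys). (\<Prod>i<length (xs @ z # ys). \<phi> ((xs @ z # ys) ! i * cyc_nth bs (int k - int i))) +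
     (\<Prod>i<length (xs @ z # ys). \<phi> ((xs @ z # ys) ! i * t (cyc_nth bs (int i - int k)))))"
    unfolding spokes_def by simp
  then show ?thesis by (simp only:) (intro slot_sum slot_add slot_prod)
qed

lemma slot_prod_list: "slot (\<lambda>z. \<phi> (prod_list (xs @ z # ys)))" "slot (\<lambda>z. \<phi>2 (prod_list (xs @ z # ys)) b)"
  using slot_\<phi>[of "prod_list xs" "prod_list ys"] slot_\<phi>2[of "prod_list xs" "prod_list ys" b]
  by (simp_all add: mult.assoc)

text \<open>Multilinear extension from left to right: entries in front of the current slot are
  already basis elements, those behind it are still general.\<close>

lemma multi_ext:
  assumes slot: "\<And>xs ys. slot (\<lambda>z. F (xs @ z # ys))"
    and base: "\<And>as. list_all2 bas js as \<Longrightarrow> F as = 0"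
    and ext: "\<And>j z G. gen j z \<Longrightarrow> slot G \<Longrightarrow> (\<And>b. bas j b \<Longrightarrow> G b = 0) \<Longrightarrow> G z = 0"
    and as: "list_all2 gen js as"
  shows "F as = 0"
proof -
  have "list_all2 bas js1 xs \<Longrightarrow> list_all2 gen js2 ys \<Longrightarrow> js = js1 @ js2 \<Longrightarrow> F (xs @ ys) = 0" for js1 js2 xs ys
  proof (induction ys arbitrary: js1 js2 xs)
    case Nil
    then show ?case using base by simp
  next
    case (Cons z ys)
    then obtain j js2' where j: "js2 = j # js2'" "gen j z" "list_all2 gen js2' ys" by (cases js2) auto
    show ?case
    proof (rule ext[OF j(2) slot])
      fix b assume "bas j b"
      then have "list_all2 bas (js1 @ [j]) (xs @ [b])" using Cons.prems(1) by (intro list_all2_appendI) auto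
      from Cons.IH[OF this j(3)] show "F (xs @ b # ys) = 0" using Cons.prems(3) j(1) by simp
    qed
  qed
  from this[of "[]" "[]" js as] as show ?thesis by simp
qed

end

section \<open>Cyclically alternating labels and sums over cut positions\<close>

definition cyc_alt :: "nat list \<Rightarrow> bool" where
  "cyc_alt js \<longleftrightarrow> js \<noteq> [] \<and> successively (\<noteq>) js \<and> (length js \<ge> 2 \<longrightarrow> last js \<noteq> hd js)"

lemma cyc_alt_rotate1: "cyc_alt js \<Longrightarrow> cyc_alt (rotate1 js)"
  by (cases js) (auto simp: cyc_alt_def successively_Cons successively_append_iff hd_append Suc_le_eq split: if_splits)

lemma cyc_alt_rotate: "cyc_alt js \<Longrightarrow> cyc_alt (rotate r js)"
  by (induction r) (auto simp: cyc_alt_rotate1)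

lemma cyc_alt_rev: "cyc_alt js \<Longrightarrow> cyc_alt (rev js)"
  by (auto simp: cyc_alt_def hd_rev last_rev successively_neq_rev simp del: successively_rev)

lemma cyc_altI:
  assumes "js \<noteq> []" "2 \<le> length js \<Longrightarrow> \<forall>k<length js. js ! k \<noteq> js ! (Suc k mod length js)"
  shows "cyc_alt js"
proof (cases "2 \<le> length js")
  case True
  have "js ! i \<noteq> js ! Suc i" if "Suc i < length js" for i
    using assms(2)[OF True, rule_format, of i] that by simp
  moreover have "last js \<noteq> hd js"
    using assms(2)[OF True, rule_format, of "length js - 1"] True assms(1)
    by (auto simp: last_conv_nth hd_conv_nth)
  ultimately show ?thesis using assms(1) by (auto simp: cyc_alt_def successively_conv_nth)
next
  case False
  then obtain a where "js = [a]" using assms(1) by (cases js; cases "tl js") auto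
  then show ?thesis by (simp add: cyc_alt_def)
qed

text \<open>Allows a sum over all rotations of a concatenation to be evaluated block by
  block.\<close>

definition split_sum :: "('b list \<Rightarrow> 'b list \<Rightarrow> complex) \<Rightarrow> 'b list \<Rightarrow> complex" where
  "split_sum G p = (\<Sum>k<length p. G (take k p) (drop k p))"

lemma sum_lessThan_plus: "(\<Sum>k<a + b. f k) = (\<Sum>k<a. f k) + (\<Sum>k<b. (f (a + k) :: complex))" for a b :: nat
  by (induction b) (simp_all add: add.assoc)

lemma split_sum_append: "split_sum G (u @ v) = split_sum (\<lambda>L R. G L (R @ v)) u + split_sum (\<lambda>L R. G (u @ L) R) v"
  unfolding split_sum_def length_append sum_lessThan_plus
  by (intro arg_cong2[where f = "(+)"] sum.cong) auto

lemma split_sum_concat: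
  "split_sum G (concat vs) = (\<Sum>j<length vs. split_sum (\<lambda>L R. G (concat (take j vs) @ L) (R @ concat (drop (Suc j) vs))) (vs ! j))"
proof (induction vs arbitrary: G)
  case (Cons v vs)
  show ?case
    by (simp add: split_sum_append Cons.IH sum.lessThan_Suc_shift del: sum.lessThan_Suc)
qed (simp add: split_sum_def)

lemma split_sum_rotate: "split_sum (\<lambda>L R. F (R @ L)) p = (\<Sum>k<length p. F (rotate k p))"
  unfolding split_sum_def by (intro sum.cong) (auto simp: rotate_drop_take)

section \<open>Real second order freeness of the limit\<close>

text \<open>The limit space enters only through its values on words, which are limits of means and
  of covariances.\<close>

locale haar_limit = loop_free \<tau> C + R: real_second_order_space nc_smul \<Phi> \<Phi>2 nc_transpose
  for \<tau> :: "nat \<Rightarrow> 'i oword \<Rightarrow> complex" and C :: "nat \<Rightarrow> 'i oword multiset \<Rightarrow> complex"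
    and \<Phi> :: "('i + unit) ncpoly \<Rightarrow> complex" and \<Phi>2 :: "('i + unit) ncpoly \<Rightarrow> ('i + unit) ncpoly \<Rightarrow> complex" +
  assumes \<Phi>_word: "\<Phi> (word_poly w) = phi w"
    and \<Phi>2_word: "\<Phi>2 (word_poly u) (word_poly v) = cc {#u, v#}"
begin

lemma emb_simps:
  "emb (p * q) = (emb p * emb q :: ('i + unit) ncpoly)" "emb 1 = (1 :: ('i + unit) ncpoly)"
  "emb (p + q) = (emb p + emb q :: ('i + unit) ncpoly)" "emb (nc_smul c p) = (nc_smul c (emb p) :: ('i + unit) ncpoly)"
  "emb (nc_transpose p) = (nc_transpose (emb p) :: ('i + unit) ncpoly)" "emb (nc_var i) = (nc_var (Inl i) :: ('i + unit) ncpoly)"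
  by (simp_all add: emb_def R.ev_mult R.ev_one R.ev_add R.ev_smul R.ev_transpose R.ev_var)

lemma word_poly_owt: "word_poly (owt w) = nc_transpose (word_poly (w :: 'i oword))"
proof (induction w)
  case (Cons l w)
  have "letter_poly (olt l) = nc_transpose (letter_poly l)" by (cases l) (simp_all add: R.t_t emb_simps)
  with Cons show ?case by (simp add: owt_Cons R.t_mult)
qed (simp add: R.t_one)

lemma single_word_poly: "Poly_Mapping.single w c = nc_smul c (word_poly (to_oword w :: 'i oword))"
proof -
  have *: "Poly_Mapping.single (Word ls) 1 = word_poly (to_oword (Word ls) :: 'i oword)" for ls
  proof (induction ls)
    case Nil
    have "Word [] = (0 :: ('i + unit) word)" by (simp add: zero_word_def)
    then show ?case by (simp add: to_oword_def)
  next
    case (Cons l ls)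
    have l: "letter_poly (to_oletter l :: 'i oletter) = Poly_Mapping.single (Word [l]) 1"
      by (cases l rule: to_oletter.cases)
        (simp_all add: emb_simps, simp_all add: nc_var_def nc_transpose_single word_transpose_def)
    have "Poly_Mapping.single (Word (l # ls)) (1::complex) = Poly_Mapping.single (Word [l]) 1 * Poly_Mapping.single (Word ls) 1"
      by (simp add: mult_single plus_word_def)
    then show ?case using Cons by (simp add: l to_oword_def)
  qed
  from *[of "letters w"] have "nc_smul c (Poly_Mapping.single w 1) = nc_smul c (word_poly (to_oword w))" by simp
  then show ?thesis by (simp add: nc_smul_single)
qed

text \<open>The elements \<open>word_poly w\<close> span the free algebra.\<close>

lemma linear_eq:
  assumes "\<And>x y. f (x + y) = f x + (f y :: complex)" "\<And>c x. f (nc_smul c x) = c * f x"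
    "\<And>x y. g (x + y) = g x + (g y :: complex)" "\<And>c x. g (nc_smul c x) = c * g x"
    "\<And>w :: 'i oword. f (word_poly w) = g (word_poly w)"
  shows "f p = g p"
  by (induction p rule: ncpoly_induct) (simp_all add: assms single_word_poly)

lemmas bilin = distrib_left distrib_right R.smul_mult_left R.smul_mult_right R.\<phi>_add R.\<phi>_smul
  R.\<phi>2_add_left R.\<phi>2_smul_left R.\<phi>2_add_right R.\<phi>2_smul_right

lemma \<Phi>2_sym: "\<Phi>2 x y = \<Phi>2 y x"
proof (rule linear_eq[of "\<lambda>x. \<Phi>2 x y" "\<lambda>x. \<Phi>2 y x"])
  fix w :: "'i oword"
  show "\<Phi>2 (word_poly w) y = \<Phi>2 y (word_poly w)"
    by (rule linear_eq[of "\<lambda>y. \<Phi>2 (word_poly w) y" "\<lambda>y. \<Phi>2 y (word_poly w)"])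
      (simp_all add: bilin \<Phi>2_word add_mset_commute)
qed (simp_all add: bilin)

text \<open>\<open>teq\<close> compares traces of whole words and is not a congruence; a replacement
  inside a word has to be valid in every context.\<close>

definition weq :: "'i oword \<Rightarrow> 'i oword \<Rightarrow> bool" where
  "weq u v \<longleftrightarrow> (\<forall>a b. teq (a @ u @ b) (a @ v @ b))"

text \<open>Linearity extends the replacement from words to arbitrary right factors, left factors
  and second entries, one at a time.\<close>

lemma eqv_word:
  assumes "weq u v"
  shows "R.eqv (word_poly u) (word_poly v)"
  unfolding R.eqv_def
proof (intro allI conjI)
  fix x y b :: "('i + unit) ncpoly"
  have 1: "\<Phi> (word_poly a * word_poly u * word_poly b) = \<Phi> (word_poly a * word_poly v * word_poly b)" for a b :: "'i oword"
    using \<Phi>_word[of "a @ u @ b"] \<Phi>_word[of "a @ v @ b"] phi_teq[of "a @ u @ b" "a @ v @ b"] assms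
    by (simp add: weq_def mult.assoc)
  have 4: "\<Phi> (word_poly a * word_poly u * y) = \<Phi> (word_poly a * word_poly v * y)" for a :: "'i oword"
    by (rule linear_eq[of "\<lambda>y. \<Phi> (word_poly a * word_poly u * y)" "\<lambda>y. \<Phi> (word_poly a * word_poly v * y)"])
      (simp_all add: bilin 1)
  show "\<Phi> (x * word_poly u * y) = \<Phi> (x * word_poly v * y)"
    by (rule linear_eq[of "\<lambda>x. \<Phi> (x * word_poly u * y)" "\<lambda>x. \<Phi> (x * word_poly v * y)"]) (simp_all add: bilin 4)
  have 2: "\<Phi>2 (word_poly a * word_poly u * word_poly c) (word_poly w) = \<Phi>2 (word_poly a * word_poly v * word_poly c) (word_poly w)"
    for a c w :: "'i oword"
    using \<Phi>2_word[of "a @ u @ c" w] \<Phi>2_word[of "a @ v @ c" w] cc_teq[of "a @ u @ c" "a @ v @ c" "{#w#}"] assms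
    by (simp add: weq_def mult.assoc)
  have 3: "\<Phi>2 (word_poly a * word_poly u * word_poly c) b = \<Phi>2 (word_poly a * word_poly v * word_poly c) b"
    for a c :: "'i oword"
    by (rule linear_eq[of "\<Phi>2 (word_poly a * word_poly u * word_poly c)" "\<Phi>2 (word_poly a * word_poly v * word_poly c)"])
      (simp_all add: bilin 2)
  have 5: "\<Phi>2 (word_poly a * word_poly u * y) b = \<Phi>2 (word_poly a * word_poly v * y) b" for a :: "'i oword"
    by (rule linear_eq[of "\<lambda>y. \<Phi>2 (word_poly a * word_poly u * y) b" "\<lambda>y. \<Phi>2 (word_poly a * word_poly v * y) b"])
      (simp_all add: bilin 3)
  show "\<Phi>2 (x * word_poly u * y) b = \<Phi>2 (x * word_poly v * y) b"
    by (rule linear_eq[of "\<lambda>x. \<Phi>2 (x * word_poly u * y) b" "\<lambda>x. \<Phi>2 (x * word_poly v * y) b"]) (simp_all add: bilin 5)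
qed

definition alg_a :: "('i + unit) ncpoly set" where
  "alg_a = generated_subalgebra nc_smul nc_transpose (\<lambda>i. nc_var (Inl i))"

definition alg_o :: "('i + unit) ncpoly set" where
  "alg_o = generated_subalgebra nc_smul nc_transpose (\<lambda>u. nc_var (Inr u))"

lemma unital_alg: "unital_subalgebra nc_smul alg_a" "unital_subalgebra nc_smul alg_o"
  by (simp_all add: alg_a_def alg_o_def generated_subalgebra_def R.unital_subalgebra_hull)

text \<open>The image of \<open>emb\<close> is a unital subalgebra that contains the generators, so
  an element of \<open>alg_a\<close> is always a one-letter word.\<close>

lemma alg_a_elem:
  assumes "x \<in> alg_a"
  obtains q where "x = word_poly [Coef q]"
proof -
  have "unital_subalgebra nc_smul (range (emb :: 'i ncpoly \<Rightarrow> _))"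
    unfolding unital_subalgebra_def R.subspace_def
  proof (intro conjI ballI allI)
    show "0 \<in> range (emb :: 'i ncpoly \<Rightarrow> _)"
      using emb_simps(4)[of 0 1] by (metis R.scale_zero_left rangeI)
    show "1 \<in> range (emb :: 'i ncpoly \<Rightarrow> _)" using emb_simps(2) by (metis rangeI)
  qed (auto simp flip: emb_simps)
  moreover have "range (\<lambda>i. nc_var (Inl i)) \<union> range (\<lambda>i. nc_transpose (nc_var (Inl i))) \<subseteq> range (emb :: 'i ncpoly \<Rightarrow> _)"
    by (auto simp flip: emb_simps)
  ultimately have "alg_a \<subseteq> range (emb :: 'i ncpoly \<Rightarrow> _)"
    unfolding alg_a_def generated_subalgebra_def by (intro hull_minimal)
  with assms that show thesis by auto
qed

definition o_words :: "('i + unit) word set" where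
  "o_words = {w. set (letters w) \<subseteq> {Var (Inr ()), VarT (Inr ())}}"

lemma alg_o_keys:
  assumes "x \<in> alg_o"
  shows "Poly_Mapping.keys x \<subseteq> o_words"
proof -
  let ?W = "{p. Poly_Mapping.keys p \<subseteq> o_words}"
  have plus: "u + v \<in> o_words" if "u \<in> o_words" "v \<in> o_words" for u v
    using that by (auto simp: o_words_def plus_word_def)
  have mult: "p * q \<in> ?W" if "p \<in> ?W" "q \<in> ?W" for p q
    using that keys_mult[of p q] plus by fastforce
  have zero: "0 \<in> o_words" by (simp add: o_words_def)
  have "unital_subalgebra nc_smul ?W"
    unfolding unital_subalgebra_def R.subspace_def
  proof (intro conjI ballI allI)
    show "p + q \<in> ?W" if "p \<in> ?W" "q \<in> ?W" for p q
      using that Poly_Mapping.keys_add[of p q] by blast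
    show "nc_smul c p \<in> ?W" if "p \<in> ?W" for c p
      unfolding nc_smul_def by (rule mult) (use that zero in auto)
    show "(1 :: ('i + unit) ncpoly) \<in> ?W"
      using zero by simp
    show "p * q \<in> ?W" if "p \<in> ?W" "q \<in> ?W" for p q
      by (rule mult[OF that])
  qed simp
  moreover have "range (\<lambda>i. nc_var (Inr i)) \<union> range (\<lambda>i. nc_transpose (nc_var (Inr i))) \<subseteq> ?W"
    by (auto simp: nc_var_def nc_transpose_single o_words_def word_transpose_def)
  ultimately have "alg_o \<subseteq> ?W"
    unfolding alg_o_def generated_subalgebra_def by (intro hull_minimal)
  with assms show ?thesis by blast
qed

lemma weq_trans: "weq u v \<Longrightarrow> weq v w \<Longrightarrow> weq u w"
  unfolding weq_def using teq_trans by blast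

lemma weq_Cons: "weq u v \<Longrightarrow> weq (l # u) (l # v)"
  unfolding weq_def
proof (intro allI)
  fix a b
  assume "\<forall>a b. teq (a @ u @ b) (a @ v @ b)"
  then have "teq ((a @ [l]) @ u @ b) ((a @ [l]) @ v @ b)" by blast
  then show "teq (a @ (l # u) @ b) (a @ (l # v) @ b)" by simp
qed

lemma weq_cancel: "weq (Orth # OrthT # w) w" "weq (OrthT # Orth # w) w"
  unfolding weq_def by (auto intro: teq_cancel_mid)

text \<open>Opposite neighbours cancel until only one of the two letters is left.\<close>

lemma weq_reduce:
  assumes "set w \<subseteq> {Orth, OrthT}"
  shows "\<exists>k e. e \<in> {Orth, OrthT} \<and> weq w (replicate k e)"
  using assms
proof (induction w)
  case Nil
  show ?case by (rule exI[of _ 0]) (auto simp: weq_def teq_refl)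
next
  case (Cons l w)
  then obtain k e where e: "e \<in> {Orth, OrthT}" "weq w (replicate k e)" by auto
  have 1: "weq (l # w) (l # replicate k e)" by (rule weq_Cons[OF e(2)])
  show ?case
  proof (cases "l = e \<or> k = 0")
    case True
    then have "l # replicate k e = replicate (Suc k) l" by auto
    with 1 Cons.prems show ?thesis by (metis insert_subset list.simps(15))
  next
    case False
    then obtain k' where k': "k = Suc k'" by (cases k) auto
    have "weq (l # replicate k e) (replicate k' e)"
      using False e(1) Cons.prems k' weq_cancel by auto
    with 1 weq_trans e(1) show ?thesis by blast
  qed
qed

text \<open>Label 0 stands for the coefficients and label 1 for the orthogonal matrix, as in the
  list \<open>[alg_a, alg_o]\<close>. \<open>Suc k\<close> excludes the empty power, which is not
  centred.\<close>

definition blk :: "nat \<Rightarrow> 'i oword \<Rightarrow> bool" where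
  "blk j w \<longleftrightarrow> (j = 0 \<and> (\<exists>q. w = [Coef q] \<and> phi w = 0)) \<or>
    (j = 1 \<and> (\<exists>k e. e \<in> {Orth, OrthT} \<and> w = replicate (Suc k) e))"

definition bas :: "nat \<Rightarrow> ('i + unit) ncpoly \<Rightarrow> bool" where
  "bas j x \<longleftrightarrow> (\<exists>w. blk j w \<and> x = word_poly w)"

definition gen :: "nat \<Rightarrow> ('i + unit) ncpoly \<Rightarrow> bool" where
  "gen j x \<longleftrightarrow> j < 2 \<and> x \<in> [alg_a, alg_o] ! j \<and> \<Phi> x = 0"

lemma reduced_replicate: "e \<in> {Orth, OrthT} \<Longrightarrow> reduced (replicate k e)"
  by (induction k) (auto simp: reduced_Cons)

lemma blk_props:
  assumes "blk j w"
  shows "w \<noteq> []" "reduced w" "is_coef (hd w) \<longleftrightarrow> j = 0" "is_coef (last w) \<longleftrightarrow> j = 0" "j < 2" "blk j (owt w)"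
proof -
  have r: "hd (replicate (Suc k) e) = e" "last (replicate (Suc k) e) = e" "replicate (Suc k) e \<noteq> []" for k and e :: "'i oletter"
    by (induction k) auto
  have "reduced w" using assms reduced_replicate by (auto simp: blk_def reduced_Cons simp del: replicate.simps)
  moreover have "is_coef (hd w) \<longleftrightarrow> j = 0" "is_coef (last w) \<longleftrightarrow> j = 0" "w \<noteq> []"
    using assms r by (auto simp: blk_def simp del: replicate.simps)
  moreover have "blk j (owt w)"
    using assms unfolding blk_def
  proof (elim disjE conjE exE)
    fix q assume "j = 0" "w = [Coef q]" "phi w = 0"
    then show "(j = 0 \<and> (\<exists>q. owt w = [Coef q] \<and> phi (owt w) = 0)) \<or> (j = 1 \<and> (\<exists>k e. e \<in> {Orth, OrthT} \<and> owt w = replicate (Suc k) e))"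
      using phi_olt[of "Coef q"] by (auto simp: owt_def)
  next
    fix k e assume *: "j = 1" "e \<in> {Orth, OrthT}" "w = replicate (Suc k) e"
    have "owt w = replicate (Suc k) (olt e)" using * by (simp add: owt_def del: replicate.simps)
    with * show "(j = 0 \<and> (\<exists>q. owt w = [Coef q] \<and> phi (owt w) = 0)) \<or> (j = 1 \<and> (\<exists>k e. e \<in> {Orth, OrthT} \<and> owt w = replicate (Suc k) e))"
      by force
  qed
  ultimately show "w \<noteq> []" "reduced w" "is_coef (hd w) \<longleftrightarrow> j = 0" "is_coef (last w) \<longleftrightarrow> j = 0" "blk j (owt w)" by blast+
  show "j < 2" using assms by (auto simp: blk_def)
qed

lemma no_clash: "is_coef a \<noteq> is_coef b \<Longrightarrow> \<not> clash a b"
  by (cases a; cases b) auto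

lemma blk_no_clash: "blk j v \<Longrightarrow> blk k w \<Longrightarrow> j \<noteq> k \<Longrightarrow> \<not> clash (last v) (hd w)"
  using blk_props[of j v] blk_props[of k w] by (intro no_clash) auto

lemma hd_concat': "ws \<noteq> [] \<Longrightarrow> hd ws \<noteq> [] \<Longrightarrow> hd (concat ws) = hd (hd ws)"
  by (cases ws) auto

lemma last_concat': "ws \<noteq> [] \<Longrightarrow> last ws \<noteq> [] \<Longrightarrow> last (concat ws) = last (last ws)"
  by (induction ws rule: rev_induct) auto

lemma reduced_concat: "list_all2 blk js ws \<Longrightarrow> successively (\<noteq>) js \<Longrightarrow> reduced (concat ws)"
proof (induction ws arbitrary: js)
  case (Cons w ws)
  then obtain j js' where j: "js = j # js'" "blk j w" "list_all2 blk js' ws" by (cases js) auto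
  have red: "reduced (concat ws)" using Cons j by (auto simp: successively_Cons)
  show ?case
  proof (cases ws)
    case (Cons v ws')
    then obtain k ks where k: "js' = k # ks" "blk k v" using j by (cases js') auto
    have "\<not> clash (last w) (hd v)" using blk_no_clash[OF j(2) k(2)] Cons.prems j k by (auto simp: successively_Cons)
    then show ?thesis
      using red blk_props[OF j(2)] blk_props[OF k(2)] Cons by (auto simp: reduced_append)
  qed (use blk_props[OF j(2)] in simp)
qed simp

lemma list_all2_bas: "list_all2 bas js as \<Longrightarrow> \<exists>ws. list_all2 blk js ws \<and> as = map word_poly ws"
proof (induction rule: list_all2_induct)
  case (Cons j js x as)
  then obtain w ws where "blk j w" "x = word_poly w" "list_all2 blk js ws" "as = map word_poly ws"
    by (auto simp: bas_def)
  then show ?case by (intro exI[of _ "w # ws"]) simp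
qed simp

text \<open>A centred coefficient already is a basis element. In the orthogonal subalgebra every
  word is equivalent to a power, so a slot that vanishes on non-empty powers is
  \<open>\<Phi>\<close> times its value at 1, and it kills centred elements.\<close>

lemma gen_ext:
  assumes "gen j z" "R.slot G" "\<And>b. bas j b \<Longrightarrow> G b = 0"
  shows "G z = 0"
proof (cases "j = 0")
  case True
  with assms(1) obtain q where q: "z = word_poly [Coef q]" using alg_a_elem by (auto simp: gen_def)
  have "phi [Coef q] = 0" using assms(1) \<Phi>_word[of "[Coef q]"] q by (simp add: gen_def)
  then have "bas j z" unfolding bas_def blk_def using True q by auto
  then show ?thesis by (rule assms(3))
next
  case False
  with assms(1) have j: "j = 1" and z: "z \<in> alg_o" "\<Phi> z = 0" by (auto simp: gen_def less_2_cases_iff)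
  have G: "G (x + y) = G x + G y" "G (nc_smul c x) = c * G x" for x y c
    using assms(2) by (auto simp: R.slot_def)
  \<comment> \<open>Non-empty powers are centred basis elements, where both sides are 0; the empty
    power is the unit.\<close>
  have wd: "G (Poly_Mapping.single w c) = c * (\<Phi> (Poly_Mapping.single w 1) * G 1)" if "w \<in> o_words" for w c
  proof -
    define u where "u = (to_oword w :: 'i oword)"
    have "set u \<subseteq> {Orth, OrthT}" using that by (auto simp: u_def to_oword_def o_words_def)
    from weq_reduce[OF this] obtain k e where e: "e \<in> {Orth, OrthT}" "weq u (replicate k e)" by blast
    from eqv_word[OF e(2)] have eq: "R.eqv (word_poly u) (word_poly (replicate k e))" .
    have 1: "G (word_poly u) = G (word_poly (replicate k e))"
      using assms(2) eq unfolding R.slot_def by blast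
    have 2: "\<Phi> (word_poly u) = \<Phi> (word_poly (replicate k e))"
      using eq[unfolded R.eqv_def, rule_format, of 1 1] by simp
    have "G (word_poly u) = \<Phi> (word_poly u) * G 1"
    proof (cases k)
      case 0
      then show ?thesis using 1 2 by (simp add: R.\<phi>_one)
    next
      case (Suc k')
      have "bas j (word_poly (replicate k e))"
        unfolding bas_def blk_def using j e(1) Suc by blast
      moreover have "\<Phi> (word_poly (replicate k e)) = 0"
        unfolding \<Phi>_word using phi_reduced[OF reduced_replicate[OF e(1), of k]] Suc by simp
      ultimately show ?thesis using 1 2 assms(3) by simp
    qed
    then show ?thesis
      using single_word_poly[of w c] single_word_poly[of w 1] G by (simp add: u_def)
  qed
  have claim: "G p = \<Phi> p * G 1" if "finite S" "S \<subseteq> o_words" "p = (\<Sum>w\<in>S. Poly_Mapping.single w (f w))" for p S and f :: "_ \<Rightarrow> complex"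
    using that
  proof (induction S arbitrary: p)
    case empty
    have "G 0 = 0" "\<Phi> 0 = 0" using G(2)[of 0 0] R.\<phi>_smul[of 0 0] by (simp_all add: nc_smul_def)
    then show ?case using empty by simp
  next
    case (insert w S)
    have "\<Phi> (Poly_Mapping.single w (f w)) = f w * \<Phi> (Poly_Mapping.single w 1)"
      using R.\<phi>_smul[of "f w" "Poly_Mapping.single w 1"] by (simp add: nc_smul_single)
    then show ?case using insert by (simp add: G R.\<phi>_add wd algebra_simps)
  qed
  have "z = (\<Sum>w\<in>Poly_Mapping.keys z. Poly_Mapping.single w (Poly_Mapping.lookup z w))"
    by (intro poly_mapping_eqI) (auto simp: lookup_sum lookup_single when_def in_keys_iff)
  then have "G z = \<Phi> z * G 1" by (rule claim[OF finite_keys alg_o_keys[OF z(1)]])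
  with z show ?thesis by simp
qed

text \<open>Concatenating basis blocks with alternating labels yields a reduced word; multilinearity
  does the rest.\<close>

theorem freeness:
  assumes "list_all2 gen js as" "successively (\<noteq>) js" "js \<noteq> []"
  shows "\<Phi> (prod_list as) = 0"
proof (rule R.multi_ext[where F = "\<lambda>as. \<Phi> (prod_list as)" and bas = bas and gen = gen and js = js])
  fix as assume "list_all2 bas js as"
  then obtain ws where ws: "list_all2 blk js ws" "as = map word_poly ws" using list_all2_bas by blast
  have "concat ws \<noteq> []"
    using ws(1) assms(3) blk_props(1) by (cases js; cases ws) auto
  then have "phi (concat ws) = 0"
    using reduced_concat[OF ws(1) assms(2)] by (intro phi_reduced)
  then show "\<Phi> (prod_list as) = 0"
    unfolding ws(2) word_poly_concat[symmetric] \<Phi>_word .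
qed (use assms(1) gen_ext R.slot_prod_list(1) in blast)+

text \<open>Through this, freeness of the two subalgebras applies to products of basis
  blocks.\<close>

lemma bas_gen: "bas j x \<Longrightarrow> gen j x"
proof -
  assume "bas j x"
  then obtain w where w: "blk j w" "x = word_poly w" by (auto simp: bas_def)
  have z: "\<Phi> x = 0" unfolding w \<Phi>_word by (rule phi_reduced) (use blk_props[OF w(1)] in auto)
  have o: "word_poly (replicate k e) \<in> alg_o" if "e \<in> {Orth, OrthT}" for k e
  proof (induction k)
    case 0
    then show ?case using unital_alg(2) by (simp add: unital_subalgebra_def)
  next
    case (Suc k)
    have "letter_poly e \<in> alg_o"
      using that unfolding alg_o_def generated_subalgebra_def by (auto intro!: hull_inc)
    then show ?case using Suc unital_alg(2) by (simp add: unital_subalgebra_def)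
  qed
  have a: "emb q \<in> alg_a" for q :: "'i ncpoly"
  proof (induction q rule: ncpoly_induct)
    case (single w c)
    have 1: "emb (Poly_Mapping.single (Word ls) 1) \<in> alg_a" for ls :: "'i letter list"
    proof (induction ls)
      case Nil
      have "Word [] = (0 :: 'i word)" by (simp add: zero_word_def)
      then show ?case using unital_alg(1) by (simp add: emb_simps unital_subalgebra_def)
    next
      case (Cons l ls)
      have "Poly_Mapping.single (Word (l # ls)) (1::complex) = Poly_Mapping.single (Word [l]) 1 * Poly_Mapping.single (Word ls) 1"
        by (simp add: mult_single plus_word_def)
      moreover have "Poly_Mapping.single (Word [l]) 1 = (case l of Var i \<Rightarrow> nc_var i | VarT i \<Rightarrow> nc_transpose (nc_var i))"
        by (cases l) (simp_all add: nc_var_def nc_transpose_single word_transpose_def)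
      moreover have "emb (case l of Var i \<Rightarrow> nc_var i | VarT i \<Rightarrow> nc_transpose (nc_var i)) \<in> alg_a"
        unfolding alg_a_def generated_subalgebra_def by (cases l) (auto simp: emb_simps intro!: hull_inc)
      ultimately show ?case using Cons unital_alg(1) by (simp add: emb_simps unital_subalgebra_def)
    qed
    have "Poly_Mapping.single w c = nc_smul c (Poly_Mapping.single (Word (letters w)) 1)"
      by (simp add: nc_smul_single)
    then show ?case using 1[of "letters w"] unital_alg(1)
      by (simp add: emb_simps unital_subalgebra_def R.subspace_def)
  next
    case (add p q)
    then show ?case using unital_alg(1) by (simp add: emb_simps unital_subalgebra_def R.subspace_def)
  qed
  from w(1) consider q where "j = 0" "w = [Coef q]" | k e where "j = 1" "e \<in> {Orth, OrthT}" "w = replicate (Suc k) e"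
    unfolding blk_def by blast
  then show "gen j x"
  proof cases
    case 1
    then show ?thesis using z w(2) a[of q] by (simp add: gen_def)
  next
    case 2
    then show ?thesis using z w(2) o[of e "Suc k"] by (simp add: gen_def)
  qed
qed

text \<open>A rotation that starts inside or at the beginning of an orthogonal block contributes 0:
  \<open>x\<close> ends in a coefficient, so the junction is reduced. On both sides only the
  rotations that start at a coefficient block remain.\<close>

lemma block_rotations:
  assumes x: "reduced x" "x \<noteq> []" "is_coef (last x)"
    and vs: "list_all2 blk ks vs" "cyc_reduced (concat vs)"
  shows "(\<Sum>k<length (concat vs). phi (x @ rotate k (concat vs))) = (\<Sum>j<length vs. phi (x @ concat (rotate j vs)))"
proof -
  have zero: "phi (x @ y @ z) = 0" if "cyc_reduced (z @ y)" "y \<noteq> []" "\<not> is_coef (hd y)" for y z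
  proof (rule phi_reduced)
    have "reduced (y @ z)" using cyc_reduced_swap[OF that(1)] by (simp add: cyc_reduced_def)
    moreover have "\<not> clash (last x) (hd (y @ z))" using that x(3) by (intro no_clash) auto
    ultimately show "reduced (x @ y @ z)" using x by (simp add: reduced_append[of x])
  qed (use x in simp)
  have "(\<Sum>k<length (concat vs). phi (x @ rotate k (concat vs))) = split_sum (\<lambda>L R. phi (x @ R @ L)) (concat vs)"
    using split_sum_rotate[of "\<lambda>y. phi (x @ y)" "concat vs"] by simp
  also have "\<dots> = (\<Sum>j<length vs. split_sum (\<lambda>L R. phi (x @ (R @ concat (drop (Suc j) vs)) @ (concat (take j vs) @ L))) (vs ! j))"
    by (rule split_sum_concat)
  also have "\<dots> = (\<Sum>j<length vs. phi (x @ concat (rotate j vs)))"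
  proof (rule sum.cong)
    fix j assume "j \<in> {..<length vs}"
    then have j: "j < length vs" by simp
    let ?v = "vs ! j"
    have b: "blk (ks ! j) ?v" using vs(1) j by (auto simp: list_all2_conv_all_nth)
    have dec: "concat vs = concat (take j vs) @ ?v @ concat (drop (Suc j) vs)"
      using id_take_nth_drop[OF j] by (metis concat.simps(2) concat_append)
    have rot: "concat (rotate j vs) = ?v @ concat (drop (Suc j) vs) @ concat (take j vs)"
      using j by (simp add: rotate_drop_take Cons_nth_drop_Suc[symmetric])
    from b consider q where "?v = [Coef q]" | k e where "e \<in> {Orth, OrthT}" "?v = replicate (Suc k) e"
      unfolding blk_def by blast
    then show "split_sum (\<lambda>L R. phi (x @ (R @ concat (drop (Suc j) vs)) @ (concat (take j vs) @ L))) ?v = phi (x @ concat (rotate j vs))"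
    proof cases
      case 1
      then show ?thesis by (simp add: rot split_sum_def)
    next
      case 2
      have z: "phi (x @ (drop i ?v @ concat (drop (Suc j) vs)) @ (concat (take j vs) @ take i ?v)) = 0" if "i < length ?v" for i
      proof (rule zero)
        show "cyc_reduced ((concat (take j vs) @ take i ?v) @ drop i ?v @ concat (drop (Suc j) vs))"
          using vs(2) dec by (metis append.assoc append_take_drop_id)
        have "i \<le> k" using that unfolding 2(2) by simp
        then have "drop i ?v = e # replicate (k - i) e" unfolding 2(2) drop_replicate by (simp add: Suc_diff_le)
        then show "drop i ?v @ concat (drop (Suc j) vs) \<noteq> []" "\<not> is_coef (hd (drop i ?v @ concat (drop (Suc j) vs)))"
          using 2(1) by auto
      qed
      have "phi (x @ concat (rotate j vs)) = 0"
        using z[of 0] blk_props(1)[OF b] by (simp add: rot)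
      then show ?thesis using z by (simp add: split_sum_def)
    qed
  qed simp
  finally show ?thesis .
qed

lemma list_all2_rotate1: "list_all2 P xs ys \<Longrightarrow> list_all2 P (rotate1 xs) (rotate1 ys)"
  by (cases xs; cases ys) (auto intro: list_all2_appendI)

lemma list_all2_rotate: "list_all2 P xs ys \<Longrightarrow> list_all2 P (rotate r xs) (rotate r ys)"
  by (induction r) (auto simp: list_all2_rotate1)

lemma list_all2_last: "list_all2 P xs ys \<Longrightarrow> ys \<noteq> [] \<Longrightarrow> P (last xs) (last ys)"
  by (induction rule: list_all2_induct) auto

lemma gen_lt: "gen j x \<Longrightarrow> j < 2"
  by (simp add: gen_def)

lemma nested_gen:
  assumes "list_all2 gen js xs" "successively (\<noteq>) js" "list_all2 gen ks ys" "successively (\<noteq>) ks"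
  shows "\<Phi> (prod_list (rev xs) * prod_list ys) = R.nested xs ys"
proof -
  define B where "B j = [alg_a, alg_o] ! j" for j :: nat
  have *: "list_all2 gen js as \<longleftrightarrow> list_all2 (\<lambda>j x. x \<in> B j \<and> \<Phi> x = 0) js as \<and> set js \<subseteq> {..<2}" for js as
    by (induction js arbitrary: as) (auto simp: gen_def B_def list_all2_Cons1)
  show ?thesis
  proof (rule R.nested_freeness[where J = "{..<2}" and B = B and js = js and ks = ks])
    show "unital_subalgebra nc_smul (B j)" if "j \<in> {..<2}" for j
      using that unital_alg by (auto simp: B_def less_2_cases_iff)
    show "\<Phi> (prod_list as) = 0" if "list_all2 (\<lambda>j x. x \<in> B j \<and> \<Phi> x = 0) js as" "set js \<subseteq> {..<2}"
      "successively (\<noteq>) js" "js \<noteq> []" for js as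
      by (rule freeness[OF _ that(3,4)]) (use that * in auto)
  qed (use assms * in auto)
qed

text \<open>A single coefficient clashes cyclically with itself and is therefore excluded; a single
  orthogonal block is a power of one letter and does not clash.\<close>

lemma cyc_reduced_concat:
  assumes "list_all2 blk js ws" "cyc_alt js" "length js \<ge> 2 \<or> js = [1]"
  shows "cyc_reduced (concat ws)"
proof -
  have ne: "ws \<noteq> []" "js \<noteq> []" using assms by (auto simp: cyc_alt_def)
  have len: "length ws = length js" using assms(1) by (simp add: list_all2_lengthD)
  have h: "blk (hd js) (hd ws)" using assms(1) ne by (cases js; cases ws) auto
  have l: "blk (last js) (last ws)" by (rule list_all2_last[OF assms(1) ne(1)])
  have hl: "hd (concat ws) = hd (hd ws)" "last (concat ws) = last (last ws)" "concat ws \<noteq> []"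
    using ne blk_props(1)[OF h] blk_props(1)[OF l] by (auto simp: hd_concat' last_concat' intro: hd_in_set)
  have "\<not> clash (last (last ws)) (hd (hd ws))"
  proof (cases "length js \<ge> 2")
    case True
    then show ?thesis using blk_no_clash[OF l h] assms(2) by (auto simp: cyc_alt_def)
  next
    case False
    then have "js = [1]" using assms by auto
    with assms(1) obtain w where w: "ws = [w]" "blk 1 w" by (auto simp: list_all2_Cons1)
    then obtain k e where "e \<in> {Orth, OrthT}" "w = replicate (Suc k) e" by (auto simp: blk_def simp del: replicate.simps)
    moreover have "last (replicate (Suc k) e) = e" by (induction k) auto
    ultimately show ?thesis using w by auto
  qed
  moreover have "reduced (concat ws)" using reduced_concat assms by (auto simp: cyc_alt_def)
  ultimately show ?thesis using hl by (simp add: cyc_reduced_def)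
qed

lemma map_word_poly_owt: "map word_poly (rev (map owt ws)) = rev (map nc_transpose (map word_poly (ws :: 'i oword list)))"
  by (simp add: rev_map word_poly_owt)

lemma owt_concat: "owt (concat ws) = concat (rev (map owt ws))"
  by (induction ws) auto

text \<open>The first word has to begin with \<open>Orth\<close> for the loop equation, and to end
  in a coefficient for the reduction from letter rotations to block rotations.\<close>

lemma \<Phi>2_nested:
  assumes ws: "list_all2 blk js ws" "cyc_alt js" "length js \<ge> 2" "concat ws = Orth # V" "last js = 0"
    and vs: "list_all2 blk ks vs" "cyc_alt ks"
  defines "as \<equiv> map word_poly ws" and "bs \<equiv> map word_poly vs"
  shows "\<Phi>2 (prod_list as) (prod_list bs) =
    (\<Sum>j<length bs. R.nested (rev as) (rotate j bs)) + (\<Sum>j<length bs. R.nested (rev as) (rotate j (rev (map nc_transpose bs))))"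
proof -
  have cx: "cyc_reduced (Orth # V)" using cyc_reduced_concat[OF ws(1,2)] ws(3,4) by simp
  have wne: "ws \<noteq> []" using ws(4) by auto
  have las: "length as = length js" "length bs = length ks"
    using ws(1) vs(1) by (auto simp: as_def bs_def dest: list_all2_lengthD)
  have lb: "blk (last js) (last ws)" by (rule list_all2_last[OF ws(1) wne])
  have lx: "is_coef (last (Orth # V))"
    using ws(4) last_concat'[OF wne] blk_props[OF lb] ws(5) by simp
  have \<Phi>2: "\<Phi>2 (prod_list as) (prod_list bs) = cc {#Orth # V, concat vs#}"
    unfolding as_def bs_def word_poly_concat[symmetric] \<Phi>2_word ws(4) ..
  show ?thesis
  proof (cases "ks = [0]")
    \<comment> \<open>A single coefficient is not cyclically reduced. The left side is 0 because it
      cannot be cut, the right side because the lengths differ.\<close>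
    case True
    then obtain q where q: "vs = [[Coef q]]" using vs(1) by (auto simp: list_all2_Cons1 blk_def)
    have "R.nested (rev as) (rotate j (ys :: ('i + unit) ncpoly list)) = 0" if "length ys = 1" for j ys
      by (rule R.nested_length) (use las ws(3) that in auto)
    then show ?thesis using \<Phi>2 cc_Coef_right[OF cx, of q] q by (simp add: bs_def)
  next
    case False
    have "length ks \<ge> 2 \<or> ks = [1]"
    proof (cases ks)
      case (Cons k ks')
      then obtain v where "blk k v" using vs(1) by (auto simp: list_all2_Cons1)
      then have "k < 2" by (rule blk_props)
      then show ?thesis using False Cons by (cases ks') auto
    qed (use vs in \<open>simp add: cyc_alt_def\<close>)
    then have cp: "cyc_reduced (concat vs)" using cyc_reduced_concat[OF vs] by simp
    have vs': "list_all2 blk (rev ks) (rev (map owt vs))"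
      using vs(1) blk_props(6) by (auto simp: list_all2_map2 elim!: list.rel_mono_strong)
    have cp': "cyc_reduced (concat (rev (map owt vs)))"
      using cyc_reduced_owt[OF cp] by (simp add: owt_concat)
    have rx: "reduced (Orth # V)" using cx by (simp add: cyc_reduced_def)
    have N: "phi ((Orth # V) @ concat (rotate j us)) = R.nested (rev as) (rotate j (map word_poly us))"
      if "list_all2 blk ls us" "cyc_alt ls" for us ls j
    proof -
      have g: "list_all2 gen (rotate j ls) (rotate j (map word_poly us))"
        by (intro list_all2_rotate) (use that bas_gen in \<open>auto simp: list_all2_map2 bas_def elim!: list.rel_mono_strong\<close>)
      have a: "list_all2 gen (rev js) (rev as)"
        using ws(1) bas_gen by (auto simp: as_def list_all2_map2 bas_def elim!: list.rel_mono_strong)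
      have "\<Phi> (prod_list (rev (rev as)) * prod_list (rotate j (map word_poly us))) = R.nested (rev as) (rotate j (map word_poly us))"
      proof (rule nested_gen[OF a _ g])
        show "successively (\<noteq>) (rev js)" using ws(2) by (simp only: successively_neq_rev cyc_alt_def)
        show "successively (\<noteq>) (rotate j ls)" using cyc_alt_rotate[OF that(2)] by (simp add: cyc_alt_def)
      qed
      moreover have "prod_list (rev (rev as)) * prod_list (rotate j (map word_poly us)) = word_poly ((Orth # V) @ concat (rotate j us))"
        unfolding word_poly_simps(3) ws(4)[symmetric] word_poly_concat as_def by (simp add: rotate_map)
      ultimately show ?thesis unfolding \<Phi>_word[symmetric] by metis
    qed
    have "\<Phi>2 (prod_list as) (prod_list bs) =
      (\<Sum>k<length (concat vs). phi ((Orth # V) @ rotate k (concat vs))) + (\<Sum>k<length (concat vs). phi ((Orth # V) @ rotate k (owt (concat vs))))"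
      unfolding \<Phi>2 using cc_cyc_reduced[OF cx cp] by simp
    also have "(\<Sum>k<length (concat vs). phi ((Orth # V) @ rotate k (concat vs))) = (\<Sum>j<length vs. phi ((Orth # V) @ concat (rotate j vs)))"
      by (rule block_rotations[OF rx _ lx vs(1) cp]) simp
    also have "(\<Sum>k<length (concat vs). phi ((Orth # V) @ rotate k (owt (concat vs)))) = (\<Sum>j<length (rev (map owt vs)). phi ((Orth # V) @ concat (rotate j (rev (map owt vs)))))"
      using block_rotations[OF rx _ lx vs' cp'] by (simp only: owt_concat[symmetric] length_owt list.distinct simp_thms)
    finally show ?thesis
      using N[OF vs] N[OF vs' cyc_alt_rev[OF vs(2)]] by (simp add: bs_def map_word_poly_owt del: map_map)
  qed
qed

lemma t_prod_list: "nc_transpose (prod_list xs) = prod_list (rev (map nc_transpose (xs :: ('i + unit) ncpoly list)))"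
  by (induction xs) (simp_all add: R.t_one R.t_mult)

lemma \<Phi>2_rotate: "\<Phi>2 (prod_list (rotate r as)) b = \<Phi>2 (prod_list as) b"
proof -
  have "\<Phi>2 (prod_list (rotate r as)) b = \<Phi>2 (prod_list (take (r mod length as) as) * prod_list (drop (r mod length as) as)) b"
    by (simp add: rotate_drop_take R.\<phi>2_trace_left)
  also have "prod_list (take (r mod length as) as) * prod_list (drop (r mod length as) as) = prod_list as"
    unfolding prod_list.append[symmetric] by simp
  finally show ?thesis .
qed

definition target :: "('i + unit) ncpoly list \<Rightarrow> ('i + unit) ncpoly list \<Rightarrow> complex" where
  "target as bs = (if length as = length bs then spokes \<Phi> nc_transpose as bs else 0)"

lemma \<Phi>2_target_Orth:
  assumes ws: "list_all2 blk js ws" "cyc_alt js" "length js \<ge> 2" "concat ws = Orth # V" "last js = 0"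
    and vs: "list_all2 blk ks vs" "cyc_alt ks"
  shows "\<Phi>2 (prod_list (map word_poly ws)) (prod_list (map word_poly vs)) = target (map word_poly ws) (map word_poly vs)"
proof (cases "length ws = length vs")
  case True
  then show ?thesis unfolding \<Phi>2_nested[OF assms] target_def by (subst R.nested_rotations) auto
next
  case False
  then show ?thesis unfolding \<Phi>2_nested[OF assms] target_def by (simp add: R.nested_length)
qed

text \<open>With two labels alternating, one of the first two blocks is orthogonal; rotate it to the
  front, and transpose if it is a power of \<open>OrthT\<close>. Both sides are invariant under
  these moves. The last block is then a coefficient, by cyclic alternation.\<close>

lemma \<Phi>2_target_basis:
  assumes as: "list_all2 bas js as" "cyc_alt js" "length js \<ge> 2"
    and bs: "list_all2 bas ks bs" "cyc_alt ks"
  shows "\<Phi>2 (prod_list as) (prod_list bs) = target as bs"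
proof -
  obtain vs where vs: "list_all2 blk ks vs" "bs = map word_poly vs" using list_all2_bas[OF bs(1)] by blast
  have len: "length as = length js" using as(1) by (simp add: list_all2_lengthD)
  have inv: "target (rotate r xs) bs = target xs bs" "target (rev (map nc_transpose xs)) bs = target xs bs" for r xs
    by (auto simp: target_def R.spokes_rotate R.spokes_transpose)
  have "\<exists>r<length js. js ! r = 1"
  proof -
    have lt: "js ! i < 2" if "i < length js" for i
      using list_all2_nthD[OF as(1) that] bas_gen gen_lt by blast
    have "js ! 0 < 2" "js ! 1 < 2" by (rule lt; use as(3) in linarith)+
    moreover have "js ! 0 \<noteq> js ! 1" using as(2,3) by (auto simp: cyc_alt_def successively_conv_nth)
    ultimately have "js ! 0 = 1 \<or> js ! 1 = 1" by linarith
    then show ?thesis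
    proof
      assume "js ! 0 = 1"
      then show ?thesis using as(3) by (intro exI[of _ 0]) auto
    next
      assume "js ! 1 = 1"
      then show ?thesis using as(3) by (intro exI[of _ 1]) auto
    qed
  qed
  then obtain r where r: "r < length js" "js ! r = 1" by blast
  define js1 where "js1 = rotate r js"
  define as1 where "as1 = rotate r as"
  have 1: "list_all2 bas js1 as1" "cyc_alt js1" "length js1 \<ge> 2" "hd js1 = 1"
    using as r by (auto simp: js1_def as1_def list_all2_rotate cyc_alt_rotate hd_rotate)
  have core: "\<Phi>2 (prod_list xs) (prod_list bs) = target xs bs"
    if xs: "list_all2 blk ls ws" "cyc_alt ls" "length ls \<ge> 2" "hd ls = 1" "hd (hd ws) = Orth" "xs = map word_poly ws" for xs ls ws
  proof -
    have ne: "ls \<noteq> []" "ws \<noteq> []" using xs(1,3) by auto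
    have "blk (hd ls) (hd ws)" using xs(1) ne by (cases ls; cases ws) auto
    then have "hd ws \<noteq> []" using blk_props by blast
    then have "concat ws \<noteq> []" "hd (concat ws) = Orth" using ne hd_concat'[of ws] xs(5) by (cases ws; simp)+
    then obtain V where V: "concat ws = Orth # V" by (cases "concat ws") auto
    have "blk (last ls) (last ws)" by (rule list_all2_last[OF xs(1) ne(2)])
    then have "last ls < 2" using blk_props by blast
    moreover have "last ls \<noteq> 1" using xs(2,3,4) by (auto simp: cyc_alt_def)
    ultimately have "last ls = 0" by linarith
    from \<Phi>2_target_Orth[OF xs(1-3) V this vs(1) bs(2)] show ?thesis using xs(6) vs(2) by simp
  qed
  obtain ws where ws: "list_all2 blk js1 ws" "as1 = map word_poly ws" using list_all2_bas[OF 1(1)] by blast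
  obtain w ws' js' where w: "ws = w # ws'" "js1 = 1 # js'" "blk 1 w"
    using ws(1) 1(3,4) by (cases js1; cases ws) auto
  from w(3) obtain k e where e: "e \<in> {Orth, OrthT}" "w = replicate (Suc k) e" by (auto simp: blk_def simp del: replicate.simps)
  have "\<Phi>2 (prod_list as1) (prod_list bs) = target as1 bs"
  proof (cases "e = Orth")
    case True
    show ?thesis by (rule core[OF ws(1) 1(2-4) _ ws(2)]) (use w e True in simp)
  next
    case False
    then have e': "e = OrthT" using e by simp
    \<comment> \<open>Transposition reverses the blocks and moves \<open>w\<close> to the end;
      rotating by \<open>length ws'\<close> brings it back to the front, now as a power of
      \<open>Orth\<close>.\<close>
    define us where "us = rotate (length ws') (rev (map owt ws))"
    define ls where "ls = rotate (length ws') (rev js1)"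
    have len: "length js' = length ws'" using ws(1) w by (auto dest: list_all2_lengthD)
    have us: "us = owt w # rev (map owt ws')"
      unfolding us_def w using rotate_append[of "rev (map owt ws')" "[owt w]"] by simp
    have ls: "ls = 1 # rev js'"
      unfolding ls_def w using rotate_append[of "rev js'" "[1]"] len by simp
    have A: "list_all2 blk ls us"
    proof -
      have "list_all2 blk js1 (map owt ws)" using ws(1) blk_props(6) by (auto simp: list_all2_map2 elim!: list.rel_mono_strong)
      then show ?thesis unfolding ls_def us_def by (intro list_all2_rotate) simp
    qed
    have B: "cyc_alt ls" unfolding ls_def by (intro cyc_alt_rotate cyc_alt_rev 1)
    have "owt w = replicate (Suc k) Orth" using e e' by (simp add: owt_def del: replicate.simps)
    then have D: "hd (hd us) = Orth" by (simp add: us)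
    have "\<Phi>2 (prod_list (map word_poly us)) (prod_list bs) = target (map word_poly us) bs"
      by (rule core[OF A B _ _ D refl]) (use ls 1 in \<open>auto simp: w\<close>)
    moreover have "map word_poly us = rotate (length ws') (rev (map nc_transpose as1))"
      unfolding us_def rotate_map[symmetric] map_word_poly_owt ws(2) ..
    ultimately show ?thesis
      by (simp only: inv \<Phi>2_rotate t_prod_list[symmetric] R.\<phi>2_t_left)
  qed
  then show ?thesis unfolding as1_def by (simp only: inv \<Phi>2_rotate)
qed

lemma target_sym: "target as bs = target bs as"
  by (simp add: target_def R.spokes_sym)

lemma slot_diff_target: "R.slot (\<lambda>z. \<Phi>2 (prod_list (xs @ z # ys)) b - target (xs @ z # ys) bs)"
proof (cases "length (xs @ 0 # ys) = length bs")
  case True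
  then have "(\<lambda>z. \<Phi>2 (prod_list (xs @ z # ys)) b - target (xs @ z # ys) bs) =
    (\<lambda>z. \<Phi>2 (prod_list (xs @ z # ys)) b - spokes \<Phi> nc_transpose (xs @ z # ys) bs)"
    by (simp add: target_def)
  then show ?thesis by (simp only:) (intro R.slot_diff R.slot_prod_list R.slot_spokes)
next
  case False
  then have "(\<lambda>z. \<Phi>2 (prod_list (xs @ z # ys)) b - target (xs @ z # ys) bs) =
    (\<lambda>z. \<Phi>2 (prod_list (xs @ z # ys)) b)"
    by (simp add: target_def)
  then show ?thesis by (simp only: R.slot_prod_list)
qed

text \<open>The basis case needs a first tuple of length at least 2; symmetry of both sides covers a
  long second tuple. The same symmetry carries the multilinear extension, which acts on the first
  entry, over to the second.\<close>

theorem second_order_freeness: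
  assumes as: "list_all2 gen js as" "cyc_alt js" and bs: "list_all2 gen ks bs" "cyc_alt ks"
    and len: "length js \<ge> 2 \<or> length ks \<ge> 2"
  shows "\<Phi>2 (prod_list as) (prod_list bs) = target as bs"
proof -
  have base: "\<Phi>2 (prod_list xs) (prod_list ys) = target xs ys" if "list_all2 bas js xs" "list_all2 bas ks ys" for xs ys
    using len
  proof
    assume "length js \<ge> 2"
    then show ?thesis using \<Phi>2_target_basis that as(2) bs(2) by blast
  next
    assume "length ks \<ge> 2"
    then have "\<Phi>2 (prod_list ys) (prod_list xs) = target ys xs" using \<Phi>2_target_basis that as(2) bs(2) by blast
    then show ?thesis by (simp add: \<Phi>2_sym[of "prod_list xs"] target_sym[of xs])
  qed
  have 1: "\<Phi>2 (prod_list as) (prod_list ys) - target as ys = 0" if ys: "list_all2 bas ks ys" for ys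
  proof (rule R.multi_ext[where F = "\<lambda>as. \<Phi>2 (prod_list as) (prod_list ys) - target as ys" and bas = bas and gen = gen and js = js])
    show "\<Phi>2 (prod_list xs) (prod_list ys) - target xs ys = 0" if "list_all2 bas js xs" for xs
      using base[OF that ys] by simp
  qed (use as(1) gen_ext slot_diff_target in blast)+
  have "\<Phi>2 (prod_list bs) (prod_list as) - target bs as = 0"
  proof (rule R.multi_ext[where F = "\<lambda>bs. \<Phi>2 (prod_list bs) (prod_list as) - target bs as" and bas = bas and gen = gen and js = ks])
    show "\<Phi>2 (prod_list ys) (prod_list as) - target ys as = 0" if "list_all2 bas ks ys" for ys
      using 1[OF that] by (simp add: \<Phi>2_sym[of "prod_list ys"] target_sym[of ys])
  qed (use bs(1) gen_ext slot_diff_target in blast)+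
  then show ?thesis by (simp add: \<Phi>2_sym[of "prod_list as"] target_sym[of as])
qed

text \<open>A coefficient offers no place to cut, so it has no gluing term with a power of the
  orthogonal matrix.\<close>

lemma \<Phi>2_different:
  assumes "x \<in> alg_a" "y \<in> alg_o" "\<Phi> x = 0" "\<Phi> y = 0"
  shows "\<Phi>2 x y = 0"
proof -
  from alg_a_elem[OF assms(1)] obtain q where q: "x = word_poly [Coef q]" .
  have "\<Phi>2 y x = 0"
  proof (rule gen_ext[where j = 1 and G = "\<lambda>z. \<Phi>2 z x"])
    show "gen 1 y" using assms by (simp add: gen_def)
    show "R.slot (\<lambda>z. \<Phi>2 z x)" using R.slot_\<phi>2[of 1 1 x] by simp
    fix b assume "bas 1 b"
    then obtain k e where b: "e \<in> {Orth, OrthT}" "b = word_poly (replicate (Suc k) e)"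
      by (auto simp: bas_def blk_def simp del: replicate.simps)
    have c: "cyc_reduced (replicate (Suc k) Orth)"
      using cyc_reduced_concat[of "[1]" "[replicate (Suc k) Orth]"] by (auto simp: blk_def cyc_alt_def simp del: replicate.simps)
    then have z: "cc {#replicate (Suc k) Orth, [Coef q]#} = 0" using cc_Coef_right[of "replicate k Orth" q] by simp
    have "owt (replicate (Suc k) OrthT) = replicate (Suc k) (Orth :: 'i oletter)" by (simp add: owt_def del: replicate.simps)
    then have "cc {#replicate (Suc k) OrthT, [Coef q]#} = 0"
      using cc_teq[OF teq_transp[of "replicate (Suc k) OrthT"], of "{#[Coef q]#}"] z by (simp only:)
    with z b show "\<Phi>2 b x = 0" by (auto simp: q \<Phi>2_word simp del: replicate.simps word_poly_simps)
  qed
  then show ?thesis using \<Phi>2_sym by simp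
qed

lemma in_subalgebras_gen:
  assumes "in_subalgebras [alg_a, alg_o] js as" "centred \<Phi> as"
  shows "list_all2 gen js as"
  using assms unfolding in_subalgebras_def centred_def list_all2_conv_all_nth gen_def by auto

theorem real_free: "real_free_second_order nc_smul \<Phi> \<Phi>2 nc_transpose [alg_a, alg_o]"
  unfolding real_free_second_order_def
proof (intro conjI)
  show "\<forall>B\<in>set [alg_a, alg_o]. unital_subalgebra nc_smul B \<and> nc_transpose ` B \<subseteq> B"
  proof -
    have "nc_transpose ` alg_a \<subseteq> alg_a" "nc_transpose ` alg_o \<subseteq> alg_o"
      unfolding alg_a_def alg_o_def by (rule R.generated_subalgebra_transpose)+
    then show ?thesis using unital_alg by simp
  qed
  show "free_family \<Phi> [alg_a, alg_o]"
    unfolding free_family_def alternating_def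
  proof (intro allI impI, elim conjE exE)
    fix as js assume *: "centred \<Phi> as" "as \<noteq> []" "in_subalgebras [alg_a, alg_o] js as" "\<forall>i. Suc i < length as \<longrightarrow> js ! i \<noteq> js ! Suc i"
    have l: "length js = length as" using *(3) by (simp add: in_subalgebras_def)
    show "\<Phi> (prod_list as) = 0"
      by (rule freeness[OF in_subalgebras_gen[OF *(3,1)]]) (use * l in \<open>auto simp: successively_conv_nth\<close>)
  qed
  show "\<forall>as bs. cyclically_alternating [alg_a, alg_o] as \<and> centred \<Phi> as \<and>
      cyclically_alternating [alg_a, alg_o] bs \<and> centred \<Phi> bs \<longrightarrow>
        (length as \<noteq> length bs \<longrightarrow> \<Phi>2 (prod_list as) (prod_list bs) = 0) \<and>
        (length as = length bs \<and> length as > 1 \<longrightarrow>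
          \<Phi>2 (prod_list as) (prod_list bs) =
            (\<Sum>k<length as.
              (\<Prod>i<length as. \<Phi> (as ! i * cyc_nth bs (int k - int i))) +
              (\<Prod>i<length as. \<Phi> (as ! i * nc_transpose (cyc_nth bs (int i - int k))))))"
    unfolding cyclically_alternating_def
  proof (intro allI impI, elim conjE exE)
    fix as bs js ks
    assume *: "centred \<Phi> as" "centred \<Phi> bs" "as \<noteq> []" "bs \<noteq> []" "in_subalgebras [alg_a, alg_o] js as"
      "in_subalgebras [alg_a, alg_o] ks bs"
      "2 \<le> length as \<longrightarrow> (\<forall>k<length as. js ! k \<noteq> js ! (Suc k mod length as))"
      "2 \<le> length bs \<longrightarrow> (\<forall>k<length bs. ks ! k \<noteq> ks ! (Suc k mod length bs))"
    have l: "length js = length as" "length ks = length bs" using *(5,6) by (simp_all add: in_subalgebras_def)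
    have c: "cyc_alt js" "cyc_alt ks" using * l by (auto intro!: cyc_altI)
    have "\<Phi>2 (prod_list as) (prod_list bs) = target as bs" if "length as \<ge> 2 \<or> length bs \<ge> 2"
      by (rule second_order_freeness[OF in_subalgebras_gen[OF *(5,1)] c(1) in_subalgebras_gen[OF *(6,2)] c(2)])
        (use that l in auto)
    moreover have "length as \<ge> 1" "length bs \<ge> 1" using *(3,4) by (simp_all add: Suc_le_eq)
    ultimately show "(length as \<noteq> length bs \<longrightarrow> \<Phi>2 (prod_list as) (prod_list bs) = 0) \<and>
        (length as = length bs \<and> length as > 1 \<longrightarrow>
          \<Phi>2 (prod_list as) (prod_list bs) =
            (\<Sum>k<length as.
              (\<Prod>i<length as. \<Phi> (as ! i * cyc_nth bs (int k - int i))) +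
              (\<Prod>i<length as. \<Phi> (as ! i * nc_transpose (cyc_nth bs (int i - int k))))))"
      unfolding target_def spokes_def by fastforce
  qed
  show "\<forall>i<length [alg_a, alg_o]. \<forall>j<length [alg_a, alg_o]. i \<noteq> j \<longrightarrow>
      (\<forall>x\<in>[alg_a, alg_o] ! i. \<forall>y\<in>[alg_a, alg_o] ! j. \<Phi> x = 0 \<and> \<Phi> y = 0 \<longrightarrow> \<Phi>2 x y = 0)"
    using \<Phi>2_different \<Phi>2_sym by (auto simp: less_Suc_eq) metis+
qed

end

section \<open>Differentiating words along rotations\<close>

text \<open>Entry functions instead of matrices: dependence on the angle, measurability and
  integrability can then be treated entry by entry.\<close>

fun lval :: "(nat \<Rightarrow> nat \<Rightarrow> real) \<Rightarrow> ('i ncpoly \<Rightarrow> nat \<Rightarrow> nat \<Rightarrow> complex) \<Rightarrow> 'i oletter \<Rightarrow> nat \<Rightarrow> nat \<Rightarrow> complex" where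
  "lval q D Orth i j = of_real (q i j)"
| "lval q D OrthT i j = of_real (q j i)"
| "lval q D (Coef p) i j = D p i j"

fun wval :: "nat \<Rightarrow> (nat \<Rightarrow> nat \<Rightarrow> real) \<Rightarrow> ('i ncpoly \<Rightarrow> nat \<Rightarrow> nat \<Rightarrow> complex) \<Rightarrow> 'i oword \<Rightarrow> nat \<Rightarrow> nat \<Rightarrow> complex" where
  "wval d q D [] i j = (if i = j then 1 else 0)"
| "wval d q D (l # w) i j = (\<Sum>k<d. lval q D l i k * wval d q D w k j)"

definition wtr :: "nat \<Rightarrow> (nat \<Rightarrow> nat \<Rightarrow> real) \<Rightarrow> ('i ncpoly \<Rightarrow> nat \<Rightarrow> nat \<Rightarrow> complex) \<Rightarrow> 'i oword \<Rightarrow> complex" where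
  "wtr d q D w = (\<Sum>i<d. wval d q D w i i)"

text \<open>The entry \<open>(i, j)\<close> of the matrix product
  \<open>X (E_ab - E_ba) Y\<close>.\<close>

definition dterm :: "(nat \<Rightarrow> nat \<Rightarrow> complex) \<Rightarrow> (nat \<Rightarrow> nat \<Rightarrow> complex) \<Rightarrow> nat \<Rightarrow> nat \<Rightarrow> nat \<Rightarrow> nat \<Rightarrow> complex" where
  "dterm X Y a b i j = X i a * Y b j - X i b * Y a j"

text \<open>By the product rule, the derivative at angle 0 of an entry of \<open>w\<close> when the
  orthogonal matrix is rotated in the plane of \<open>a\<close> and \<open>b\<close>.\<close>

definition dval :: "nat \<Rightarrow> (nat \<Rightarrow> nat \<Rightarrow> real) \<Rightarrow> ('i ncpoly \<Rightarrow> nat \<Rightarrow> nat \<Rightarrow> complex) \<Rightarrow> nat \<Rightarrow> nat \<Rightarrow> 'i oword \<Rightarrow> nat \<Rightarrow> nat \<Rightarrow> complex" where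
  "dval d q D a b w i j = (\<Sum>(s, L, R)\<leftarrow>cuts w. s * dterm (wval d q D L) (wval d q D R) a b i j)"

lemma sum_sum_list: "(\<Sum>i\<in>I. \<Sum>x\<leftarrow>xs. f i x) = (\<Sum>x\<leftarrow>xs. \<Sum>i\<in>I. (f i x :: complex))"
  by (induction xs) (simp_all add: sum.distrib)

lemma wval_append:
  "i < d \<Longrightarrow> wval d q D (u @ v) i j = (\<Sum>k<d. wval d q D u i k * wval d q D v k j)"
proof (induction u arbitrary: i)
  case Nil
  have "(\<Sum>k<d. (if i = k then 1 else 0) * wval d q D v k j) = (\<Sum>k<d. if i = k then wval d q D v k j else 0)"
    by (intro sum.cong) auto
  then show ?case using Nil by simp
next
  case (Cons l u)
  have "wval d q D ((l # u) @ v) i j = (\<Sum>k<d. lval q D l i k * (\<Sum>m<d. wval d q D u k m * wval d q D v m j))"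
    using Cons.IH by simp
  also have "\<dots> = (\<Sum>k<d. \<Sum>m<d. lval q D l i k * wval d q D u k m * wval d q D v m j)"
    by (simp add: sum_distrib_left mult.assoc)
  also have "\<dots> = (\<Sum>m<d. \<Sum>k<d. lval q D l i k * wval d q D u k m * wval d q D v m j)"
    by (rule sum.swap)
  also have "\<dots> = (\<Sum>m<d. wval d q D (l # u) i m * wval d q D v m j)"
    by (simp add: sum_distrib_right)
  finally show ?case .
qed

lemma wtr_rot: "wtr d q D (u @ v) = wtr d q D (v @ u)"
proof -
  have "wtr d q D (u @ v) = (\<Sum>i<d. \<Sum>k<d. wval d q D u i k * wval d q D v k i)"
    by (simp add: wtr_def wval_append)
  also have "\<dots> = (\<Sum>k<d. \<Sum>i<d. wval d q D u i k * wval d q D v k i)" by (rule sum.swap)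
  also have "\<dots> = wtr d q D (v @ u)" by (simp add: wtr_def wval_append mult.commute)
  finally show ?thesis .
qed

lemma wval_single: "k < d \<Longrightarrow> wval d q D [l] i k = lval q D l i k"
proof -
  assume "k < d"
  have "wval d q D [l] i k = (\<Sum>m<d. if m = k then lval q D l i m else 0)"
    by (simp add: if_distrib cong: if_cong)
  with \<open>k < d\<close> show ?thesis by simp
qed

locale word_values =
  fixes d :: nat and q :: "nat \<Rightarrow> nat \<Rightarrow> real" and D :: "'i ncpoly \<Rightarrow> nat \<Rightarrow> nat \<Rightarrow> complex"
  assumes q_left: "i < d \<Longrightarrow> j < d \<Longrightarrow> (\<Sum>k<d. q k i * q k j) = (if i = j then 1 else 0)"
    and q_right: "i < d \<Longrightarrow> j < d \<Longrightarrow> (\<Sum>k<d. q i k * q j k) = (if i = j then 1 else 0)"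
    and D_transpose: "i < d \<Longrightarrow> j < d \<Longrightarrow> D (nc_transpose p) i j = D p j i"
    and D_mult: "i < d \<Longrightarrow> j < d \<Longrightarrow> D (p * r) i j = (\<Sum>k<d. D p i k * D r k j)"
    and D_affine: "i < d \<Longrightarrow> j < d \<Longrightarrow> D (p + Poly_Mapping.single 0 c) i j = D p i j + (if i = j then c else 0)"
begin

abbreviation "V \<equiv> wval d q D"
abbreviation "T \<equiv> wtr d q D"

lemma wval_owt: "i < d \<Longrightarrow> j < d \<Longrightarrow> V (owt w) i j = V w j i"
proof (induction w arbitrary: i j)
  case (Cons l w)
  have l: "lval q D (olt l) i j = lval q D l j i" if "i < d" "j < d" for i j
    using that by (cases l) (simp_all add: D_transpose)
  have "V (owt (l # w)) i j = (\<Sum>k<d. V (owt w) i k * V [olt l] k j)"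
    unfolding owt_Cons by (rule wval_append[OF Cons.prems(1)])
  also have "\<dots> = (\<Sum>k<d. V w k i * lval q D l j k)"
    using Cons by (intro sum.cong) (simp_all add: wval_single l del: wval.simps)
  finally show ?case by (simp add: mult.commute)
qed (simp add: eq_commute)

lemma wtr_owt: "T (owt w) = T w"
  by (simp add: wtr_def wval_owt)

lemma complex_q:
  "i < d \<Longrightarrow> j < d \<Longrightarrow> (\<Sum>k<d. complex_of_real (q k i) * of_real (q k j)) = (if i = j then 1 else 0)"
  "i < d \<Longrightarrow> j < d \<Longrightarrow> (\<Sum>k<d. complex_of_real (q i k) * of_real (q j k)) = (if i = j then 1 else 0)"
  using q_left[of i j] q_right[of i j] by (simp_all flip: of_real_mult of_real_sum)

lemma wval_cancel:
  assumes "i < d"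
  shows "V (Orth # OrthT # w) i j = V w i j" "V (OrthT # Orth # w) i j = V w i j"
    "V (Coef p # Coef r # w) i j = V (Coef (p * r) # w) i j"
proof -
  have *: "V (a # b # w) i j = (\<Sum>m<d. (\<Sum>k<d. lval q D a i k * lval q D b k m) * V w m j)" for a b
  proof -
    have "V (a # b # w) i j = (\<Sum>k<d. \<Sum>m<d. lval q D a i k * lval q D b k m * V w m j)"
      by (simp add: sum_distrib_left mult.assoc)
    also have "\<dots> = (\<Sum>m<d. \<Sum>k<d. lval q D a i k * lval q D b k m * V w m j)" by (rule sum.swap)
    finally show ?thesis by (simp add: sum_distrib_right)
  qed
  have 1: "(\<Sum>m<d. (if i = m then 1 else 0) * V w m j) = V w i j"
    using wval_append[OF assms, of q D "[]" w j] by simp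
  have "(\<Sum>m<d. (\<Sum>k<d. lval q D Orth i k * lval q D OrthT k m) * V w m j) = (\<Sum>m<d. (if i = m then 1 else 0) * V w m j)"
    using assms by (intro sum.cong refl arg_cong2[where f = "(*)"]) (simp add: complex_q)
  then show "V (Orth # OrthT # w) i j = V w i j" unfolding * 1 .
  have "(\<Sum>m<d. (\<Sum>k<d. lval q D OrthT i k * lval q D Orth k m) * V w m j) = (\<Sum>m<d. (if i = m then 1 else 0) * V w m j)"
    using assms by (intro sum.cong refl arg_cong2[where f = "(*)"]) (simp add: complex_q)
  then show "V (OrthT # Orth # w) i j = V w i j" unfolding * 1 .
  show "V (Coef p # Coef r # w) i j = V (Coef (p * r) # w) i j"
    unfolding * using assms by (simp add: D_mult)
qed

lemma teq_wtr: "teq u v \<Longrightarrow> T u = T v"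
proof (induction rule: teq.induct)
  case (teq_rot u v)
  show ?case by (rule wtr_rot)
next
  case (teq_transp w)
  show ?case by (rule wtr_owt[symmetric])
qed (simp_all add: wtr_def wval_cancel del: wval.simps)

lemma wtr_affine: "T (Coef (p + Poly_Mapping.single 0 c) # w) = T (Coef p # w) + c * T w"
proof -
  have "V (Coef (p + Poly_Mapping.single 0 c) # w) i j = V (Coef p # w) i j + c * V w i j" if "i < d" for i j
  proof -
    have "V (Coef (p + Poly_Mapping.single 0 c) # w) i j = (\<Sum>k<d. D p i k * V w k j + (if i = k then c * V w k j else 0))"
      using that by (auto simp: D_affine distrib_right intro!: sum.cong)
    then show ?thesis using that by (simp add: sum.distrib)
  qed
  then show ?thesis by (simp add: wtr_def sum.distrib sum_distrib_left del: wval.simps)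
qed

text \<open>Taking the entry \<open>(b, a)\<close> of \<open>G\<close> makes the half
  \<open>E_ba\<close> of the generator split the trace, while \<open>E_ab\<close> pairs
  \<open>L\<close> with the transpose of \<open>R\<close>.\<close>

lemma contract_self:
  "(\<Sum>a<d. \<Sum>b<d. dval d q D a b G b a) = (\<Sum>(s, L, R)\<leftarrow>cuts G. s * (T (L @ owt R) - T L * T R))"
proof -
  have "(\<Sum>a<d. \<Sum>b<d. dval d q D a b G b a) =
    (\<Sum>(s, L, R)\<leftarrow>cuts G. s * (\<Sum>a<d. \<Sum>b<d. dterm (V L) (V R) a b b a))"
    by (simp add: dval_def sum_sum_list case_prod_unfold sum_distrib_left)
  also have "(\<lambda>L R. \<Sum>a<d. \<Sum>b<d. dterm (V L) (V R) a b b a) = (\<lambda>L R. T (L @ owt R) - T L * T R)"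
  proof (intro ext)
    fix L R
    have "(\<Sum>a<d. \<Sum>b<d. V L b a * V R b a) = (\<Sum>b<d. \<Sum>a<d. V L b a * V R b a)" by (rule sum.swap)
    also have "\<dots> = T (L @ owt R)" by (simp add: wtr_def wval_append wval_owt)
    finally have 1: "(\<Sum>a<d. \<Sum>b<d. V L b a * V R b a) = T (L @ owt R)" .
    have 2: "(\<Sum>a<d. \<Sum>b<d. V L b b * V R a a) = T L * T R"
      by (simp add: wtr_def sum_product) (rule sum.swap)
    show "(\<Sum>a<d. \<Sum>b<d. dterm (V L) (V R) a b b a) = T (L @ owt R) - T L * T R"
      unfolding dterm_def sum_subtractf 1 2 ..
  qed
  finally show ?thesis by (simp add: case_prod_unfold fun_eq_iff)
qed

text \<open>The half \<open>E_ab\<close> of the generator pairs \<open>G\<close> with the transpose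
  of \<open>R @ L\<close>, the half \<open>E_ba\<close> with \<open>R @ L\<close> itself.\<close>

lemma contract_other:
  "(\<Sum>a<d. \<Sum>b<d. V G b a * (\<Sum>i<d. dval d q D a b u i i)) =
    (\<Sum>(s, L, R)\<leftarrow>cuts u. s * (T (G @ owt (R @ L)) - T (G @ R @ L)))"
proof -
  have "(\<Sum>a<d. \<Sum>b<d. V G b a * (\<Sum>i<d. dval d q D a b u i i)) =
    (\<Sum>(s, L, R)\<leftarrow>cuts u. s * (\<Sum>a<d. \<Sum>b<d. V G b a * (\<Sum>i<d. dterm (V L) (V R) a b i i)))"
    by (simp add: dval_def sum_sum_list case_prod_unfold sum_distrib_left sum_list_const_mult[symmetric] mult.left_commute)
  also have "(\<lambda>L R. \<Sum>a<d. \<Sum>b<d. V G b a * (\<Sum>i<d. dterm (V L) (V R) a b i i)) = (\<lambda>L R. T (G @ owt (R @ L)) - T (G @ R @ L))"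
  proof (intro ext)
    fix L R
    have "(\<Sum>i<d. dterm (V L) (V R) a b i i) = V (R @ L) b a - V (R @ L) a b" if "a < d" "b < d" for a b
      using that by (simp add: dterm_def sum_subtractf wval_append mult.commute)
    then have "(\<Sum>a<d. \<Sum>b<d. V G b a * (\<Sum>i<d. dterm (V L) (V R) a b i i)) =
      (\<Sum>a<d. \<Sum>b<d. V G b a * V (R @ L) b a) - (\<Sum>a<d. \<Sum>b<d. V G b a * V (R @ L) a b)"
      by (simp add: right_diff_distrib sum_subtractf)
    also have "(\<Sum>a<d. \<Sum>b<d. V G b a * V (R @ L) b a) = (\<Sum>b<d. \<Sum>a<d. V G b a * V (R @ L) b a)" by (rule sum.swap)
    also have "\<dots> = T (G @ owt (R @ L))" by (simp add: wtr_def wval_append[of _ d q D G] wval_owt del: owt_append)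
    also have "(\<Sum>a<d. \<Sum>b<d. V G b a * V (R @ L) a b) = (\<Sum>b<d. \<Sum>a<d. V G b a * V (R @ L) a b)" by (rule sum.swap)
    also have "\<dots> = T (G @ R @ L)" by (simp add: wtr_def wval_append[of _ d q D G])
    finally show "(\<Sum>a<d. \<Sum>b<d. V G b a * (\<Sum>i<d. dterm (V L) (V R) a b i i)) = T (G @ owt (R @ L)) - T (G @ R @ L)" .
  qed
  finally show ?thesis by (simp add: case_prod_unfold fun_eq_iff)
qed

end

text \<open>The product rule at the first letter; it matches the recursion of \<open>wval\<close>,
  so that the derivative can be identified by induction on the word.\<close>

lemma dval_Cons:
  "dval d q D a b (l # w) i j =
    (case l of Orth \<Rightarrow> (if i = a then wval d q D (Orth # w) b j else 0) - (if i = b then wval d q D (Orth # w) a j else 0)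
      | OrthT \<Rightarrow> wval d q D [OrthT] i b * wval d q D w a j - wval d q D [OrthT] i a * wval d q D w b j
      | Coef p \<Rightarrow> 0) + (\<Sum>k<d. lval q D l i k * dval d q D a b w k j)"
proof -
  have "(\<Sum>x\<leftarrow>cuts w. case (case x of (s, L, R) \<Rightarrow> (s, l # L, R)) of (s, L, R) \<Rightarrow> s * dterm (wval d q D L) (wval d q D R) a b i j)
    = (\<Sum>k<d. lval q D l i k * dval d q D a b w k j)"
  proof -
    have "dterm (wval d q D (l # L)) Y a b i j = (\<Sum>k<d. lval q D l i k * dterm (wval d q D L) Y a b k j)" for L Y
      by (simp add: dterm_def sum_distrib_right sum_subtractf right_diff_distrib mult.assoc)
    then show ?thesis
      by (simp add: dval_def sum_sum_list case_prod_unfold sum_list_const_mult[symmetric] sum_distrib_left mult.left_commute del: wval.simps)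
  qed
  then show ?thesis
    by (cases l) (auto simp: dval_def dterm_def comp_def simp del: wval.simps(2))
qed

lemma norm3: "norm (a + b + c) \<le> norm a + norm b + norm (c :: complex)"
  using norm_triangle_ineq[of "a + b" c] norm_triangle_ineq[of a b] by linarith

section \<open>Random variables with all moments, and first order expansions under the
  integral\<close>

context prob_space
begin

text \<open>These variables form an algebra, so neither products of traces nor error constants ever
  leave it.\<close>

definition nice :: "('a \<Rightarrow> complex) \<Rightarrow> bool" where
  "nice f \<longleftrightarrow> f \<in> borel_measurable M \<and> (\<forall>n::nat. integrable M (\<lambda>x. norm (f x) ^ n))"

lemma nice_measurable: "nice f \<Longrightarrow> f \<in> borel_measurable M"
  by (simp add: nice_def)

lemma nice_integrable: "nice f \<Longrightarrow> integrable M f"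
proof -
  assume f: "nice f"
  then have "integrable M (\<lambda>x. norm (f x) ^ 1)" unfolding nice_def by blast
  then have "integrable M (\<lambda>x. norm (f x))" by simp
  then show ?thesis using f integrable_norm_iff[of f M] by (simp add: nice_def)
qed

lemma nice_const [simp]: "nice (\<lambda>_. c)"
  by (simp add: nice_def)

lemma nice_bound:
  assumes "f \<in> borel_measurable M" "\<And>n::nat. integrable M (g n)" "\<And>n x. x \<in> space M \<Longrightarrow> norm (f x) ^ n \<le> g n x"
  shows "nice f"
  unfolding nice_def
proof (intro conjI allI)
  show "integrable M (\<lambda>x. norm (f x) ^ n)" for n
    by (rule Bochner_Integration.integrable_bound[OF assms(2)[of n]])
      (use assms in \<open>auto intro!: AE_I2 order_trans[OF assms(3)]\<close>)
qed fact

lemma nice_add: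
  assumes "nice f" "nice g"
  shows "nice (\<lambda>x. f x + g x)"
proof (rule nice_bound)
  have "norm (f x + g x) ^ n \<le> 2 ^ n * (norm (f x) ^ n + norm (g x) ^ n)" for x and n :: nat
  proof -
    have "norm (f x + g x) \<le> 2 * max (norm (f x)) (norm (g x))"
      using norm_triangle_ineq[of "f x" "g x"] by simp
    then have "norm (f x + g x) ^ n \<le> (2 * max (norm (f x)) (norm (g x))) ^ n"
      by (intro power_mono) auto
    also have "\<dots> = 2 ^ n * max (norm (f x)) (norm (g x)) ^ n" by (simp add: power_mult_distrib)
    also have "max (norm (f x)) (norm (g x)) ^ n \<le> norm (f x) ^ n + norm (g x) ^ n"
      by (auto simp: max_def)
    finally show ?thesis by simp
  qed
  then show "\<And>n x. norm (f x + g x) ^ n \<le> 2 ^ n * (norm (f x) ^ n + norm (g x) ^ n)" .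
qed (use assms in \<open>auto simp: nice_def\<close>)

lemma nice_mult:
  assumes "nice f" "nice g"
  shows "nice (\<lambda>x. f x * g x)"
proof (rule nice_bound)
  have "norm (f x * g x) ^ n \<le> norm (f x) ^ (2 * n) + norm (g x) ^ (2 * n)" for x and n :: nat
  proof -
    have "2 * (norm (f x) ^ n * norm (g x) ^ n) \<le> (norm (f x) ^ n)\<^sup>2 + (norm (g x) ^ n)\<^sup>2"
      using sum_squares_bound[of "norm (f x) ^ n" "norm (g x) ^ n"] by simp
    moreover have "0 \<le> norm (f x) ^ n * norm (g x) ^ n" by simp
    ultimately have "norm (f x) ^ n * norm (g x) ^ n \<le> (norm (f x) ^ n)\<^sup>2 + (norm (g x) ^ n)\<^sup>2"
      by linarith
    then show ?thesis by (simp add: norm_mult power_mult_distrib power_mult[symmetric] mult.commute)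
  qed
  then show "\<And>n x. norm (f x * g x) ^ n \<le> norm (f x) ^ (2 * n) + norm (g x) ^ (2 * n)" .
qed (use assms in \<open>auto simp: nice_def\<close>)

lemma nice_cmult: "nice f \<Longrightarrow> nice (\<lambda>x. c * f x)"
  by (rule nice_mult) auto

lemma nice_diff: "nice f \<Longrightarrow> nice g \<Longrightarrow> nice (\<lambda>x. f x - g x)"
  using nice_add[of f "\<lambda>x. (-1) * g x"] nice_cmult[of g "-1"] by simp

lemma nice_sum: "(\<And>i. i \<in> I \<Longrightarrow> nice (f i)) \<Longrightarrow> nice (\<lambda>x. \<Sum>i\<in>I. f i x)"
  by (induction I rule: infinite_finite_induct) (auto intro: nice_add)

lemma nice_sum_list: "(\<And>i. i \<in> set I \<Longrightarrow> nice (f i)) \<Longrightarrow> nice (\<lambda>x. \<Sum>i\<leftarrow>I. f i x)"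
  by (induction I) (auto intro: nice_add)

lemma nice_sum_mset: "(\<And>i. i \<in># I \<Longrightarrow> nice (f i)) \<Longrightarrow> nice (\<lambda>x. \<Sum>i\<in>#I. f i x)"
  by (induction I) (auto intro: nice_add)

lemma nice_prod: "(\<And>i. i \<in> I \<Longrightarrow> nice (f i)) \<Longrightarrow> nice (\<lambda>x. \<Prod>i\<in>I. f i x)"
  by (induction I rule: infinite_finite_induct) (auto intro: nice_mult)

lemma nice_prod_mset: "(\<And>i. i \<in># I \<Longrightarrow> nice (f i)) \<Longrightarrow> nice (\<lambda>x. \<Prod>i\<in>#I. f i x)"
  by (induction I) (auto intro: nice_mult)

lemma nice_norm: "nice f \<Longrightarrow> nice (\<lambda>x. of_real (norm (f x)))"
  by (auto simp: nice_def intro!: borel_measurable_of_real borel_measurable_norm)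

lemma nice_bounded:
  assumes "f \<in> borel_measurable M" "\<And>x. x \<in> space M \<Longrightarrow> norm (f x) \<le> B"
  shows "nice f"
  by (rule nice_bound[where g = "\<lambda>n _. B ^ n"]) (use assms in \<open>auto intro: power_mono\<close>)

lemma nice_cong: "(\<And>x. x \<in> space M \<Longrightarrow> f x = g x) \<Longrightarrow> nice f \<longleftrightarrow> nice g"
  unfolding nice_def by (simp cong: measurable_cong Bochner_Integration.integrable_cong)

text \<open>
  The expansion \<open>F t = F 0 + t F' + O(t\<^sup>2)\<close>, with an error constant that has moments of all orders, is
  stable under products and may be integrated; no measurability of the derivative in \<open>t\<close> enters.
\<close>

definition dl :: "(real \<Rightarrow> 'a \<Rightarrow> complex) \<Rightarrow> ('a \<Rightarrow> complex) \<Rightarrow> bool" where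
  "dl F F' \<longleftrightarrow> nice (F 0) \<and> nice F' \<and> (\<forall>t. F t \<in> borel_measurable M) \<and>
    (\<exists>C. nice C \<and> (\<forall>x\<in>space M. \<forall>t. 0 < t \<longrightarrow> t \<le> 1 \<longrightarrow> norm (F t x - F 0 x - of_real t * F' x) \<le> t\<^sup>2 * norm (C x)))"

lemma dlI:
  assumes "nice (F 0)" "nice F'" "\<And>t. F t \<in> borel_measurable M" "nice C"
    "\<And>x t. x \<in> space M \<Longrightarrow> 0 < t \<Longrightarrow> t \<le> 1 \<Longrightarrow> norm (F t x - F 0 x - of_real t * F' x) \<le> t\<^sup>2 * norm (C x)"
  shows "dl F F'"
  using assms unfolding dl_def by blast

lemma dl_const: "nice f \<Longrightarrow> dl (\<lambda>_. f) (\<lambda>_. 0)"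
  by (rule dlI[where C = "\<lambda>_. 0"]) (auto simp: nice_measurable)

lemma dl_add:
  assumes "dl F F'" "dl G G'"
  shows "dl (\<lambda>t x. F t x + G t x) (\<lambda>x. F' x + G' x)"
proof -
  from assms obtain C E where C: "nice C" "\<And>x t. x \<in> space M \<Longrightarrow> 0 < t \<Longrightarrow> t \<le> 1 \<Longrightarrow> norm (F t x - F 0 x - of_real t * F' x) \<le> t\<^sup>2 * norm (C x)"
    and E: "nice E" "\<And>x t. x \<in> space M \<Longrightarrow> 0 < t \<Longrightarrow> t \<le> 1 \<Longrightarrow> norm (G t x - G 0 x - of_real t * G' x) \<le> t\<^sup>2 * norm (E x)"
    unfolding dl_def by blast
  show ?thesis
  proof (rule dlI[where C = "\<lambda>x. of_real (norm (C x)) + of_real (norm (E x))"])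
    fix x t assume x: "x \<in> space M" "0 < t" "t \<le> (1::real)"
    have "F t x + G t x - (F 0 x + G 0 x) - of_real t * (F' x + G' x) =
      (F t x - F 0 x - of_real t * F' x) + (G t x - G 0 x - of_real t * G' x)"
      by (simp add: algebra_simps)
    also have "norm \<dots> \<le> t\<^sup>2 * norm (C x) + t\<^sup>2 * norm (E x)"
      by (intro order_trans[OF norm_triangle_ineq] add_mono C E x)
    also have "\<dots> = t\<^sup>2 * norm (complex_of_real (norm (C x)) + complex_of_real (norm (E x)))"
      by (simp add: distrib_left flip: of_real_add)
    finally show "norm (F t x + G t x - (F 0 x + G 0 x) - of_real t * (F' x + G' x)) \<le> \<dots>" .
  qed (use assms C E in \<open>auto simp: dl_def intro!: nice_add nice_norm borel_measurable_add\<close>)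
qed

lemma dl_mult:
  assumes "dl F F'" "dl G G'"
  shows "dl (\<lambda>t x. F t x * G t x) (\<lambda>x. F' x * G 0 x + F 0 x * G' x)"
proof -
  from assms obtain C E where C: "nice C" "\<And>x t. x \<in> space M \<Longrightarrow> 0 < t \<Longrightarrow> t \<le> 1 \<Longrightarrow> norm (F t x - F 0 x - of_real t * F' x) \<le> t\<^sup>2 * norm (C x)"
    and E: "nice E" "\<And>x t. x \<in> space M \<Longrightarrow> 0 < t \<Longrightarrow> t \<le> 1 \<Longrightarrow> norm (G t x - G 0 x - of_real t * G' x) \<le> t\<^sup>2 * norm (E x)"
    unfolding dl_def by blast
  have n: "nice (F 0)" "nice (G 0)" "nice F'" "nice G'" using assms by (auto simp: dl_def)
  let ?n = "\<lambda>f x. complex_of_real (norm (f x))"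
  \<comment> \<open>The three second order contributions for \<open>t \<le> 1\<close>: the product
    of the derivatives, the error of \<open>F\<close> times a bound for \<open>G\<close>, and the
    error of \<open>G\<close> times a bound for the first order part of \<open>F\<close>.\<close>
  let ?B = "\<lambda>x. ?n F' x * ?n G' x + ?n C x * (?n (G 0) x + ?n G' x + ?n E x) + ?n E x * (?n (F 0) x + ?n F' x)"
  show ?thesis
  proof (rule dlI[where C = ?B])
    fix x t assume x: "x \<in> space M" "0 < t" "t \<le> (1::real)"
    define r where "r = F t x - F 0 x - of_real t * F' x"
    define s where "s = G t x - G 0 x - of_real t * G' x"
    have r: "norm r \<le> t\<^sup>2 * norm (C x)" and s: "norm s \<le> t\<^sup>2 * norm (E x)"
      unfolding r_def s_def by (rule C(2)[OF x], rule E(2)[OF x])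
    have t2: "t\<^sup>2 \<le> 1" using x by (simp add: power_le_one)
    have "F t x * G t x - F 0 x * G 0 x - of_real t * (F' x * G 0 x + F 0 x * G' x) =
      of_real (t\<^sup>2) * (F' x * G' x) + r * (G 0 x + of_real t * G' x + s) + s * (F 0 x + of_real t * F' x)"
      unfolding r_def s_def by (simp add: algebra_simps power2_eq_square)
    also have "norm \<dots> \<le> t\<^sup>2 * (norm (F' x) * norm (G' x)) + norm r * (norm (G 0 x) + norm (G' x) + norm (E x)) + norm s * (norm (F 0 x) + norm (F' x))"
    proof -
      have a: "norm (G 0 x + of_real t * G' x + s) \<le> norm (G 0 x) + norm (G' x) + norm (E x)"
      proof -
        have "norm (G 0 x + of_real t * G' x + s) \<le> norm (G 0 x) + norm (of_real t * G' x) + norm s"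
          by (rule norm3)
        also have "norm (of_real t * G' x) \<le> norm (G' x)" using x by (simp add: norm_mult mult_left_le_one_le)
        also have "norm s \<le> norm (E x)" using s mult_right_mono[OF t2, of "norm (E x)"] by simp
        finally show ?thesis by simp
      qed
      have b: "norm (F 0 x + of_real t * F' x) \<le> norm (F 0 x) + norm (F' x)"
      proof -
        have "norm (F 0 x + of_real t * F' x) \<le> norm (F 0 x) + norm (of_real t * F' x)" by (rule norm_triangle_ineq)
        also have "norm (of_real t * F' x) \<le> norm (F' x)" using x by (simp add: norm_mult mult_left_le_one_le)
        finally show ?thesis by simp
      qed
      have "norm (of_real (t\<^sup>2) * (F' x * G' x)) = t\<^sup>2 * (norm (F' x) * norm (G' x))"
        by (simp add: norm_mult norm_power)
      moreover have "norm (r * (G 0 x + of_real t * G' x + s)) \<le> norm r * (norm (G 0 x) + norm (G' x) + norm (E x))"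
        unfolding norm_mult by (intro mult_left_mono a) auto
      moreover have "norm (s * (F 0 x + of_real t * F' x)) \<le> norm s * (norm (F 0 x) + norm (F' x))"
        unfolding norm_mult by (intro mult_left_mono b) auto
      ultimately show ?thesis
        using norm3[of "of_real (t\<^sup>2) * (F' x * G' x)" "r * (G 0 x + of_real t * G' x + s)" "s * (F 0 x + of_real t * F' x)"]
        by linarith
    qed
    also have "\<dots> \<le> t\<^sup>2 * (norm (F' x) * norm (G' x)) + (t\<^sup>2 * norm (C x)) * (norm (G 0 x) + norm (G' x) + norm (E x)) + (t\<^sup>2 * norm (E x)) * (norm (F 0 x) + norm (F' x))"
      by (intro add_mono mult_right_mono r s) auto
    also have "\<dots> = t\<^sup>2 * (norm (F' x) * norm (G' x) + norm (C x) * (norm (G 0 x) + norm (G' x) + norm (E x)) + norm (E x) * (norm (F 0 x) + norm (F' x)))"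
      by (simp add: algebra_simps)
    also have "\<dots> = t\<^sup>2 * norm (?B x)"
      by (simp flip: of_real_add of_real_mult)
    finally show "norm (F t x * G t x - F 0 x * G 0 x - of_real t * (F' x * G 0 x + F 0 x * G' x)) \<le> t\<^sup>2 * norm (?B x)" .
  qed (use assms C E n in \<open>auto simp: dl_def intro!: nice_add nice_mult nice_norm borel_measurable_times\<close>)
qed

lemma dl_sum: "(\<And>i. i \<in> I \<Longrightarrow> dl (F i) (F' i)) \<Longrightarrow> dl (\<lambda>t x. \<Sum>i\<in>I. F i t x) (\<lambda>x. \<Sum>i\<in>I. F' i x)"
  by (induction I rule: infinite_finite_induct) (auto intro: dl_add dl_const[of "\<lambda>_. 0"])

lemma dl_prod_mset:
  assumes "\<And>u. u \<in># U \<Longrightarrow> dl (F u) (F' u)"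
  shows "dl (\<lambda>t x. \<Prod>u\<in>#U. F u t x) (\<lambda>x. \<Sum>u\<in>#U. F' u x * (\<Prod>v\<in>#U - {#u#}. F v 0 x))"
  using assms
proof (induction U)
  case empty
  show ?case using dl_const[of "\<lambda>_. 1"] by simp
next
  case (add w U)
  have "dl (\<lambda>t x. F w t x * (\<Prod>u\<in>#U. F u t x)) (\<lambda>x. F' w x * (\<Prod>u\<in>#U. F u 0 x) + F w 0 x * (\<Sum>u\<in>#U. F' u x * (\<Prod>v\<in>#U - {#u#}. F v 0 x)))"
    by (intro dl_mult add) (use add in auto)
  moreover have "F w 0 x * (\<Sum>u\<in>#U. F' u x * (\<Prod>v\<in>#U - {#u#}. F v 0 x)) = (\<Sum>u\<in>#U. F' u x * (\<Prod>v\<in>#add_mset w U - {#u#}. F v 0 x))" for x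
  proof -
    \<comment> \<open>Summing over a submultiset \<open>N\<close> keeps \<open>U\<close> fixed
      during the induction.\<close>
    have "F w 0 x * (\<Sum>u\<in>#N. F' u x * (\<Prod>v\<in>#U - {#u#}. F v 0 x)) = (\<Sum>u\<in>#N. F' u x * (\<Prod>v\<in>#add_mset w U - {#u#}. F v 0 x))"
      if "N \<subseteq># U" for N
      using that
    proof (induction N)
      case (add u N)
      then have "u \<in># U" "N \<subseteq># U" by (auto dest: mset_subset_eqD mset_subset_eq_insertD)
      moreover have "add_mset w U - {#u#} = add_mset w (U - {#u#})" using \<open>u \<in># U\<close> by (simp add: multiset_eq_iff)
      ultimately show ?case using add by (simp add: algebra_simps)
    qed simp
    then show ?thesis by blast
  qed
  ultimately show ?case by simp
qed

text \<open>Integrating the expansion gives \<open>t * norm (\<integral>x. F' x \<partial>M) \<le>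
  t\<^sup>2 * K\<close>. Divide by \<open>t\<close> and let \<open>t\<close> tend to 0.\<close>

lemma dl_integral_0:
  assumes F: "dl F F'" and c: "\<And>t. (\<integral>x. F t x \<partial>M) = (\<integral>x. F 0 x \<partial>M)"
  shows "(\<integral>x. F' x \<partial>M) = 0"
proof -
  from F obtain C where n: "nice (F 0)" "nice F'" "\<And>t. F t \<in> borel_measurable M" and C: "nice C"
    "\<And>x t. x \<in> space M \<Longrightarrow> 0 < t \<Longrightarrow> t \<le> 1 \<Longrightarrow> norm (F t x - F 0 x - of_real t * F' x) \<le> t\<^sup>2 * norm (C x)"
    unfolding dl_def by blast
  note i = nice_integrable[OF n(1)] nice_integrable[OF n(2)]
  have iC: "integrable M (\<lambda>x. norm (C x))" using nice_integrable[OF C(1)] by simp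
  define K where "K = (\<integral>x. norm (C x) \<partial>M)"
  have bound: "norm (\<integral>x. F' x \<partial>M) \<le> t * K" if t: "0 < t" "t \<le> 1" for t
  proof -
    let ?R = "\<lambda>x. F t x - F 0 x - of_real t * F' x"
    have meas: "?R \<in> borel_measurable M"
      by (intro borel_measurable_diff borel_measurable_times n(3) nice_measurable[OF n(1)] nice_measurable[OF n(2)] borel_measurable_const)
    have iR: "integrable M ?R"
      by (rule Bochner_Integration.integrable_bound[of _ "\<lambda>x. t\<^sup>2 * norm (C x)"])
        (use iC meas C(2) t in \<open>auto intro!: AE_I2\<close>)
    have "integrable M (\<lambda>x. ?R x + F 0 x + of_real t * F' x)"
      using iR i by (intro Bochner_Integration.integrable_add) auto
    then have iF: "integrable M (F t)" by simp
    have "(\<integral>x. ?R x \<partial>M) = - of_real t * (\<integral>x. F' x \<partial>M)"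
      using iF i c[of t] by simp
    then have "t * norm (\<integral>x. F' x \<partial>M) = norm (\<integral>x. ?R x \<partial>M)"
      using t by (simp add: norm_mult)
    also have "\<dots> \<le> (\<integral>x. norm (?R x) \<partial>M)" by (rule integral_norm_bound)
    also have "\<dots> \<le> (\<integral>x. t\<^sup>2 * norm (C x) \<partial>M)"
      using iR iC C(2) t by (intro integral_mono) auto
    also have "\<dots> = t * (t * K)" by (simp add: K_def power2_eq_square)
    finally show ?thesis using t by simp
  qed
  have "norm (\<integral>x. F' x \<partial>M) \<le> 0"
  proof (rule tendsto_lowerbound)
    show "((\<lambda>t. t * K) \<longlongrightarrow> 0) (at_right 0)" by (auto intro!: tendsto_eq_intros)
    show "\<forall>\<^sub>F t in at_right 0. norm (\<integral>x. F' x \<partial>M) \<le> t * K"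
      by (rule eventually_mono[OF eventually_at_right_real[of 0 1]]) (auto intro: bound)
  qed simp
  then show ?thesis by simp
qed

end

section \<open>Entries of polynomials in a family of matrices\<close>

definition ment :: "nat \<Rightarrow> ('i \<Rightarrow> complex mat) \<Rightarrow> 'i ncpoly \<Rightarrow> nat \<Rightarrow> nat \<Rightarrow> complex" where
  "ment d X p i j = mat_eval d X p $$ (i, j)"

locale mat_family =
  fixes d :: nat and X :: "'i \<Rightarrow> complex mat"
  assumes X_carrier: "X i \<in> carrier_mat d d"
begin

lemma letter_carrier: "letter_value transpose_mat X l \<in> carrier_mat d d"
  by (cases l) (auto simp: X_carrier)

lemma mat_word_simps:
  "mat_word d X (Word []) = 1\<^sub>m d" "mat_word d X (Word (l # ls)) = letter_value transpose_mat X l * mat_word d X (Word ls)"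
  by (simp_all add: mat_word_def)

lemma mat_word_carrier: "mat_word d X w \<in> carrier_mat d d"
proof (cases w)
  case (Word ls)
  show ?thesis unfolding Word
    by (induction ls) (auto simp: mat_word_simps intro!: mult_carrier_mat letter_carrier)
qed

lemma mat_word_append: "mat_word d X (u + v) = mat_word d X u * mat_word d X v"
proof -
  have "mat_word d X (Word (us @ vs)) = mat_word d X (Word us) * mat_word d X (Word vs)" for us vs
  proof (induction us)
    case Nil
    then show ?case using mat_word_carrier[of "Word vs"] by (simp add: mat_word_simps)
  next
    case (Cons l us)
    then show ?case
      using assoc_mult_mat[OF letter_carrier mat_word_carrier mat_word_carrier, of l "Word us" "Word vs"]
      by (simp add: mat_word_simps)
  qed
  from this[of "letters u" "letters v"] show ?thesis by (simp add: plus_word_def)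
qed

lemma mat_word_transpose: "mat_word d X (word_transpose w) = transpose_mat (mat_word d X w)"
proof -
  have "mat_word d X (Word (rev (map letter_transpose ls))) = transpose_mat (mat_word d X (Word ls))" for ls
  proof (induction ls)
    case (Cons l ls)
    have "letter_value transpose_mat X (letter_transpose l) = transpose_mat (letter_value transpose_mat X l)"
      by (cases l) simp_all
    then have l: "letter_value transpose_mat X (letter_transpose l) * 1\<^sub>m d = transpose_mat (letter_value transpose_mat X l)"
      using right_mult_one_mat[OF letter_carrier, of "letter_transpose l"] by simp
    have "Word (rev (map letter_transpose (l # ls))) = Word (rev (map letter_transpose ls)) + Word [letter_transpose l]"
      by (simp add: plus_word_def)
    then show ?case
      using Cons transpose_mult[OF letter_carrier mat_word_carrier, of l "Word ls"]
      by (simp add: mat_word_append l mat_word_simps)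
  qed (simp add: mat_word_simps)
  from this[of "letters w"] show ?thesis by (simp add: word_transpose_def)
qed

lemma entry_mult:
  assumes "P \<in> carrier_mat d d" "R \<in> carrier_mat d d" "i < d" "j < d"
  shows "(P * R) $$ (i, j) = (\<Sum>k<d. P $$ (i, k) * R $$ (k, j))"
  using assms by (auto simp: scalar_prod_def atLeast0LessThan)

lemma ment_eq: "i < d \<Longrightarrow> j < d \<Longrightarrow> ment d X p i j = (\<Sum>w\<in>Poly_Mapping.keys p. Poly_Mapping.lookup p w * mat_word d X w $$ (i, j))"
  by (simp add: ment_def mat_eval_def)

lemma ment_single: "i < d \<Longrightarrow> j < d \<Longrightarrow> ment d X (Poly_Mapping.single w c) i j = c * mat_word d X w $$ (i, j)"
  by (simp add: ment_eq)

lemma ment_add: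
  assumes "i < d" "j < d"
  shows "ment d X (p + q) i j = ment d X p i j + ment d X q i j"
proof -
  have *: "ment d X r i j = (\<Sum>w\<in>Poly_Mapping.keys p \<union> Poly_Mapping.keys q. Poly_Mapping.lookup r w * mat_word d X w $$ (i, j))"
    if "Poly_Mapping.keys r \<subseteq> Poly_Mapping.keys p \<union> Poly_Mapping.keys q" for r
    unfolding ment_eq[OF assms] using that
    by (intro sum.mono_neutral_left) (auto simp: in_keys_iff)
  show ?thesis
    by (simp add: * Poly_Mapping.keys_add lookup_add distrib_right sum.distrib)
qed

lemma ment_smul: "i < d \<Longrightarrow> j < d \<Longrightarrow> ment d X (nc_smul c p) i j = c * ment d X p i j"
  by (induction p rule: ncpoly_induct) (simp_all add: nc_smul_add nc_smul_single ment_add ment_single distrib_left)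

lemma ment_mult:
  assumes "i < d" "j < d"
  shows "ment d X (p * q) i j = (\<Sum>k<d. ment d X p i k * ment d X q k j)"
proof (induction p rule: ncpoly_induct)
  case (single u c)
  show ?case
  proof (induction q rule: ncpoly_induct)
    case (single v e)
    then show ?case using assms
      by (simp add: mult_single ment_single mat_word_append entry_mult[OF mat_word_carrier mat_word_carrier] sum_distrib_left mult_ac)
  qed (use assms in \<open>simp_all add: distrib_left ment_add sum.distrib\<close>)
qed (use assms in \<open>simp_all add: distrib_right ment_add sum.distrib\<close>)

lemma ment_transpose: "i < d \<Longrightarrow> j < d \<Longrightarrow> ment d X (nc_transpose p) i j = ment d X p j i"
  using mat_word_carrier[THEN carrier_matD(1)] mat_word_carrier[THEN carrier_matD(2)]
  by (induction p rule: ncpoly_induct) (auto simp: nc_transpose_add nc_transpose_single ment_add ment_single mat_word_transpose)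

lemma ment_one: "i < d \<Longrightarrow> j < d \<Longrightarrow> ment d X 1 i j = (if i = j then 1 else 0)"
proof -
  have "mat_word d X 0 = 1\<^sub>m d" by (simp add: mat_word_def)
  then show "i < d \<Longrightarrow> j < d \<Longrightarrow> ?thesis" using ment_single[of i j 0 1] by simp
qed

lemma ment_affine: "i < d \<Longrightarrow> j < d \<Longrightarrow> ment d X (p + Poly_Mapping.single 0 c) i j = ment d X p i j + (if i = j then c else 0)"
  using ment_single[of i j 0 c] by (simp add: ment_add mat_word_def)

lemma ment_var: "i < d \<Longrightarrow> j < d \<Longrightarrow> ment d X (nc_var k) i j = X k $$ (i, j)"
  using X_carrier[of k] by (simp add: nc_var_def ment_single mat_word_simps)

lemma mat_trace_eval: "mat_trace (mat_eval d X p) = (\<Sum>i<d. ment d X p i i)"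
  by (simp add: mat_trace_def ment_def mat_eval_def)

end

section \<open>Rotations in a coordinate plane and orthogonal matrices\<close>

definition rot_mat :: "nat \<Rightarrow> nat \<Rightarrow> nat \<Rightarrow> real \<Rightarrow> real mat" where
  "rot_mat d a b t = mat d d (\<lambda>(i, j).
    if i = a then (if j = a then cos t else if j = b then sin t else 0)
    else if i = b then (if j = b then cos t else if j = a then - sin t else 0)
    else if i = j then 1 else 0)"

lemma rot_mat_carrier: "rot_mat d a b t \<in> carrier_mat d d"
  by (simp add: rot_mat_def)

lemma sum_split2:
  fixes f :: "nat \<Rightarrow> real"
  assumes "a < d" "b < d" "a \<noteq> b"
  shows "(\<Sum>k<d. f k) = f a + f b + (\<Sum>k\<in>{..<d} - {a, b}. f k)"
proof -
  have "(\<Sum>k<d. f k) = f a + (\<Sum>k\<in>{..<d} - {a}. f k)" using assms by (intro sum.remove) auto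
  also have "(\<Sum>k\<in>{..<d} - {a}. f k) = f b + (\<Sum>k\<in>{..<d} - {a} - {b}. f k)" using assms by (intro sum.remove) auto
  finally show ?thesis by (simp add: Diff_insert2[symmetric] insert_commute add.assoc)
qed

lemma rot_mat_dims [simp]: "dim_row (rot_mat d a b t) = d" "dim_col (rot_mat d a b t) = d"
  by (simp_all add: rot_mat_def)

lemma rot_mat_orthogonal:
  assumes "a < d" "b < d" "a \<noteq> b"
  shows "rot_mat d a b t \<in> orthogonal_group d"
proof -
  have "(\<Sum>k<d. rot_mat d a b t $$ (k, i) * rot_mat d a b t $$ (k, j)) = (if i = j then 1 else 0)" if "i < d" "j < d" for i j
  proof -
    have "(\<Sum>k\<in>{..<d} - {a, b}. rot_mat d a b t $$ (k, i) * rot_mat d a b t $$ (k, j)) =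
      (\<Sum>k\<in>{..<d} - {a, b}. if k = i then (if i = j then 1 else 0) else 0)"
      using that by (intro sum.cong) (auto simp: rot_mat_def)
    also have "\<dots> = (if i \<in> {..<d} - {a, b} then (if i = j then 1 else 0) else 0)"
      by (simp add: sum.delta)
    finally show ?thesis
      using assms that sin_cos_squared_add[of t]
      by (subst sum_split2[OF assms]) (auto simp: rot_mat_def power2_eq_square algebra_simps)
  qed
  then have "transpose_mat (rot_mat d a b t) * rot_mat d a b t = 1\<^sub>m d"
    using rot_mat_carrier[of d a b t]
    by (intro eq_matI) (auto simp: scalar_prod_def atLeast0LessThan rot_mat_carrier)
  then show ?thesis using rot_mat_carrier by (simp add: orthogonal_group_def)
qed

lemma rot_mat_entry:
  assumes "a < d" "b < d" "a \<noteq> b" "P \<in> carrier_mat d d" "i < d" "j < d"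
  shows "(rot_mat d a b t * P) $$ (i, j) =
    (if i = a then cos t * P $$ (a, j) + sin t * P $$ (b, j)
     else if i = b then cos t * P $$ (b, j) - sin t * P $$ (a, j) else P $$ (i, j))"
proof -
  have "(rot_mat d a b t * P) $$ (i, j) = (\<Sum>k<d. rot_mat d a b t $$ (i, k) * P $$ (k, j))"
    using assms rot_mat_carrier[of d a b t] by (auto simp: scalar_prod_def atLeast0LessThan)
  also have "\<dots> = rot_mat d a b t $$ (i, a) * P $$ (a, j) + rot_mat d a b t $$ (i, b) * P $$ (b, j) +
    (\<Sum>k\<in>{..<d} - {a, b}. rot_mat d a b t $$ (i, k) * P $$ (k, j))"
    by (rule sum_split2[OF assms(1-3)])
  also have "(\<Sum>k\<in>{..<d} - {a, b}. rot_mat d a b t $$ (i, k) * P $$ (k, j)) =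
    (\<Sum>k\<in>{..<d} - {a, b}. if k = i then P $$ (i, j) else 0)"
    using assms by (intro sum.cong) (auto simp: rot_mat_def)
  also have "\<dots> = (if i \<in> {..<d} - {a, b} then P $$ (i, j) else 0)"
    by (simp add: sum.delta)
  finally show ?thesis using assms by (auto simp: rot_mat_def)
qed

lemma sin_bound: "\<bar>sin t - t\<bar> \<le> t\<^sup>2" for t :: real
proof -
  have "\<bar>sin t - t\<bar> \<le> inverse 2 * \<bar>t\<bar> ^ 2"
    using Maclaurin_sin_bound[of t 2] by (simp add: sin_coeff_def numeral_2_eq_2)
  also have "\<dots> \<le> t\<^sup>2" by simp
  finally show ?thesis .
qed

lemma cos_bound: "\<bar>cos t - 1\<bar> \<le> t\<^sup>2" for t :: real
proof -
  have "cos t = 1 - 2 * (sin (t / 2))\<^sup>2" using cos_double_sin[of "t / 2"] by simp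
  then have "\<bar>cos t - 1\<bar> = 2 * (sin (t / 2))\<^sup>2" by simp
  also have "(sin (t / 2))\<^sup>2 \<le> (t / 2)\<^sup>2" using abs_sin_x_le_abs_x[of "t / 2"] by (metis power2_abs power_mono abs_ge_zero)
  also have "2 * (t / 2)\<^sup>2 \<le> t\<^sup>2" by (simp add: power2_eq_square)
  finally show ?thesis by simp
qed

lemma orthogonal_rows:
  assumes U: "U \<in> orthogonal_group d" and ij: "i < d" "j < d"
  shows "(\<Sum>k<d. U $$ (k, i) * U $$ (k, j)) = (if i = j then 1 else 0)"
    "(\<Sum>k<d. U $$ (i, k) * U $$ (j, k)) = (if i = j then 1 else 0)"
proof -
  have c: "U \<in> carrier_mat d d" and e: "transpose_mat U * U = 1\<^sub>m d" using U by (auto simp: orthogonal_group_def)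
  \<comment> \<open>A left inverse of a square matrix is a right inverse: the group is defined by
    orthonormal columns, and the rows follow.\<close>
  have e': "U * transpose_mat U = 1\<^sub>m d" by (rule mat_mult_left_right_inverse[OF _ c e]) (use c in simp)
  have "(transpose_mat U * U) $$ (i, j) = (\<Sum>k<d. U $$ (k, i) * U $$ (k, j))"
    using c ij by (auto simp: scalar_prod_def atLeast0LessThan)
  then show "(\<Sum>k<d. U $$ (k, i) * U $$ (k, j)) = (if i = j then 1 else 0)" using e ij by simp
  have "(U * transpose_mat U) $$ (i, j) = (\<Sum>k<d. U $$ (i, k) * U $$ (j, k))"
    using c ij by (auto simp: scalar_prod_def atLeast0LessThan)
  then show "(\<Sum>k<d. U $$ (i, k) * U $$ (j, k)) = (if i = j then 1 else 0)" using e' ij by simp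
qed

lemma orthogonal_bound:
  assumes U: "U \<in> orthogonal_group d" and ij: "i < d" "j < d"
  shows "\<bar>U $$ (i, j)\<bar> \<le> 1"
proof -
  have "(U $$ (i, j))\<^sup>2 \<le> (\<Sum>k<d. (U $$ (k, j))\<^sup>2)"
    using ij by (intro member_le_sum) auto
  also have "\<dots> = 1" using orthogonal_rows(1)[OF U ij(2) ij(2)] by (simp add: power2_eq_square)
  finally show ?thesis by (simp add: abs_square_le_1)
qed

section \<open>Measurability of word entries\<close>

lemma mat_entries_eq_mat: "P \<in> carrier_mat d d \<Longrightarrow> mat d d (mat_entries d P) = P"
  by (intro eq_matI) (auto simp: mat_entries_def)

lemma mat_entries_measurable:
  assumes "\<And>i j. i < d \<Longrightarrow> j < d \<Longrightarrow> (\<lambda>x. F x $$ (i, j)) \<in> borel_measurable N"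
  shows "(\<lambda>x. mat_entries d (F x)) \<in> measurable N (entries_space d)"
  unfolding entries_space_def mat_entries_def
  by (rule measurable_restrict) (use assms in auto)

lemma entries_space_component: "i < d \<Longrightarrow> j < d \<Longrightarrow> (\<lambda>x. x (i, j)) \<in> measurable (entries_space d) borel"
  unfolding entries_space_def by (rule measurable_component_singleton) auto

abbreviation family_space :: "nat \<Rightarrow> ('i \<Rightarrow> nat \<times> nat \<Rightarrow> complex) measure" where
  "family_space d \<equiv> \<Pi>\<^sub>M i\<in>UNIV. entries_space d"

lemma family_component: "r < d \<Longrightarrow> c < d \<Longrightarrow> (\<lambda>y. y i (r, c)) \<in> measurable (family_space d) borel"
  by (rule measurable_compose[where N = "entries_space d" and f = "\<lambda>y. y i"])
    (auto intro: measurable_component_singleton entries_space_component)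

lemma mat_word_measurable:
  assumes "i < d" "j < d"
  shows "(\<lambda>y :: 'i \<Rightarrow> _. mat_word d (\<lambda>i. mat d d (y i)) w $$ (i, j)) \<in> measurable (family_space d) borel"
proof -
  have "(\<lambda>y :: 'i \<Rightarrow> _. mat_word d (\<lambda>i. mat d d (y i)) (Word ls) $$ (i, j)) \<in> measurable (family_space d) borel" if "i < d" "j < d" for ls i j
    using that
  proof (induction ls arbitrary: i)
    case Nil
    then show ?case by (simp add: mat_word_def)
  next
    case (Cons l ls)
    have fam: "mat_family d (\<lambda>i. mat d d (y i))" for y :: "'i \<Rightarrow> nat \<times> nat \<Rightarrow> complex" by unfold_locales simp
    have eq: "mat_word d (\<lambda>i. mat d d (y i)) (Word (l # ls)) $$ (i, j) =
      (\<Sum>k<d. letter_value transpose_mat (\<lambda>i. mat d d (y i)) l $$ (i, k) * mat_word d (\<lambda>i. mat d d (y i)) (Word ls) $$ (k, j))"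
      for y :: "'i \<Rightarrow> nat \<times> nat \<Rightarrow> complex"
      unfolding mat_family.mat_word_simps[OF fam]
      by (rule mat_family.entry_mult[OF fam mat_family.letter_carrier[OF fam] mat_family.mat_word_carrier[OF fam] Cons.prems])
    have l: "(\<lambda>y :: 'i \<Rightarrow> _. letter_value transpose_mat (\<lambda>i. mat d d (y i)) l $$ (i, k)) \<in> measurable (family_space d) borel" if "k < d" for k
      using Cons.prems that by (cases l) (simp_all add: family_component)
    show ?case unfolding eq
      by (intro borel_measurable_sum borel_measurable_times l Cons.IH) (use Cons.prems in auto)
  qed
  from this[OF assms, of "letters w"] show ?thesis by simp
qed

lemma ment_measurable:
  assumes "i < d" "j < d"
  shows "(\<lambda>y :: 'i \<Rightarrow> _. ment d (\<lambda>i. mat d d (y i)) p i j) \<in> measurable (family_space d) borel"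
proof -
  have fam: "mat_family d (\<lambda>i. mat d d (y i))" for y :: "'i \<Rightarrow> nat \<times> nat \<Rightarrow> complex" by unfold_locales simp
  show ?thesis unfolding mat_family.ment_eq[OF fam assms]
    by (intro borel_measurable_sum borel_measurable_times mat_word_measurable assms) auto
qed

lemma wval_measurable:
  assumes "i < d" "j < d"
  shows "(\<lambda>(x, y :: 'i \<Rightarrow> _). wval d (\<lambda>i j. x (i, j)) (ment d (\<lambda>i. mat d d (y i))) w i j)
    \<in> measurable (entries_space d \<Otimes>\<^sub>M family_space d) borel"
  using assms
proof (induction w arbitrary: i)
  case (Cons l w)
  have l: "(\<lambda>(x, y :: 'i \<Rightarrow> _). lval (\<lambda>i j. x (i, j)) (ment d (\<lambda>i. mat d d (y i))) l i k) \<in> measurable (entries_space d \<Otimes>\<^sub>M family_space d) borel"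
    if k: "k < d" for k
  proof (cases l)
    case Orth
    have "(\<lambda>z. complex_of_real (fst z (i, k))) \<in> measurable (entries_space d \<Otimes>\<^sub>M family_space d) borel"
      by (rule measurable_compose[OF measurable_fst measurable_compose[OF entries_space_component borel_measurable_of_real]]) (use Cons.prems k in auto)
    then show ?thesis using Orth by (simp add: case_prod_unfold)
  next
    case OrthT
    have "(\<lambda>z. complex_of_real (fst z (k, i))) \<in> measurable (entries_space d \<Otimes>\<^sub>M family_space d) borel"
      by (rule measurable_compose[OF measurable_fst measurable_compose[OF entries_space_component borel_measurable_of_real]]) (use Cons.prems k in auto)
    then show ?thesis using OrthT by (simp add: case_prod_unfold)
  next
    case (Coef p)
    have "(\<lambda>z. ment d (\<lambda>i. mat d d (snd z i)) p i k) \<in> measurable (entries_space d \<Otimes>\<^sub>M family_space d) borel"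
      by (rule measurable_compose[OF measurable_snd ment_measurable]) (use Cons.prems k in auto)
    then show ?thesis using Coef by (simp add: case_prod_unfold)
  qed
  have "(\<lambda>z. \<Sum>k<d. lval (\<lambda>i j. fst z (i, j)) (ment d (\<lambda>i. mat d d (snd z i))) l i k * wval d (\<lambda>i j. fst z (i, j)) (ment d (\<lambda>i. mat d d (snd z i))) w k j)
    \<in> measurable (entries_space d \<Otimes>\<^sub>M family_space d) borel"
    using l Cons by (intro borel_measurable_sum borel_measurable_times) (auto simp: case_prod_unfold)
  then show ?case by (simp add: case_prod_unfold)
qed simp

lemma wval_cong:
  assumes "\<And>i j. i < d \<Longrightarrow> j < d \<Longrightarrow> q i j = q' i j" "\<And>p i j. i < d \<Longrightarrow> j < d \<Longrightarrow> D p i j = D' p i j" "i < d"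
  shows "wval d q D w i j = wval d q' D' w i j"
  using assms(3)
proof (induction w arbitrary: i)
  case (Cons l w)
  have "lval q D l i k = lval q' D' l i k" if "k < d" for k
    using that assms(1,2) Cons.prems by (cases l) auto
  with Cons show ?case by (auto intro!: sum.cong)
qed simp

section \<open>The loop equations of a Haar orthogonal matrix\<close>

locale haar_ensemble = prob_space M for M :: "'w measure" +
  fixes d :: nat and Q :: "'w \<Rightarrow> real mat" and A :: "'i \<Rightarrow> 'w \<Rightarrow> complex mat"
  assumes haar: "haar_orthogonal M d Q"
    and rand: "\<And>i. random_matrix M d (A i)"
    and indep: "indep_set (sigma_entries M d (\<lambda>_::unit. Q)) (sigma_entries M d A)"
begin

definition X :: "'w \<Rightarrow> nat \<times> nat \<Rightarrow> real" where "X \<omega> = mat_entries d (Q \<omega>)"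
definition Y :: "'w \<Rightarrow> 'i \<Rightarrow> nat \<times> nat \<Rightarrow> complex" where "Y \<omega> = (\<lambda>i. mat_entries d (A i \<omega>))"

lemma X_measurable: "X \<in> measurable M (entries_space d)"
  using haar by (simp add: haar_orthogonal_def X_def[abs_def])

lemma A_carrier: "\<omega> \<in> space M \<Longrightarrow> A i \<omega> \<in> carrier_mat d d"
  using rand by (simp add: random_matrix_def)

lemma A_measurable: "r < d \<Longrightarrow> c < d \<Longrightarrow> (\<lambda>\<omega>. A i \<omega> $$ (r, c)) \<in> borel_measurable M"
  using rand by (simp add: random_matrix_def)

lemma Y_measurable: "Y \<in> measurable M (family_space d)"
proof -
  have m: "(\<lambda>\<omega>. mat_entries d (A i \<omega>)) \<in> measurable M (entries_space d)" for i
    by (rule mat_entries_measurable) (rule A_measurable)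
  have "(\<lambda>\<omega> i. mat_entries d (A i \<omega>)) \<in> measurable M (family_space d)"
  proof (rule measurable_PiM_single'[OF m])
    show "(\<lambda>\<omega> i. mat_entries d (A i \<omega>)) \<in> space M \<rightarrow> (\<Pi>\<^sub>E i\<in>UNIV. space (entries_space d))"
      by (intro Pi_I PiE_I measurable_space[OF m]) simp_all
  qed
  then show ?thesis by (simp add: Y_def[abs_def])
qed

lemma Q_orth: "\<omega> \<in> space M \<Longrightarrow> Q \<omega> \<in> orthogonal_group d"
  using haar by (simp add: haar_orthogonal_def)

lemma Q_carrier: "\<omega> \<in> space M \<Longrightarrow> Q \<omega> \<in> carrier_mat d d"
  using Q_orth by (simp add: orthogonal_group_def)

text \<open>Independence is a statement about the sigma-algebras of families, so the single
  orthogonal matrix is treated as a family over \<open>unit\<close>.\<close>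

lemma prob_XY:
  assumes "B \<in> sets (entries_space d)" "C \<in> sets (family_space d)"
  shows "prob ((X -` B \<inter> space M) \<inter> (Y -` C \<inter> space M)) = prob (X -` B \<inter> space M) * prob (Y -` C \<inter> space M)"
proof (rule indep_setD[OF indep])
  let ?P = "\<Pi>\<^sub>M u\<in>(UNIV :: unit set). entries_space d :: (nat \<times> nat \<Rightarrow> real) measure"
  have "(\<lambda>z. z ()) -` B \<inter> space ?P \<in> sets ?P"
    by (rule measurable_sets[where A = "entries_space d"]) (auto intro: measurable_component_singleton assms(1))
  moreover have "X -` B \<inter> space M = (\<lambda>\<omega> u :: unit. X \<omega>) -` ((\<lambda>z. z ()) -` B \<inter> space ?P) \<inter> space M"
    using measurable_space[OF X_measurable] by (auto simp: space_PiM)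
  ultimately show "X -` B \<inter> space M \<in> sigma_entries M d (\<lambda>_::unit. Q)"
    unfolding sigma_entries_def sets_vimage_algebra X_def[abs_def] by (intro sigma_sets.Basic) blast
  show "Y -` C \<inter> space M \<in> sigma_entries M d A"
    using assms(2) unfolding sigma_entries_def sets_vimage_algebra Y_def[abs_def] by (intro sigma_sets.Basic) blast
qed

text \<open>The map \<open>h\<close> lets one statement give the joint law with the original and
  with the rotated orthogonal matrix.\<close>

lemma distr_pair:
  assumes h: "h \<in> measurable (entries_space d) (entries_space d)"
  shows "distr M (entries_space d) (h \<circ> X) \<Otimes>\<^sub>M distr M (family_space d) Y =
    distr M (entries_space d \<Otimes>\<^sub>M family_space d) (\<lambda>\<omega>. ((h \<circ> X) \<omega>, Y \<omega>))"
proof (rule pair_measure_eqI)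
  have hX: "h \<circ> X \<in> measurable M (entries_space d)" using X_measurable h by (rule measurable_comp)
  have P: "(\<lambda>\<omega>. ((h \<circ> X) \<omega>, Y \<omega>)) \<in> measurable M (entries_space d \<Otimes>\<^sub>M family_space d)"
    using hX Y_measurable by (rule measurable_Pair)
  interpret X: prob_space "distr M (entries_space d) (h \<circ> X)" by (rule prob_space_distr[OF hX])
  interpret Y: prob_space "distr M (family_space d) Y" by (rule prob_space_distr[OF Y_measurable])
  show "sigma_finite_measure (distr M (entries_space d) (h \<circ> X))" "sigma_finite_measure (distr M (family_space d) Y)"
    by unfold_locales
  fix B C assume "B \<in> sets (distr M (entries_space d) (h \<circ> X))" "C \<in> sets (distr M (family_space d) Y)"
  then have B: "B \<in> sets (entries_space d)" and C: "C \<in> sets (family_space d)" by simp_all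
  have hB: "h -` B \<inter> space (entries_space d) \<in> sets (entries_space d)" by (rule measurable_sets[OF h B])
  have e: "(h \<circ> X) -` B \<inter> space M = X -` (h -` B \<inter> space (entries_space d)) \<inter> space M"
    using measurable_space[OF X_measurable] by auto
  have "emeasure (distr M (entries_space d \<Otimes>\<^sub>M family_space d) (\<lambda>\<omega>. ((h \<circ> X) \<omega>, Y \<omega>))) (B \<times> C) =
    emeasure M (((h \<circ> X) -` B \<inter> space M) \<inter> (Y -` C \<inter> space M))"
    unfolding emeasure_distr[OF P pair_measureI[OF B C]] by (rule arg_cong[where f = "emeasure M"]) auto
  also have "\<dots> = emeasure M ((h \<circ> X) -` B \<inter> space M) * emeasure M (Y -` C \<inter> space M)"
    unfolding e emeasure_eq_measure prob_XY[OF hB C] by (rule ennreal_mult'') simp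
  also have "\<dots> = emeasure (distr M (entries_space d) (h \<circ> X)) B * emeasure (distr M (family_space d) Y) C"
    unfolding emeasure_distr[OF hX B] emeasure_distr[OF Y_measurable C] ..
  finally show "emeasure (distr M (entries_space d) (h \<circ> X)) B * emeasure (distr M (family_space d) Y) C =
    emeasure (distr M (entries_space d \<Otimes>\<^sub>M family_space d) (\<lambda>\<omega>. ((h \<circ> X) \<omega>, Y \<omega>))) (B \<times> C)" ..
qed simp

text \<open>Both joint laws are products with the same marginals, by independence and left
  invariance of the Haar measure.\<close>

lemma invariance:
  fixes F :: "(nat \<times> nat \<Rightarrow> real) \<times> ('i \<Rightarrow> nat \<times> nat \<Rightarrow> complex) \<Rightarrow> complex"
  assumes U: "U \<in> orthogonal_group d" and F: "F \<in> borel_measurable (entries_space d \<Otimes>\<^sub>M family_space d)"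
  shows "(\<integral>\<omega>. F (mat_entries d (U * Q \<omega>), Y \<omega>) \<partial>M) = (\<integral>\<omega>. F (X \<omega>, Y \<omega>) \<partial>M)"
    and "(\<lambda>\<omega>. F (mat_entries d (U * Q \<omega>), Y \<omega>)) \<in> borel_measurable M"
proof -
  have Uc: "U \<in> carrier_mat d d" using U by (simp add: orthogonal_group_def)
  define h where "h x = mat_entries d (U * mat d d x)" for x :: "nat \<times> nat \<Rightarrow> real"
  have h: "h \<in> measurable (entries_space d) (entries_space d)"
    unfolding h_def
  proof (rule mat_entries_measurable)
    fix i j assume ij: "i < d" "j < d"
    have "(U * mat d d x) $$ (i, j) = (\<Sum>k<d. U $$ (i, k) * x (k, j))" for x
      using Uc ij by (auto simp: scalar_prod_def atLeast0LessThan)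
    then show "(\<lambda>x. (U * mat d d x) $$ (i, j)) \<in> borel_measurable (entries_space d)"
      using ij by (auto intro!: borel_measurable_sum borel_measurable_times entries_space_component)
  qed
  have hX: "h (X \<omega>) = mat_entries d (U * Q \<omega>)" if "\<omega> \<in> space M" for \<omega>
    using Q_carrier[OF that] by (simp add: h_def X_def mat_entries_eq_mat)
  have hXm: "h \<circ> X \<in> measurable M (entries_space d)" using X_measurable h by (rule measurable_comp)
  have XY: "(\<lambda>\<omega>. (X \<omega>, Y \<omega>)) \<in> measurable M (entries_space d \<Otimes>\<^sub>M family_space d)"
    using X_measurable Y_measurable by (rule measurable_Pair)
  have hXY: "(\<lambda>\<omega>. ((h \<circ> X) \<omega>, Y \<omega>)) \<in> measurable M (entries_space d \<Otimes>\<^sub>M family_space d)"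
    using hXm Y_measurable by (rule measurable_Pair)
  have 1: "distr M (entries_space d) (h \<circ> X) \<Otimes>\<^sub>M distr M (family_space d) Y =
    distr M (entries_space d \<Otimes>\<^sub>M family_space d) (\<lambda>\<omega>. ((h \<circ> X) \<omega>, Y \<omega>))"
    by (rule distr_pair[OF h])
  have 2: "distr M (entries_space d) X \<Otimes>\<^sub>M distr M (family_space d) Y =
    distr M (entries_space d \<Otimes>\<^sub>M family_space d) (\<lambda>\<omega>. (X \<omega>, Y \<omega>))"
    using distr_pair[of "\<lambda>x. x"] by (simp add: comp_def)
  have "distr M (entries_space d) (h \<circ> X) = distr M (entries_space d) (\<lambda>\<omega>. mat_entries d (U * Q \<omega>))"
    by (rule distr_cong) (simp_all add: hX)
  also have "\<dots> = distr M (entries_space d) X"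
    using haar U by (simp add: haar_orthogonal_def X_def[abs_def])
  finally have eq: "distr M (entries_space d \<Otimes>\<^sub>M family_space d) (\<lambda>\<omega>. ((h \<circ> X) \<omega>, Y \<omega>)) =
    distr M (entries_space d \<Otimes>\<^sub>M family_space d) (\<lambda>\<omega>. (X \<omega>, Y \<omega>))"
    using 1 2 by metis
  have "(\<integral>\<omega>. F (mat_entries d (U * Q \<omega>), Y \<omega>) \<partial>M) = (\<integral>\<omega>. F ((h \<circ> X) \<omega>, Y \<omega>) \<partial>M)"
    by (rule Bochner_Integration.integral_cong) (simp_all add: hX)
  also have "\<dots> = (\<integral>z. F z \<partial>distr M (entries_space d \<Otimes>\<^sub>M family_space d) (\<lambda>\<omega>. ((h \<circ> X) \<omega>, Y \<omega>)))"
    by (rule integral_distr[symmetric, OF hXY F])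
  also have "\<dots> = (\<integral>\<omega>. F (X \<omega>, Y \<omega>) \<partial>M)"
    unfolding eq by (rule integral_distr[OF XY F])
  finally show "(\<integral>\<omega>. F (mat_entries d (U * Q \<omega>), Y \<omega>) \<partial>M) = (\<integral>\<omega>. F (X \<omega>, Y \<omega>) \<partial>M)" .
  have "(\<lambda>\<omega>. F ((h \<circ> X) \<omega>, Y \<omega>)) \<in> borel_measurable M" by (rule measurable_compose[OF hXY F])
  then show "(\<lambda>\<omega>. F (mat_entries d (U * Q \<omega>), Y \<omega>)) \<in> borel_measurable M"
    by (rule measurable_cong[THEN iffD1, rotated]) (simp add: hX)
qed

definition qf :: "'w \<Rightarrow> nat \<Rightarrow> nat \<Rightarrow> real" where "qf \<omega> i j = Q \<omega> $$ (i, j)"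
definition Df :: "'w \<Rightarrow> 'i ncpoly \<Rightarrow> nat \<Rightarrow> nat \<Rightarrow> complex" where "Df \<omega> = ment d (\<lambda>i. A i \<omega>)"
definition T :: "'i oword \<Rightarrow> 'w \<Rightarrow> complex" where "T w \<omega> = wtr d (qf \<omega>) (Df \<omega>) w"

lemma fam: "\<omega> \<in> space M \<Longrightarrow> mat_family d (\<lambda>i. A i \<omega>)"
  by unfold_locales (rule A_carrier)

lemma word_values_at: "\<omega> \<in> space M \<Longrightarrow> word_values d (qf \<omega>) (Df \<omega>)"
  unfolding Df_def qf_def
  by unfold_locales (use orthogonal_rows[OF Q_orth] mat_family.ment_transpose[OF fam] mat_family.ment_mult[OF fam] mat_family.ment_affine[OF fam] in auto)

lemma nice_A: "r < d \<Longrightarrow> c < d \<Longrightarrow> nice (\<lambda>\<omega>. A i \<omega> $$ (r, c))"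
  using rand by (simp add: nice_def random_matrix_def)

lemma nice_mat_word:
  assumes "i < d" "j < d"
  shows "nice (\<lambda>\<omega>. mat_word d (\<lambda>i. A i \<omega>) w $$ (i, j))"
proof -
  have "nice (\<lambda>\<omega>. mat_word d (\<lambda>i. A i \<omega>) (Word ls) $$ (i, j))" if "i < d" "j < d" for ls i j
    using that
  proof (induction ls arbitrary: i)
    case Nil
    then show ?case by (simp add: mat_word_def)
  next
    case (Cons l ls)
    have l: "nice (\<lambda>\<omega>. letter_value transpose_mat (\<lambda>i. A i \<omega>) l $$ (i, k))" if "k < d" for k
    proof (cases l)
      case (VarT x)
      have "nice (\<lambda>\<omega>. A x \<omega> $$ (k, i))" using nice_A Cons.prems that by blast
      then show ?thesis
        by (rule nice_cong[THEN iffD1, rotated]) (use VarT Cons.prems that in \<open>simp add: carrier_matD[OF A_carrier]\<close>)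
    qed (use nice_A Cons.prems that in auto)
    have "nice (\<lambda>\<omega>. \<Sum>k<d. letter_value transpose_mat (\<lambda>i. A i \<omega>) l $$ (i, k) * mat_word d (\<lambda>i. A i \<omega>) (Word ls) $$ (k, j))"
      by (intro nice_sum nice_mult l Cons.IH) (use Cons.prems in auto)
    then show ?case
    proof (rule nice_cong[THEN iffD1, rotated])
      fix \<omega> assume "\<omega> \<in> space M"
      note f = fam[OF this]
      show "(\<Sum>k<d. letter_value transpose_mat (\<lambda>i. A i \<omega>) l $$ (i, k) * mat_word d (\<lambda>i. A i \<omega>) (Word ls) $$ (k, j)) =
        mat_word d (\<lambda>i. A i \<omega>) (Word (l # ls)) $$ (i, j)"
        unfolding mat_family.mat_word_simps[OF f]
        by (rule mat_family.entry_mult[symmetric, OF f mat_family.letter_carrier[OF f] mat_family.mat_word_carrier[OF f] Cons.prems])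
    qed
  qed
  from this[OF assms, of "letters w"] show ?thesis by simp
qed

lemma nice_Df: "i < d \<Longrightarrow> j < d \<Longrightarrow> nice (\<lambda>\<omega>. Df \<omega> p i j)"
proof -
  assume ij: "i < d" "j < d"
  have "nice (\<lambda>\<omega>. \<Sum>w\<in>Poly_Mapping.keys p. Poly_Mapping.lookup p w * mat_word d (\<lambda>i. A i \<omega>) w $$ (i, j))"
    by (intro nice_sum nice_cmult nice_mat_word ij)
  then show ?thesis
    by (rule nice_cong[THEN iffD1, rotated]) (simp add: Df_def mat_family.ment_eq[OF fam] ij)
qed

lemma qf_measurable: "i < d \<Longrightarrow> j < d \<Longrightarrow> (\<lambda>\<omega>. qf \<omega> i j) \<in> borel_measurable M"
proof -
  assume ij: "i < d" "j < d"
  have "(\<lambda>\<omega>. X \<omega> (i, j)) \<in> borel_measurable M"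
    by (rule measurable_compose[OF X_measurable entries_space_component[OF ij]])
  then show ?thesis using ij by (simp add: X_def mat_entries_def qf_def)
qed

lemma qf_bound: "\<omega> \<in> space M \<Longrightarrow> i < d \<Longrightarrow> j < d \<Longrightarrow> \<bar>qf \<omega> i j\<bar> \<le> 1"
  unfolding qf_def by (rule orthogonal_bound[OF Q_orth])

lemma nice_qf: "i < d \<Longrightarrow> j < d \<Longrightarrow> nice (\<lambda>\<omega>. complex_of_real (qf \<omega> i j))"
  by (rule nice_bounded[where B = 1], rule measurable_compose[OF qf_measurable borel_measurable_of_real])
    (simp_all add: qf_bound)

lemma nice_wval: "i < d \<Longrightarrow> j < d \<Longrightarrow> nice (\<lambda>\<omega>. wval d (qf \<omega>) (Df \<omega>) w i j)"
proof (induction w arbitrary: i)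
  case (Cons l w)
  have "nice (\<lambda>\<omega>. lval (qf \<omega>) (Df \<omega>) l i k)" if "k < d" for k
    using that Cons.prems by (cases l) (simp_all add: nice_qf nice_Df)
  then show ?case using Cons by (auto intro!: nice_sum nice_mult)
qed simp

lemma nice_T: "nice (T w)"
  unfolding T_def[abs_def] wtr_def by (intro nice_sum nice_wval) auto

end

lemma borel_measurable_prod_mset:
  fixes f :: "'b \<Rightarrow> 'a \<Rightarrow> complex"
  shows "(\<And>u. u \<in># U \<Longrightarrow> f u \<in> borel_measurable N) \<Longrightarrow> (\<lambda>x. \<Prod>u\<in>#U. f u x) \<in> borel_measurable N"
  by (induction U) (auto intro!: borel_measurable_times)

lemma (in prob_space) dl_cong:
  assumes "dl F F'" "\<And>x. x \<in> space M \<Longrightarrow> F' x = F'' x"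
  shows "dl F F''"
proof -
  have "nice F''" using assms nice_cong[of F' F''] by (auto simp: dl_def)
  then show ?thesis using assms by (auto simp: dl_def)
qed

context haar_ensemble
begin

definition qt :: "nat \<Rightarrow> nat \<Rightarrow> real \<Rightarrow> 'w \<Rightarrow> nat \<Rightarrow> nat \<Rightarrow> real" where
  "qt a b t \<omega> i j = (rot_mat d a b t * Q \<omega>) $$ (i, j)"

context
  fixes a b :: nat
  assumes ab: "a < d" "b < d" "a \<noteq> b"
begin

lemma qt_entry:
  "\<omega> \<in> space M \<Longrightarrow> i < d \<Longrightarrow> j < d \<Longrightarrow> qt a b t \<omega> i j =
    (if i = a then cos t * qf \<omega> a j + sin t * qf \<omega> b j
     else if i = b then cos t * qf \<omega> b j - sin t * qf \<omega> a j else qf \<omega> i j)"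
  unfolding qt_def qf_def by (rule rot_mat_entry[OF ab Q_carrier])

lemma qt_0: "\<omega> \<in> space M \<Longrightarrow> i < d \<Longrightarrow> j < d \<Longrightarrow> qt a b 0 \<omega> i j = qf \<omega> i j"
  by (simp add: qt_entry)

lemma wval_qt_0: "\<omega> \<in> space M \<Longrightarrow> i < d \<Longrightarrow> wval d (qt a b 0 \<omega>) (Df \<omega>) w i j = wval d (qf \<omega>) (Df \<omega>) w i j"
  by (rule wval_cong) (simp_all add: qt_0)

lemma qt_measurable: "i < d \<Longrightarrow> j < d \<Longrightarrow> (\<lambda>\<omega>. qt a b t \<omega> i j) \<in> borel_measurable M"
proof -
  assume ij: "i < d" "j < d"
  have "(\<lambda>\<omega>. if i = a then cos t * qf \<omega> a j + sin t * qf \<omega> b j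
     else if i = b then cos t * qf \<omega> b j - sin t * qf \<omega> a j else qf \<omega> i j) \<in> borel_measurable M"
    using qf_measurable[OF ij] qf_measurable[OF ab(1) ij(2)] qf_measurable[OF ab(2) ij(2)] by auto
  then show ?thesis
    by (rule measurable_cong[THEN iffD1, rotated]) (simp add: qt_entry ij)
qed

lemma dl_qt:
  assumes ij: "i < d" "j < d"
  shows "dl (\<lambda>t \<omega>. complex_of_real (qt a b t \<omega> i j))
    (\<lambda>\<omega>. of_real ((if i = a then qf \<omega> b j else 0) - (if i = b then qf \<omega> a j else 0)))"
\<comment> \<open>One t^2 comes from \<open>cos t - 1\<close> and one from \<open>sin t - t\<close>;
  entries of an orthogonal matrix are at most 1 in absolute value.\<close>
proof (rule dlI[where C = "\<lambda>_. 2"])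
  show "nice (\<lambda>\<omega>. complex_of_real (qt a b 0 \<omega> i j))"
    using nice_qf[OF ij] by (rule nice_cong[THEN iffD1, rotated]) (simp add: qt_0 ij)
  show "nice (\<lambda>\<omega>. complex_of_real ((if i = a then qf \<omega> b j else 0) - (if i = b then qf \<omega> a j else 0)))"
    using nice_qf[OF ab(1) ij(2)] nice_qf[OF ab(2) ij(2)] ab nice_diff[of "\<lambda>_. 0"] by (cases "i = a"; cases "i = b") simp_all
  show "(\<lambda>\<omega>. complex_of_real (qt a b t \<omega> i j)) \<in> borel_measurable M" for t
    by (rule measurable_compose[OF qt_measurable[OF ij] borel_measurable_of_real])
  fix \<omega> t assume \<omega>: "\<omega> \<in> space M" and t: "0 < t" "t \<le> (1 :: real)"
  have key: "\<bar>cos t * x + sin t * y - x - t * y\<bar> \<le> t\<^sup>2 * 2" if "\<bar>x\<bar> \<le> 1" "\<bar>y\<bar> \<le> 1" for x y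
  proof -
    have "cos t * x + sin t * y - x - t * y = (cos t - 1) * x + (sin t - t) * y" by (simp add: algebra_simps)
    also have "\<bar>\<dots>\<bar> \<le> \<bar>cos t - 1\<bar> * \<bar>x\<bar> + \<bar>sin t - t\<bar> * \<bar>y\<bar>"
      by (rule order_trans[OF abs_triangle_ineq]) (simp only: abs_mult order_refl)
    also have "\<dots> \<le> t\<^sup>2 * 1 + t\<^sup>2 * 1" using sin_bound[of t] cos_bound[of t] that by (intro add_mono mult_mono) auto
    finally show ?thesis by simp
  qed
  note q = qf_bound[OF \<omega> ab(1) ij(2)] qf_bound[OF \<omega> ab(2) ij(2)]
  have "\<bar>qt a b t \<omega> i j - qt a b 0 \<omega> i j - t * ((if i = a then qf \<omega> b j else 0) - (if i = b then qf \<omega> a j else 0))\<bar> \<le> t\<^sup>2 * 2"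
    using key[of "qf \<omega> a j" "qf \<omega> b j"] key[of "qf \<omega> b j" "- qf \<omega> a j"] q ab
    by (simp add: qt_entry[OF \<omega> ij])
  then show "norm (complex_of_real (qt a b t \<omega> i j) - complex_of_real (qt a b 0 \<omega> i j)
     - complex_of_real t * complex_of_real ((if i = a then qf \<omega> b j else 0) - (if i = b then qf \<omega> a j else 0)))
     \<le> t\<^sup>2 * norm (2 :: complex)"
    by (simp only: of_real_diff[symmetric] of_real_mult[symmetric] norm_of_real norm_numeral)
qed simp

lemma dl_wval:
  "i < d \<Longrightarrow> j < d \<Longrightarrow> dl (\<lambda>t \<omega>. wval d (qt a b t \<omega>) (Df \<omega>) w i j) (\<lambda>\<omega>. dval d (qf \<omega>) (Df \<omega>) a b w i j)"
proof (induction w arbitrary: i)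
  case Nil
  then show ?case using dl_const[of "\<lambda>_. if i = j then 1 else 0"] by (simp add: dval_def)
next
  case (Cons l w)
  define l' where "l' k \<omega> = (case l of
      Orth \<Rightarrow> complex_of_real ((if i = a then qf \<omega> b k else 0) - (if i = b then qf \<omega> a k else 0))
    | OrthT \<Rightarrow> of_real ((if k = a then qf \<omega> b i else 0) - (if k = b then qf \<omega> a i else 0))
    | Coef p \<Rightarrow> 0)" for k \<omega>
  have l: "dl (\<lambda>t \<omega>. lval (qt a b t \<omega>) (Df \<omega>) l i k) (l' k)" if k: "k < d" for k
    using dl_qt[OF Cons.prems(1) k] dl_qt[OF k Cons.prems(1)] dl_const[OF nice_Df[OF Cons.prems(1) k]]
    unfolding l'_def[abs_def] by (cases l) simp_all
  have "dl (\<lambda>t \<omega>. \<Sum>k<d. lval (qt a b t \<omega>) (Df \<omega>) l i k * wval d (qt a b t \<omega>) (Df \<omega>) w k j)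
    (\<lambda>\<omega>. \<Sum>k<d. l' k \<omega> * wval d (qt a b 0 \<omega>) (Df \<omega>) w k j + lval (qt a b 0 \<omega>) (Df \<omega>) l i k * dval d (qf \<omega>) (Df \<omega>) a b w k j)"
    by (intro dl_sum dl_mult l Cons.IH) (use Cons.prems in auto)
  then have "dl (\<lambda>t \<omega>. \<Sum>k<d. lval (qt a b t \<omega>) (Df \<omega>) l i k * wval d (qt a b t \<omega>) (Df \<omega>) w k j)
    (\<lambda>\<omega>. dval d (qf \<omega>) (Df \<omega>) a b (l # w) i j)"
  proof (rule dl_cong)
    fix \<omega> assume \<omega>: "\<omega> \<in> space M"
    let ?V = "wval d (qf \<omega>) (Df \<omega>)"
    have l0: "lval (qt a b 0 \<omega>) (Df \<omega>) l i k = lval (qf \<omega>) (Df \<omega>) l i k" if "k < d" for k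
      using that Cons.prems \<omega> by (cases l) (simp_all add: qt_0)
    have "(\<Sum>k<d. l' k \<omega> * ?V w k j) = (case l of
        Orth \<Rightarrow> (if i = a then ?V (Orth # w) b j else 0) - (if i = b then ?V (Orth # w) a j else 0)
      | OrthT \<Rightarrow> ?V [OrthT] i b * ?V w a j - ?V [OrthT] i a * ?V w b j
      | Coef p \<Rightarrow> 0)"
    proof (cases l)
      case Orth
      then show ?thesis using ab by (simp add: l'_def sum_negf)
    next
      case OrthT
      have "(\<Sum>k<d. l' k \<omega> * ?V w k j) =
        (\<Sum>k<d. (if k = a then of_real (qf \<omega> b i) * ?V w k j else 0) - (if k = b then of_real (qf \<omega> a i) * ?V w k j else 0))"
        using OrthT by (intro sum.cong) (auto simp: l'_def)
      also have "\<dots> = of_real (qf \<omega> b i) * ?V w a j - of_real (qf \<omega> a i) * ?V w b j"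
        using ab by (simp add: sum_subtractf)
      finally show ?thesis using OrthT ab by (simp add: wval_single del: wval.simps)
    qed (simp add: l'_def)
    then show "(\<Sum>k<d. l' k \<omega> * wval d (qt a b 0 \<omega>) (Df \<omega>) w k j + lval (qt a b 0 \<omega>) (Df \<omega>) l i k * dval d (qf \<omega>) (Df \<omega>) a b w k j) =
      dval d (qf \<omega>) (Df \<omega>) a b (l # w) i j"
      unfolding dval_Cons sum.distrib by (simp add: wval_qt_0[OF \<omega>] l0)
  qed
  then show ?case by simp
qed

lemma dl_product:
  "dl (\<lambda>t \<omega>. wval d (qt a b t \<omega>) (Df \<omega>) G b a * (\<Prod>u\<in>#us. wtr d (qt a b t \<omega>) (Df \<omega>) u - c u))
    (\<lambda>\<omega>. dval d (qf \<omega>) (Df \<omega>) a b G b a * (\<Prod>u\<in>#us. T u \<omega> - c u) +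
      wval d (qf \<omega>) (Df \<omega>) G b a * (\<Sum>u\<in>#us. (\<Sum>i<d. dval d (qf \<omega>) (Df \<omega>) a b u i i) * (\<Prod>v\<in>#us - {#u#}. T v \<omega> - c v)))"
proof -
  have T: "dl (\<lambda>t \<omega>. wtr d (qt a b t \<omega>) (Df \<omega>) u - c u) (\<lambda>\<omega>. \<Sum>i<d. dval d (qf \<omega>) (Df \<omega>) a b u i i)" for u
  proof -
    have "dl (\<lambda>t \<omega>. (\<Sum>i<d. wval d (qt a b t \<omega>) (Df \<omega>) u i i) + (- c u)) (\<lambda>\<omega>. (\<Sum>i<d. dval d (qf \<omega>) (Df \<omega>) a b u i i) + 0)"
      by (intro dl_add dl_sum dl_wval dl_const) auto
    then show ?thesis by (simp add: wtr_def)
  qed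
  have T0: "wtr d (qt a b 0 \<omega>) (Df \<omega>) u = T u \<omega>" if "\<omega> \<in> space M" for u \<omega>
    using that by (simp add: wtr_def T_def wval_qt_0)
  have "dl (\<lambda>t \<omega>. wval d (qt a b t \<omega>) (Df \<omega>) G b a * (\<Prod>u\<in>#us. wtr d (qt a b t \<omega>) (Df \<omega>) u - c u))
    (\<lambda>\<omega>. dval d (qf \<omega>) (Df \<omega>) a b G b a * (\<Prod>u\<in>#us. wtr d (qt a b 0 \<omega>) (Df \<omega>) u - c u) +
      wval d (qt a b 0 \<omega>) (Df \<omega>) G b a * (\<Sum>u\<in>#us. (\<Sum>i<d. dval d (qf \<omega>) (Df \<omega>) a b u i i) * (\<Prod>v\<in>#us - {#u#}. wtr d (qt a b 0 \<omega>) (Df \<omega>) v - c v)))"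
    by (intro dl_mult dl_prod_mset dl_wval T ab)
  then show ?thesis
    by (rule dl_cong) (simp add: T0 wval_qt_0 ab)
qed

text \<open>The integrand is a measurable function of the entries of the orthogonal matrix and of
  the ensemble, so its mean does not see the rotation.\<close>

lemma product_invariant:
  "(\<integral>\<omega>. wval d (qt a b t \<omega>) (Df \<omega>) G b a * (\<Prod>u\<in>#us. wtr d (qt a b t \<omega>) (Df \<omega>) u - c u) \<partial>M) =
   (\<integral>\<omega>. wval d (qf \<omega>) (Df \<omega>) G b a * (\<Prod>u\<in>#us. T u \<omega> - c u) \<partial>M)"
proof -
  define F where "F z = wval d (\<lambda>i j. fst z (i, j)) (ment d (\<lambda>i. mat d d (snd z i))) G b a *
    (\<Prod>u\<in>#us. wtr d (\<lambda>i j. fst z (i, j)) (ment d (\<lambda>i. mat d d (snd z i))) u - c u)"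
    for z :: "(nat \<times> nat \<Rightarrow> real) \<times> ('i \<Rightarrow> nat \<times> nat \<Rightarrow> complex)"
  have V: "(\<lambda>z :: (nat \<times> nat \<Rightarrow> real) \<times> ('i \<Rightarrow> nat \<times> nat \<Rightarrow> complex). wval d (\<lambda>i j. fst z (i, j)) (ment d (\<lambda>i. mat d d (snd z i))) w i j) \<in> borel_measurable (entries_space d \<Otimes>\<^sub>M family_space d)"
    if "i < d" "j < d" for w i j
    using wval_measurable[OF that, of w] by (simp add: case_prod_unfold)
  have F: "F \<in> borel_measurable (entries_space d \<Otimes>\<^sub>M family_space d)"
    unfolding F_def[abs_def] wtr_def
    by (intro borel_measurable_times borel_measurable_prod_mset borel_measurable_diff borel_measurable_sum borel_measurable_const V ab) auto
  have A: "mat d d (Y \<omega> i) = A i \<omega>" if "\<omega> \<in> space M" for i \<omega>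
    using A_carrier[OF that] by (simp add: Y_def mat_entries_eq_mat)
  have FP: "F (mat_entries d P, Y \<omega>) = wval d (\<lambda>i j. P $$ (i, j)) (Df \<omega>) G b a * (\<Prod>u\<in>#us. wtr d (\<lambda>i j. P $$ (i, j)) (Df \<omega>) u - c u)"
    if "\<omega> \<in> space M" for P \<omega>
  proof -
    have "wval d (\<lambda>i j. mat_entries d P (i, j)) (Df \<omega>) w i j = wval d (\<lambda>i j. P $$ (i, j)) (Df \<omega>) w i j" if "i < d" for w i j
      by (rule wval_cong) (simp_all add: mat_entries_def that)
    then show ?thesis using ab by (simp add: F_def A[OF that] Df_def[symmetric] wtr_def)
  qed
  have "(\<integral>\<omega>. F (mat_entries d (rot_mat d a b t * Q \<omega>), Y \<omega>) \<partial>M) = (\<integral>\<omega>. F (X \<omega>, Y \<omega>) \<partial>M)"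
    by (rule invariance(1)[OF rot_mat_orthogonal[OF ab] F])
  moreover have "(\<integral>\<omega>. F (mat_entries d (rot_mat d a b t * Q \<omega>), Y \<omega>) \<partial>M) =
    (\<integral>\<omega>. wval d (qt a b t \<omega>) (Df \<omega>) G b a * (\<Prod>u\<in>#us. wtr d (qt a b t \<omega>) (Df \<omega>) u - c u) \<partial>M)"
    by (rule Bochner_Integration.integral_cong) (simp_all add: FP qt_def[abs_def])
  moreover have "(\<integral>\<omega>. F (X \<omega>, Y \<omega>) \<partial>M) = (\<integral>\<omega>. wval d (qf \<omega>) (Df \<omega>) G b a * (\<Prod>u\<in>#us. T u \<omega> - c u) \<partial>M)"
    by (rule Bochner_Integration.integral_cong) (simp_all add: FP X_def qf_def[abs_def] T_def)
  ultimately show ?thesis by simp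
qed

end

definition H :: "('i oword \<Rightarrow> complex) \<Rightarrow> 'i oword multiset \<Rightarrow> 'w \<Rightarrow> complex" where
  "H c us \<omega> = (\<Prod>u\<in>#us. T u \<omega> - c u)"

lemma nice_H: "nice (H c us)"
  unfolding H_def[abs_def] by (intro nice_prod_mset nice_diff nice_T) auto

lemma integral_sum_list:
  "(\<And>x. x \<in> set xs \<Longrightarrow> nice (f x)) \<Longrightarrow> (\<integral>\<omega>. (\<Sum>x\<leftarrow>xs. f x \<omega>) \<partial>M) = (\<Sum>x\<leftarrow>xs. \<integral>\<omega>. f x \<omega> \<partial>M)"
  by (induction xs) (auto simp: nice_integrable nice_sum_list)

lemma integral_sum_mset:
  "(\<And>x. x \<in># U \<Longrightarrow> nice (f x)) \<Longrightarrow> (\<integral>\<omega>. (\<Sum>x\<in>#U. f x \<omega>) \<partial>M) = (\<Sum>x\<in>#U. \<integral>\<omega>. f x \<omega> \<partial>M)"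
  by (induction U) (auto simp: nice_integrable nice_sum_mset)

text \<open>The test function is the entry \<open>(b, a)\<close> of \<open>G\<close> times the
  remaining factors, rotated in the plane of \<open>a\<close> and \<open>b\<close>. Its derivative
  has mean 0, and summing over \<open>a\<close> and \<open>b\<close> contracts the entries to
  traces.\<close>

theorem loop_equation:
  "(\<Sum>(s, L, R)\<leftarrow>cuts G. s * (\<integral>\<omega>. (T (L @ owt R) \<omega> - T L \<omega> * T R \<omega>) * H c us \<omega> \<partial>M)) +
   (\<Sum>u\<in>#us. \<Sum>(s, L, R)\<leftarrow>cuts u. s * (\<integral>\<omega>. (T (G @ owt (R @ L)) \<omega> - T (G @ R @ L) \<omega>) * H c (us - {#u#}) \<omega> \<partial>M)) = 0"
proof -
  let ?dv = "\<lambda>\<omega> a b w i j. dval d (qf \<omega>) (Df \<omega>) a b w i j"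
  let ?V = "\<lambda>\<omega> w i j. wval d (qf \<omega>) (Df \<omega>) w i j"
  define K where "K a b \<omega> = ?dv \<omega> a b G b a * H c us \<omega> +
     ?V \<omega> G b a * (\<Sum>u\<in>#us. (\<Sum>i<d. ?dv \<omega> a b u i i) * H c (us - {#u#}) \<omega>)" for a b \<omega>
  have nd: "nice (\<lambda>\<omega>. ?dv \<omega> a b w i j)" if "a < d" "b < d" "i < d" "j < d" for a b w i j
    unfolding dval_def dterm_def case_prod_unfold
    by (intro nice_sum_list nice_mult nice_diff nice_wval nice_const that)
  have nK: "nice (K a b)" if "a < d" "b < d" for a b
    unfolding K_def[abs_def]
    by (intro nice_add nice_mult nice_sum_mset nice_sum nd nice_wval nice_H that) auto
  have K0: "(\<integral>\<omega>. K a b \<omega> \<partial>M) = 0" if ab: "a < d" "b < d" for a b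
  \<comment> \<open>For \<open>a = b\<close> there is no rotation, but the skew derivative is 0, so
    the sum may run over all pairs.\<close>
  proof (cases "a = b")
    case True
    have "?dv \<omega> a b w i j = 0" for \<omega> w i j
      unfolding True dval_def dterm_def by (simp add: case_prod_unfold)
    then show ?thesis by (simp add: K_def)
  next
    case False
    show ?thesis unfolding K_def H_def
      by (rule dl_integral_0[OF dl_product[OF ab False]])
        (simp only: product_invariant[OF ab False])
  qed
  have sum_mset_swap: "(\<Sum>b\<in>B. \<Sum>u\<in>#us. f b u) = (\<Sum>u\<in>#us. \<Sum>b\<in>B. (f b u :: complex))" for f and B :: "nat set"
    by (induction us) (simp_all add: sum.distrib)
  have "(\<Sum>a<d. \<Sum>b<d. K a b \<omega>) =
    (\<Sum>(s, L, R)\<leftarrow>cuts G. s * ((T (L @ owt R) \<omega> - T L \<omega> * T R \<omega>) * H c us \<omega>)) +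
    (\<Sum>u\<in>#us. \<Sum>(s, L, R)\<leftarrow>cuts u. s * ((T (G @ owt (R @ L)) \<omega> - T (G @ R @ L) \<omega>) * H c (us - {#u#}) \<omega>))"
    if "\<omega> \<in> space M" for \<omega>
  proof -
    note contract = word_values.contract_self[OF word_values_at[OF that]] word_values.contract_other[OF word_values_at[OF that]]
    have 1: "(\<Sum>a<d. \<Sum>b<d. ?dv \<omega> a b G b a * H c us \<omega>) = (\<Sum>(s, L, R)\<leftarrow>cuts G. s * ((T (L @ owt R) \<omega> - T L \<omega> * T R \<omega>) * H c us \<omega>))"
      unfolding sum_distrib_right[symmetric] contract(1) T_def
      by (simp add: sum_list_mult_const[symmetric] case_prod_unfold mult.assoc)
    have "(\<Sum>a<d. \<Sum>b<d. ?V \<omega> G b a * (\<Sum>u\<in>#us. (\<Sum>i<d. ?dv \<omega> a b u i i) * H c (us - {#u#}) \<omega>)) =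
      (\<Sum>a<d. \<Sum>b<d. \<Sum>u\<in>#us. ?V \<omega> G b a * (\<Sum>i<d. ?dv \<omega> a b u i i) * H c (us - {#u#}) \<omega>)"
    proof -
      have "v * (\<Sum>u\<in>#us. g u * h u) = (\<Sum>u\<in>#us. v * g u * (h u :: complex))" for v g h
        by (induction us) (simp_all add: distrib_left mult.assoc)
      then show ?thesis by simp
    qed
    also have "\<dots> = (\<Sum>u\<in>#us. (\<Sum>a<d. \<Sum>b<d. ?V \<omega> G b a * (\<Sum>i<d. ?dv \<omega> a b u i i)) * H c (us - {#u#}) \<omega>)"
      by (simp add: sum_mset_swap sum_distrib_right)
    also have "\<dots> = (\<Sum>u\<in>#us. \<Sum>(s, L, R)\<leftarrow>cuts u. s * ((T (G @ owt (R @ L)) \<omega> - T (G @ R @ L) \<omega>) * H c (us - {#u#}) \<omega>))"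
      unfolding contract(2) T_def
      by (simp add: sum_list_mult_const[symmetric] case_prod_unfold mult.assoc)
    finally show ?thesis unfolding K_def sum.distrib 1 by simp
  qed
  then have "(\<integral>\<omega>. (\<Sum>a<d. \<Sum>b<d. K a b \<omega>) \<partial>M) =
    (\<integral>\<omega>. (\<Sum>x\<leftarrow>cuts G. fst x * ((T (fst (snd x) @ owt (snd (snd x))) \<omega> - T (fst (snd x)) \<omega> * T (snd (snd x)) \<omega>) * H c us \<omega>)) +
    (\<Sum>u\<in>#us. \<Sum>x\<leftarrow>cuts u. fst x * ((T (G @ owt (snd (snd x) @ fst (snd x))) \<omega> - T (G @ snd (snd x) @ fst (snd x)) \<omega>) * H c (us - {#u#}) \<omega>)) \<partial>M)"
    by (intro Bochner_Integration.integral_cong refl) (simp add: case_prod_unfold del: owt_append)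
  also have "\<dots> = (\<integral>\<omega>. (\<Sum>x\<leftarrow>cuts G. fst x * ((T (fst (snd x) @ owt (snd (snd x))) \<omega> - T (fst (snd x)) \<omega> * T (snd (snd x)) \<omega>) * H c us \<omega>)) \<partial>M) +
    (\<integral>\<omega>. (\<Sum>u\<in>#us. \<Sum>x\<leftarrow>cuts u. fst x * ((T (G @ owt (snd (snd x) @ fst (snd x))) \<omega> - T (G @ snd (snd x) @ fst (snd x)) \<omega>) * H c (us - {#u#}) \<omega>)) \<partial>M)"
    by (intro Bochner_Integration.integral_add nice_integrable nice_sum_list nice_sum_mset nice_cmult nice_mult nice_diff nice_T nice_H)
  also have "(\<integral>\<omega>. (\<Sum>x\<leftarrow>cuts G. fst x * ((T (fst (snd x) @ owt (snd (snd x))) \<omega> - T (fst (snd x)) \<omega> * T (snd (snd x)) \<omega>) * H c us \<omega>)) \<partial>M) =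
     (\<Sum>x\<leftarrow>cuts G. fst x * (\<integral>\<omega>. (T (fst (snd x) @ owt (snd (snd x))) \<omega> - T (fst (snd x)) \<omega> * T (snd (snd x)) \<omega>) * H c us \<omega> \<partial>M))"
    by (subst integral_sum_list) (auto intro!: nice_cmult nice_mult nice_diff nice_T nice_H)
  also have "(\<integral>\<omega>. (\<Sum>u\<in>#us. \<Sum>x\<leftarrow>cuts u. fst x * ((T (G @ owt (snd (snd x) @ fst (snd x))) \<omega> - T (G @ snd (snd x) @ fst (snd x)) \<omega>) * H c (us - {#u#}) \<omega>)) \<partial>M) =
     (\<Sum>u\<in>#us. \<Sum>x\<leftarrow>cuts u. fst x * (\<integral>\<omega>. (T (G @ owt (snd (snd x) @ fst (snd x))) \<omega> - T (G @ snd (snd x) @ fst (snd x)) \<omega>) * H c (us - {#u#}) \<omega> \<partial>M))"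
    by (subst integral_sum_mset, intro nice_sum_list nice_cmult nice_mult nice_diff nice_T nice_H,
      subst integral_sum_list) (auto intro!: nice_cmult nice_mult nice_diff nice_T nice_H)
  also have "(\<integral>\<omega>. (\<Sum>a<d. \<Sum>b<d. K a b \<omega>) \<partial>M) = (\<Sum>a<d. \<Sum>b<d. \<integral>\<omega>. K a b \<omega> \<partial>M)"
    by (subst Bochner_Integration.integral_sum, (intro nice_integrable nice_sum nK; simp),
        intro sum.cong refl Bochner_Integration.integral_sum nice_integrable nK) auto
  also have "\<dots> = 0" by (simp add: K0)
  finally show ?thesis by (simp add: case_prod_unfold)
qed

definition mean :: "'i oword \<Rightarrow> complex" where
  "mean w = (\<integral>\<omega>. T w \<omega> \<partial>M)"

definition CC :: "'i oword multiset \<Rightarrow> complex" where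
  "CC U = (\<integral>\<omega>. H mean U \<omega> \<partial>M)"

lemma T_teq: "\<omega> \<in> space M \<Longrightarrow> teq u v \<Longrightarrow> T u \<omega> = T v \<omega>"
  unfolding T_def by (rule word_values.teq_wtr[OF word_values_at])

lemma mean_teq: "teq u v \<Longrightarrow> mean u = mean v"
  unfolding mean_def by (rule Bochner_Integration.integral_cong) (simp_all add: T_teq)

lemma CC_teq: "teq u v \<Longrightarrow> CC (add_mset u U) = CC (add_mset v U)"
  unfolding CC_def H_def by (rule Bochner_Integration.integral_cong) (simp_all add: T_teq mean_teq)

lemma CC_empty: "CC {#} = 1"
  by (simp add: CC_def H_def prob_space)

lemma CC_single: "CC {#w#} = 0"
  by (simp add: CC_def H_def mean_def nice_integrable nice_T prob_space)

lemma T_Nil: "T [] \<omega> = of_nat d"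
  by (simp add: T_def wtr_def)

lemma mean_Nil: "mean [] = of_nat d"
  by (simp add: mean_def T_Nil prob_space)

lemma mean_affine: "mean (Coef (p + Poly_Mapping.single 0 c) # w) = mean (Coef p # w) + c * mean w"
proof -
  have "mean (Coef (p + Poly_Mapping.single 0 c) # w) = (\<integral>\<omega>. T (Coef p # w) \<omega> + c * T w \<omega> \<partial>M)"
    unfolding mean_def T_def
    by (rule Bochner_Integration.integral_cong) (simp_all add: word_values.wtr_affine[OF word_values_at])
  then show ?thesis by (simp add: mean_def nice_integrable nice_T)
qed

lemma H_add: "H mean (add_mset w U) \<omega> = (T w \<omega> - mean w) * H mean U \<omega>"
  by (simp add: H_def)

lemma integral_TH: "(\<integral>\<omega>. T w \<omega> * H mean U \<omega> \<partial>M) = CC (add_mset w U) + mean w * CC U"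
proof -
  have "(\<integral>\<omega>. T w \<omega> * H mean U \<omega> \<partial>M) = (\<integral>\<omega>. H mean (add_mset w U) \<omega> + mean w * H mean U \<omega> \<partial>M)"
    by (rule Bochner_Integration.integral_cong) (simp_all add: H_add algebra_simps)
  also have "\<dots> = CC (add_mset w U) + mean w * CC U"
    by (simp add: CC_def nice_integrable nice_H nice_cmult)
  finally show ?thesis .
qed

lemma integral_TTH: "(\<integral>\<omega>. T v \<omega> * T w \<omega> * H mean U \<omega> \<partial>M) =
  CC (add_mset v (add_mset w U)) + mean v * CC (add_mset w U) + mean w * CC (add_mset v U) + mean v * mean w * CC U"
proof -
  have "(\<integral>\<omega>. T v \<omega> * T w \<omega> * H mean U \<omega> \<partial>M) = (\<integral>\<omega>. T v \<omega> * H mean (add_mset w U) \<omega> + mean w * (T v \<omega> * H mean U \<omega>) \<partial>M)"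
    by (rule Bochner_Integration.integral_cong) (simp_all add: H_add algebra_simps)
  also have "\<dots> = (\<integral>\<omega>. T v \<omega> * H mean (add_mset w U) \<omega> \<partial>M) + mean w * (\<integral>\<omega>. T v \<omega> * H mean U \<omega> \<partial>M)"
    by (subst Bochner_Integration.integral_add) (simp_all add: nice_integrable nice_H nice_T nice_mult nice_cmult)
  finally show ?thesis by (simp add: integral_TH algebra_simps)
qed

lemma split_term: "(\<integral>\<omega>. (T x \<omega> - T v \<omega> * T w \<omega>) * H mean U \<omega> \<partial>M) =
  CC (add_mset x U) + mean x * CC U -
  (CC (add_mset v (add_mset w U)) + mean v * CC (add_mset w U) + mean w * CC (add_mset v U) + mean v * mean w * CC U)"
proof -
  have "(\<integral>\<omega>. (T x \<omega> - T v \<omega> * T w \<omega>) * H mean U \<omega> \<partial>M) = (\<integral>\<omega>. T x \<omega> * H mean U \<omega> - T v \<omega> * T w \<omega> * H mean U \<omega> \<partial>M)"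
    by (simp add: left_diff_distrib)
  also have "\<dots> = (\<integral>\<omega>. T x \<omega> * H mean U \<omega> \<partial>M) - (\<integral>\<omega>. T v \<omega> * T w \<omega> * H mean U \<omega> \<partial>M)"
    by (intro Bochner_Integration.integral_diff nice_integrable nice_mult nice_T nice_H)
  finally show ?thesis unfolding integral_TH integral_TTH .
qed

lemma merge_term: "(\<integral>\<omega>. (T x \<omega> - T y \<omega>) * H mean U \<omega> \<partial>M) =
  CC (add_mset x U) + mean x * CC U - CC (add_mset y U) - mean y * CC U"
proof -
  have "(\<integral>\<omega>. (T x \<omega> - T y \<omega>) * H mean U \<omega> \<partial>M) = (\<integral>\<omega>. T x \<omega> * H mean U \<omega> - T y \<omega> * H mean U \<omega> \<partial>M)"
    by (simp add: left_diff_distrib)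
  also have "\<dots> = (\<integral>\<omega>. T x \<omega> * H mean U \<omega> \<partial>M) - (\<integral>\<omega>. T y \<omega> * H mean U \<omega> \<partial>M)"
    by (intro Bochner_Integration.integral_diff nice_integrable nice_mult nice_T nice_H)
  finally show ?thesis unfolding integral_TH by simp
qed

text \<open>The cut in front of the leading \<open>Orth\<close> has \<open>L = []\<close>. It gives
  the trace of the transpose of \<open>Orth # V\<close> minus \<open>d\<close> times the trace of
  \<open>Orth # V\<close>, which is the left-hand side with reversed sign.\<close>

lemma loop_moments:
  "(of_nat d - 1) * (CC (add_mset (Orth # V) us) + mean (Orth # V) * CC us) =
    (\<Sum>(s, L, R)\<leftarrow>cuts V. s * (CC (add_mset (Orth # L @ owt R) us) + mean (Orth # L @ owt R) * CC us -
      (CC (add_mset (Orth # L) (add_mset R us)) + mean (Orth # L) * CC (add_mset R us) + mean R * CC (add_mset (Orth # L) us) + mean (Orth # L) * mean R * CC us))) +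
    (\<Sum>u\<in>#us. \<Sum>(s, L, R)\<leftarrow>cuts u. s *
      (CC (add_mset (Orth # V @ owt (R @ L)) (us - {#u#})) + mean (Orth # V @ owt (R @ L)) * CC (us - {#u#})
      - CC (add_mset (Orth # V @ R @ L) (us - {#u#})) - mean (Orth # V @ R @ L) * CC (us - {#u#})))"
proof -
  let ?G = "Orth # V"
  have "(\<integral>\<omega>. (T ([] @ owt ?G) \<omega> - T [] \<omega> * T ?G \<omega>) * H mean us \<omega> \<partial>M) = (\<integral>\<omega>. (1 - of_nat d) * (T ?G \<omega> * H mean us \<omega>) \<partial>M)"
  proof (rule Bochner_Integration.integral_cong)
    fix \<omega> assume "\<omega> \<in> space M"
    from T_teq[OF this teq_transp[of ?G]] show "(T ([] @ owt ?G) \<omega> - T [] \<omega> * T ?G \<omega>) * H mean us \<omega> = (1 - of_nat d) * (T ?G \<omega> * H mean us \<omega>)"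
      by (simp add: T_Nil algebra_simps)
  qed simp
  also have "\<dots> = (1 - of_nat d) * (CC (add_mset ?G us) + mean ?G * CC us)"
    by (simp add: integral_TH)
  finally have first: "(\<integral>\<omega>. (T ([] @ owt ?G) \<omega> - T [] \<omega> * T ?G \<omega>) * H mean us \<omega> \<partial>M) = (1 - of_nat d) * (CC (add_mset ?G us) + mean ?G * CC us)" .
  have cuts: "cuts ?G = (1, [], ?G) # map (\<lambda>(s, L, R). (s, Orth # L, R)) (cuts V)" by simp
  have eq0: "(1 - of_nat d) * (CC (add_mset ?G us) + mean ?G * CC us) +
    (\<Sum>(s, L, R)\<leftarrow>cuts V. s * (\<integral>\<omega>. (T ((Orth # L) @ owt R) \<omega> - T (Orth # L) \<omega> * T R \<omega>) * H mean us \<omega> \<partial>M)) +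
    (\<Sum>u\<in>#us. \<Sum>(s, L, R)\<leftarrow>cuts u. s * (\<integral>\<omega>. (T (?G @ owt (R @ L)) \<omega> - T (?G @ R @ L) \<omega>) * H mean (us - {#u#}) \<omega> \<partial>M)) = 0"
    using loop_equation[of mean us ?G] unfolding cuts
    by (simp add: first[simplified] comp_def case_prod_unfold del: cuts.simps owt_append)
  have "(of_nat d - 1) * x = y" if "(1 - of_nat d) * x + y = 0" for x y :: complex
  proof -
    have "(of_nat d - 1) * x = - ((1 - of_nat d) * x)" by (simp add: algebra_simps)
    also have "\<dots> = y" using that by (simp add: add_eq_0_iff)
    finally show ?thesis .
  qed
  from this[OF eq0[unfolded split_term merge_term add.assoc]] show ?thesis
    by (simp add: add.assoc)
qed

lemma mean_loop:
  "(of_nat d - 1) * mean (Orth # V) = (\<Sum>(s, L, R)\<leftarrow>cuts V. s * (mean (Orth # L @ owt R) - CC {#Orth # L, R#} - mean (Orth # L) * mean R))"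
  using loop_moments[of V "{#}"] by (simp add: CC_empty CC_single diff_diff_eq)

text \<open>Subtracting \<open>mean_loop\<close> times \<open>CC us\<close> removes the products of
  two means, which are of order d^2, and leaves the correction
  \<open>CC {#Orth # L, R#} * CC us\<close>.\<close>

lemma CC_loop:
  "(of_nat d - 1) * CC (add_mset (Orth # V) us) =
    (\<Sum>(s, L, R)\<leftarrow>cuts V. s * (CC (add_mset (Orth # L @ owt R) us) - CC (add_mset (Orth # L) (add_mset R us))
      + CC {#Orth # L, R#} * CC us - mean (Orth # L) * CC (add_mset R us) - mean R * CC (add_mset (Orth # L) us))) +
    (\<Sum>u\<in>#us. \<Sum>(s, L, R)\<leftarrow>cuts u. s *
      (CC (add_mset (Orth # V @ owt (R @ L)) (us - {#u#})) + mean (Orth # V @ owt (R @ L)) * CC (us - {#u#})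
      - CC (add_mset (Orth # V @ R @ L) (us - {#u#})) - mean (Orth # V @ R @ L) * CC (us - {#u#})))"
    (is "_ = ?S + ?M")
proof -
  have e: "(of_nat d - 1) * (mean (Orth # V) * CC us) = (\<Sum>(s, L, R)\<leftarrow>cuts V. CC us * (s * (mean (Orth # L @ owt R) - CC {#Orth # L, R#} - mean (Orth # L) * mean R)))"
  proof -
    have "(of_nat d - 1) * (mean (Orth # V) * CC us) = CC us * ((of_nat d - 1) * mean (Orth # V))" by simp
    also have "\<dots> = (\<Sum>(s, L, R)\<leftarrow>cuts V. CC us * (s * (mean (Orth # L @ owt R) - CC {#Orth # L, R#} - mean (Orth # L) * mean R)))"
      unfolding mean_loop by (rule sum_triples_cong) simp
    finally show ?thesis .
  qed
  have "(of_nat d - 1) * CC (add_mset (Orth # V) us) =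
    (of_nat d - 1) * (CC (add_mset (Orth # V) us) + mean (Orth # V) * CC us) - (of_nat d - 1) * (mean (Orth # V) * CC us)"
    by (simp add: algebra_simps)
  also have "\<dots> = ?S + ?M"
  proof -
    have d: "(\<Sum>(s, L, R)\<leftarrow>xs. f s L R) - (\<Sum>(s, L, R)\<leftarrow>xs. g s L R) = (\<Sum>(s, L, R)\<leftarrow>xs. (f s L R - g s L R :: complex))"
      for xs :: "(complex \<times> 'i oword \<times> 'i oword) list" and f g
      by (induction xs) auto
    have sw: "x + m - y = (x - y) + (m :: complex)" for x m y by simp
    show ?thesis
      unfolding loop_moments e sw d
      by (intro arg_cong2[where f = "(+)"] refl sum_triples_cong') (simp add: algebra_simps)
  qed
  finally show ?thesis .
qed

end

section \<open>Cumulants and covariances of random variables\<close>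

definition mom :: "'w measure \<Rightarrow> (nat \<Rightarrow> 'w \<Rightarrow> complex) \<Rightarrow> nat set \<Rightarrow> complex" where
  "mom N X B = (\<integral>\<omega>. (\<Prod>i\<in>B. X i \<omega>) \<partial>N)"

context prob_space
begin

lemma mom_split: "finite B \<Longrightarrow> j \<in> B \<Longrightarrow> mom M (X(j := f)) B = (\<integral>\<omega>. f \<omega> * (\<Prod>i\<in>B - {j}. X i \<omega>) \<partial>M)"
  unfolding mom_def
  by (intro Bochner_Integration.integral_cong refl) (simp add: prod.remove[of B j])

lemma mom_other: "j \<notin> B \<Longrightarrow> mom M (X(j := f)) B = mom M X B"
  unfolding mom_def by (intro Bochner_Integration.integral_cong refl prod.cong) auto

lemma mom_cong: "(\<And>i \<omega>. i \<in> B \<Longrightarrow> \<omega> \<in> space M \<Longrightarrow> X i \<omega> = X' i \<omega>) \<Longrightarrow> mom M X B = mom M X' B"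
  unfolding mom_def by (intro Bochner_Integration.integral_cong refl prod.cong) auto

lemma mom_empty [simp]: "mom M X {} = 1"
  by (simp add: mom_def prob_space)

lemma cumul_mom_slot:
  assumes S: "finite S" "j \<in> S" and X: "\<And>i. i \<in> S \<Longrightarrow> nice (X i)" "nice f" "nice g"
  shows "cumul (mom M (X(j := (\<lambda>\<omega>. a * f \<omega> + b * g \<omega>)))) S = a * cumul (mom M (X(j := f))) S + b * cumul (mom M (X(j := g))) S"
proof (rule cumul_slot[OF S])
  fix B assume B: "B \<subseteq> S" "j \<in> B"
  have fB: "finite B" using finite_subset[OF B(1) S(1)] .
  have n: "nice (\<lambda>\<omega>. \<Prod>i\<in>B - {j}. X i \<omega>)" using B X(1) by (intro nice_prod) auto
  have "(\<integral>\<omega>. (a * f \<omega> + b * g \<omega>) * (\<Prod>i\<in>B - {j}. X i \<omega>) \<partial>M) =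
    (\<integral>\<omega>. a * (f \<omega> * (\<Prod>i\<in>B - {j}. X i \<omega>)) + b * (g \<omega> * (\<Prod>i\<in>B - {j}. X i \<omega>)) \<partial>M)"
    by (simp add: algebra_simps)
  also have "\<dots> = a * (\<integral>\<omega>. f \<omega> * (\<Prod>i\<in>B - {j}. X i \<omega>) \<partial>M) + b * (\<integral>\<omega>. g \<omega> * (\<Prod>i\<in>B - {j}. X i \<omega>) \<partial>M)"
    using X n by (subst Bochner_Integration.integral_add) (auto intro!: nice_integrable nice_cmult nice_mult)
  finally show "mom M (X(j := (\<lambda>\<omega>. a * f \<omega> + b * g \<omega>))) B = a * mom M (X(j := f)) B + b * mom M (X(j := g)) B"
    unfolding mom_split[OF fB B(2)] .
qed (simp_all add: mom_other)

lemma cumul_mom_const: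
  assumes "finite S" "j \<in> S" "card S \<ge> 2"
  shows "cumul (mom M (X(j := (\<lambda>_. c)))) S = 0"
proof (rule cumul_const[OF assms(1,2,3)])
  fix B assume B: "j \<in> B" "B \<subseteq> S"
  then have "finite B" using finite_subset assms(1) by blast
  then show "mom M (X(j := (\<lambda>_. c))) B = c * mom M (X(j := (\<lambda>_. c))) (B - {j})"
    using B by (simp add: mom_split mom_other) (simp add: mom_def)
qed simp

text \<open>Centring one variable at a time: by multilinearity each change is a multiple of a
  cumulant with a constant entry, which is 0 from order 2 on.\<close>

lemma cumul_mom_shift:
  assumes S: "finite S" "card S \<ge> 2" and X: "\<And>i. i \<in> S \<Longrightarrow> nice (X i)"
  shows "cumul (mom M (\<lambda>i \<omega>. X i \<omega> - c i)) S = cumul (mom M X) S"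
proof -
  have "cumul (mom M (\<lambda>i \<omega>. if i \<in> I then X i \<omega> - c i else X i \<omega>)) S = cumul (mom M X) S" if "finite I" "I \<subseteq> S" for I
    using that
  proof (induction I)
    case (insert j I)
    let ?Y = "\<lambda>i \<omega>. if i \<in> I then X i \<omega> - c i else X i \<omega>"
    have nY: "nice (?Y i)" if "i \<in> S" for i
      using X[OF that] nice_diff[OF X[OF that], of "\<lambda>_. c i"] by (cases "i \<in> I") auto
    have j: "j \<in> S" using insert by auto
    have "(\<lambda>i \<omega>. if i \<in> insert j I then X i \<omega> - c i else X i \<omega>) = ?Y(j := (\<lambda>\<omega>. 1 * X j \<omega> + (- c j) * 1))"
      using insert by (auto simp: fun_eq_iff)
    then have "cumul (mom M (\<lambda>i \<omega>. if i \<in> insert j I then X i \<omega> - c i else X i \<omega>)) S =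
      1 * cumul (mom M (?Y(j := X j))) S + (- c j) * cumul (mom M (?Y(j := (\<lambda>_. 1)))) S"
      using cumul_mom_slot[OF S(1) j nY X[OF j] nice_const[of 1], where a = 1 and b = "- c j"] by simp
    also have "cumul (mom M (?Y(j := (\<lambda>_. 1)))) S = 0" by (rule cumul_mom_const[OF S(1) j S(2)])
    also have "?Y(j := X j) = ?Y" using insert by (auto simp: fun_eq_iff)
    finally show ?case using insert by simp
  qed simp
  from this[of S] S(1) have "cumul (mom M (\<lambda>i \<omega>. if i \<in> S then X i \<omega> - c i else X i \<omega>)) S = cumul (mom M X) S" by simp
  moreover have "cumul (mom M (\<lambda>i \<omega>. if i \<in> S then X i \<omega> - c i else X i \<omega>)) S = cumul (mom M (\<lambda>i \<omega>. X i \<omega> - c i)) S"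
    by (rule cumul_cong) (auto intro!: mom_cong)
  ultimately show ?thesis by simp
qed

lemma covariance_add:
  assumes "nice X" "nice X'" "nice Y"
  shows "covariance M (\<lambda>\<omega>. X \<omega> + X' \<omega>) Y = covariance M X Y + covariance M X' Y"
  using assms by (simp add: covariance_def distrib_right nice_integrable nice_mult)

lemma covariance_smul: "covariance M (\<lambda>\<omega>. c * X \<omega>) Y = c * covariance M X Y"
  by (simp add: covariance_def algebra_simps)

lemma covariance_const: "nice Y \<Longrightarrow> covariance M (\<lambda>_. c) Y = 0"
  by (simp add: covariance_def prob_space)

end

lemma covariance_sym: "covariance M X Y = covariance M Y X"
  by (simp add: covariance_def mult.commute)

lemma (in word_values) wval_coefs:
  "i < d \<Longrightarrow> j < d \<Longrightarrow> (\<And>i j. i < d \<Longrightarrow> j < d \<Longrightarrow> D 1 i j = (if i = j then 1 else 0)) \<Longrightarrow>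
    wval d q D (map Coef ps) i j = D (prod_list ps) i j"
  by (induction ps arbitrary: i) (simp_all add: D_mult)

lemma odeg_0_coefs: "odeg w = 0 \<Longrightarrow> \<exists>ps. w = map Coef ps"
proof (induction w)
  case (Cons l w)
  then show ?case by (cases l) (auto intro: exI[of _ "_ # _"])
qed simp

section \<open>The joint ensemble and its polynomial traces\<close>

context haar_ensemble
begin

definition J :: "'w \<Rightarrow> 'i + unit \<Rightarrow> complex mat" where
  "J \<omega> = (\<lambda>x. case_sum A (\<lambda>_ \<omega>. map_mat complex_of_real (Q \<omega>)) x \<omega>)"

definition TJ :: "('i + unit) ncpoly \<Rightarrow> 'w \<Rightarrow> complex" where
  "TJ p \<omega> = mat_trace (mat_eval d (J \<omega>) p)"

lemma J_simps: "J \<omega> (Inl i) = A i \<omega>" "J \<omega> (Inr u) = map_mat complex_of_real (Q \<omega>)"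
  by (simp_all add: J_def)

lemma J_fam: "\<omega> \<in> space M \<Longrightarrow> mat_family d (J \<omega>)"
proof
  fix x :: "'i + unit" assume "\<omega> \<in> space M"
  then show "J \<omega> x \<in> carrier_mat d d" using A_carrier Q_carrier by (cases x) (auto simp: J_simps)
qed

lemma J_random: "random_matrix M d (case_sum A (\<lambda>_ \<omega>. map_mat complex_of_real (Q \<omega>)) x)"
proof (cases x)
  case (Inr u)
  have "nice (\<lambda>\<omega>. map_mat complex_of_real (Q \<omega>) $$ (r, c))" if "r < d" "c < d" for r c
    using nice_qf[OF that] by (rule nice_cong[THEN iffD1, rotated]) (use that in \<open>simp add: qf_def carrier_matD[OF Q_carrier]\<close>)
  then show ?thesis using Inr Q_carrier by (auto simp: random_matrix_def nice_def)
qed (simp add: rand)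

lemma mat_word_J:
  assumes \<omega>: "\<omega> \<in> space M" and ij: "i < d" "j < d"
  shows "mat_word d (J \<omega>) w $$ (i, j) = wval d (qf \<omega>) (Df \<omega>) (to_oword w) i j"
proof -
  interpret F: mat_family d "J \<omega>" by (rule J_fam[OF \<omega>])
  interpret G: mat_family d "\<lambda>i. A i \<omega>" by (rule fam[OF \<omega>])
  have "mat_word d (J \<omega>) (Word ls) $$ (i, j) = wval d (qf \<omega>) (Df \<omega>) (map to_oletter ls) i j" if "i < d" "j < d" for ls i j
    using that
  proof (induction ls arbitrary: i)
    case Nil
    then show ?case by (simp add: F.mat_word_simps)
  next
    case (Cons l ls)
    have l: "letter_value transpose_mat (J \<omega>) l $$ (i, k) = lval (qf \<omega>) (Df \<omega>) (to_oletter l) i k" if "k < d" for k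
      using Cons.prems that Q_carrier[OF \<omega>] A_carrier[OF \<omega>]
      by (cases l rule: to_oletter.cases) (auto simp: J_simps Df_def qf_def G.ment_var G.ment_transpose carrier_matD[OF A_carrier[OF \<omega>]])
    show ?case
      using Cons l by (simp add: F.mat_word_simps F.entry_mult[OF F.letter_carrier F.mat_word_carrier])
  qed
  from this[OF ij, of "letters w"] show ?thesis by (simp add: to_oword_def)
qed

lemma TJ_add: "\<omega> \<in> space M \<Longrightarrow> TJ (p + q) \<omega> = TJ p \<omega> + TJ q \<omega>"
  using mat_family.ment_add[OF J_fam] by (simp add: TJ_def mat_family.mat_trace_eval[OF J_fam] sum.distrib)

lemma TJ_smul: "\<omega> \<in> space M \<Longrightarrow> TJ (nc_smul c p) \<omega> = c * TJ p \<omega>"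
  using mat_family.ment_smul[OF J_fam] by (simp add: TJ_def mat_family.mat_trace_eval[OF J_fam] sum_distrib_left)

lemma TJ_trace: "\<omega> \<in> space M \<Longrightarrow> TJ (p * q) \<omega> = TJ (q * p) \<omega>"
proof -
  assume \<omega>: "\<omega> \<in> space M"
  note [simp] = mat_family.ment_mult[OF J_fam[OF \<omega>]] mat_family.mat_trace_eval[OF J_fam[OF \<omega>]]
  have "TJ (p * q) \<omega> = (\<Sum>i<d. \<Sum>k<d. ment d (J \<omega>) p i k * ment d (J \<omega>) q k i)" by (simp add: TJ_def)
  also have "\<dots> = (\<Sum>k<d. \<Sum>i<d. ment d (J \<omega>) p i k * ment d (J \<omega>) q k i)" by (rule sum.swap)
  also have "\<dots> = TJ (q * p) \<omega>" by (simp add: TJ_def mult.commute)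
  finally show ?thesis .
qed

lemma TJ_transpose: "\<omega> \<in> space M \<Longrightarrow> TJ (nc_transpose p) \<omega> = TJ p \<omega>"
  using mat_family.ment_transpose[OF J_fam] by (simp add: TJ_def mat_family.mat_trace_eval[OF J_fam])

lemma TJ_one: "\<omega> \<in> space M \<Longrightarrow> TJ 1 \<omega> = of_nat d"
  using mat_family.ment_one[OF J_fam] by (simp add: TJ_def mat_family.mat_trace_eval[OF J_fam])

lemma TJ_single: "\<omega> \<in> space M \<Longrightarrow> TJ (Poly_Mapping.single w c) \<omega> = c * T (to_oword w) \<omega>"
  using mat_family.ment_single[OF J_fam]
  by (simp add: TJ_def mat_family.mat_trace_eval[OF J_fam] mat_word_J T_def wtr_def sum_distrib_left)

lemma nice_TJ: "nice (TJ p)"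
proof (induction p rule: ncpoly_induct)
  case (single w c)
  show ?case
    using nice_cmult[OF nice_T, of c "to_oword w"] by (rule nice_cong[THEN iffD1, rotated]) (simp add: TJ_single)
next
  case (add p q)
  show ?case
    using nice_add[OF add] by (rule nice_cong[THEN iffD1, rotated]) (simp add: TJ_add)
qed

lemma T_coefs: "\<omega> \<in> space M \<Longrightarrow> T (map Coef ps) \<omega> = mat_trace (mat_eval d (\<lambda>i. A i \<omega>) (prod_list ps))"
proof -
  assume \<omega>: "\<omega> \<in> space M"
  have "wval d (qf \<omega>) (Df \<omega>) (map Coef ps) i j = Df \<omega> (prod_list ps) i j" if "i < d" "j < d" for i j
    by (rule word_values.wval_coefs[OF word_values_at[OF \<omega>] that]) (simp add: Df_def mat_family.ment_one[OF fam[OF \<omega>]])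
  then show ?thesis by (simp add: T_def wtr_def mat_family.mat_trace_eval[OF fam[OF \<omega>]] Df_def)
qed

lemma CC_mom: "CC (image_mset W (mset_set B)) = mom M (\<lambda>i \<omega>. T (W i) \<omega> - mean (W i)) B"
  by (simp add: CC_def H_def mom_def image_mset.compositionality comp_def prod_unfold_prod_mset)

lemma CC_pair: "CC {#u, v#} = covariance M (T u) (T v)"
proof -
  have "CC {#u, v#} = (\<integral>\<omega>. T u \<omega> * H mean {#v#} \<omega> \<partial>M)"
    using integral_TH[of u "{#v#}"] by (simp add: CC_single)
  also have "\<dots> = (\<integral>\<omega>. T u \<omega> * T v \<omega> - mean v * T u \<omega> \<partial>M)" by (simp add: H_def algebra_simps)
  also have "\<dots> = (\<integral>\<omega>. T u \<omega> * T v \<omega> \<partial>M) - mean v * mean u"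
    unfolding mean_def[of u] by (subst Bochner_Integration.integral_diff) (simp_all add: nice_integrable nice_mult nice_T nice_cmult)
  finally show ?thesis by (simp add: covariance_def mean_def)
qed

text \<open>Links the two descriptions of a word, as a polynomial in the joint ensemble and as a
  list with merged coefficients: they have the same entries as matrices.\<close>

lemma word_poly_J:
  assumes space: "real_second_order_space nc_smul \<Phi> \<Phi>2 (nc_transpose :: ('i + unit) ncpoly \<Rightarrow> _)"
    and \<omega>: "\<omega> \<in> space M"
  shows "TJ (word_poly w) \<omega> = T w \<omega>"
proof -
  interpret R: real_second_order_space nc_smul \<Phi> \<Phi>2 "nc_transpose :: ('i + unit) ncpoly \<Rightarrow> _" by (rule space)
  interpret F: mat_family d "J \<omega>" by (rule J_fam[OF \<omega>])
  interpret G: mat_family d "\<lambda>i. A i \<omega>" by (rule fam[OF \<omega>])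
  have emb_word: "ment d (J \<omega>) (prod_list (map (letter_value nc_transpose (\<lambda>i. nc_var (Inl i))) ls)) i j = mat_word d (\<lambda>i. A i \<omega>) (Word ls) $$ (i, j)"
    if "i < d" "j < d" for ls i j
    using that
  proof (induction ls arbitrary: i)
    case Nil
    then show ?case by (simp add: F.ment_one G.mat_word_simps)
  next
    case (Cons l ls)
    have "ment d (J \<omega>) (letter_value nc_transpose (\<lambda>i. nc_var (Inl i)) l) i k = letter_value transpose_mat (\<lambda>i. A i \<omega>) l $$ (i, k)" if "k < d" for k
      using that Cons.prems by (cases l) (auto simp: F.ment_var F.ment_transpose J_simps carrier_matD[OF A_carrier[OF \<omega>]])
    then show ?case
      using Cons by (simp add: F.ment_mult G.mat_word_simps G.entry_mult[OF G.letter_carrier G.mat_word_carrier])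
  qed
  have emb: "ment d (J \<omega>) (emb p) i j = Df \<omega> p i j" if "i < d" "j < d" for p i j
    unfolding emb_def Df_def using that
  proof (induction p rule: ncpoly_induct)
    case (single w c)
    then show ?case by (simp add: R.ev_single F.ment_smul emb_word G.ment_single)
  qed (simp add: R.ev_add F.ment_add G.ment_add)
  have "ment d (J \<omega>) (word_poly w) i j = wval d (qf \<omega>) (Df \<omega>) w i j" if "i < d" "j < d" for i j
    using that
  proof (induction w arbitrary: i)
    case Nil
    then show ?case by (simp add: F.ment_one)
  next
    case (Cons l w)
    have "ment d (J \<omega>) (letter_poly l) i k = lval (qf \<omega>) (Df \<omega>) l i k" if "k < d" for k
      using that Cons.prems Q_carrier[OF \<omega>] by (cases l) (auto simp: F.ment_var F.ment_transpose J_simps qf_def emb)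
    then show ?case using Cons by (simp add: F.ment_mult)
  qed
  then show ?thesis by (simp add: TJ_def T_def wtr_def F.mat_trace_eval)
qed

end

lemma tendsto_cong_ge1: "(\<And>d. d \<ge> 1 \<Longrightarrow> f d = g d) \<Longrightarrow> (f \<longlonglongrightarrow> l) \<longleftrightarrow> (g \<longlonglongrightarrow> (l :: complex))"
  by (rule filterlim_cong[OF refl refl]) (auto simp: eventually_sequentially)

lemma convergent_ge1: "(\<And>d. d \<ge> 1 \<Longrightarrow> f d = g d) \<Longrightarrow> g \<longlonglongrightarrow> (l :: complex) \<Longrightarrow> convergent f"
  by (rule convergentI[OF iffD2[OF tendsto_cong_ge1]])

lemma image_mset_nth: "image_mset ((!) ws) (mset_set {..<length ws}) = mset ws"
  by (metis lessThan_atLeast0 map_nth mset_map mset_upt)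

lemma image_mset_remove:
  "finite I \<Longrightarrow> j \<in> I \<Longrightarrow> image_mset W (mset_set (I - {j})) = image_mset W (mset_set I) - {#W j#}"
  by (simp add: mset_set.remove[of I j])

text \<open>The default 1 concerns orthogonal letters, which are absent from the words of degree 0
  to which this is applied.\<close>

definition coef_prod :: "'i oword \<Rightarrow> 'i ncpoly" where
  "coef_prod w = prod_list (map (\<lambda>l. case l of Coef p \<Rightarrow> p | _ \<Rightarrow> 1) w)"

lemma coef_prod_map [simp]: "coef_prod (map Coef ps) = prod_list ps"
  by (simp add: coef_prod_def comp_def)

section \<open>The joint limit\<close>

locale haar_sequence =
  fixes M :: "nat \<Rightarrow> 'w measure"
    and A :: "nat \<Rightarrow> 'i \<Rightarrow> 'w \<Rightarrow> complex mat"
    and Q :: "nat \<Rightarrow> 'w \<Rightarrow> real mat"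
    and smul :: "complex \<Rightarrow> 'a::ring_1 \<Rightarrow> 'a"
    and \<phi> :: "'a \<Rightarrow> complex"
    and \<phi>2 :: "'a \<Rightarrow> 'a \<Rightarrow> complex"
    and t :: "'a \<Rightarrow> 'a"
    and a :: "'i \<Rightarrow> 'a"
  assumes limit: "real_second_order_limit M A smul \<phi> \<phi>2 t a"
    and haar: "\<And>d. d \<ge> 1 \<Longrightarrow> haar_orthogonal (M d) d (Q d)"
    and indep: "\<And>d. d \<ge> 1 \<Longrightarrow>
      prob_space.indep_set (M d) (sigma_entries (M d) d (\<lambda>_::unit. Q d)) (sigma_entries (M d) d (A d))"
begin

abbreviation "Tr p d \<omega> \<equiv> mat_trace (mat_eval d (\<lambda>i. A d i \<omega>) p)"
abbreviation "T d \<equiv> haar_ensemble.T d (Q d) (A d)"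
abbreviation "TJ d \<equiv> haar_ensemble.TJ d (Q d) (A d)"
abbreviation "mean d \<equiv> haar_ensemble.mean (M d) d (Q d) (A d)"
abbreviation "CC d \<equiv> haar_ensemble.CC (M d) d (Q d) (A d)"

definition \<tau> :: "nat \<Rightarrow> 'i oword \<Rightarrow> complex" where "\<tau> d w = mean d w / of_nat d"

lemma ens: "d \<ge> 1 \<Longrightarrow> haar_ensemble (M d) d (Q d) (A d)"
  using limit haar indep
  by (auto simp: real_second_order_limit_def haar_ensemble_def haar_ensemble_axioms_def)

lemma prob: "d \<ge> 1 \<Longrightarrow> prob_space (M d)"
  by (rule haar_ensemble.axioms(1)[OF ens])

lemma limits:
  "(\<lambda>d. \<integral>\<omega>. Tr p d \<omega> / of_nat d \<partial>M d) \<longlonglongrightarrow> \<phi> (nc_eval smul t a p)"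
  "(\<lambda>d. covariance (M d) (Tr p d) (Tr q d)) \<longlonglongrightarrow> \<phi>2 (nc_eval smul t a p) (nc_eval smul t a q)"
  "r \<ge> 3 \<Longrightarrow> (\<lambda>d. joint_cumulant (M d) r (\<lambda>k. Tr (ps k) d)) \<longlonglongrightarrow> 0"
  using limit by (auto simp: real_second_order_limit_def Let_def)

lemma T_coef_prod:
  assumes "d \<ge> 1" "\<omega> \<in> space (M d)" "odeg w = 0"
  shows "T d w \<omega> = Tr (coef_prod w) d \<omega>"
proof -
  from odeg_0_coefs[OF assms(3)] obtain ps where w: "w = map Coef ps" by blast
  show ?thesis using haar_ensemble.T_coefs[OF ens[OF assms(1)] assms(2), of ps] by (simp add: w)
qed

lemma \<tau>_limit_base:
  assumes "odeg w = 0"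
  shows "(\<lambda>d. \<tau> d w) \<longlonglongrightarrow> \<phi> (nc_eval smul t a (coef_prod w))"
proof -
  have "\<tau> d w = (\<integral>\<omega>. Tr (coef_prod w) d \<omega> / of_nat d \<partial>M d)" if "d \<ge> 1" for d
  proof -
    have "(\<integral>\<omega>. Tr (coef_prod w) d \<omega> / of_nat d \<partial>M d) = (\<integral>\<omega>. T d w \<omega> / of_nat d \<partial>M d)"
      by (rule Bochner_Integration.integral_cong) (simp_all add: T_coef_prod[OF that _ assms])
    then show ?thesis by (auto simp: \<tau>_def haar_ensemble.mean_def[OF ens[OF that]])
  qed
  then show ?thesis using limits(1) tendsto_cong_ge1[of "\<lambda>d. \<tau> d w"] by simp
qed

text \<open>On words of degree 0 this is the hypothesis on the ensemble, after enumerating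
  \<open>B\<close>: order 2 is a covariance, higher orders vanish.\<close>

lemma cumul_base:
  assumes B: "finite B" "card B \<ge> 2" and W: "\<And>i. i \<in> B \<Longrightarrow> odeg (W i) = 0"
  shows "\<exists>l. (\<lambda>d. cumul (mom (M d) (\<lambda>i. T d (W i))) B) \<longlonglongrightarrow> l \<and> (card B \<ge> 3 \<longrightarrow> l = 0)"
proof -
  obtain e where e: "bij_betw e {..<card B} B"
    using ex_bij_betw_nat_finite[OF B(1)] by (auto simp: lessThan_atLeast0)
  then have inj: "inj_on e {..<card B}" and im: "e ` {..<card B} = B" by (auto simp: bij_betw_def)
  define p where "p k = coef_prod (W (e k))" for k
  have eq: "cumul (mom (M d) (\<lambda>i. T d (W i))) B = joint_cumulant (M d) (card B) (\<lambda>k. Tr (p k) d)" if d: "d \<ge> 1" for d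
  proof -
    have "cumul (mom (M d) (\<lambda>i. T d (W i))) (e ` {..<card B}) = cumul (\<lambda>C. mom (M d) (\<lambda>i. T d (W i)) (e ` C)) {..<card B}"
      by (rule cumul_reindex[OF inj])
    also have "\<dots> = cumul (mom (M d) (\<lambda>k. Tr (p k) d)) {..<card B}"
    proof (rule cumul_cong)
      fix C assume C: "C \<subseteq> {..<card B}"
      have "T d (W (e k)) \<omega> = Tr (p k) d \<omega>" if "k \<in> C" "\<omega> \<in> space (M d)" for k \<omega>
        unfolding p_def using T_coef_prod[OF d that(2)] W im C that(1) by blast
      then show "mom (M d) (\<lambda>i. T d (W i)) (e ` C) = mom (M d) (\<lambda>k. Tr (p k) d) C"
        unfolding mom_def
        by (intro Bochner_Integration.integral_cong refl) (simp add: prod.reindex[OF inj_on_subset[OF inj C]])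
    qed
    finally show ?thesis by (simp add: im joint_cumulant_cumul mom_def[abs_def])
  qed
  show ?thesis
  proof (cases "card B \<ge> 3")
    case True
    have "(\<lambda>d. cumul (mom (M d) (\<lambda>i. T d (W i))) B) \<longlonglongrightarrow> 0"
      using limits(3)[OF True, of p] tendsto_cong_ge1[OF eq] by simp
    then show ?thesis by blast
  next
    case False
    with B have two: "card B = 2" by simp
    have "joint_cumulant (M d) 2 (\<lambda>k. Tr (p k) d) = covariance (M d) (Tr (p 0) d) (Tr (p 1) d)" if "d \<ge> 1" for d
    proof -
      interpret prob_space "M d" by (rule prob[OF that])
      have "{..<2} = {0, 1 :: nat}" by auto
      then show ?thesis
        unfolding joint_cumulant_cumul using cumul_pair[of 0 1 "\<lambda>B. \<integral>\<omega>. (\<Prod>i\<in>B. Tr (p i) d \<omega>) \<partial>M d"]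
        by (simp add: covariance_def prob_space)
    qed
    then have "(\<lambda>d. cumul (mom (M d) (\<lambda>i. T d (W i))) B) \<longlonglongrightarrow> \<phi>2 (nc_eval smul t a (p 0)) (nc_eval smul t a (p 1))"
      using limits(2)[of "p 0" "p 1"] tendsto_cong_ge1[OF eq] tendsto_cong_ge1[of "\<lambda>d. joint_cumulant (M d) 2 (\<lambda>k. Tr (p k) d)"]
      by (simp add: two)
    then show ?thesis using False by blast
  qed
qed

text \<open>Supplies the start of the induction on the degree. The hypothesis speaks of cumulants,
  the loop equations of centred moments, and \<open>wick_limit\<close> translates between
  them.\<close>

lemma CC_limit_base:
  assumes ws: "\<And>w. w \<in> set ws \<Longrightarrow> odeg w = 0"
  obtains g where "\<And>B. B \<subseteq> {..<length ws} \<Longrightarrow> (\<lambda>d. CC d (image_mset ((!) ws) (mset_set B))) \<longlonglongrightarrow> g B"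
    "\<And>z B. z \<in> B \<Longrightarrow> B \<subseteq> {..<length ws} \<Longrightarrow> g B = (\<Sum>j\<in>B - {z}. g {z, j} * g (B - {z, j}))"
proof -
  let ?S = "{..<length ws}"
  \<comment> \<open>Shifting the index keeps away from dimension 0, where nothing is
    assumed.\<close>
  define m where "m d B = CC (Suc d) (image_mset ((!) ws) (mset_set B))" for d B
  have e: "haar_ensemble (M (Suc d)) (Suc d) (Q (Suc d)) (A (Suc d))" for d by (rule ens) simp
  have m0: "m d {} = 1" and m1: "m d {i} = 0" for d i
    using haar_ensemble.CC_empty[OF e] haar_ensemble.CC_single[OF e] by (simp_all add: m_def)
  have cum: "cumul (m d) B = cumul (mom (M (Suc d)) (\<lambda>i. T (Suc d) (ws ! i))) B" if "B \<subseteq> ?S" "card B \<ge> 2" for d B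
  proof -
    interpret E: haar_ensemble "M (Suc d)" "Suc d" "Q (Suc d)" "A (Suc d)" by (rule e)
    have "finite B" using finite_subset[OF that(1)] by simp
    from E.cumul_mom_shift[OF this that(2) E.nice_T]
    show ?thesis unfolding m_def E.CC_mom by simp
  qed
  have "\<exists>l. (\<lambda>d. cumul (m d) B) \<longlonglongrightarrow> l \<and> (card B \<ge> 3 \<longrightarrow> l = 0)" if B: "B \<subseteq> ?S" "card B \<ge> 2" for B
  proof -
    have "finite B" using finite_subset[OF B(1)] by simp
    moreover have "odeg (ws ! i) = 0" if "i \<in> B" for i using ws that B(1) by auto
    ultimately obtain l where l: "(\<lambda>d. cumul (mom (M d) (\<lambda>i. T d (ws ! i))) B) \<longlonglongrightarrow> l" "card B \<ge> 3 \<longrightarrow> l = 0"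
      using cumul_base[of B "(!) ws"] B(2) by blast
    then show ?thesis using LIMSEQ_Suc[OF l(1)] unfolding cum[OF B] by blast
  qed
  note lims = this
  define k where "k B = lim (\<lambda>d. cumul (m d) B)" for B
  have k: "(\<lambda>d. cumul (m d) B) \<longlonglongrightarrow> k B" "card B \<ge> 3 \<Longrightarrow> k B = 0" if "B \<subseteq> ?S" "card B \<ge> 2" for B
    using lims[OF that] limI unfolding k_def by (metis (no_types, lifting))+
  have k0: "k B = 0" if "B \<subseteq> ?S" "card B \<ge> 3" for B using k(2)[OF that(1) _ that(2)] that(2) by simp
  from wick_limit[of ?S m k, OF finite_lessThan m0 m1 k(1) k0] obtain g where
    g: "\<And>B. B \<subseteq> ?S \<Longrightarrow> (\<lambda>d. m d B) \<longlonglongrightarrow> g B"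
      "\<And>z B. z \<in> B \<Longrightarrow> B \<subseteq> ?S \<Longrightarrow> g B = (\<Sum>j\<in>B - {z}. k {z, j} * g (B - {z, j}))" by blast
  have g0: "g {} = 1" using g(1)[of "{}"] by (simp add: m0 LIMSEQ_const_iff)
  show thesis
  proof (rule that[of g])
    show "(\<lambda>d. CC d (image_mset ((!) ws) (mset_set B))) \<longlonglongrightarrow> g B" if "B \<subseteq> ?S" for B
      using g(1)[OF that] unfolding m_def by (rule LIMSEQ_imp_Suc)
    fix z B assume B: "z \<in> B" "B \<subseteq> ?S"
    \<comment> \<open>Wick's formula for a two-element set, with \<open>g {} = 1\<close>, identifies
      the pair cumulants with pair moments.\<close>
    have "g {z, j} = k {z, j}" if "j \<in> B - {z}" for j
    proof -
      have "{z, j} - {z} = {j}" using that by auto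
      then show ?thesis using g(2)[of z "{z, j}"] B that g0 by auto
    qed
    then show "g B = (\<Sum>j\<in>B - {z}. g {z, j} * g (B - {z, j}))"
      unfolding g(2)[OF B] by (intro sum.cong) auto
  qed
qed

lemma odegs_0: "odegs U = 0 \<Longrightarrow> w \<in># U \<Longrightarrow> odeg w = 0"
  by (auto dest!: multi_member_split)

lemma CC_base: "odegs U = 0 \<Longrightarrow> convergent (\<lambda>d. CC d U)"
proof -
  assume U: "odegs U = 0"
  obtain ws where ws: "mset ws = U" using ex_mset by blast
  then have ws0: "odeg w = 0" if "w \<in> set ws" for w using that odegs_0[OF U] by auto
  obtain g where "\<And>B. B \<subseteq> {..<length ws} \<Longrightarrow> (\<lambda>d. CC d (image_mset ((!) ws) (mset_set B))) \<longlonglongrightarrow> g B"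
    by (rule CC_limit_base[of ws]) (erule ws0, rule that)
  from this[of "{..<length ws}"] show ?thesis by (simp add: image_mset_nth ws convergentI)
qed

lemma wick_base:
  assumes U: "odegs (add_mset w U) = 0"
  shows "lim (\<lambda>d. CC d (add_mset w U)) = (\<Sum>u\<in>#U. lim (\<lambda>d. CC d {#w, u#}) * lim (\<lambda>d. CC d (U - {#u#})))"
proof -
  obtain us where us: "mset us = U" using ex_mset by blast
  \<comment> \<open>With \<open>w\<close> at position 0, index 0 is the pivot of Wick's
    formula.\<close>
  define ws where "ws = w # us"
  have ws: "mset ws = add_mset w U" "ws ! 0 = w" by (simp_all add: ws_def us)
  have ws0: "odeg v = 0" if "v \<in> set ws" for v
    using odegs_0[OF U, of v] that unfolding ws(1)[symmetric] by simp
  obtain g where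
    g: "\<And>B. B \<subseteq> {..<length ws} \<Longrightarrow> (\<lambda>d. CC d (image_mset ((!) ws) (mset_set B))) \<longlonglongrightarrow> g B"
      "\<And>z B. z \<in> B \<Longrightarrow> B \<subseteq> {..<length ws} \<Longrightarrow> g B = (\<Sum>j\<in>B - {z}. g {z, j} * g (B - {z, j}))"
    by (rule CC_limit_base[of ws]) (erule ws0, rule that)
  let ?S = "{..<length ws}"
  have z: "0 \<in> ?S" by (simp add: ws_def)
  have l: "lim (\<lambda>d. CC d (image_mset ((!) ws) (mset_set B))) = g B" if "B \<subseteq> ?S" for B
    using g(1)[OF that] by (rule limI)
  have U': "U = image_mset ((!) ws) (mset_set (?S - {0}))"
    using z by (simp only: image_mset_remove[OF finite_lessThan z] image_mset_nth ws) simp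
  have "lim (\<lambda>d. CC d (add_mset w U)) = g ?S"
    using l[of ?S] by (simp add: image_mset_nth ws)
  also have "\<dots> = (\<Sum>j\<in>?S - {0}. g {0, j} * g (?S - {0, j}))" by (rule g(2)[OF z]) simp
  also have "\<dots> = (\<Sum>j\<in>?S - {0}. lim (\<lambda>d. CC d {#w, ws ! j#}) * lim (\<lambda>d. CC d (U - {#ws ! j#})))"
  proof (rule sum.cong)
    fix j assume j: "j \<in> ?S - {0}"
    have "g {0, j} = lim (\<lambda>d. CC d {#w, ws ! j#})"
      using l[of "{0, j}"] j z ws(2) by simp
    moreover have "g (?S - {0, j}) = lim (\<lambda>d. CC d (U - {#ws ! j#}))"
    proof -
      have "?S - {0} - {j} = ?S - {0, j}" by auto
      then show ?thesis using l[of "?S - {0, j}"] image_mset_remove[of "?S - {0}" j "(!) ws"] j U' by auto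
    qed
    ultimately show "g {0, j} * g (?S - {0, j}) = lim (\<lambda>d. CC d {#w, ws ! j#}) * lim (\<lambda>d. CC d (U - {#ws ! j#}))" by simp
  qed simp
  also have "\<dots> = (\<Sum>u\<in>#image_mset ((!) ws) (mset_set (?S - {0})). lim (\<lambda>d. CC d {#w, u#}) * lim (\<lambda>d. CC d (U - {#u#})))"
    by (simp add: sum_unfold_sum_mset image_mset.compositionality comp_def)
  finally show ?thesis using U' by simp
qed

lemma d_\<tau>: "d \<ge> 1 \<Longrightarrow> of_nat d * \<tau> d w = mean d w"
  by (simp add: \<tau>_def)

sublocale L: loop_free \<tau> CC
proof unfold_locales
  fix d :: nat assume d: "1 \<le> d"
  interpret E: haar_ensemble "M d" d "Q d" "A d" by (rule ens[OF d])
  note dt = d_\<tau>[OF d]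
  show "\<tau> d u = \<tau> d v" if "teq u v" for u v using E.mean_teq[OF that] by (simp add: \<tau>_def)
  show "CC d (add_mset u U) = CC d (add_mset v U)" if "teq u v" for u v U by (rule E.CC_teq[OF that])
  show "CC d {#} = 1" by (rule E.CC_empty)
  show "CC d {#w#} = 0" for w by (rule E.CC_single)
  show "(of_nat d - 1) * (of_nat d * \<tau> d (Orth # V)) =
      (\<Sum>(s, L, R)\<leftarrow>cuts V. s * (of_nat d * \<tau> d (Orth # L @ owt R) - CC d {#Orth # L, R#}
        - of_nat d ^ 2 * \<tau> d (Orth # L) * \<tau> d R))" for V
  proof -
    have "of_nat d ^ 2 * \<tau> d u * \<tau> d v = mean d u * mean d v" for u v
      unfolding dt[symmetric] by (simp add: power2_eq_square)
    then show ?thesis by (simp add: dt E.mean_loop)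
  qed
  show "(of_nat d - 1) * CC d (add_mset (Orth # V) us) =
      (\<Sum>(s, L, R)\<leftarrow>cuts V. s * (CC d (add_mset (Orth # L @ owt R) us) - CC d (add_mset (Orth # L) (add_mset R us))
        + CC d {#Orth # L, R#} * CC d us
        - of_nat d * \<tau> d (Orth # L) * CC d (add_mset R us) - of_nat d * \<tau> d R * CC d (add_mset (Orth # L) us)))
      + (\<Sum>u\<in>#us. \<Sum>(s, L, R)\<leftarrow>cuts u. s *
          (CC d (add_mset (Orth # V @ owt (R @ L)) (us - {#u#})) + of_nat d * \<tau> d (Orth # V @ owt (R @ L)) * CC d (us - {#u#})
          - CC d (add_mset (Orth # V @ R @ L) (us - {#u#})) - of_nat d * \<tau> d (Orth # V @ R @ L) * CC d (us - {#u#})))" for V us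
    unfolding dt by (rule E.CC_loop)
  show "\<tau> d [] = 1" using d by (simp add: \<tau>_def E.mean_Nil)
  show "\<tau> d (Coef (p + Poly_Mapping.single 0 c) # v) = \<tau> d (Coef p # v) + c * \<tau> d v" for p c v
    by (simp add: \<tau>_def E.mean_affine add_divide_distrib)
next
  show "convergent (\<lambda>d. \<tau> d w)" if "odeg w = 0" for w using \<tau>_limit_base[OF that] by (rule convergentI)
qed (rule CC_base wick_base; assumption)+

text \<open>The limit exists because it does on single words and traces are linear; see
  \<open>tendsto_\<Phi>\<close>.\<close>

definition \<Phi> :: "('i + unit) ncpoly \<Rightarrow> complex" where
  "\<Phi> p = lim (\<lambda>d. (\<integral>\<omega>. TJ d p \<omega> \<partial>M d) / of_nat d)"

definition \<Phi>2 :: "('i + unit) ncpoly \<Rightarrow> ('i + unit) ncpoly \<Rightarrow> complex" where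
  "\<Phi>2 p q = lim (\<lambda>d. covariance (M d) (TJ d p) (TJ d q))"

lemma integral_TJ_add: "d \<ge> 1 \<Longrightarrow> (\<integral>\<omega>. TJ d (p + q) \<omega> \<partial>M d) = (\<integral>\<omega>. TJ d p \<omega> \<partial>M d) + (\<integral>\<omega>. TJ d q \<omega> \<partial>M d)"
proof -
  assume "d \<ge> 1"
  then interpret E: haar_ensemble "M d" d "Q d" "A d" by (rule ens)
  have "(\<integral>\<omega>. TJ d (p + q) \<omega> \<partial>M d) = (\<integral>\<omega>. TJ d p \<omega> + TJ d q \<omega> \<partial>M d)"
    by (rule Bochner_Integration.integral_cong) (simp_all add: E.TJ_add)
  then show ?thesis by (simp add: E.nice_integrable E.nice_TJ)
qed

lemma integral_TJ_single: "d \<ge> 1 \<Longrightarrow> (\<integral>\<omega>. TJ d (Poly_Mapping.single w c) \<omega> \<partial>M d) = c * mean d (to_oword w)"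
proof -
  assume "d \<ge> 1"
  then interpret E: haar_ensemble "M d" d "Q d" "A d" by (rule ens)
  have "(\<integral>\<omega>. TJ d (Poly_Mapping.single w c) \<omega> \<partial>M d) = (\<integral>\<omega>. c * T d (to_oword w) \<omega> \<partial>M d)"
    by (rule Bochner_Integration.integral_cong) (simp_all add: E.TJ_single)
  then show ?thesis by (simp add: E.mean_def)
qed

lemma covariance_cong:
  "(\<And>\<omega>. \<omega> \<in> space N \<Longrightarrow> X \<omega> = X' \<omega>) \<Longrightarrow> (\<And>\<omega>. \<omega> \<in> space N \<Longrightarrow> Y \<omega> = Y' \<omega>) \<Longrightarrow> covariance N X Y = covariance N X' Y'"
  unfolding covariance_def
  by (intro arg_cong2[where f = "(-)"] arg_cong2[where f = "(*)"] Bochner_Integration.integral_cong refl) auto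

lemma cov_TJ_add: "d \<ge> 1 \<Longrightarrow> covariance (M d) (TJ d (p + q)) (TJ d r) = covariance (M d) (TJ d p) (TJ d r) + covariance (M d) (TJ d q) (TJ d r)"
proof -
  assume "d \<ge> 1"
  then interpret E: haar_ensemble "M d" d "Q d" "A d" by (rule ens)
  have "covariance (M d) (TJ d (p + q)) (TJ d r) = covariance (M d) (\<lambda>\<omega>. TJ d p \<omega> + TJ d q \<omega>) (TJ d r)"
    by (rule covariance_cong) (simp_all add: E.TJ_add)
  then show ?thesis using E.covariance_add[OF E.nice_TJ E.nice_TJ E.nice_TJ] by simp
qed

lemma cov_TJ_single:
  "d \<ge> 1 \<Longrightarrow> covariance (M d) (TJ d (Poly_Mapping.single w c)) (TJ d (Poly_Mapping.single v e)) = c * (e * CC d {#to_oword w, to_oword v#})"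
proof -
  assume "d \<ge> 1"
  then interpret E: haar_ensemble "M d" d "Q d" "A d" by (rule ens)
  have "covariance (M d) (TJ d (Poly_Mapping.single w c)) (TJ d (Poly_Mapping.single v e)) =
    covariance (M d) (\<lambda>\<omega>. c * T d (to_oword w) \<omega>) (\<lambda>\<omega>. e * T d (to_oword v) \<omega>)"
    by (rule covariance_cong) (simp_all add: E.TJ_single)
  also have "\<dots> = c * covariance (M d) (\<lambda>\<omega>. e * T d (to_oword v) \<omega>) (T d (to_oword w))"
    by (subst E.covariance_smul) (simp add: covariance_sym)
  also have "\<dots> = c * (e * covariance (M d) (T d (to_oword w)) (T d (to_oword v)))"
    by (subst E.covariance_smul) (simp add: covariance_sym)
  finally show ?thesis by (simp add: E.CC_pair)
qed

lemma tendsto_\<Phi>: "(\<lambda>d. (\<integral>\<omega>. TJ d p \<omega> \<partial>M d) / of_nat d) \<longlonglongrightarrow> \<Phi> p"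
proof -
  have "convergent (\<lambda>d. (\<integral>\<omega>. TJ d p \<omega> \<partial>M d) / of_nat d)"
  proof (induction p rule: ncpoly_induct)
    case (single w c)
    have "(\<lambda>d. c * \<tau> d (to_oword w)) \<longlonglongrightarrow> c * L.phi (to_oword w)"
      by (intro tendsto_intros L.tendsto_phi)
    moreover have "(\<integral>\<omega>. TJ d (Poly_Mapping.single w c) \<omega> \<partial>M d) / of_nat d = c * \<tau> d (to_oword w)" if "d \<ge> 1" for d
      using that by (simp add: integral_TJ_single \<tau>_def)
    ultimately show ?case by (rule convergent_ge1[rotated])
  next
    case (add p q)
    then obtain k l where kl: "(\<lambda>d. (\<integral>\<omega>. TJ d p \<omega> \<partial>M d) / of_nat d) \<longlonglongrightarrow> k" "(\<lambda>d. (\<integral>\<omega>. TJ d q \<omega> \<partial>M d) / of_nat d) \<longlonglongrightarrow> l"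
      by (auto simp: convergent_def)
    have "(\<integral>\<omega>. TJ d (p + q) \<omega> \<partial>M d) / of_nat d = (\<integral>\<omega>. TJ d p \<omega> \<partial>M d) / of_nat d + (\<integral>\<omega>. TJ d q \<omega> \<partial>M d) / of_nat d" if "d \<ge> 1" for d
      using that by (simp add: integral_TJ_add add_divide_distrib)
    from convergent_ge1[OF this tendsto_add[OF kl]] show ?case .
  qed
  then show ?thesis by (simp add: \<Phi>_def convergent_LIMSEQ_iff)
qed

lemma tendsto_\<Phi>2: "(\<lambda>d. covariance (M d) (TJ d p) (TJ d q)) \<longlonglongrightarrow> \<Phi>2 p q"
proof -
  have conv_add: "convergent (\<lambda>d. covariance (M d) (TJ d (p + q)) (TJ d r))"
    if "convergent (\<lambda>d. covariance (M d) (TJ d p) (TJ d r))" "convergent (\<lambda>d. covariance (M d) (TJ d q) (TJ d r))" for p q r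
  proof -
    from that obtain k l where "(\<lambda>d. covariance (M d) (TJ d p) (TJ d r)) \<longlonglongrightarrow> k" "(\<lambda>d. covariance (M d) (TJ d q) (TJ d r)) \<longlonglongrightarrow> l"
      by (auto simp: convergent_def)
    from tendsto_add[OF this] show ?thesis
      by (rule convergent_ge1[rotated]) (rule cov_TJ_add)
  qed
  have "convergent (\<lambda>d. covariance (M d) (TJ d p) (TJ d q))"
  proof (induction p rule: ncpoly_induct)
    case (single w c)
    show ?case
    proof (induction q rule: ncpoly_induct)
      case (single v e)
      have "(\<lambda>d. c * (e * CC d {#to_oword w, to_oword v#})) \<longlonglongrightarrow> c * (e * L.cc {#to_oword w, to_oword v#})"
        by (intro tendsto_intros L.tendsto_cc)
      then show ?case by (rule convergent_ge1[rotated]) (rule cov_TJ_single)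
    next
      case (add q r)
      then show ?case
        unfolding covariance_sym[of _ "TJ _ (Poly_Mapping.single w c)"] by (rule conv_add)
    qed
  qed (rule conv_add)
  then show ?thesis by (simp add: \<Phi>2_def convergent_LIMSEQ_iff)
qed

lemma \<Phi>_cong:
  assumes "\<And>d \<omega>. d \<ge> 1 \<Longrightarrow> \<omega> \<in> space (M d) \<Longrightarrow> TJ d p \<omega> = TJ d q \<omega>"
  shows "\<Phi> p = \<Phi> q"
  using tendsto_\<Phi> tendsto_\<Phi>
proof (rule LIMSEQ_unique_ge1)
  fix d :: nat assume "d \<ge> 1"
  then have "(\<integral>\<omega>. TJ d p \<omega> \<partial>M d) = (\<integral>\<omega>. TJ d q \<omega> \<partial>M d)"
    by (intro Bochner_Integration.integral_cong refl assms)
  then show "(\<integral>\<omega>. TJ d p \<omega> \<partial>M d) / of_nat d = (\<integral>\<omega>. TJ d q \<omega> \<partial>M d) / of_nat d" by simp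
qed

lemma \<Phi>2_cong:
  assumes "\<And>d \<omega>. d \<ge> 1 \<Longrightarrow> \<omega> \<in> space (M d) \<Longrightarrow> TJ d p \<omega> = TJ d q \<omega>"
  shows "\<Phi>2 p r = \<Phi>2 q r"
  by (rule LIMSEQ_unique_ge1[OF tendsto_\<Phi>2 tendsto_\<Phi>2]) (intro covariance_cong assms refl)

lemma \<Phi>2_sym: "\<Phi>2 p q = \<Phi>2 q p"
  unfolding \<Phi>2_def by (subst covariance_sym) (rule refl)

lemma TJ_eqs:
  assumes "d \<ge> 1" "\<omega> \<in> space (M d)"
  shows "TJ d (nc_smul c p) \<omega> = c * TJ d p \<omega>" "TJ d (p * q) \<omega> = TJ d (q * p) \<omega>"
    "TJ d (nc_transpose p) \<omega> = TJ d p \<omega>" "TJ d 1 \<omega> = of_nat d"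
proof -
  interpret E: haar_ensemble "M d" d "Q d" "A d" by (rule ens[OF assms(1)])
  show "TJ d (nc_smul c p) \<omega> = c * TJ d p \<omega>" "TJ d (p * q) \<omega> = TJ d (q * p) \<omega>"
    "TJ d (nc_transpose p) \<omega> = TJ d p \<omega>" "TJ d 1 \<omega> = of_nat d"
    using assms(2) by (simp_all add: E.TJ_smul E.TJ_transpose E.TJ_one E.TJ_trace[of \<omega> p q])
qed

lemma \<Phi>_add: "\<Phi> (p + q) = \<Phi> p + \<Phi> q"
  by (rule LIMSEQ_unique_ge1[OF tendsto_\<Phi> tendsto_add[OF tendsto_\<Phi> tendsto_\<Phi>]])
    (simp add: integral_TJ_add add_divide_distrib)

lemma \<Phi>_smul: "\<Phi> (nc_smul c p) = c * \<Phi> p"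
proof (rule LIMSEQ_unique_ge1[OF tendsto_\<Phi> tendsto_mult[OF tendsto_const tendsto_\<Phi>]])
  fix d :: nat assume d: "d \<ge> 1"
  have "(\<integral>\<omega>. TJ d (nc_smul c p) \<omega> \<partial>M d) = (\<integral>\<omega>. c * TJ d p \<omega> \<partial>M d)"
    by (intro Bochner_Integration.integral_cong refl TJ_eqs d)
  then show "(\<integral>\<omega>. TJ d (nc_smul c p) \<omega> \<partial>M d) / of_nat d = c * ((\<integral>\<omega>. TJ d p \<omega> \<partial>M d) / of_nat d)" by simp
qed

lemma \<Phi>_one: "\<Phi> 1 = 1"
proof (rule LIMSEQ_unique_ge1[OF tendsto_\<Phi> tendsto_const])
  fix d :: nat assume d: "d \<ge> 1"
  interpret prob_space "M d" by (rule prob[OF d])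
  have "(\<integral>\<omega>. TJ d 1 \<omega> \<partial>M d) = (\<integral>\<omega>. of_nat d \<partial>M d)"
    by (intro Bochner_Integration.integral_cong refl TJ_eqs d)
  then show "(\<integral>\<omega>. TJ d 1 \<omega> \<partial>M d) / of_nat d = 1" using d by (simp add: prob_space)
qed

lemma \<Phi>2_add: "\<Phi>2 (p + q) r = \<Phi>2 p r + \<Phi>2 q r"
  by (rule LIMSEQ_unique_ge1[OF tendsto_\<Phi>2 tendsto_add[OF tendsto_\<Phi>2 tendsto_\<Phi>2]]) (rule cov_TJ_add)

lemma \<Phi>2_smul: "\<Phi>2 (nc_smul c p) r = c * \<Phi>2 p r"
proof (rule LIMSEQ_unique_ge1[OF tendsto_\<Phi>2 tendsto_mult[OF tendsto_const tendsto_\<Phi>2]])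
  fix d :: nat assume d: "d \<ge> 1"
  interpret E: haar_ensemble "M d" d "Q d" "A d" by (rule ens[OF d])
  have "covariance (M d) (TJ d (nc_smul c p)) (TJ d r) = covariance (M d) (\<lambda>\<omega>. c * TJ d p \<omega>) (TJ d r)"
    by (intro covariance_cong refl TJ_eqs d)
  then show "covariance (M d) (TJ d (nc_smul c p)) (TJ d r) = c * covariance (M d) (TJ d p) (TJ d r)"
    by (simp add: E.covariance_smul)
qed

lemma \<Phi>2_one: "\<Phi>2 1 r = 0"
proof (rule LIMSEQ_unique_ge1[OF tendsto_\<Phi>2 tendsto_const])
  fix d :: nat assume d: "d \<ge> 1"
  interpret E: haar_ensemble "M d" d "Q d" "A d" by (rule ens[OF d])
  have "covariance (M d) (TJ d 1) (TJ d r) = covariance (M d) (\<lambda>\<omega>. of_nat d) (TJ d r)"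
    by (intro covariance_cong refl TJ_eqs d)
  then show "covariance (M d) (TJ d 1) (TJ d r) = 0"
    by (simp add: E.covariance_const E.nice_TJ)
qed

text \<open>The axioms for the functionals hold for traces and covariances at every
  \<open>d \<ge> 1\<close> and pass to the limit; those for the second entry follow by
  symmetry.\<close>

lemma space: "real_second_order_space nc_smul \<Phi> \<Phi>2 nc_transpose"
proof (intro real_second_order_space.intro vector_space_nc_smul real_second_order_space_axioms.intro)
  show "\<Phi> (x * y) = \<Phi> (y * x)" for x y by (intro \<Phi>_cong TJ_eqs)
  show "\<Phi> (nc_transpose x) = \<Phi> x" for x by (intro \<Phi>_cong TJ_eqs)
  have tr: "\<Phi>2 (x * y) z = \<Phi>2 (y * x) z" and tt: "\<Phi>2 (nc_transpose x) z = \<Phi>2 x z" for x y z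
    by (intro \<Phi>2_cong TJ_eqs; assumption)+
  show "\<Phi>2 (x * y) z = \<Phi>2 (y * x) z" "\<Phi>2 z (x * y) = \<Phi>2 z (y * x)"
    "\<Phi>2 (nc_transpose x) z = \<Phi>2 x z" "\<Phi>2 z (nc_transpose x) = \<Phi>2 z x" for x y z
    unfolding \<Phi>2_sym[of z] by (rule tr tt)+
  show "\<Phi>2 z (x + y) = \<Phi>2 z x + \<Phi>2 z y" "\<Phi>2 z (nc_smul c x) = c * \<Phi>2 z x" "\<Phi>2 z 1 = 0" for x y z c
    unfolding \<Phi>2_sym[of z] by (rule \<Phi>2_add \<Phi>2_smul \<Phi>2_one)+
qed (simp_all add: nc_smul_mult_left nc_smul_mult_right nc_transpose_add nc_transpose_smul nc_transpose_mult
    nc_transpose_twice \<Phi>_add \<Phi>_smul \<Phi>_one \<Phi>2_add \<Phi>2_smul \<Phi>2_one)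

lemma TJ_word_poly: "d \<ge> 1 \<Longrightarrow> \<omega> \<in> space (M d) \<Longrightarrow> TJ d (word_poly w) \<omega> = T d w \<omega>"
  by (rule haar_ensemble.word_poly_J[OF ens space])

sublocale H: haar_limit \<tau> CC \<Phi> \<Phi>2
proof (intro haar_limit.intro haar_limit_axioms.intro L.loop_free_axioms space)
  show "\<Phi> (word_poly w) = L.phi w" for w
  proof (rule LIMSEQ_unique_ge1[OF tendsto_\<Phi> L.tendsto_phi])
    fix d :: nat assume d: "d \<ge> 1"
    have "(\<integral>\<omega>. TJ d (word_poly w) \<omega> \<partial>M d) = (\<integral>\<omega>. T d w \<omega> \<partial>M d)"
      by (intro Bochner_Integration.integral_cong refl TJ_word_poly d)
    then show "(\<integral>\<omega>. TJ d (word_poly w) \<omega> \<partial>M d) / of_nat d = \<tau> d w"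
      by (simp add: \<tau>_def haar_ensemble.mean_def[OF ens[OF d]])
  qed
  show "\<Phi>2 (word_poly u) (word_poly v) = L.cc {#u, v#}" for u v
  proof (rule LIMSEQ_unique_ge1[OF tendsto_\<Phi>2 L.tendsto_cc])
    fix d :: nat assume d: "d \<ge> 1"
    have "covariance (M d) (TJ d (word_poly u)) (TJ d (word_poly v)) = covariance (M d) (T d u) (T d v)"
      by (intro covariance_cong TJ_word_poly d)
    then show "covariance (M d) (TJ d (word_poly u)) (TJ d (word_poly v)) = CC d {#u, v#}"
      by (simp add: haar_ensemble.CC_pair[OF ens[OF d]])
  qed
qed

text \<open>Cumulants are polynomials in the moments, so they converge to the cumulants of the limit
  moments. These obey Wick's formula and are therefore Gaussian. Centring does not change cumulants
  of this order.\<close>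

lemma cumul_T_limit:
  assumes S: "finite S" "card S \<ge> 3"
  shows "(\<lambda>d. cumul (mom (M d) (\<lambda>i. T d (W i))) S) \<longlonglongrightarrow> 0"
proof -
  define g where "g B = L.cc (image_mset W (mset_set B))" for B
  have "g {} = 1"
    using LIMSEQ_unique_ge1[OF L.tendsto_cc tendsto_const[of 1]] haar_ensemble.CC_empty[OF ens] by (simp add: g_def)
  obtain z where z: "z \<in> S" using S by fastforce
  have "cumul g S = 0"
  proof (rule cumul_gaussian[where m = g and z = z and c = "\<lambda>j. L.cc {#W z, W j#}", OF S(1) z S(2) \<open>g {} = 1\<close>])
    fix S' assume S': "z \<in> S'" "S' \<subseteq> S"
    have fin: "finite S'" "finite (S' - {z})" using finite_subset[OF S'(2) S(1)] by auto
    let ?I = "image_mset W (mset_set (S' - {z}))"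
    have "image_mset W (mset_set S') = add_mset (W z) ?I"
      using fin S' by (simp add: mset_set.remove[of S' z])
    then have "g S' = (\<Sum>u\<in>#?I. L.cc {#W z, u#} * L.cc (?I - {#u#}))"
      by (simp only: g_def L.wick[of "W z" ?I])
    also have "\<dots> = (\<Sum>j\<in>S' - {z}. L.cc {#W z, W j#} * L.cc (?I - {#W j#}))"
      by (simp add: sum_unfold_sum_mset image_mset.compositionality comp_def)
    also have "\<dots> = (\<Sum>j\<in>S' - {z}. L.cc {#W z, W j#} * g (S' - {z, j}))"
    proof (rule sum.cong)
      fix j assume j: "j \<in> S' - {z}"
      have "S' - {z} - {j} = S' - {z, j}" by auto
      then show "L.cc {#W z, W j#} * L.cc (?I - {#W j#}) = L.cc {#W z, W j#} * g (S' - {z, j})"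
        using image_mset_remove[OF fin(2) j, of W] by (simp add: g_def)
    qed simp
    finally show "g S' = (\<Sum>j\<in>S' - {z}. L.cc {#W z, W j#} * g (S' - {z, j}))" .
  qed
  moreover have "(\<lambda>d. cumul (\<lambda>B. CC d (image_mset W (mset_set B))) S) \<longlonglongrightarrow> cumul g S"
    unfolding g_def by (rule cumul_tendsto[OF S(1) L.tendsto_cc])
  moreover have "cumul (mom (M d) (\<lambda>i. T d (W i))) S = cumul (\<lambda>B. CC d (image_mset W (mset_set B))) S" if "d \<ge> 1" for d
  proof -
    interpret E: haar_ensemble "M d" d "Q d" "A d" by (rule ens[OF that])
    show ?thesis unfolding E.CC_mom
      by (rule E.cumul_mom_shift[symmetric]) (use S E.nice_T in auto)
  qed
  ultimately show ?thesis using tendsto_cong_ge1[of "\<lambda>d. cumul (mom (M d) (\<lambda>i. T d (W i))) S"] by simp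
qed

text \<open>Multilinear passage from words to polynomials: \<open>n\<close> counts the leading
  entries that already hold polynomials, the others hold words.\<close>

lemma cumul_TJ_limit:
  assumes r: "r \<ge> 3"
  shows "(\<lambda>d. cumul (mom (M d) (\<lambda>k. if k < n then TJ d (p k) else T d (W k))) {..<r}) \<longlonglongrightarrow> 0"
proof (induction n arbitrary: p W)
  case 0
  show ?case using cumul_T_limit[of "{..<r}" W] r by simp
next
  case (Suc n)
  let ?X = "\<lambda>q d k. if k = n then TJ d q else if k < n then TJ d (p k) else T d (W k)"
  have eq: "(\<lambda>k. if k < Suc n then TJ d (p k) else T d (W k)) = ?X (p n) d" for d
    by (auto simp: fun_eq_iff)
  have "(\<lambda>d. cumul (mom (M d) (?X q d)) {..<r}) \<longlonglongrightarrow> 0" for q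
  proof (cases "n < r")
    case False
    then have "cumul (mom (M d) (?X q d)) {..<r} = cumul (mom (M d) (\<lambda>k. if k < n then TJ d (p k) else T d (W k))) {..<r}" for d
      by (intro cumul_cong) (auto simp: mom_def intro!: Bochner_Integration.integral_cong prod.cong)
    then show ?thesis using Suc[of p W] by simp
  next
    case True
    then have n: "finite {..<r}" "n \<in> {..<r}" by auto
    show ?thesis
    proof (induction q rule: ncpoly_induct)
      case (single w c)
      let ?Y = "\<lambda>d k. if k < n then TJ d (p k) else T d ((W(n := to_oword w)) k)"
      have "cumul (mom (M d) (?X (Poly_Mapping.single w c) d)) {..<r} = c * cumul (mom (M d) (?Y d)) {..<r}" if d: "d \<ge> 1" for d
      proof -
        interpret E: haar_ensemble "M d" d "Q d" "A d" by (rule ens[OF d])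
        \<comment> \<open>The zero multiple brings the scaled entry into the form required by
          \<open>cumul_mom_slot\<close>.\<close>
        have "cumul (mom (M d) (?X (Poly_Mapping.single w c) d)) {..<r} =
          cumul (mom (M d) ((?Y d)(n := (\<lambda>\<omega>. c * T d (to_oword w) \<omega> + 0 * T d (to_oword w) \<omega>)))) {..<r}"
          by (intro cumul_cong E.mom_cong) (auto simp: E.TJ_single)
        also have "\<dots> = c * cumul (mom (M d) ((?Y d)(n := T d (to_oword w)))) {..<r}"
          using E.cumul_mom_slot[OF n, of "?Y d" "T d (to_oword w)" "T d (to_oword w)" c 0] by (simp add: E.nice_T E.nice_TJ)
        also have "(?Y d)(n := T d (to_oword w)) = ?Y d" by auto
        finally show ?thesis .
      qed
      moreover have "(\<lambda>d. c * cumul (mom (M d) (?Y d)) {..<r}) \<longlonglongrightarrow> 0"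
        using tendsto_mult[OF tendsto_const Suc[of p "W(n := to_oword w)"], of c] by simp
      ultimately show ?case
        using tendsto_cong_ge1[of "\<lambda>d. cumul (mom (M d) (?X (Poly_Mapping.single w c) d)) {..<r}"] by simp
    next
      case (add q q')
      have "cumul (mom (M d) (?X (q + q') d)) {..<r} = cumul (mom (M d) (?X q d)) {..<r} + cumul (mom (M d) (?X q' d)) {..<r}" if d: "d \<ge> 1" for d
      proof -
        interpret E: haar_ensemble "M d" d "Q d" "A d" by (rule ens[OF d])
        have u: "(?X q d)(n := TJ d s) = ?X s d" for s by auto
        have "cumul (mom (M d) (?X (q + q') d)) {..<r} =
          cumul (mom (M d) ((?X q d)(n := (\<lambda>\<omega>. 1 * TJ d q \<omega> + 1 * TJ d q' \<omega>)))) {..<r}"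
          by (intro cumul_cong E.mom_cong) (auto simp: E.TJ_add)
        also have "\<dots> = 1 * cumul (mom (M d) ((?X q d)(n := TJ d q))) {..<r} + 1 * cumul (mom (M d) ((?X q d)(n := TJ d q'))) {..<r}"
          by (rule E.cumul_mom_slot[OF n]) (auto simp: E.nice_T E.nice_TJ)
        finally show ?thesis unfolding u by simp
      qed
      then show ?case
        using tendsto_cong_ge1[of "\<lambda>d. cumul (mom (M d) (?X (q + q') d)) {..<r}"] tendsto_add[OF add] by simp
    qed
  qed
  then show ?case unfolding eq .
qed

lemma joint_limit:
  "real_second_order_limit M (\<lambda>d. case_sum (A d) (\<lambda>_ \<omega>. map_mat complex_of_real (Q d \<omega>))) nc_smul \<Phi> \<Phi>2 nc_transpose nc_var"
proof -
  let ?J = "\<lambda>d. case_sum (A d) (\<lambda>(_::unit) \<omega>. map_mat complex_of_real (Q d \<omega>))"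
  have w: "prod_list (map (letter_value nc_transpose nc_var) (letters w)) = Poly_Mapping.single w 1" for w :: "('i + unit) word"
  proof -
    have "prod_list (map (letter_value nc_transpose nc_var) ls) = Poly_Mapping.single (Word ls) 1" for ls :: "('i + unit) letter list"
    proof (induction ls)
      case Nil
      show ?case by (simp add: zero_word_def flip: single_one)
    next
      case (Cons l ls)
      then show ?case
        by (cases l) (simp_all add: nc_var_def nc_transpose_single word_transpose_def mult_single plus_word_def)
    qed
    then show ?thesis by simp
  qed
  \<comment> \<open>Evaluation at the variables themselves is the identity, so the limit functionals
    act on the polynomials directly.\<close>
  have ev: "nc_eval nc_smul nc_transpose nc_var p = p" for p :: "('i + unit) ncpoly"
    by (induction p rule: ncpoly_induct) (simp_all add: H.R.ev_add H.R.ev_single w nc_smul_single)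
  have tr: "mat_trace (mat_eval d (\<lambda>x. ?J d x \<omega>) p) = TJ d p \<omega>" if "d \<ge> 1" for d p \<omega>
    by (simp add: haar_ensemble.TJ_def[OF ens[OF that]] haar_ensemble.J_def[OF ens[OF that]])
  show ?thesis
    unfolding real_second_order_limit_def Let_def ev
  proof (intro conjI allI impI space)
    fix d :: nat assume d: "d \<ge> 1"
    show "prob_space (M d)" by (rule prob[OF d])
    show "random_matrix (M d) d (?J d x)" for x by (rule haar_ensemble.J_random[OF ens[OF d]])
  next
    fix p
    show "(\<lambda>d. \<integral>\<omega>. mat_trace (mat_eval d (\<lambda>x. ?J d x \<omega>) p) / of_nat d \<partial>M d) \<longlonglongrightarrow> \<Phi> p"
      by (rule iffD2[OF tendsto_cong_ge1 tendsto_\<Phi>]) (simp add: tr)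
  next
    fix p q
    show "(\<lambda>d. covariance (M d) (\<lambda>\<omega>. mat_trace (mat_eval d (\<lambda>x. ?J d x \<omega>) p))
        (\<lambda>\<omega>. mat_trace (mat_eval d (\<lambda>x. ?J d x \<omega>) q))) \<longlonglongrightarrow> \<Phi>2 p q"
      by (rule iffD2[OF tendsto_cong_ge1 tendsto_\<Phi>2]) (simp add: tr)
  next
    fix r :: nat and p assume r: "r \<ge> 3"
    show "(\<lambda>d. joint_cumulant (M d) r (\<lambda>k \<omega>. mat_trace (mat_eval d (\<lambda>x. ?J d x \<omega>) (p k)))) \<longlonglongrightarrow> 0"
    \<comment> \<open>With \<open>n = r\<close> every entry holds a polynomial; the empty words only
      fill the positions beyond.\<close>
    proof (rule iffD2[OF tendsto_cong_ge1 cumul_TJ_limit[OF r, where n = r and p = p]])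
      fix d :: nat assume "d \<ge> 1"
      then show "joint_cumulant (M d) r (\<lambda>k \<omega>. mat_trace (mat_eval d (\<lambda>x. ?J d x \<omega>) (p k))) =
        cumul (mom (M d) (\<lambda>k. if k < r then TJ d (p k) else T d ((\<lambda>_. []) k))) {..<r}"
        unfolding joint_cumulant_cumul by (simp add: tr, intro cumul_cong) (auto simp: mom_def intro!: Bochner_Integration.integral_cong prod.cong)
    qed
  qed
qed

theorem asymptotically_free: "asymptotically_real_free M A (\<lambda>d (_::unit) \<omega>. map_mat complex_of_real (Q d \<omega>))"
proof -
  have v: "case_sum (\<lambda>i. nc_var (Inl i)) (\<lambda>u. nc_var (Inr ())) = (nc_var :: 'i + unit \<Rightarrow> _)"
    by (rule ext) (simp split: sum.split)
  show ?thesis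
    unfolding asymptotically_real_free_def
    by (rule exI[of _ nc_smul], rule exI[of _ \<Phi>], rule exI[of _ \<Phi>2], rule exI[of _ nc_transpose],
        rule exI[of _ "\<lambda>i. nc_var (Inl i)"], rule exI[of _ "\<lambda>u. nc_var (Inr u)"])
      (use joint_limit H.real_free in \<open>simp add: v H.alg_a_def H.alg_o_def\<close>)
qed

end

theorem theorem50:
  fixes M :: "nat \<Rightarrow> 'w measure"
    and A :: "nat \<Rightarrow> 'i \<Rightarrow> 'w \<Rightarrow> complex mat"
    and Q :: "nat \<Rightarrow> 'w \<Rightarrow> real mat"
    and smul :: "complex \<Rightarrow> 'a::ring_1 \<Rightarrow> 'a"
    and \<phi> :: "'a \<Rightarrow> complex"
    and \<phi>2 :: "'a \<Rightarrow> 'a \<Rightarrow> complex"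
    and t :: "'a \<Rightarrow> 'a"
    and a :: "'i \<Rightarrow> 'a"
  assumes limit: "real_second_order_limit M A smul \<phi> \<phi>2 t a"
    and haar: "\<And>d. d \<ge> 1 \<Longrightarrow> haar_orthogonal (M d) d (Q d)"
    and indep: "\<And>d. d \<ge> 1 \<Longrightarrow>
      prob_space.indep_set (M d) (sigma_entries (M d) d (\<lambda>_::unit. Q d)) (sigma_entries (M d) d (A d))"
  shows "asymptotically_real_free M A (\<lambda>d (_::unit) \<omega>. map_mat complex_of_real (Q d \<omega>))"
proof -
  interpret haar_sequence M A Q smul \<phi> \<phi>2 t a
    by (intro haar_sequence.intro limit haar indep)
  show ?thesis by (rule asymptotically_free)
qed

end
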